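(* Let $A$ be any commutative unital ring, let $G=\mathrm{GL}_{2,A}$ or $G=\mathrm{SL}_{2,A}$, let $T\subseteq G$ be the diagonal torus and $N\subseteq G$ the schematic normalizer of $T$, and let $\sigma,q:N\times T\to N$ be the action map and the projection map. There is a faithfully flat map of affine group schemes $\pi:N\to N/T$ with $T\cong\ker(\pi)$, giving an exact sequence of group schemes $$e\to T\to N\xrightarrow{\ \pi\ }N/T\to e .$$ For any map $f:N\to Z$ to an affine scheme $Z$ with $f\circ\sigma=f\circ q$ there is a unique map $f^*:N/T\to Z$ with $f^*\circ\pi=f$. Hence the affine group scheme $N/T$ is uniquely determined up to isomorphism. If $G=\mathrm{GL}_{2,A}$, the sequence splits and there is an isomorphism of group schemes $N\cong T\rtimes N/T$, where the right-hand side is the semidirect product (with respect to a section of $\pi$).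
   Context: All schemes and maps are over $\mathrm{Spec}(A)$; $k[X]$ denotes the coordinate ring (an $A$-algebra) of an affine $A$-scheme $X$. Let $D=x_{11}x_{22}-x_{12}x_{21}$. $\mathrm{GL}_{2,A}=\mathrm{Spec}(A[x_{ij},1/D])$ and $\mathrm{SL}_{2,A}=\mathrm{Spec}(A[x_{ij}]/(D-1))$, with the Hopf algebra structure inducing matrix multiplication. In $k[G]$ let $I_1=(x_{12},x_{21})$, $I_2=(x_{11},x_{22})$, $I=I_1I_2$. The diagonal torus is $T=V(I_1)=\mathrm{Spec}(k[G]/I_1)$ and the schematic normalizer of $T$ is $N=V(I)=\mathrm{Spec}(k[G]/I)$; these are closed subgroup schemes of $G$ and $T$ is a closed normal subgroup scheme of $N$. The action $\sigma:N\times T\to N$ is right multiplication $(n,t)\mapsto nt$, and $q(n,t)=n$. With $\sigma^{\#}:k[N]\to k[N]\otimes_A k[T]$ the ring map of $\sigma$, put $k[N/T]=\{x\in k[N]:\sigma^{\#}(x)=x\otimes 1\}$ and $N/T=\mathrm{Spec}(k[N/T])$, with Hopf algebra structure induced from that of $k[N]$. Exactness of the sequence means that $\pi$ is a faithfully flat homomorphism with kernel $T$. *)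

theory Defs
  imports "HOL-Library.Multiset" "HOL-Algebra.Module" "HOL-Algebra.QuotRing" "HOL-Algebra.Ideal_Product"
begin

text \<open>
  An affine scheme \<open>X\<close> over \<open>Spec A\<close> is represented by its coordinate ring, an \<open>A\<close>-algebra
  in the sense of the locale \<^locale>\<open>algebra\<close> of HOL-Algebra (the zero ring is allowed as base).
  A map \<open>X \<rightarrow> Y\<close> is represented by its comorphism, an \<open>A\<close>-algebra homomorphism from the
  coordinate ring of \<open>Y\<close> to that of \<open>X\<close>.  Thus all composites appear in reversed order.
\<close>

section \<open>Algebras, quotients, tensor products\<close>

definition alg_hom ::
    "('a, 'r) ring_scheme \<Rightarrow> ('a, 'b, 's) module_scheme \<Rightarrow> ('a, 'c, 't) module_scheme \<Rightarrow> ('b \<Rightarrow> 'c) set"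
  where "alg_hom A B C =
    {f \<in> ring_hom B C. \<forall>a\<in>carrier A. \<forall>x\<in>carrier B. f (a \<odot>\<^bsub>B\<^esub> x) = a \<odot>\<^bsub>C\<^esub> f x}"

definition base_algebra :: "('a, 'r) ring_scheme \<Rightarrow> ('a, 'a) module"
  where "base_algebra A = \<lparr>carrier = carrier A, mult = mult A, one = \<one>\<^bsub>A\<^esub>, zero = \<zero>\<^bsub>A\<^esub>,
    add = add A, smult = mult A\<rparr>"

text \<open>The quotient \<open>M / H\<close> of a module by a submodule, or of an algebra by an ideal.\<close>

definition quot :: "('a, 'b, 's) module_scheme \<Rightarrow> 'b set \<Rightarrow> ('a, 'b set) module"
  where "quot M H = \<lparr>carrier = a_rcosets\<^bsub>M\<^esub> H, mult = rcoset_mult M H, one = H +>\<^bsub>M\<^esub> \<one>\<^bsub>M\<^esub>,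
    zero = H, add = set_add M, smult = (\<lambda>r X. \<Union>x\<in>X. H +>\<^bsub>M\<^esub> (r \<odot>\<^bsub>M\<^esub> x))\<rparr>"

text \<open>The map on a quotient induced by a map that is constant on each coset.\<close>

definition induced :: "('b \<Rightarrow> 'c) \<Rightarrow> 'b set \<Rightarrow> 'c"
  where "induced f X = the_elem (f ` X)"

text \<open>
  The monoid algebra \<open>A[M]\<close>.  Its underlying module is free on the carrier of \<open>M\<close> and does not
  depend on the multiplication of \<open>M\<close>.
\<close>

definition monoid_algebra ::
    "('a, 'r) ring_scheme \<Rightarrow> ('m, 's) monoid_scheme \<Rightarrow> ('a, 'm \<Rightarrow> 'a) module"
  where "monoid_algebra A M = \<lparr>
    carrier = {p. (\<forall>m. p m \<in> carrier A) \<and> finite {m. p m \<noteq> \<zero>\<^bsub>A\<^esub>} \<and>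
                  {m. p m \<noteq> \<zero>\<^bsub>A\<^esub>} \<subseteq> carrier M},
    mult = (\<lambda>p q m. finsum A (\<lambda>(u, v). p u \<otimes>\<^bsub>A\<^esub> q v)
              {(u, v). p u \<noteq> \<zero>\<^bsub>A\<^esub> \<and> q v \<noteq> \<zero>\<^bsub>A\<^esub> \<and> u \<otimes>\<^bsub>M\<^esub> v = m}),
    one = (\<lambda>m. if m = \<one>\<^bsub>M\<^esub> then \<one>\<^bsub>A\<^esub> else \<zero>\<^bsub>A\<^esub>),
    zero = (\<lambda>m. \<zero>\<^bsub>A\<^esub>),
    add = (\<lambda>p q m. p m \<oplus>\<^bsub>A\<^esub> q m),
    smult = (\<lambda>a p m. a \<otimes>\<^bsub>A\<^esub> p m)\<rparr>"

definition single :: "('a, 'r) ring_scheme \<Rightarrow> 'm \<Rightarrow> 'm \<Rightarrow> 'a"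
  where "single A m = (\<lambda>m'. if m' = m then \<one>\<^bsub>A\<^esub> else \<zero>\<^bsub>A\<^esub>)"

definition lin_ext ::
    "('a, 'r) ring_scheme \<Rightarrow> ('a, 'b, 's) module_scheme \<Rightarrow> ('m \<Rightarrow> 'b) \<Rightarrow> ('m \<Rightarrow> 'a) \<Rightarrow> 'b"
  where "lin_ext A B \<phi> p = finsum B (\<lambda>m. p m \<odot>\<^bsub>B\<^esub> \<phi> m) {m. p m \<noteq> \<zero>\<^bsub>A\<^esub>}"

text \<open>
  The submodule of the free module on \<open>M \<times> N\<close> generated by the bilinearity relations.  For algebras
  \<open>M\<close> and \<open>N\<close> it is an ideal of the monoid algebra of the multiplicative monoid \<open>M \<times> N\<close>, so that
  the quotient is the tensor product algebra with \<open>(b \<otimes> c)(b' \<otimes> c') = bb' \<otimes> cc'\<close>.  For mere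
  modules the fields \<^const>\<open>monoid.mult\<close> and \<^const>\<open>monoid.one\<close> are irrelevant.
\<close>

definition tensor_null ::
    "('a, 'r) ring_scheme \<Rightarrow> ('a, 'b, 's) module_scheme \<Rightarrow> ('a, 'c, 't) module_scheme \<Rightarrow> ('b \<times> 'c \<Rightarrow> 'a) set"
  where "tensor_null R M N = (let F = monoid_algebra R (M \<times>\<times> N) in
    \<Inter>{H. submodule H R F \<and>
      (\<forall>x\<in>carrier M. \<forall>x'\<in>carrier M. \<forall>y\<in>carrier N.
        single R (x \<oplus>\<^bsub>M\<^esub> x', y) \<ominus>\<^bsub>F\<^esub> (single R (x, y) \<oplus>\<^bsub>F\<^esub> single R (x', y)) \<in> H) \<and>
      (\<forall>x\<in>carrier M. \<forall>y\<in>carrier N. \<forall>y'\<in>carrier N.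
        single R (x, y \<oplus>\<^bsub>N\<^esub> y') \<ominus>\<^bsub>F\<^esub> (single R (x, y) \<oplus>\<^bsub>F\<^esub> single R (x, y')) \<in> H) \<and>
      (\<forall>r\<in>carrier R. \<forall>x\<in>carrier M. \<forall>y\<in>carrier N.
        single R (r \<odot>\<^bsub>M\<^esub> x, y) \<ominus>\<^bsub>F\<^esub> (r \<odot>\<^bsub>F\<^esub> single R (x, y)) \<in> H \<and>
        single R (x, r \<odot>\<^bsub>N\<^esub> y) \<ominus>\<^bsub>F\<^esub> (r \<odot>\<^bsub>F\<^esub> single R (x, y)) \<in> H)})"

definition tensor ::
    "('a, 'r) ring_scheme \<Rightarrow> ('a, 'b, 's) module_scheme \<Rightarrow> ('a, 'c, 't) module_scheme \<Rightarrow>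
     ('a, ('b \<times> 'c \<Rightarrow> 'a) set) module"
  where "tensor R M N = quot (monoid_algebra R (M \<times>\<times> N)) (tensor_null R M N)"

definition pure ::
    "('a, 'r) ring_scheme \<Rightarrow> ('a, 'b, 's) module_scheme \<Rightarrow> ('a, 'c, 't) module_scheme \<Rightarrow>
     'b \<Rightarrow> 'c \<Rightarrow> ('b \<times> 'c \<Rightarrow> 'a) set"
  where "pure R M N x y = tensor_null R M N +>\<^bsub>monoid_algebra R (M \<times>\<times> N)\<^esub> single R (x, y)"

text \<open>The linear map \<open>x \<otimes> y \<mapsto> \<beta> x y\<close> into \<open>P\<close> given by a bilinear map \<open>\<beta>\<close>.\<close>

definition tensor_lift ::
    "('a, 'r) ring_scheme \<Rightarrow> ('a, 'd, 's) module_scheme \<Rightarrow> ('b \<Rightarrow> 'c \<Rightarrow> 'd) \<Rightarrow> ('b \<times> 'c \<Rightarrow> 'a) set \<Rightarrow> 'd"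
  where "tensor_lift R P \<beta> = induced (lin_ext R P (\<lambda>(x, y). \<beta> x y))"

text \<open>\<open>f \<otimes> g\<close> with values in \<open>M \<otimes> N\<close>.\<close>

definition tensor_map ::
    "('a, 'r) ring_scheme \<Rightarrow> ('a, 'b, 's) module_scheme \<Rightarrow> ('a, 'c, 't) module_scheme \<Rightarrow>
     ('d \<Rightarrow> 'b) \<Rightarrow> ('e \<Rightarrow> 'c) \<Rightarrow> ('d \<times> 'e \<Rightarrow> 'a) set \<Rightarrow> ('b \<times> 'c \<Rightarrow> 'a) set"
  where "tensor_map R M N f g = tensor_lift R (tensor R M N) (\<lambda>x y. pure R M N (f x) (g y))"

definition tensor_assoc ::
    "('a, 'r) ring_scheme \<Rightarrow> ('a, 'b, 's) module_scheme \<Rightarrow> ('a, 'c, 't) module_scheme \<Rightarrow>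
     ('a, 'd, 'u) module_scheme \<Rightarrow>
     (('b \<times> 'c \<Rightarrow> 'a) set \<times> 'd \<Rightarrow> 'a) set \<Rightarrow> ('b \<times> ('c \<times> 'd \<Rightarrow> 'a) set \<Rightarrow> 'a) set"
  where "tensor_assoc R L M N = (let P = tensor R L (tensor R M N) in
    tensor_lift R P (\<lambda>w z. tensor_lift R P (\<lambda>x y. pure R L (tensor R M N) x (pure R M N y z)) w))"

section \<open>Faithful flatness\<close>

definition lin_map ::
    "('a, 'r) ring_scheme \<Rightarrow> ('a, 'b, 's) module_scheme \<Rightarrow> ('a, 'c, 't) module_scheme \<Rightarrow> ('b \<Rightarrow> 'c) set"
  where "lin_map R M N = {u \<in> carrier M \<rightarrow> carrier N.
    (\<forall>x\<in>carrier M. \<forall>y\<in>carrier M. u (x \<oplus>\<^bsub>M\<^esub> y) = u x \<oplus>\<^bsub>N\<^esub> u y) \<and>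
    (\<forall>r\<in>carrier R. \<forall>x\<in>carrier M. u (r \<odot>\<^bsub>M\<^esub> x) = r \<odot>\<^bsub>N\<^esub> u x)}"

definition exact_at ::
    "('a, 'b, 's) module_scheme \<Rightarrow> ('b \<Rightarrow> 'c) \<Rightarrow> ('a, 'c, 't) module_scheme \<Rightarrow> ('c \<Rightarrow> 'd) \<Rightarrow>
     ('a, 'd, 'u) module_scheme \<Rightarrow> bool"
  where "exact_at M1 u M2 v M3 \<longleftrightarrow> u ` carrier M1 = {y \<in> carrier M2. v y = \<zero>\<^bsub>M3\<^esub>}"

definition restrict_scalars ::
    "('c, 's) ring_scheme \<Rightarrow> ('b \<Rightarrow> 'c) \<Rightarrow> ('b, 'c) module"
  where "restrict_scalars S \<phi> = \<lparr>carrier = carrier S, mult = mult S, one = \<one>\<^bsub>S\<^esub>, zero = \<zero>\<^bsub>S\<^esub>,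
    add = add S, smult = (\<lambda>r s. \<phi> r \<otimes>\<^bsub>S\<^esub> s)\<rparr>"

text \<open>
  The ring homomorphism \<open>\<phi> : R \<rightarrow> S\<close> is faithfully flat: a sequence of \<open>R\<close>-modules is exact iff it is
  exact after applying \<open>S \<otimes> _\<close>.  A definition cannot quantify over types, so the types of the
  elements of the three modules are parameters; theorems leave them as free type variables.
\<close>

definition faithfully_flat ::
    "'m1 itself \<Rightarrow> 'm2 itself \<Rightarrow> 'm3 itself \<Rightarrow>
     ('b, 'r) ring_scheme \<Rightarrow> ('c, 's) ring_scheme \<Rightarrow> ('b \<Rightarrow> 'c) \<Rightarrow> bool"
  where "faithfully_flat _ _ _ R S \<phi> \<longleftrightarrow> \<phi> \<in> ring_hom R S \<and>
    (\<forall>(M1 :: ('b, 'm1) module) (M2 :: ('b, 'm2) module) (M3 :: ('b, 'm3) module) u v.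
       module R M1 \<and> module R M2 \<and> module R M3 \<and> u \<in> lin_map R M1 M2 \<and> v \<in> lin_map R M2 M3 \<longrightarrow>
       (let S' = restrict_scalars S \<phi>;
            M1' = tensor R S' M1; M2' = tensor R S' M2; M3' = tensor R S' M3
        in exact_at M1 u M2 v M3 \<longleftrightarrow>
           exact_at M1' (tensor_map R S' M2 id u) M2' (tensor_map R S' M3 id v) M3'))"

section \<open>Affine group schemes\<close>

record ('a, 'b) hopf = "('a, 'b) module" +
  comult :: "'b \<Rightarrow> ('b \<times> 'b \<Rightarrow> 'a) set"
  counit :: "'b \<Rightarrow> 'a"
  antipode :: "'b \<Rightarrow> 'b"

text \<open>Affine group schemes are represented by commutative Hopf algebras.\<close>

locale affine_group_scheme = algebra A H
  for A :: "('a, 'r) ring_scheme" and H :: "('a, 'b, 's) hopf_scheme" +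
  assumes comult_hom: "comult H \<in> alg_hom A H (tensor A H H)"
    and counit_hom: "counit H \<in> alg_hom A H (base_algebra A)"
    and antipode_hom: "antipode H \<in> alg_hom A H H"
    and coassoc: "x \<in> carrier H \<Longrightarrow>
      tensor_assoc A H H H (tensor_map A (tensor A H H) H (comult H) id (comult H x)) =
      tensor_map A H (tensor A H H) id (comult H) (comult H x)"
    and counit_left: "x \<in> carrier H \<Longrightarrow>
      tensor_lift A H (\<lambda>y z. counit H y \<odot>\<^bsub>H\<^esub> z) (comult H x) = x"
    and counit_right: "x \<in> carrier H \<Longrightarrow>
      tensor_lift A H (\<lambda>y z. counit H z \<odot>\<^bsub>H\<^esub> y) (comult H x) = x"
    and antipode_left: "x \<in> carrier H \<Longrightarrow>
      tensor_lift A H (\<lambda>y z. antipode H y \<otimes>\<^bsub>H\<^esub> z) (comult H x) = counit H x \<odot>\<^bsub>H\<^esub> \<one>\<^bsub>H\<^esub>"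
    and antipode_right: "x \<in> carrier H \<Longrightarrow>
      tensor_lift A H (\<lambda>y z. y \<otimes>\<^bsub>H\<^esub> antipode H z) (comult H x) = counit H x \<odot>\<^bsub>H\<^esub> \<one>\<^bsub>H\<^esub>"

text \<open>\<open>f\<close> is the comorphism of a homomorphism of affine group schemes \<open>H \<rightarrow> K\<close>.\<close>

definition group_scheme_hom ::
    "('a, 'r) ring_scheme \<Rightarrow> ('a, 'b, 's) hopf_scheme \<Rightarrow> ('a, 'c, 't) hopf_scheme \<Rightarrow> ('c \<Rightarrow> 'b) \<Rightarrow> bool"
  where "group_scheme_hom A H K f \<longleftrightarrow>
    affine_group_scheme A H \<and> affine_group_scheme A K \<and> f \<in> alg_hom A K H \<and>
    (\<forall>x\<in>carrier K. comult H (f x) = tensor_map A H H f f (comult K x) \<and>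
                   counit H (f x) = counit K x)"

definition group_scheme_iso ::
    "('a, 'r) ring_scheme \<Rightarrow> ('a, 'b, 's) hopf_scheme \<Rightarrow> ('a, 'c, 't) hopf_scheme \<Rightarrow> ('c \<Rightarrow> 'b) \<Rightarrow> bool"
  where "group_scheme_iso A H K f \<longleftrightarrow>
    group_scheme_hom A H K f \<and> bij_betw f (carrier K) (carrier H)"

text \<open>The closed subgroup scheme \<open>V(J)\<close> of \<open>H\<close>, for a Hopf ideal \<open>J\<close>.\<close>

definition closed_subgroup ::
    "('a, 'r) ring_scheme \<Rightarrow> ('a, 'b, 's) hopf_scheme \<Rightarrow> 'b set \<Rightarrow> ('a, 'b set) hopf"
  where "closed_subgroup A H J = (let K = quot H J; p = (\<lambda>x. J +>\<^bsub>H\<^esub> x) in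
    module.extend K (hopf.fields
      (induced (\<lambda>x. tensor_map A K K p p (comult H x)))
      (induced (counit H))
      (induced (\<lambda>x. p (antipode H x)))))"

text \<open>
  The kernel of a homomorphism \<open>H \<rightarrow> K\<close> with comorphism \<open>p\<close>, i.e. the fibre over the unit section
  \<open>Spec A \<rightarrow> K\<close>, as a closed subgroup scheme of \<open>H\<close>.
\<close>

definition kernel_ideal ::
    "('a, 'b, 's) hopf_scheme \<Rightarrow> ('c \<Rightarrow> 'b) \<Rightarrow> ('a, 'r) ring_scheme \<Rightarrow> ('a, 'c, 't) hopf_scheme \<Rightarrow> 'b set"
  where "kernel_ideal H p A K = Idl\<^bsub>H\<^esub> (p ` {y \<in> carrier K. counit K y = \<zero>\<^bsub>A\<^esub>})"

definition kernel_scheme ::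
    "('a, 'r) ring_scheme \<Rightarrow> ('a, 'b, 's) hopf_scheme \<Rightarrow> ('a, 'c, 't) hopf_scheme \<Rightarrow> ('c \<Rightarrow> 'b) \<Rightarrow>
     ('a, 'b set) hopf"
  where "kernel_scheme A H K p = closed_subgroup A H (kernel_ideal H p A K)"

text \<open>
  Exactness of \<open>e \<rightarrow> T \<rightarrow> N \<rightarrow> Q \<rightarrow> e\<close>, where \<open>\<iota>\<close> and \<open>p\<close> are the comorphisms of \<open>T \<rightarrow> N\<close> and \<open>N \<rightarrow> Q\<close>:
  the latter is faithfully flat, and the former identifies \<open>T\<close> with its kernel.
\<close>

definition short_exact ::
    "'m1 itself \<Rightarrow> 'm2 itself \<Rightarrow> 'm3 itself \<Rightarrow> ('a, 'r) ring_scheme \<Rightarrow>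
     ('a, 't, 's1) hopf_scheme \<Rightarrow> ('n \<Rightarrow> 't) \<Rightarrow> ('a, 'n, 's2) hopf_scheme \<Rightarrow> ('q \<Rightarrow> 'n) \<Rightarrow>
     ('a, 'q, 's3) hopf_scheme \<Rightarrow> bool"
  where "short_exact m1 m2 m3 A T \<iota> N p Q \<longleftrightarrow>
    group_scheme_hom A T N \<iota> \<and> group_scheme_hom A N Q p \<and>
    faithfully_flat m1 m2 m3 Q N p \<and>
    (\<exists>\<theta>. group_scheme_iso A T (kernel_scheme A N Q p) \<theta> \<and>
         (\<forall>x\<in>carrier N. \<theta> (kernel_ideal N p A Q +>\<^bsub>N\<^esub> x) = \<iota> x))"

section \<open>Points with values in an algebra\<close>

text \<open>
  A point of \<open>X\<close> with values in the algebra \<open>R\<close> is a map \<open>Spec R \<rightarrow> X\<close>, hence a homomorphism from the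
  coordinate ring of \<open>X\<close> to \<open>R\<close>.  \<open>pt_pair\<close> is the pair of two points as a point of the product.
\<close>

definition pt_pair ::
    "('a, 'r) ring_scheme \<Rightarrow> ('a, 'd, 's) module_scheme \<Rightarrow> ('b \<Rightarrow> 'd) \<Rightarrow> ('c \<Rightarrow> 'd) \<Rightarrow>
     ('b \<times> 'c \<Rightarrow> 'a) set \<Rightarrow> 'd"
  where "pt_pair A R f g = tensor_lift A R (\<lambda>x y. f x \<otimes>\<^bsub>R\<^esub> g y)"

definition pt_mult ::
    "('a, 'r) ring_scheme \<Rightarrow> ('a, 'b, 's) hopf_scheme \<Rightarrow> ('a, 'd, 't) module_scheme \<Rightarrow>
     ('b \<Rightarrow> 'd) \<Rightarrow> ('b \<Rightarrow> 'd) \<Rightarrow> 'b \<Rightarrow> 'd"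
  where "pt_mult A H R f g = pt_pair A R f g \<circ> comult H"

definition pt_inv :: "('a, 'b, 's) hopf_scheme \<Rightarrow> ('b \<Rightarrow> 'd) \<Rightarrow> 'b \<Rightarrow> 'd"
  where "pt_inv H f = f \<circ> antipode H"

section \<open>Quotients by right multiplication\<close>

text \<open>
  Comorphisms of \<open>\<sigma>, q : N \<times> T \<rightarrow> N\<close>, \<open>\<sigma>(n, t) = nt\<close> and \<open>q(n, t) = n\<close>, where \<open>\<iota>\<close> is the
  comorphism of \<open>T \<rightarrow> N\<close>.
\<close>

definition act ::
    "('a, 'r) ring_scheme \<Rightarrow> ('a, 'n, 's) hopf_scheme \<Rightarrow> ('a, 't, 'u) hopf_scheme \<Rightarrow> ('n \<Rightarrow> 't) \<Rightarrow>
     'n \<Rightarrow> ('n \<times> 't \<Rightarrow> 'a) set"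
  where "act A N T \<iota> = tensor_map A N T id \<iota> \<circ> comult N"

definition proj ::
    "('a, 'r) ring_scheme \<Rightarrow> ('a, 'n, 's) hopf_scheme \<Rightarrow> ('a, 't, 'u) hopf_scheme \<Rightarrow>
     'n \<Rightarrow> ('n \<times> 't \<Rightarrow> 'a) set"
  where "proj A N T x = pure A N T x \<one>\<^bsub>T\<^esub>"

text \<open>
  \<open>N/T\<close>: the algebra of invariants.  Its comultiplication is the restriction of that of \<open>N\<close>, read
  through the map \<open>k[N/T] \<otimes> k[N/T] \<rightarrow> k[N] \<otimes> k[N]\<close>.
\<close>

definition invariants ::
    "('a, 'r) ring_scheme \<Rightarrow> ('a, 'n) hopf \<Rightarrow> ('a, 't, 'u) hopf_scheme \<Rightarrow> ('n \<Rightarrow> 't) \<Rightarrow> 'n set"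
  where "invariants A N T \<iota> = {x \<in> carrier N. act A N T \<iota> x = proj A N T x}"

definition quotient_scheme ::
    "('a, 'r) ring_scheme \<Rightarrow> ('a, 'n) hopf \<Rightarrow> ('a, 't, 'u) hopf_scheme \<Rightarrow> ('n \<Rightarrow> 't) \<Rightarrow> ('a, 'n) hopf"
  where "quotient_scheme A N T \<iota> = (let Q = N\<lparr>carrier := invariants A N T \<iota>\<rparr> in
    Q\<lparr>comult := (\<lambda>x. THE w. w \<in> carrier (tensor A Q Q) \<and> tensor_map A N N id id w = comult N x)\<rparr>)"

text \<open>
  The map \<open>N \<rightarrow> Q\<close> with comorphism \<open>p\<close> satisfies \<open>p \<circ> \<sigma> = p \<circ> q\<close>, and every map \<open>f\<close> from \<open>N\<close> to an
  affine scheme \<open>Z\<close> with \<open>f \<circ> \<sigma> = f \<circ> q\<close> factors uniquely through it.  The type of the elements of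
  the coordinate ring of \<open>Z\<close> is a parameter.  Intersecting with \<^const>\<open>extensional\<close> identifies
  comorphisms that agree on the carrier.
\<close>

definition categorical_quotient ::
    "'z itself \<Rightarrow> ('a, 'r) ring_scheme \<Rightarrow> ('a, 'n, 's) hopf_scheme \<Rightarrow> ('a, 't, 'u) hopf_scheme \<Rightarrow>
     ('n \<Rightarrow> 't) \<Rightarrow> ('a, 'q, 'v) module_scheme \<Rightarrow> ('q \<Rightarrow> 'n) \<Rightarrow> bool"
  where "categorical_quotient _ A N T \<iota> Q p \<longleftrightarrow>
    algebra A Q \<and> p \<in> alg_hom A Q N \<and>
    (\<forall>y\<in>carrier Q. act A N T \<iota> (p y) = proj A N T (p y)) \<and>
    (\<forall>(Z :: ('a, 'z) module) f.
       algebra A Z \<and> f \<in> alg_hom A Z N \<and>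
       (\<forall>z\<in>carrier Z. act A N T \<iota> (f z) = proj A N T (f z)) \<longrightarrow>
       (\<exists>!g. g \<in> alg_hom A Z Q \<inter> extensional (carrier Z) \<and> (\<forall>z\<in>carrier Z. p (g z) = f z)))"

section \<open>Semidirect products\<close>

text \<open>
  The semidirect product of \<open>T\<close> and \<open>Q\<close> for an action \<open>(h, t) \<mapsto> h\<cdot>t\<close> of \<open>Q\<close> on \<open>T\<close> with comorphism
  \<open>\<alpha> : k[T] \<rightarrow> k[Q] \<otimes> k[T]\<close>.  The underlying scheme is \<open>T \<times> Q\<close>, and the structure maps are obtained
  by evaluating \<open>(t1, h1)(t2, h2) = (t1 (h1\<cdot>t2), h1 h2)\<close> and \<open>(t, h)\<^sup>-\<^sup>1 = (h\<^sup>-\<^sup>1\<cdot>t\<^sup>-\<^sup>1, h\<^sup>-\<^sup>1)\<close> at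
  the universal points.
\<close>

definition semidirect ::
    "('a, 'r) ring_scheme \<Rightarrow> ('a, 't, 's) hopf_scheme \<Rightarrow> ('a, 'q, 'u) hopf_scheme \<Rightarrow>
     ('t \<Rightarrow> ('q \<times> 't \<Rightarrow> 'a) set) \<Rightarrow> ('a, ('t \<times> 'q \<Rightarrow> 'a) set) hopf"
  where "semidirect A T Q \<alpha> = (let
      P = tensor A T Q;
      t = (\<lambda>a. pure A T Q a \<one>\<^bsub>Q\<^esub>);
      h = (\<lambda>b. pure A T Q \<one>\<^bsub>T\<^esub> b);
      R = tensor A P P;
      t1 = (\<lambda>a. pure A P P (t a) \<one>\<^bsub>P\<^esub>);
      h1 = (\<lambda>b. pure A P P (h b) \<one>\<^bsub>P\<^esub>);
      t2 = (\<lambda>a. pure A P P \<one>\<^bsub>P\<^esub> (t a));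
      h2 = (\<lambda>b. pure A P P \<one>\<^bsub>P\<^esub> (h b))
    in module.extend P (hopf.fields
      (pt_pair A R (pt_mult A T R t1 (pt_pair A R h1 t2 \<circ> \<alpha>)) (pt_mult A Q R h1 h2))
      (pt_pair A (base_algebra A) (counit T) (counit Q))
      (pt_pair A P (pt_pair A P (pt_inv Q h) (pt_inv T t) \<circ> \<alpha>) (pt_inv Q h))))"

text \<open>
  The action \<open>h\<cdot>t = s(h) t s(h)\<^sup>-\<^sup>1\<close> of \<open>Q\<close> on a closed normal subgroup scheme \<open>T\<close> of \<open>N\<close> given by a
  homomorphism \<open>Q \<rightarrow> N\<close> with comorphism \<open>s\<close>.  The map \<open>Q \<times> T \<rightarrow> N\<close> so described has comorphism
  \<open>c\<close>, which factors through the surjection \<open>\<iota> : k[N] \<rightarrow> k[T]\<close>.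
\<close>

definition conj_action ::
    "('a, 'r) ring_scheme \<Rightarrow> ('a, 'n, 's) hopf_scheme \<Rightarrow> ('a, 't, 'u) hopf_scheme \<Rightarrow> ('n \<Rightarrow> 't) \<Rightarrow>
     ('a, 'q, 'v) hopf_scheme \<Rightarrow> ('n \<Rightarrow> 'q) \<Rightarrow> 't \<Rightarrow> ('q \<times> 't \<Rightarrow> 'a) set"
  where "conj_action A N T \<iota> Q s = (let
      R = tensor A Q T;
      h = (\<lambda>x. pure A Q T (s x) \<one>\<^bsub>T\<^esub>);
      t = (\<lambda>x. pure A Q T \<one>\<^bsub>Q\<^esub> (\<iota> x));
      c = pt_mult A N R (pt_mult A N R h t) (pt_inv N h)
    in (\<lambda>y. the_elem (c ` {x \<in> carrier N. \<iota> x = y})))"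

section \<open>\<open>GL\<^sub>2\<close>, \<open>SL\<^sub>2\<close>, the diagonal torus and its normalizer\<close>

text \<open>\<open>Dinv\<close> is the additional variable for \<open>1/D\<close> in the case of \<open>GL\<^sub>2\<close>.\<close>

datatype coord = X11 | X12 | X21 | X22 | Dinv

datatype matrix_group = GL2 | SL2

definition poly_algebra :: "('a, 'r) ring_scheme \<Rightarrow> coord set \<Rightarrow> ('a, coord multiset \<Rightarrow> 'a) module"
  where "poly_algebra A V =
    monoid_algebra A \<lparr>carrier = {m. set_mset m \<subseteq> V}, mult = (+), one = {#}\<rparr>"

definition var :: "('a, 'r) ring_scheme \<Rightarrow> coord \<Rightarrow> coord multiset \<Rightarrow> 'a"
  where "var A v = single A {#v#}"

definition poly_eval ::
    "('a, 'r) ring_scheme \<Rightarrow> ('a, 'b, 's) module_scheme \<Rightarrow> (coord \<Rightarrow> 'b) \<Rightarrow> (coord multiset \<Rightarrow> 'a) \<Rightarrow> 'b"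
  where "poly_eval A B \<phi> =
    lin_ext A B (\<lambda>m. finprod B (\<lambda>v. \<phi> v [^]\<^bsub>B\<^esub> count m v) (set_mset m))"

definition det2 :: "('b, 's) ring_scheme \<Rightarrow> (coord \<Rightarrow> 'b) \<Rightarrow> 'b"
  where "det2 B x = (x X11 \<otimes>\<^bsub>B\<^esub> x X22) \<ominus>\<^bsub>B\<^esub> (x X12 \<otimes>\<^bsub>B\<^esub> x X21)"

text \<open>
  \<open>A[x\<^sub>i\<^sub>j, 1/D]\<close> is presented as \<open>A[x\<^sub>i\<^sub>j, y] / (D y - 1)\<close>, and the coordinate ring of \<open>SL\<^sub>2\<close> is
  \<open>A[x\<^sub>i\<^sub>j] / (D - 1)\<close>.
\<close>

fun coords :: "matrix_group \<Rightarrow> coord set"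
  where
    "coords GL2 = {X11, X12, X21, X22, Dinv}"
  | "coords SL2 = {X11, X12, X21, X22}"

fun relation :: "('a, 'r) ring_scheme \<Rightarrow> matrix_group \<Rightarrow> coord multiset \<Rightarrow> 'a"
  where
    "relation A GL2 = (let P = poly_algebra A (coords GL2) in
       (det2 P (var A) \<otimes>\<^bsub>P\<^esub> var A Dinv) \<ominus>\<^bsub>P\<^esub> \<one>\<^bsub>P\<^esub>)"
  | "relation A SL2 = (let P = poly_algebra A (coords SL2) in
       det2 P (var A) \<ominus>\<^bsub>P\<^esub> \<one>\<^bsub>P\<^esub>)"

definition relation_ideal :: "('a, 'r) ring_scheme \<Rightarrow> matrix_group \<Rightarrow> (coord multiset \<Rightarrow> 'a) set"
  where "relation_ideal A g = Idl\<^bsub>poly_algebra A (coords g)\<^esub> {relation A g}"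

definition coord_algebra ::
    "('a, 'r) ring_scheme \<Rightarrow> matrix_group \<Rightarrow> ('a, (coord multiset \<Rightarrow> 'a) set) module"
  where "coord_algebra A g = quot (poly_algebra A (coords g)) (relation_ideal A g)"

definition cvar ::
    "('a, 'r) ring_scheme \<Rightarrow> matrix_group \<Rightarrow> coord \<Rightarrow> (coord multiset \<Rightarrow> 'a) set"
  where "cvar A g v = relation_ideal A g +>\<^bsub>poly_algebra A (coords g)\<^esub> var A v"

fun det_inverse :: "('a, 'r) ring_scheme \<Rightarrow> matrix_group \<Rightarrow> (coord multiset \<Rightarrow> 'a) set"
  where
    "det_inverse A GL2 = cvar A GL2 Dinv"
  | "det_inverse A SL2 = \<one>\<^bsub>coord_algebra A SL2\<^esub>"

text \<open>The structure maps on coordinates: matrix product, identity matrix, inverse matrix.\<close>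

fun comult_coord ::
    "('a, 'r) ring_scheme \<Rightarrow> matrix_group \<Rightarrow> coord \<Rightarrow>
     ((coord multiset \<Rightarrow> 'a) set \<times> (coord multiset \<Rightarrow> 'a) set \<Rightarrow> 'a) set"
  where
    "comult_coord A g X11 = (let B = coord_algebra A g; x = cvar A g in
       pure A B B (x X11) (x X11) \<oplus>\<^bsub>tensor A B B\<^esub> pure A B B (x X12) (x X21))"
  | "comult_coord A g X12 = (let B = coord_algebra A g; x = cvar A g in
       pure A B B (x X11) (x X12) \<oplus>\<^bsub>tensor A B B\<^esub> pure A B B (x X12) (x X22))"
  | "comult_coord A g X21 = (let B = coord_algebra A g; x = cvar A g in
       pure A B B (x X21) (x X11) \<oplus>\<^bsub>tensor A B B\<^esub> pure A B B (x X22) (x X21))"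
  | "comult_coord A g X22 = (let B = coord_algebra A g; x = cvar A g in
       pure A B B (x X21) (x X12) \<oplus>\<^bsub>tensor A B B\<^esub> pure A B B (x X22) (x X22))"
  | "comult_coord A g Dinv = (let B = coord_algebra A g; x = cvar A g in
       pure A B B (x Dinv) (x Dinv))"

fun counit_coord :: "('a, 'r) ring_scheme \<Rightarrow> coord \<Rightarrow> 'a"
  where
    "counit_coord A X11 = \<one>\<^bsub>A\<^esub>"
  | "counit_coord A X12 = \<zero>\<^bsub>A\<^esub>"
  | "counit_coord A X21 = \<zero>\<^bsub>A\<^esub>"
  | "counit_coord A X22 = \<one>\<^bsub>A\<^esub>"
  | "counit_coord A Dinv = \<one>\<^bsub>A\<^esub>"

fun antipode_coord ::
    "('a, 'r) ring_scheme \<Rightarrow> matrix_group \<Rightarrow> coord \<Rightarrow> (coord multiset \<Rightarrow> 'a) set"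
  where
    "antipode_coord A g X11 = det_inverse A g \<otimes>\<^bsub>coord_algebra A g\<^esub> cvar A g X22"
  | "antipode_coord A g X12 =
       \<ominus>\<^bsub>coord_algebra A g\<^esub> (det_inverse A g \<otimes>\<^bsub>coord_algebra A g\<^esub> cvar A g X12)"
  | "antipode_coord A g X21 =
       \<ominus>\<^bsub>coord_algebra A g\<^esub> (det_inverse A g \<otimes>\<^bsub>coord_algebra A g\<^esub> cvar A g X21)"
  | "antipode_coord A g X22 = det_inverse A g \<otimes>\<^bsub>coord_algebra A g\<^esub> cvar A g X11"
  | "antipode_coord A g Dinv = det2 (coord_algebra A g) (cvar A g)"

definition matrix_scheme ::
    "('a, 'r) ring_scheme \<Rightarrow> matrix_group \<Rightarrow> ('a, (coord multiset \<Rightarrow> 'a) set) hopf"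
  where "matrix_scheme A g = (let B = coord_algebra A g in
    module.extend B (hopf.fields
      (induced (poly_eval A (tensor A B B) (comult_coord A g)))
      (induced (poly_eval A (base_algebra A) (counit_coord A)))
      (induced (poly_eval A B (antipode_coord A g)))))"

definition I1 :: "('a, 'r) ring_scheme \<Rightarrow> matrix_group \<Rightarrow> (coord multiset \<Rightarrow> 'a) set set"
  where "I1 A g = Idl\<^bsub>matrix_scheme A g\<^esub> {cvar A g X12, cvar A g X21}"

definition I2 :: "('a, 'r) ring_scheme \<Rightarrow> matrix_group \<Rightarrow> (coord multiset \<Rightarrow> 'a) set set"
  where "I2 A g = Idl\<^bsub>matrix_scheme A g\<^esub> {cvar A g X11, cvar A g X22}"

definition torus ::
    "('a, 'r) ring_scheme \<Rightarrow> matrix_group \<Rightarrow> ('a, (coord multiset \<Rightarrow> 'a) set set) hopf"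
  where "torus A g = closed_subgroup A (matrix_scheme A g) (I1 A g)"

definition normalizer ::
    "('a, 'r) ring_scheme \<Rightarrow> matrix_group \<Rightarrow> ('a, (coord multiset \<Rightarrow> 'a) set set) hopf"
  where "normalizer A g =
    closed_subgroup A (matrix_scheme A g) (ideal_prod (matrix_scheme A g) (I1 A g) (I2 A g))"

text \<open>The comorphism \<open>k[G] / I1 I2 \<rightarrow> k[G] / I1\<close> of the inclusion of the torus into its normalizer.\<close>

definition torus_incl ::
    "('a, 'r) ring_scheme \<Rightarrow> matrix_group \<Rightarrow>
     (coord multiset \<Rightarrow> 'a) set set \<Rightarrow> (coord multiset \<Rightarrow> 'a) set set"
  where "torus_incl A g = induced (\<lambda>x. I1 A g +>\<^bsub>matrix_scheme A g\<^esub> x)"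

definition weyl ::
    "('a, 'r) ring_scheme \<Rightarrow> matrix_group \<Rightarrow> ('a, (coord multiset \<Rightarrow> 'a) set set) hopf"
  where "weyl A g = quotient_scheme A (normalizer A g) (torus A g) (torus_incl A g)"

text \<open>The comorphism of \<open>\<pi> : N \<rightarrow> N/T\<close>, i.e. the inclusion \<open>k[N/T] \<subseteq> k[N]\<close>.\<close>

definition quotient_map ::
    "('a, 'r) ring_scheme \<Rightarrow> matrix_group \<Rightarrow>
     (coord multiset \<Rightarrow> 'a) set set \<Rightarrow> (coord multiset \<Rightarrow> 'a) set set"
  where "quotient_map A g = (\<lambda>x. x)"

end

theory Submission
  imports Defs
begin

text \<open>
  Modulo \<open>I\<^sub>1 I\<^sub>2\<close> a diagonal entry times an antidiagonal one vanishes, so \<open>e = x\<^sub>1\<^sub>1 x\<^sub>2\<^sub>2 / D\<close> and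
  \<open>e' = - x\<^sub>1\<^sub>2 x\<^sub>2\<^sub>1 / D\<close> are orthogonal idempotents of \<open>k[N]\<close> with sum \<open>1\<close>.  Evaluating an invariant
  at \<open>1\<close> and at a monomial matrix \<open>w\<close> gives the retraction \<open>r z = z(1) e + z(w) e'\<close> of \<open>k[N]\<close> onto
  \<open>k[N/T] = A e + A e'\<close>, and the remaining assertions on \<open>N/T\<close> as a group and as a categorical quotient
  follow from it.

  For flatness, restrict \<open>z\<close> to the cosets \<open>T\<close> and \<open>w T\<close>, that is, map it to a ring \<open>L\<close> of Laurent
  polynomials by \<open>\<kappa>\<^sub>1\<close> and \<open>\<kappa>\<^sub>2\<close>.  Both restrictions are expressed in the same monomials in
  \<open>u = x\<^sub>1\<^sub>1 \<plusminus> x\<^sub>2\<^sub>1\<close> and \<open>y = x\<^sub>2\<^sub>2 + x\<^sub>1\<^sub>2\<close>: with \<open>\<beta> : L \<rightarrow> k[N]\<close> substituting \<open>u\<close> and \<open>y\<close> for the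
  variables, \<open>z = e \<beta> (\<kappa>\<^sub>1 z) + e' \<beta> (\<kappa>\<^sub>2 z)\<close>.  Hence these monomials and the coefficients of
  \<open>\<kappa>\<^sub>1\<close> and \<open>\<kappa>\<^sub>2\<close> form a dual basis of \<open>k[N]\<close> over its direct summand \<open>k[N/T]\<close>.

  For \<open>GL\<^sub>2\<close> the permutation matrix \<open>w\<close> satisfies \<open>w\<^sup>2 = 1\<close>, and \<open>r\<close> is the comorphism of a section of
  \<open>\<pi>\<close>; for \<open>SL\<^sub>2\<close> one only has \<open>w\<^sup>2 = - 1\<close>.
\<close>

section \<open>Linear maps and algebra homomorphisms\<close>

text \<open>Calculations in iterated tensor products are avoided by studying a Hopf algebra through
  its points. Homomorphisms from \<open>k[G]\<close>, \<open>k[N]\<close>, \<open>k[T]\<close> to an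
  algebra \<open>R\<close> are the matrices of the group over \<open>R\<close>, the monomial ones
  and the diagonal ones, so an identity between comorphisms becomes, at a universal point, an
  identity of matrices or of elements of an abstract group. The Hopf ideal conditions are read off
  in the same way from the shape of a matrix. Nothing is assumed about \<open>A\<close>. If
  \<open>R\<close> has nontrivial idempotents, a monomial matrix need not be diagonal or
  antidiagonal, and gluing along \<open>e\<close> and \<open>e'\<close> replaces the case
  distinction. The comultiplication descends to \<open>k[N/T]\<close> because
  \<open>k[N/T] \<otimes> k[N/T]\<close> embeds into \<open>k[N] \<otimes> k[N]\<close>; here this
  comes from the left inverse \<open>r \<otimes> r\<close> and not from flatness. The sign in
  \<open>u\<close> is dictated by \<open>w = (0, 1; s, 0)\<close>: the lower left entry of
  \<open>w diag(u, y)\<close> is \<open>s u\<close>, and since \<open>s s = 1\<close> it equals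
  \<open>x21\<close> on the second coset when \<open>u\<close> is \<open>s x21\<close> there. The
  upper right entry is \<open>y\<close>, which needs no sign.\<close>

lemma lin_mapI:
  assumes "\<And>x. x \<in> carrier M \<Longrightarrow> u x \<in> carrier N"
    and "\<And>x y. x \<in> carrier M \<Longrightarrow> y \<in> carrier M \<Longrightarrow> u (x \<oplus>\<^bsub>M\<^esub> y) = u x \<oplus>\<^bsub>N\<^esub> u y"
    and "\<And>r x. r \<in> carrier R \<Longrightarrow> x \<in> carrier M \<Longrightarrow> u (r \<odot>\<^bsub>M\<^esub> x) = r \<odot>\<^bsub>N\<^esub> u x"
  shows "u \<in> lin_map R M N"
  using assms by (auto simp: lin_map_def)

lemma lin_map_closed: "u \<in> lin_map R M N \<Longrightarrow> x \<in> carrier M \<Longrightarrow> u x \<in> carrier N"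
  by (auto simp: lin_map_def)

lemma lin_map_add:
  "u \<in> lin_map R M N \<Longrightarrow> x \<in> carrier M \<Longrightarrow> y \<in> carrier M \<Longrightarrow> u (x \<oplus>\<^bsub>M\<^esub> y) = u x \<oplus>\<^bsub>N\<^esub> u y"
  by (auto simp: lin_map_def)

lemma lin_map_smult:
  "u \<in> lin_map R M N \<Longrightarrow> r \<in> carrier R \<Longrightarrow> x \<in> carrier M \<Longrightarrow> u (r \<odot>\<^bsub>M\<^esub> x) = r \<odot>\<^bsub>N\<^esub> u x"
  by (auto simp: lin_map_def)

lemma lin_map_zero:
  assumes "module R M" "module R N" "u \<in> lin_map R M N"
  shows "u \<zero>\<^bsub>M\<^esub> = \<zero>\<^bsub>N\<^esub>"
proof -
  interpret M: module R M by fact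
  interpret N: module R N by fact
  have "u \<zero>\<^bsub>M\<^esub> = u (\<zero>\<^bsub>R\<^esub> \<odot>\<^bsub>M\<^esub> \<zero>\<^bsub>M\<^esub>)" by simp
  also have "\<dots> = \<zero>\<^bsub>R\<^esub> \<odot>\<^bsub>N\<^esub> u \<zero>\<^bsub>M\<^esub>"
    using assms(3) by (simp only: lin_map_smult M.R.zero_closed M.M.zero_closed)
  finally show ?thesis using lin_map_closed[OF assms(3)] by simp
qed

lemma lin_map_uminus:
  assumes "module R M" "module R N" "u \<in> lin_map R M N" "x \<in> carrier M"
  shows "u (\<ominus>\<^bsub>M\<^esub> x) = \<ominus>\<^bsub>N\<^esub> u x"
proof -
  interpret M: module R M by fact
  interpret N: module R N by fact
  have "u (\<ominus>\<^bsub>M\<^esub> x) = u ((\<ominus>\<^bsub>R\<^esub> \<one>\<^bsub>R\<^esub>) \<odot>\<^bsub>M\<^esub> x)"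
    using assms(4) by (simp add: M.smult_l_minus)
  also have "\<dots> = (\<ominus>\<^bsub>R\<^esub> \<one>\<^bsub>R\<^esub>) \<odot>\<^bsub>N\<^esub> u x"
    using assms by (simp only: lin_map_smult M.R.one_closed M.R.a_inv_closed)
  finally show ?thesis using lin_map_closed[OF assms(3,4)] by (simp add: N.smult_l_minus)
qed

lemma (in abelian_group) minus_eq_zero_iff:
  assumes "x \<in> carrier G" "y \<in> carrier G" shows "x \<ominus> y = \<zero> \<longleftrightarrow> x = y"
  using assms by (metis a_minus_def minus_equality minus_minus a_inv_closed r_neg)

lemma lin_map_minus:
  assumes "module R M" "module R N" "u \<in> lin_map R M N" "x \<in> carrier M" "y \<in> carrier M"
  shows "u (x \<ominus>\<^bsub>M\<^esub> y) = u x \<ominus>\<^bsub>N\<^esub> u y"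
proof -
  interpret M: module R M by fact
  show ?thesis
    using assms unfolding a_minus_def
    by (simp add: lin_map_add[OF assms(3)] lin_map_uminus[OF assms(1,2,3)])
qed

lemma lin_map_comp:
  "u \<in> lin_map R M N \<Longrightarrow> v \<in> lin_map R N P \<Longrightarrow> (\<lambda>x. v (u x)) \<in> lin_map R M P"
  by (auto simp: lin_map_def Pi_iff)

lemma lin_map_id: "(\<lambda>x. x) \<in> lin_map R M M"
  by (auto simp: lin_map_def)

lemma alg_hom_lin: "f \<in> alg_hom A B C \<Longrightarrow> f \<in> lin_map A B C"
  by (auto simp: alg_hom_def lin_map_def ring_hom_def)

lemma alg_hom_closed: "f \<in> alg_hom A B C \<Longrightarrow> x \<in> carrier B \<Longrightarrow> f x \<in> carrier C"
  by (auto simp: alg_hom_def ring_hom_def)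

lemma alg_hom_add:
  "f \<in> alg_hom A B C \<Longrightarrow> x \<in> carrier B \<Longrightarrow> y \<in> carrier B \<Longrightarrow> f (x \<oplus>\<^bsub>B\<^esub> y) = f x \<oplus>\<^bsub>C\<^esub> f y"
  by (auto simp: alg_hom_def ring_hom_def)

lemma alg_hom_mult:
  "f \<in> alg_hom A B C \<Longrightarrow> x \<in> carrier B \<Longrightarrow> y \<in> carrier B \<Longrightarrow> f (x \<otimes>\<^bsub>B\<^esub> y) = f x \<otimes>\<^bsub>C\<^esub> f y"
  by (auto simp: alg_hom_def ring_hom_def)

lemma alg_hom_one: "f \<in> alg_hom A B C \<Longrightarrow> f \<one>\<^bsub>B\<^esub> = \<one>\<^bsub>C\<^esub>"
  by (auto simp: alg_hom_def ring_hom_def)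

lemma alg_hom_smult:
  "f \<in> alg_hom A B C \<Longrightarrow> a \<in> carrier A \<Longrightarrow> x \<in> carrier B \<Longrightarrow> f (a \<odot>\<^bsub>B\<^esub> x) = a \<odot>\<^bsub>C\<^esub> f x"
  by (auto simp: alg_hom_def)

lemmas alg_hom_simps = alg_hom_closed alg_hom_add alg_hom_mult alg_hom_one alg_hom_smult

lemma alg_homI:
  assumes "f \<in> lin_map A B C" "f \<one>\<^bsub>B\<^esub> = \<one>\<^bsub>C\<^esub>"
    and "\<And>x y. x \<in> carrier B \<Longrightarrow> y \<in> carrier B \<Longrightarrow> f (x \<otimes>\<^bsub>B\<^esub> y) = f x \<otimes>\<^bsub>C\<^esub> f y"
  shows "f \<in> alg_hom A B C"
  using assms by (auto simp: alg_hom_def lin_map_def ring_hom_def Pi_iff)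

lemma algebra_module: "algebra A B \<Longrightarrow> module A B"
  by (rule algebra.axioms)

lemma alg_hom_zero: "algebra A B \<Longrightarrow> algebra A C \<Longrightarrow> f \<in> alg_hom A B C \<Longrightarrow> f \<zero>\<^bsub>B\<^esub> = \<zero>\<^bsub>C\<^esub>"
  by (rule lin_map_zero[OF algebra_module algebra_module alg_hom_lin])

lemma alg_hom_uminus:
  "algebra A B \<Longrightarrow> algebra A C \<Longrightarrow> f \<in> alg_hom A B C \<Longrightarrow> x \<in> carrier B \<Longrightarrow>
    f (\<ominus>\<^bsub>B\<^esub> x) = \<ominus>\<^bsub>C\<^esub> f x"
  by (rule lin_map_uminus[OF algebra_module algebra_module alg_hom_lin])

lemma alg_hom_minus:
  "algebra A B \<Longrightarrow> algebra A C \<Longrightarrow> f \<in> alg_hom A B C \<Longrightarrow> x \<in> carrier B \<Longrightarrow> y \<in> carrier B \<Longrightarrow>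
    f (x \<ominus>\<^bsub>B\<^esub> y) = f x \<ominus>\<^bsub>C\<^esub> f y"
  by (rule lin_map_minus[OF algebra_module algebra_module alg_hom_lin])

lemma alg_hom_comp:
  "f \<in> alg_hom A B C \<Longrightarrow> h \<in> alg_hom A C D \<Longrightarrow> (\<lambda>x. h (f x)) \<in> alg_hom A B D"
  by (auto simp: alg_hom_def ring_hom_def Pi_iff)

lemma alg_hom_id: "(\<lambda>x. x) \<in> alg_hom A B B"
  by (auto simp: alg_hom_def ring_hom_def)

text \<open>Membership in \<open>alg_hom\<close> ignores the values of a function off the carrier,
  so a map may be replaced by a formula that is known only on the carrier.\<close>

lemma alg_hom_cong:
  assumes "algebra A B" "f \<in> alg_hom A B C" "\<And>x. x \<in> carrier B \<Longrightarrow> h x = f x"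
  shows "h \<in> alg_hom A B C"
proof -
  interpret algebra A B by fact
  show ?thesis using assms(2,3) by (auto simp: alg_hom_def ring_hom_def Pi_iff)
qed

text \<open>Maps out of a quotient are defined through representatives (\<open>induced\<close>,
  \<open>the_elem\<close>). Once such an \<open>h\<close> satisfies \<open>h (p x) = f x\<close>,
  choosing preimages of the arguments transfers each homomorphism law from \<open>f\<close>.\<close>

lemma alg_hom_factor_surj:
  assumes "algebra A B" "p \<in> alg_hom A B C" "p ` carrier B = carrier C"
    and "f \<in> alg_hom A B D" "\<And>x. x \<in> carrier B \<Longrightarrow> h (p x) = f x"
  shows "h \<in> alg_hom A C D"
proof -
  interpret algebra A B by fact
  have S: "\<exists>x\<in>carrier B. y = p x" if "y \<in> carrier C" for y using that assms(3) by auto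
  show ?thesis
  proof (rule alg_homI, rule lin_mapI)
    show "h y \<in> carrier D" if "y \<in> carrier C" for y
      using S[OF that] assms by (auto simp: alg_hom_simps)
    show "h (y \<oplus>\<^bsub>C\<^esub> z) = h y \<oplus>\<^bsub>D\<^esub> h z" if yz: "y \<in> carrier C" "z \<in> carrier C" for y z
    proof -
      obtain a b where "a \<in> carrier B" "b \<in> carrier B" "y = p a" "z = p b" using S yz by metis
      then show ?thesis
        using assms(5)[of "a \<oplus>\<^bsub>B\<^esub> b"] assms by (simp add: alg_hom_simps[OF assms(2)] alg_hom_simps[OF assms(4)])
    qed
    show "h (y \<otimes>\<^bsub>C\<^esub> z) = h y \<otimes>\<^bsub>D\<^esub> h z" if yz: "y \<in> carrier C" "z \<in> carrier C" for y z
    proof -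
      obtain a b where "a \<in> carrier B" "b \<in> carrier B" "y = p a" "z = p b" using S yz by metis
      then show ?thesis
        using assms(5)[of "a \<otimes>\<^bsub>B\<^esub> b"] assms by (simp add: alg_hom_simps[OF assms(2)] alg_hom_simps[OF assms(4)])
    qed
    show "h (r \<odot>\<^bsub>C\<^esub> y) = r \<odot>\<^bsub>D\<^esub> h y" if ry: "r \<in> carrier A" "y \<in> carrier C" for r y
    proof -
      obtain a where "a \<in> carrier B" "y = p a" using S ry by metis
      then show ?thesis
        using assms(5)[of "r \<odot>\<^bsub>B\<^esub> a"] ry assms by (simp add: alg_hom_simps[OF assms(2)] alg_hom_simps[OF assms(4)])
    qed
    show "h \<one>\<^bsub>C\<^esub> = \<one>\<^bsub>D\<^esub>"
      using assms(5)[of "\<one>\<^bsub>B\<^esub>"] by (simp add: alg_hom_one[OF assms(2)] alg_hom_one[OF assms(4)])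
  qed
qed

text \<open>The axioms mention only these six fields, so they pass between records of different
  types, such as \<open>B Quot J\<close> and \<open>quot B J\<close>.\<close>

lemma cring_ring_fields_cong:
  assumes "cring R" "carrier S = carrier R" "mult S = mult R" "\<one>\<^bsub>S\<^esub> = \<one>\<^bsub>R\<^esub>"
    "\<zero>\<^bsub>S\<^esub> = \<zero>\<^bsub>R\<^esub>" "add S = add R"
  shows "cring S"
  using assms(1)
  unfolding cring_def ring_def ring_axioms_def abelian_group_def abelian_group_axioms_def
    abelian_monoid_def comm_group_def group_def group_axioms_def comm_monoid_def
    comm_monoid_axioms_def monoid_def Units_def partial_object.simps monoid.simps assms(2-) .

lemma abelian_group_fields_cong:
  assumes "abelian_group R" "carrier S = carrier R" "\<zero>\<^bsub>S\<^esub> = \<zero>\<^bsub>R\<^esub>" "add S = add R"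
  shows "abelian_group S"
  using assms(1)
  unfolding abelian_group_def abelian_group_axioms_def abelian_monoid_def comm_group_def
    group_def group_axioms_def comm_monoid_def comm_monoid_axioms_def monoid_def Units_def
    partial_object.simps monoid.simps assms(2-) .

text \<open>Test objects of the universal property are bare \<open>module\<close> records; a
  coordinate ring with Hopf structure enters it in truncated form.\<close>

lemma algebra_truncate: "algebra A B \<Longrightarrow> algebra A (module.truncate B)"
proof -
  assume "algebra A B"
  then interpret algebra A B .
  show ?thesis
    by (rule algebraI, rule R_cring, rule cring_ring_fields_cong[OF M_cring])
      (auto simp: module.truncate_def smult_l_distr smult_r_distr smult_assoc1 smult_assoc2)
qed

lemma algebra_base:
  assumes "cring A" shows "algebra A (base_algebra A)"
proof -
  interpret cring A by fact
  show ?thesis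
    by (rule algebraI, rule cring_axioms, rule cring_ring_fields_cong[OF cring_axioms])
      (auto simp: base_algebra_def l_distr r_distr m_assoc)
qed

lemma base_algebra_simps [simp]:
  "carrier (base_algebra A) = carrier A" "\<one>\<^bsub>base_algebra A\<^esub> = \<one>\<^bsub>A\<^esub>" "\<zero>\<^bsub>base_algebra A\<^esub> = \<zero>\<^bsub>A\<^esub>"
  "mult (base_algebra A) = mult A" "add (base_algebra A) = add A" "smult (base_algebra A) = mult A"
  by (auto simp: base_algebra_def)

lemma alg_hom_unit:
  assumes "algebra A B" shows "(\<lambda>a. a \<odot>\<^bsub>B\<^esub> \<one>\<^bsub>B\<^esub>) \<in> alg_hom A (base_algebra A) B"
proof -
  interpret algebra A B by fact
  show ?thesis
    by (rule alg_homI, rule lin_mapI)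
      (auto simp: smult_l_distr smult_assoc1 smult_assoc2)
qed

section \<open>Quotients\<close>

lemma quot_sel:
  "carrier (quot M H) = a_rcosets\<^bsub>M\<^esub> H" "mult (quot M H) = rcoset_mult M H"
  "\<one>\<^bsub>quot M H\<^esub> = H +>\<^bsub>M\<^esub> \<one>\<^bsub>M\<^esub>" "\<zero>\<^bsub>quot M H\<^esub> = H" "add (quot M H) = set_add M"
  "smult (quot M H) = (\<lambda>r X. \<Union>x\<in>X. H +>\<^bsub>M\<^esub> (r \<odot>\<^bsub>M\<^esub> x))"
  by (auto simp: quot_def)

locale module_quotient = module R M for R :: "('a, 'r) ring_scheme" and M :: "('a, 'b, 's) module_scheme" +
  fixes H assumes H: "submodule H R M"
begin

lemma abelian_subgroup: "abelian_subgroup H M"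
  using H submodule.axioms(1) abelian_subgroupI3 additive_subgroup.intro M.abelian_group_axioms by blast

lemma H_subset: "H \<subseteq> carrier M" using submoduleE(1)[OF H] .

lemma quot_carrier: "carrier (quot M H) = (\<lambda>x. H +>\<^bsub>M\<^esub> x) ` carrier M"
  by (auto simp: quot_sel A_RCOSETS_def RCOSETS_def a_r_coset_def)

lemma coset_closed [simp]: "x \<in> carrier M \<Longrightarrow> H +>\<^bsub>M\<^esub> x \<in> carrier (quot M H)"
  by (simp add: quot_carrier)

lemma coset_eq_iff:
  assumes "x \<in> carrier M" "y \<in> carrier M"
  shows "H +>\<^bsub>M\<^esub> x = H +>\<^bsub>M\<^esub> y \<longleftrightarrow> x \<ominus>\<^bsub>M\<^esub> y \<in> H"
proof -
  interpret abelian_subgroup H M by (rule abelian_subgroup)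
  show ?thesis
    using assms a_rcos_module_minus[OF ring.intro]
    by (metis a_rcos_module a_rcos_self a_repr_independence' a_minus_def)
qed

lemma coset_mem: assumes "x \<in> carrier M" "y \<in> H +>\<^bsub>M\<^esub> x"
  shows "y \<in> carrier M" "H +>\<^bsub>M\<^esub> y = H +>\<^bsub>M\<^esub> x"
proof -
  interpret abelian_subgroup H M by (rule abelian_subgroup)
  show "y \<in> carrier M" using assms a_elemrcos_carrier by blast
  show "H +>\<^bsub>M\<^esub> y = H +>\<^bsub>M\<^esub> x" using assms a_repr_independence' by metis
qed

lemma coset_self: "x \<in> carrier M \<Longrightarrow> x \<in> H +>\<^bsub>M\<^esub> x"
  using abelian_subgroup.a_rcos_self[OF abelian_subgroup] .

lemma coset_add:
  "x \<in> carrier M \<Longrightarrow> y \<in> carrier M \<Longrightarrow>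
    (H +>\<^bsub>M\<^esub> x) \<oplus>\<^bsub>quot M H\<^esub> (H +>\<^bsub>M\<^esub> y) = H +>\<^bsub>M\<^esub> (x \<oplus>\<^bsub>M\<^esub> y)"
  by (simp add: quot_sel abelian_subgroup.a_rcos_sum[OF abelian_subgroup])

lemma coset_smult:
  assumes "r \<in> carrier R" "x \<in> carrier M"
  shows "r \<odot>\<^bsub>quot M H\<^esub> (H +>\<^bsub>M\<^esub> x) = H +>\<^bsub>M\<^esub> (r \<odot>\<^bsub>M\<^esub> x)"
proof -
  have "H +>\<^bsub>M\<^esub> (r \<odot>\<^bsub>M\<^esub> y) = H +>\<^bsub>M\<^esub> (r \<odot>\<^bsub>M\<^esub> x)" if "y \<in> H +>\<^bsub>M\<^esub> x" for y
  proof -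
    have y: "y \<in> carrier M" "y \<ominus>\<^bsub>M\<^esub> x \<in> H"
      using coset_mem[OF assms(2) that] coset_eq_iff assms(2) by auto
    have "r \<odot>\<^bsub>M\<^esub> y \<ominus>\<^bsub>M\<^esub> r \<odot>\<^bsub>M\<^esub> x = r \<odot>\<^bsub>M\<^esub> (y \<ominus>\<^bsub>M\<^esub> x)"
      using y assms by (simp add: a_minus_def smult_r_distr smult_r_minus)
    then show ?thesis using y assms submoduleE(4)[OF H] coset_eq_iff by auto
  qed
  then show ?thesis unfolding quot_sel using coset_self[OF assms(2)] by blast
qed

lemma coset_zero: "H +>\<^bsub>M\<^esub> \<zero>\<^bsub>M\<^esub> = \<zero>\<^bsub>quot M H\<^esub>"
  using M.a_coset_add_zero[OF H_subset] by (simp add: quot_sel)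

lemma coset_eq_zero_iff: "x \<in> carrier M \<Longrightarrow> H +>\<^bsub>M\<^esub> x = \<zero>\<^bsub>quot M H\<^esub> \<longleftrightarrow> x \<in> H"
  using coset_eq_iff[of x "\<zero>\<^bsub>M\<^esub>"] coset_zero M.minus_equality[of "\<zero>\<^bsub>M\<^esub>" "\<zero>\<^bsub>M\<^esub>"]
  by (simp add: a_minus_def del: M.a_coset_add_zero)

lemma quot_elim:
  assumes "X \<in> carrier (quot M H)" obtains x where "x \<in> carrier M" "X = H +>\<^bsub>M\<^esub> x"
  using assms quot_carrier by auto

lemma quot_abelian_group: "abelian_group (quot M H)"
proof (rule abelian_groupI)
  fix X assume X: "X \<in> carrier (quot M H)"
  then obtain x where x: "x \<in> carrier M" "X = H +>\<^bsub>M\<^esub> x" by (rule quot_elim)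
  show "\<zero>\<^bsub>quot M H\<^esub> \<oplus>\<^bsub>quot M H\<^esub> X = X"
    unfolding coset_zero[symmetric] x(2) using x(1) by (simp add: coset_add del: M.a_coset_add_zero)
  show "\<exists>Y\<in>carrier (quot M H). Y \<oplus>\<^bsub>quot M H\<^esub> X = \<zero>\<^bsub>quot M H\<^esub>"
    using x by (intro bexI[of _ "H +>\<^bsub>M\<^esub> (\<ominus>\<^bsub>M\<^esub> x)"])
      (simp_all add: coset_add M.l_neg coset_zero del: M.a_coset_add_zero)
  fix Y assume Y: "Y \<in> carrier (quot M H)"
  then obtain y where y: "y \<in> carrier M" "Y = H +>\<^bsub>M\<^esub> y" by (rule quot_elim)
  show "X \<oplus>\<^bsub>quot M H\<^esub> Y \<in> carrier (quot M H)" using x y by (simp add: coset_add)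
  show "X \<oplus>\<^bsub>quot M H\<^esub> Y = Y \<oplus>\<^bsub>quot M H\<^esub> X"
    using x y by (simp add: coset_add M.a_comm)
  fix Z assume Z: "Z \<in> carrier (quot M H)"
  then obtain z where z: "z \<in> carrier M" "Z = H +>\<^bsub>M\<^esub> z" by (rule quot_elim)
  show "X \<oplus>\<^bsub>quot M H\<^esub> Y \<oplus>\<^bsub>quot M H\<^esub> Z = X \<oplus>\<^bsub>quot M H\<^esub> (Y \<oplus>\<^bsub>quot M H\<^esub> Z)"
    using x y z by (simp add: coset_add M.a_assoc)
next
  show "\<zero>\<^bsub>quot M H\<^esub> \<in> carrier (quot M H)" unfolding coset_zero[symmetric] by (simp del: M.a_coset_add_zero)
qed

lemma quot_module: "module R (quot M H)"
  by (rule moduleI[OF R.cring_axioms quot_abelian_group]; (elim quot_elim)?)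
    (simp_all add: coset_add coset_smult smult_l_distr smult_r_distr smult_assoc1)

lemma coset_lin: "(\<lambda>x. H +>\<^bsub>M\<^esub> x) \<in> lin_map R M (quot M H)"
  by (rule lin_mapI) (auto simp: coset_add coset_smult)

text \<open>Two representatives of a coset differ by an element of \<open>H\<close>, so
  \<open>f\<close> takes a single value there and \<open>the_elem\<close> is applied to a
  singleton.\<close>

lemma induced_coset:
  assumes "module R N" "f \<in> lin_map R M N" "\<And>h. h \<in> H \<Longrightarrow> f h = \<zero>\<^bsub>N\<^esub>" "x \<in> carrier M"
  shows "induced f (H +>\<^bsub>M\<^esub> x) = f x"
proof -
  interpret N: module R N by fact
  have "f y = f x" if "y \<in> H +>\<^bsub>M\<^esub> x" for y
  proof -
    have y: "y \<in> carrier M" "y \<ominus>\<^bsub>M\<^esub> x \<in> H"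
      using coset_mem[OF assms(4) that] coset_eq_iff assms(4) by auto
    then have "f y \<ominus>\<^bsub>N\<^esub> f x = \<zero>\<^bsub>N\<^esub>"
      using assms lin_map_minus[OF module_axioms assms(1,2)] by metis
    then show ?thesis
      using y lin_map_closed[OF assms(2)] assms(4) N.minus_eq_zero_iff by simp
  qed
  then have "f ` (H +>\<^bsub>M\<^esub> x) = {f x}" using coset_self[OF assms(4)] by blast
  then show ?thesis by (simp add: induced_def)
qed

lemma induced_lin:
  assumes "module R N" "f \<in> lin_map R M N" "\<And>h. h \<in> H \<Longrightarrow> f h = \<zero>\<^bsub>N\<^esub>"
  shows "induced f \<in> lin_map R (quot M H) N"
  by (rule lin_mapI)
    (auto simp: quot_carrier coset_add coset_smult induced_coset[OF assms] lin_map_closed[OF assms(2)]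
      lin_map_add[OF assms(2)] lin_map_smult[OF assms(2)])

end

locale algebra_quotient = algebra A B for A :: "('a, 'r) ring_scheme" and B :: "('a, 'b, 's) module_scheme" +
  fixes J assumes J: "ideal J B"
begin

lemma J_submodule: "submodule J A B"
proof -
  interpret J: ideal J B by (rule J)
  show ?thesis
  proof (rule submoduleI)
  show "r \<odot>\<^bsub>B\<^esub> x \<in> J" if "r \<in> carrier A" "x \<in> J" for r x
  proof -
    \<comment> \<open>Scalars act through the unit, so closure under scalars is a case of absorption
      by the ring element \<open>r \<odot> \<one>\<close>.\<close>
    have "r \<odot>\<^bsub>B\<^esub> x = (r \<odot>\<^bsub>B\<^esub> \<one>\<^bsub>B\<^esub>) \<otimes>\<^bsub>B\<^esub> x"
      using that J.a_subset by (auto simp: smult_assoc2)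
    then show ?thesis using that J.I_l_closed by simp
  qed
  qed (use J.a_subset J.a_inv_closed in auto)
qed

sublocale Q: module_quotient A B J by (intro module_quotient.intro module_quotient_axioms.intro module_axioms J_submodule)

lemma coset_mult:
  "x \<in> carrier B \<Longrightarrow> y \<in> carrier B \<Longrightarrow>
    (J +>\<^bsub>B\<^esub> x) \<otimes>\<^bsub>quot B J\<^esub> (J +>\<^bsub>B\<^esub> y) = J +>\<^bsub>B\<^esub> (x \<otimes>\<^bsub>B\<^esub> y)"
  by (simp add: quot_sel ideal.rcoset_mult_add[OF J])

lemma quot_algebra: "algebra A (quot B J)"
proof (rule algebraI)
  interpret M: module A "quot B J" by (rule Q.quot_module)
  have "cring (B Quot J)" by (rule ideal.quotient_is_cring[OF J M_cring])
  then show "cring (quot B J)"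
    by (rule cring_ring_fields_cong) (auto simp: quot_sel FactRing_def)
qed (use R_cring Q.quot_module in \<open>auto simp: module_def module_axioms_def Q.quot_carrier coset_mult Q.coset_smult smult_assoc2\<close>)

lemma coset_hom: "(\<lambda>x. J +>\<^bsub>B\<^esub> x) \<in> alg_hom A B (quot B J)"
  by (rule alg_homI[OF Q.coset_lin]) (simp_all add: coset_mult, simp only: quot_sel)

lemma induced_hom:
  assumes "algebra A C" "f \<in> alg_hom A B C" "\<And>h. h \<in> J \<Longrightarrow> f h = \<zero>\<^bsub>C\<^esub>"
  shows "induced f \<in> alg_hom A (quot B J) C"
    and "\<And>x. x \<in> carrier B \<Longrightarrow> induced f (J +>\<^bsub>B\<^esub> x) = f x"
proof -
  show *: "\<And>x. x \<in> carrier B \<Longrightarrow> induced f (J +>\<^bsub>B\<^esub> x) = f x"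
    by (rule Q.induced_coset[OF algebra_module[OF assms(1)] alg_hom_lin[OF assms(2)] assms(3)])
  show "induced f \<in> alg_hom A (quot B J) C"
    by (rule alg_hom_factor_surj[OF algebra_axioms coset_hom _ assms(2) *]) (auto simp: Q.quot_carrier)
qed

end

lemma alg_hom_kernel_ideal:
  assumes "algebra A B" "algebra A C" "f \<in> alg_hom A B C"
  shows "ideal {x \<in> carrier B. f x = \<zero>\<^bsub>C\<^esub>} B"
proof -
  interpret B: algebra A B by fact
  interpret C: algebra A C by fact
  have "ring_hom_ring B C f"
    by (rule ring_hom_ringI2) (use assms(3) B.ring_axioms C.ring_axioms in \<open>auto simp: alg_hom_def\<close>)
  from ring_hom_ring.kernel_is_ideal[OF this] show ?thesis by (simp add: a_kernel_def kernel_def)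
qed

lemma alg_hom_zero_on_genideal:
  assumes "algebra A B" "algebra A C" "f \<in> alg_hom A B C"
    and "S \<subseteq> carrier B" "\<And>s. s \<in> S \<Longrightarrow> f s = \<zero>\<^bsub>C\<^esub>" "x \<in> Idl\<^bsub>B\<^esub> S"
  shows "f x = \<zero>\<^bsub>C\<^esub>"
proof -
  interpret B: algebra A B by fact
  have "Idl\<^bsub>B\<^esub> S \<subseteq> {x \<in> carrier B. f x = \<zero>\<^bsub>C\<^esub>}"
    by (rule B.genideal_minimal[OF alg_hom_kernel_ideal[OF assms(1-3)]]) (use assms(4,5) in auto)
  then show ?thesis using assms(6) by auto
qed

section \<open>Monoid algebras\<close>

lemma monoid_algebra_sel:
  "carrier (monoid_algebra A M) = {p. (\<forall>m. p m \<in> carrier A) \<and> finite {m. p m \<noteq> \<zero>\<^bsub>A\<^esub>} \<and>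
      {m. p m \<noteq> \<zero>\<^bsub>A\<^esub>} \<subseteq> carrier M}"
  "mult (monoid_algebra A M) = (\<lambda>p q m. finsum A (\<lambda>(u, v). p u \<otimes>\<^bsub>A\<^esub> q v)
      {(u, v). p u \<noteq> \<zero>\<^bsub>A\<^esub> \<and> q v \<noteq> \<zero>\<^bsub>A\<^esub> \<and> u \<otimes>\<^bsub>M\<^esub> v = m})"
  "\<one>\<^bsub>monoid_algebra A M\<^esub> = single A \<one>\<^bsub>M\<^esub>"
  "\<zero>\<^bsub>monoid_algebra A M\<^esub> = (\<lambda>m. \<zero>\<^bsub>A\<^esub>)"
  "add (monoid_algebra A M) = (\<lambda>p q m. p m \<oplus>\<^bsub>A\<^esub> q m)"
  "smult (monoid_algebra A M) = (\<lambda>a p m. a \<otimes>\<^bsub>A\<^esub> p m)"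
  by (auto simp: monoid_algebra_def single_def)

locale free_module = cring A for A :: "('a, 'r) ring_scheme" +
  fixes M :: "('m, 's) monoid_scheme"
begin

abbreviation F where "F \<equiv> monoid_algebra A M"

lemma F_carrierI:
  assumes "\<And>m. p m \<in> carrier A" "finite S" "S \<subseteq> carrier M" "\<And>m. m \<notin> S \<Longrightarrow> p m = \<zero>\<^bsub>A\<^esub>"
  shows "p \<in> carrier F"
proof -
  have "{m. p m \<noteq> \<zero>\<^bsub>A\<^esub>} \<subseteq> S" using assms(4) by auto
  then show ?thesis using assms(1,2,3) finite_subset by (auto simp: monoid_algebra_sel)
qed

lemma F_closed: "p \<in> carrier F \<Longrightarrow> p m \<in> carrier A"
  by (simp add: monoid_algebra_sel)

lemma F_support: "p \<in> carrier F \<Longrightarrow> finite {m. p m \<noteq> \<zero>\<^bsub>A\<^esub>}" "p \<in> carrier F \<Longrightarrow> {m. p m \<noteq> \<zero>\<^bsub>A\<^esub>} \<subseteq> carrier M"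
  by (auto simp: monoid_algebra_sel)

lemma single_closed: "m \<in> carrier M \<Longrightarrow> single A m \<in> carrier F"
  by (rule F_carrierI[of _ "{m}"]) (auto simp: single_def)

lemma F_add_closed: "p \<in> carrier F \<Longrightarrow> q \<in> carrier F \<Longrightarrow> p \<oplus>\<^bsub>F\<^esub> q \<in> carrier F"
  by (rule F_carrierI[of _ "{m. p m \<noteq> \<zero>\<^bsub>A\<^esub>} \<union> {m. q m \<noteq> \<zero>\<^bsub>A\<^esub>}"])
    (auto simp: monoid_algebra_sel)

lemma F_smult_closed: "a \<in> carrier A \<Longrightarrow> p \<in> carrier F \<Longrightarrow> a \<odot>\<^bsub>F\<^esub> p \<in> carrier F"
  by (rule F_carrierI[of _ "{m. p m \<noteq> \<zero>\<^bsub>A\<^esub>}"]) (auto simp: monoid_algebra_sel)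

lemma F_module: "module A F"
proof (rule moduleI[OF is_cring])
  show "abelian_group F"
  proof (rule abelian_groupI)
    fix p assume p: "p \<in> carrier F"
    have "(\<lambda>m. \<ominus>\<^bsub>A\<^esub> p m) \<in> carrier F"
      by (rule F_carrierI[of _ "{m. p m \<noteq> \<zero>\<^bsub>A\<^esub>}"]) (use p in \<open>auto simp: monoid_algebra_sel\<close>)
    then show "\<exists>q\<in>carrier F. q \<oplus>\<^bsub>F\<^esub> p = \<zero>\<^bsub>F\<^esub>"
      by (rule bexI[rotated]) (use p in \<open>auto simp: monoid_algebra_sel l_neg\<close>)
  qed (auto simp: F_add_closed, auto simp: monoid_algebra_sel a_ac)
qed (auto simp: F_smult_closed, auto simp: monoid_algebra_sel l_distr r_distr m_assoc)

sublocale F: module A F by (rule F_module)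

text \<open>Induction on a finite set containing the support: one basis element with its coefficient
  is split off at a time.\<close>

lemma F_induct [consumes 1, case_names zero single add smult]:
  assumes "p \<in> carrier F" and "P \<zero>\<^bsub>F\<^esub>" and "\<And>m. m \<in> carrier M \<Longrightarrow> P (single A m)"
    and "\<And>p q. p \<in> carrier F \<Longrightarrow> q \<in> carrier F \<Longrightarrow> P p \<Longrightarrow> P q \<Longrightarrow> P (p \<oplus>\<^bsub>F\<^esub> q)"
    and "\<And>a p. a \<in> carrier A \<Longrightarrow> p \<in> carrier F \<Longrightarrow> P p \<Longrightarrow> P (a \<odot>\<^bsub>F\<^esub> p)"
  shows "P p"
proof -
  have "p \<in> carrier F \<Longrightarrow> {m. p m \<noteq> \<zero>\<^bsub>A\<^esub>} \<subseteq> S \<Longrightarrow> P p" if "finite S" for S p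
    using that
  proof (induction S arbitrary: p)
    case empty
    then have "p = \<zero>\<^bsub>F\<^esub>" by (auto simp: monoid_algebra_sel)
    then show ?case using assms(2) by simp
  next
    case (insert m S)
    show ?case
    proof (cases "p m = \<zero>\<^bsub>A\<^esub>")
      case True then show ?thesis using insert by (metis (mono_tags) mem_Collect_eq subset_insert)
    next
      case False
      then have m: "m \<in> carrier M" using F_support[OF insert.prems(1)] by auto
      have q: "p(m := \<zero>\<^bsub>A\<^esub>) \<in> carrier F"
        by (rule F_carrierI[of _ "{m. p m \<noteq> \<zero>\<^bsub>A\<^esub>}"])
          (use insert.prems(1) F_support[OF insert.prems(1)] F_closed in auto)
      have "P (p(m := \<zero>\<^bsub>A\<^esub>))" by (rule insert.IH[OF q]) (use insert.prems(2) in auto)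
      moreover have "p = p m \<odot>\<^bsub>F\<^esub> single A m \<oplus>\<^bsub>F\<^esub> p(m := \<zero>\<^bsub>A\<^esub>)"
        using F_closed[OF insert.prems(1)] by (auto simp: monoid_algebra_sel single_def)
      ultimately show ?thesis
        using assms(3-5) m q single_closed F_closed[OF insert.prems(1)] F.smult_closed by metis
    qed
  qed
  then show ?thesis using assms(1) F_support(1) by blast
qed

text \<open>The support changes under addition and scaling. Padding with zero terms over a common
  finite \<open>W\<close> makes the sums comparable.\<close>

lemma lin_ext_eq:
  assumes "module A B" "\<phi> \<in> carrier M \<rightarrow> carrier B" "p \<in> carrier F"
    and "finite W" "W \<subseteq> carrier M" "{m. p m \<noteq> \<zero>\<^bsub>A\<^esub>} \<subseteq> W"
  shows "lin_ext A B \<phi> p = (\<Oplus>\<^bsub>B\<^esub>m\<in>W. p m \<odot>\<^bsub>B\<^esub> \<phi> m)"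
proof -
  interpret B: module A B by fact
  show ?thesis unfolding lin_ext_def
    by (rule B.M.add.finprod_mono_neutral_cong_left)
      (use assms F_closed in \<open>auto simp: Pi_iff subset_iff\<close>)
qed

lemma lin_ext_lin:
  assumes "module A B" "\<phi> \<in> carrier M \<rightarrow> carrier B"
  shows "lin_ext A B \<phi> \<in> lin_map A F B"
proof -
  interpret B: module A B by fact
  have cl: "(\<lambda>m. p m \<odot>\<^bsub>B\<^esub> \<phi> m) \<in> W \<rightarrow> carrier B" if "p \<in> carrier F" "W \<subseteq> carrier M" for p W
    using that assms F_closed by (auto simp: Pi_iff subset_iff)
  show ?thesis
  proof (rule lin_mapI)
    show "lin_ext A B \<phi> p \<in> carrier B" if "p \<in> carrier F" for p
      unfolding lin_ext_def by (rule B.M.finsum_closed) (rule cl[OF that F_support(2)[OF that]])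
    fix p assume p: "p \<in> carrier F"
    show "lin_ext A B \<phi> (p \<oplus>\<^bsub>F\<^esub> q) = lin_ext A B \<phi> p \<oplus>\<^bsub>B\<^esub> lin_ext A B \<phi> q" if q: "q \<in> carrier F" for q
    proof -
      let ?W = "{m. p m \<noteq> \<zero>\<^bsub>A\<^esub>} \<union> {m. q m \<noteq> \<zero>\<^bsub>A\<^esub>}"
      have W: "finite ?W" "?W \<subseteq> carrier M" using F_support p q by auto
      have "lin_ext A B \<phi> (p \<oplus>\<^bsub>F\<^esub> q) = (\<Oplus>\<^bsub>B\<^esub>m\<in>?W. (p \<oplus>\<^bsub>F\<^esub> q) m \<odot>\<^bsub>B\<^esub> \<phi> m)"
        by (rule lin_ext_eq[OF assms F_add_closed[OF p q] W]) (auto simp: monoid_algebra_sel(5))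
      also have "\<dots> = (\<Oplus>\<^bsub>B\<^esub>m\<in>?W. p m \<odot>\<^bsub>B\<^esub> \<phi> m \<oplus>\<^bsub>B\<^esub> q m \<odot>\<^bsub>B\<^esub> \<phi> m)"
        by (rule B.M.finsum_cong') (use p q assms W F_closed in \<open>auto simp: monoid_algebra_sel(5) Pi_iff B.smult_l_distr subset_iff\<close>)
      also have "\<dots> = lin_ext A B \<phi> p \<oplus>\<^bsub>B\<^esub> lin_ext A B \<phi> q"
        using lin_ext_eq[OF assms p W] lin_ext_eq[OF assms q W] B.M.finsum_addf[OF cl[OF p W(2)] cl[OF q W(2)]] by auto
      finally show ?thesis .
    qed
    show "lin_ext A B \<phi> (a \<odot>\<^bsub>F\<^esub> p) = a \<odot>\<^bsub>B\<^esub> lin_ext A B \<phi> p" if a: "a \<in> carrier A" for a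
    proof -
      let ?W = "{m. p m \<noteq> \<zero>\<^bsub>A\<^esub>}"
      have W: "finite ?W" "?W \<subseteq> carrier M" using F_support p by auto
      have "lin_ext A B \<phi> (a \<odot>\<^bsub>F\<^esub> p) = (\<Oplus>\<^bsub>B\<^esub>m\<in>?W. (a \<odot>\<^bsub>F\<^esub> p) m \<odot>\<^bsub>B\<^esub> \<phi> m)"
        by (rule lin_ext_eq[OF assms F_smult_closed[OF a p] W]) (use a in \<open>auto simp: monoid_algebra_sel(6)\<close>)
      also have "\<dots> = (\<Oplus>\<^bsub>B\<^esub>m\<in>?W. a \<odot>\<^bsub>B\<^esub> (p m \<odot>\<^bsub>B\<^esub> \<phi> m))"
        by (rule B.M.finsum_cong') (use p a assms W F_closed in \<open>auto simp: monoid_algebra_sel(6) Pi_iff B.smult_assoc1 subset_iff\<close>)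
      also have "\<dots> = a \<odot>\<^bsub>B\<^esub> lin_ext A B \<phi> p"
        unfolding lin_ext_def by (rule B.finsum_smult_ldistr[symmetric, OF W(1) a cl[OF p W(2)]])
      finally show ?thesis .
    qed
  qed
qed

lemma lin_ext_single:
  assumes "module A B" "\<phi> \<in> carrier M \<rightarrow> carrier B" "m \<in> carrier M"
  shows "lin_ext A B \<phi> (single A m) = \<phi> m"
proof -
  interpret B: module A B by fact
  have "\<phi> m \<in> carrier B" using assms by auto
  moreover have "single A m m = \<one>\<^bsub>A\<^esub>" "{k. single A m k \<noteq> \<zero>\<^bsub>A\<^esub>} \<subseteq> {m}"
    by (auto simp: single_def)
  ultimately show ?thesis
    using lin_ext_eq[OF assms(1,2) single_closed[OF assms(3)], of "{m}"] assms(3) by simp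
qed

text \<open>The index set in the definition of the convolution depends on \<open>m\<close> and on
  both supports. Moving the condition on the product into the summand leaves one set
  \<open>W\<close>, over which distributivity and symmetry are those of finite sums.\<close>

lemma F_mult_eq:
  assumes "p \<in> carrier F" "q \<in> carrier F" "finite W" "{u. p u \<noteq> \<zero>\<^bsub>A\<^esub>} \<times> {v. q v \<noteq> \<zero>\<^bsub>A\<^esub>} \<subseteq> W"
  shows "(p \<otimes>\<^bsub>F\<^esub> q) m = (\<Oplus>\<^bsub>A\<^esub>x\<in>W. if fst x \<otimes>\<^bsub>M\<^esub> snd x = m then p (fst x) \<otimes>\<^bsub>A\<^esub> q (snd x) else \<zero>\<^bsub>A\<^esub>)"
  unfolding monoid_algebra_sel(2)
proof (rule add.finprod_mono_neutral_cong_left)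
  show "{(u, v). p u \<noteq> \<zero>\<^bsub>A\<^esub> \<and> q v \<noteq> \<zero>\<^bsub>A\<^esub> \<and> u \<otimes>\<^bsub>M\<^esub> v = m} \<subseteq> W" using assms(4) by auto
  fix x assume x: "x \<in> W - {(u, v). p u \<noteq> \<zero>\<^bsub>A\<^esub> \<and> q v \<noteq> \<zero>\<^bsub>A\<^esub> \<and> u \<otimes>\<^bsub>M\<^esub> v = m}"
  show "(if fst x \<otimes>\<^bsub>M\<^esub> snd x = m then p (fst x) \<otimes>\<^bsub>A\<^esub> q (snd x) else \<zero>\<^bsub>A\<^esub>) = \<zero>\<^bsub>A\<^esub>"
    using x F_closed[OF assms(1)] F_closed[OF assms(2)] by (cases x) auto
qed (use assms F_closed in auto)

lemma F_mult_closed: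
  assumes "monoid M" "p \<in> carrier F" "q \<in> carrier F"
  shows "p \<otimes>\<^bsub>F\<^esub> q \<in> carrier F"
proof -
  interpret M: monoid M by fact
  let ?W = "{u. p u \<noteq> \<zero>\<^bsub>A\<^esub>} \<times> {v. q v \<noteq> \<zero>\<^bsub>A\<^esub>}"
  have W: "finite ?W" "?W \<subseteq> carrier M \<times> carrier M" using F_support assms(2,3) by auto
  note eq = F_mult_eq[OF assms(2,3) W(1) subset_refl]
  show ?thesis
  proof (rule F_carrierI[of _ "(\<lambda>x. fst x \<otimes>\<^bsub>M\<^esub> snd x) ` ?W"])
    show "(p \<otimes>\<^bsub>F\<^esub> q) m \<in> carrier A" for m
      unfolding eq by (rule finsum_closed) (use F_closed assms in auto)
    show "(p \<otimes>\<^bsub>F\<^esub> q) m = \<zero>\<^bsub>A\<^esub>" if "m \<notin> (\<lambda>x. fst x \<otimes>\<^bsub>M\<^esub> snd x) ` ?W" for m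
      unfolding eq by (rule add.finprod_one_eqI) (metis (no_types, lifting) image_eqI that)
  qed (use W in auto)
qed

lemma F_mult_commute:
  assumes "comm_monoid M" "p \<in> carrier F" "q \<in> carrier F"
  shows "p \<otimes>\<^bsub>F\<^esub> q = q \<otimes>\<^bsub>F\<^esub> p"
proof
  interpret M: comm_monoid M by fact
  let ?U = "{u. p u \<noteq> \<zero>\<^bsub>A\<^esub>}" and ?V = "{v. q v \<noteq> \<zero>\<^bsub>A\<^esub>}"
  have fin: "finite ?U" "finite ?V" "?U \<subseteq> carrier M" "?V \<subseteq> carrier M" using F_support assms(2,3) by auto
  fix m
  let ?f = "\<lambda>p q x. if fst x \<otimes>\<^bsub>M\<^esub> snd x = m then p (fst x) \<otimes>\<^bsub>A\<^esub> q (snd x) else \<zero>\<^bsub>A\<^esub>"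
  have "(q \<otimes>\<^bsub>F\<^esub> p) m = finsum A (?f q p) (prod.swap ` (?U \<times> ?V))"
    by (rule F_mult_eq[OF assms(3,2)]) (use fin in auto)
  also have "\<dots> = finsum A (\<lambda>x. ?f q p (prod.swap x)) (?U \<times> ?V)"
    by (rule finsum_reindex) (use F_closed assms in auto)
  also have "\<dots> = finsum A (?f p q) (?U \<times> ?V)"
    by (rule finsum_cong') (use F_closed assms fin m_comm M.m_comm in \<open>auto simp: subset_iff\<close>)
  also have "\<dots> = (p \<otimes>\<^bsub>F\<^esub> q) m"
    by (rule F_mult_eq[symmetric]) (use fin assms in auto)
  finally show "(p \<otimes>\<^bsub>F\<^esub> q) m = (q \<otimes>\<^bsub>F\<^esub> p) m" by simp
qed

lemma F_mult_l_distr: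
  assumes "p \<in> carrier F" "p' \<in> carrier F" "q \<in> carrier F"
  shows "(p \<oplus>\<^bsub>F\<^esub> p') \<otimes>\<^bsub>F\<^esub> q = p \<otimes>\<^bsub>F\<^esub> q \<oplus>\<^bsub>F\<^esub> p' \<otimes>\<^bsub>F\<^esub> q"
proof
  fix m
  let ?W = "({u. p u \<noteq> \<zero>\<^bsub>A\<^esub>} \<union> {u. p' u \<noteq> \<zero>\<^bsub>A\<^esub>}) \<times> {v. q v \<noteq> \<zero>\<^bsub>A\<^esub>}"
  let ?f = "\<lambda>p x. if fst x \<otimes>\<^bsub>M\<^esub> snd x = m then p (fst x) \<otimes>\<^bsub>A\<^esub> q (snd x) else \<zero>\<^bsub>A\<^esub>"
  have W: "finite ?W" using F_support assms by auto
  have "((p \<oplus>\<^bsub>F\<^esub> p') \<otimes>\<^bsub>F\<^esub> q) m = finsum A (?f (p \<oplus>\<^bsub>F\<^esub> p')) ?W"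
    by (rule F_mult_eq[OF F_add_closed[OF assms(1,2)] assms(3) W]) (auto simp: monoid_algebra_sel(5))
  also have "\<dots> = finsum A (\<lambda>x. ?f p x \<oplus>\<^bsub>A\<^esub> ?f p' x) ?W"
    by (rule finsum_cong') (use assms F_closed in \<open>auto simp: monoid_algebra_sel(5) l_distr\<close>)
  also have "\<dots> = finsum A (?f p) ?W \<oplus>\<^bsub>A\<^esub> finsum A (?f p') ?W"
    by (rule finsum_addf) (use assms F_closed in auto)
  also have "\<dots> = (p \<otimes>\<^bsub>F\<^esub> q) m \<oplus>\<^bsub>A\<^esub> (p' \<otimes>\<^bsub>F\<^esub> q) m"
    by (subst (1 2) F_mult_eq[OF _ assms(3) W]) (use assms in auto)
  finally show "((p \<oplus>\<^bsub>F\<^esub> p') \<otimes>\<^bsub>F\<^esub> q) m = (p \<otimes>\<^bsub>F\<^esub> q \<oplus>\<^bsub>F\<^esub> p' \<otimes>\<^bsub>F\<^esub> q) m"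
    by (simp only: monoid_algebra_sel(5))
qed

lemma F_mult_smult:
  assumes "p \<in> carrier F" "q \<in> carrier F" "a \<in> carrier A"
  shows "(a \<odot>\<^bsub>F\<^esub> p) \<otimes>\<^bsub>F\<^esub> q = a \<odot>\<^bsub>F\<^esub> (p \<otimes>\<^bsub>F\<^esub> q)"
proof
  fix m
  let ?W = "{u. p u \<noteq> \<zero>\<^bsub>A\<^esub>} \<times> {v. q v \<noteq> \<zero>\<^bsub>A\<^esub>}"
  let ?f = "\<lambda>p x. if fst x \<otimes>\<^bsub>M\<^esub> snd x = m then p (fst x) \<otimes>\<^bsub>A\<^esub> q (snd x) else \<zero>\<^bsub>A\<^esub>"
  have W: "finite ?W" using F_support assms by auto
  have "((a \<odot>\<^bsub>F\<^esub> p) \<otimes>\<^bsub>F\<^esub> q) m = finsum A (?f (a \<odot>\<^bsub>F\<^esub> p)) ?W"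
    by (rule F_mult_eq[OF F_smult_closed[OF assms(3,1)] assms(2) W]) (use assms(3) in \<open>auto simp: monoid_algebra_sel(6)\<close>)
  also have "\<dots> = finsum A (\<lambda>x. a \<otimes>\<^bsub>A\<^esub> ?f p x) ?W"
    by (rule finsum_cong') (use assms F_closed in \<open>auto simp: monoid_algebra_sel(6) m_assoc\<close>)
  also have "\<dots> = a \<otimes>\<^bsub>A\<^esub> finsum A (?f p) ?W"
    by (rule finsum_rdistr[symmetric, OF W assms(3)]) (use assms F_closed in auto)
  also have "\<dots> = a \<otimes>\<^bsub>A\<^esub> (p \<otimes>\<^bsub>F\<^esub> q) m"
    by (subst F_mult_eq[OF assms(1,2) W]) auto
  finally show "((a \<odot>\<^bsub>F\<^esub> p) \<otimes>\<^bsub>F\<^esub> q) m = (a \<odot>\<^bsub>F\<^esub> (p \<otimes>\<^bsub>F\<^esub> q)) m"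
    by (simp only: monoid_algebra_sel(6))
qed

lemma single_mult:
  assumes "m \<in> carrier M" "n \<in> carrier M"
  shows "single A m \<otimes>\<^bsub>F\<^esub> single A n = single A (m \<otimes>\<^bsub>M\<^esub> n)"
proof
  fix k
  show "(single A m \<otimes>\<^bsub>F\<^esub> single A n) k = single A (m \<otimes>\<^bsub>M\<^esub> n) k"
    by (subst F_mult_eq[OF single_closed[OF assms(1)] single_closed[OF assms(2)], of "{(m, n)}"])
      (auto simp: single_def)
qed

lemma F_algebra:
  assumes "comm_monoid M"
  shows "algebra A F"
proof -
  interpret M: comm_monoid M by fact
  note closed [simp] = F_mult_closed[OF M.monoid_axioms] single_closed
  have F_mult_r_distr: "q \<otimes>\<^bsub>F\<^esub> (p \<oplus>\<^bsub>F\<^esub> p') = q \<otimes>\<^bsub>F\<^esub> p \<oplus>\<^bsub>F\<^esub> q \<otimes>\<^bsub>F\<^esub> p'"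
    if "p \<in> carrier F" "p' \<in> carrier F" "q \<in> carrier F" for p p' q
    using that by (simp add: F_mult_commute[OF assms, of q] F_mult_l_distr)
  have F_mult_smult_r: "q \<otimes>\<^bsub>F\<^esub> (a \<odot>\<^bsub>F\<^esub> p) = a \<odot>\<^bsub>F\<^esub> (q \<otimes>\<^bsub>F\<^esub> p)"
    if "p \<in> carrier F" "q \<in> carrier F" "a \<in> carrier A" for p q a
    using that by (simp add: F_mult_commute[OF assms, of q] F_mult_smult)
  have zero_mult: "\<zero>\<^bsub>F\<^esub> \<otimes>\<^bsub>F\<^esub> q = \<zero>\<^bsub>F\<^esub>" if "q \<in> carrier F" for q
    using F_mult_smult[OF F.M.zero_closed that zero_closed] that by simp
  have mult_zero: "q \<otimes>\<^bsub>F\<^esub> \<zero>\<^bsub>F\<^esub> = \<zero>\<^bsub>F\<^esub>" if "q \<in> carrier F" for q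
    using F_mult_smult_r[OF F.M.zero_closed that zero_closed] that by simp
  note bilinear = F_mult_l_distr F_mult_r_distr F_mult_smult F_mult_smult_r zero_mult mult_zero
  \<comment> \<open>Both sides are linear in each argument, so three nested inductions leave only
    basis elements, where this is associativity in \<open>M\<close>.\<close>
  have assoc: "p \<otimes>\<^bsub>F\<^esub> q \<otimes>\<^bsub>F\<^esub> r = p \<otimes>\<^bsub>F\<^esub> (q \<otimes>\<^bsub>F\<^esub> r)"
    if "p \<in> carrier F" "q \<in> carrier F" "r \<in> carrier F" for p q r
    using that(1)
  proof (induction rule: F_induct)
    case (single k)
    show ?case using that(2)
    proof (induction rule: F_induct)
      case (single m)
      show ?case using that(3)
        by (induction rule: F_induct)
          (use \<open>k \<in> carrier M\<close> \<open>m \<in> carrier M\<close> in \<open>simp_all add: bilinear single_mult M.m_assoc\<close>)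
    qed (use \<open>k \<in> carrier M\<close> that in \<open>simp_all add: bilinear\<close>)
  qed (use that in \<open>simp_all add: bilinear\<close>)
  have one: "single A \<one>\<^bsub>M\<^esub> \<otimes>\<^bsub>F\<^esub> p = p" if "p \<in> carrier F" for p
    using that by (induction rule: F_induct) (simp_all add: bilinear single_mult)
  show ?thesis
  proof (rule algebraI[OF is_cring])
    show "cring F"
    proof (rule cringI[OF F.M.abelian_group_axioms])
      show "Group.comm_monoid F"
        by (rule comm_monoidI)
          (use assoc one F_mult_commute[OF assms] in \<open>auto simp: monoid_algebra_sel(3)\<close>)
    qed (rule F_mult_l_distr)
  qed (auto simp: F.smult_l_distr F.smult_r_distr F.smult_assoc1 F_mult_smult)
qed

text \<open>Multiplicativity is bilinear in \<open>p\<close> and \<open>q\<close>, so it may be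
  tested on basis elements, where it is the assumption on \<open>\<phi>\<close>.\<close>

lemma lin_ext_hom:
  assumes "comm_monoid M" "algebra A B" "\<phi> \<in> carrier M \<rightarrow> carrier B" "\<phi> \<one>\<^bsub>M\<^esub> = \<one>\<^bsub>B\<^esub>"
    and "\<And>m n. m \<in> carrier M \<Longrightarrow> n \<in> carrier M \<Longrightarrow> \<phi> (m \<otimes>\<^bsub>M\<^esub> n) = \<phi> m \<otimes>\<^bsub>B\<^esub> \<phi> n"
  shows "lin_ext A B \<phi> \<in> alg_hom A F B"
proof -
  interpret M: comm_monoid M by fact
  interpret B: algebra A B by fact
  interpret FA: algebra A F by (rule F_algebra) fact
  note L = lin_ext_lin[OF algebra_module[OF assms(2)] assms(3)]
  note S [simp] = lin_ext_single[OF algebra_module[OF assms(2)] assms(3)]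
  note Lsimps [simp] = lin_map_closed[OF L] lin_map_add[OF L] lin_map_smult[OF L]
    lin_map_zero[OF F_module B.module_axioms L]
  have Fr: "x \<otimes>\<^bsub>F\<^esub> (a \<odot>\<^bsub>F\<^esub> y) = a \<odot>\<^bsub>F\<^esub> (x \<otimes>\<^bsub>F\<^esub> y)"
    if "x \<in> carrier F" "y \<in> carrier F" "a \<in> carrier A" for x y a
    by (metis FA.m_comm FA.smult_assoc2 F.smult_closed that)
  have Br: "x \<otimes>\<^bsub>B\<^esub> (a \<odot>\<^bsub>B\<^esub> y) = a \<odot>\<^bsub>B\<^esub> (x \<otimes>\<^bsub>B\<^esub> y)"
    if "x \<in> carrier B" "y \<in> carrier B" "a \<in> carrier A" for x y a
    by (metis B.m_comm B.smult_assoc2 B.smult_closed that)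
  show ?thesis
  proof (rule alg_homI[OF L])
    show "lin_ext A B \<phi> \<one>\<^bsub>F\<^esub> = \<one>\<^bsub>B\<^esub>" by (simp add: monoid_algebra_sel(3) assms(4))
    show "lin_ext A B \<phi> (p \<otimes>\<^bsub>F\<^esub> q) = lin_ext A B \<phi> p \<otimes>\<^bsub>B\<^esub> lin_ext A B \<phi> q"
      if "p \<in> carrier F" "q \<in> carrier F" for p q
      using that(1)
    proof (induction rule: F_induct)
      case (single k)
      show ?case using that(2)
        by (induction rule: F_induct)
          (use \<open>k \<in> carrier M\<close> funcset_mem[OF assms(3)] in \<open>simp_all add: single_closed single_mult assms(5) FA.r_distr B.r_distr Fr Br\<close>)
    qed (use that in \<open>simp_all add: FA.l_distr B.l_distr FA.smult_assoc2 B.smult_assoc2\<close>)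
  qed
qed

end

section \<open>Tensor products\<close>

locale tensor_product = M: module R M + N: module R N
  for R :: "('a, 'r) ring_scheme" and M :: "('a, 'b, 's) module_scheme" and N :: "('a, 'c, 't) module_scheme"
begin

sublocale FM: free_module R "M \<times>\<times> N" by (rule free_module.intro) (rule M.R.cring_axioms)

lemma cross_closed [simp]:
  "x \<in> carrier M \<Longrightarrow> y \<in> carrier N \<Longrightarrow> single R (x, y) \<in> carrier FM.F"
  by (rule FM.single_closed) simp

text \<open>Minimality of an intersection, to be used by taking for \<open>H\<close> the set on
  which a desired property holds.\<close>

lemma tensor_null_least:
  assumes "submodule H R FM.F"
    and "\<And>x x' y. x \<in> carrier M \<Longrightarrow> x' \<in> carrier M \<Longrightarrow> y \<in> carrier N \<Longrightarrow>
      single R (x \<oplus>\<^bsub>M\<^esub> x', y) \<ominus>\<^bsub>FM.F\<^esub> (single R (x, y) \<oplus>\<^bsub>FM.F\<^esub> single R (x', y)) \<in> H"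
    and "\<And>x y y'. x \<in> carrier M \<Longrightarrow> y \<in> carrier N \<Longrightarrow> y' \<in> carrier N \<Longrightarrow>
      single R (x, y \<oplus>\<^bsub>N\<^esub> y') \<ominus>\<^bsub>FM.F\<^esub> (single R (x, y) \<oplus>\<^bsub>FM.F\<^esub> single R (x, y')) \<in> H"
    and "\<And>r x y. r \<in> carrier R \<Longrightarrow> x \<in> carrier M \<Longrightarrow> y \<in> carrier N \<Longrightarrow>
      single R (r \<odot>\<^bsub>M\<^esub> x, y) \<ominus>\<^bsub>FM.F\<^esub> (r \<odot>\<^bsub>FM.F\<^esub> single R (x, y)) \<in> H"
    and "\<And>r x y. r \<in> carrier R \<Longrightarrow> x \<in> carrier M \<Longrightarrow> y \<in> carrier N \<Longrightarrow>
      single R (x, r \<odot>\<^bsub>N\<^esub> y) \<ominus>\<^bsub>FM.F\<^esub> (r \<odot>\<^bsub>FM.F\<^esub> single R (x, y)) \<in> H"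
  shows "tensor_null R M N \<subseteq> H"
  unfolding tensor_null_def Let_def by (rule Inter_lower) (use assms in auto)

lemma tensor_null_submodule: "submodule (tensor_null R M N) R FM.F"
proof (rule FM.F.submoduleI)
  have C: "tensor_null R M N \<subseteq> carrier FM.F"
    by (rule tensor_null_least[OF FM.F.carrier_is_submodule])
      (auto intro!: FM.F.M.minus_closed FM.F.M.add.m_closed FM.F.smult_closed cross_closed)
  then show "tensor_null R M N \<subseteq> carrier FM.F" .
qed (unfold tensor_null_def Let_def, (auto dest: FM.F.submoduleE(3-5))[1],
    auto simp: FM.F.submoduleE(3-5) submodule_def additive_subgroup.zero_closed[OF additive_subgroup.intro])

sublocale TQ: module_quotient R FM.F "tensor_null R M N"
  by (intro module_quotient.intro module_quotient_axioms.intro FM.F_module tensor_null_submodule)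

lemma tensor_null_relations:
  shows "x \<in> carrier M \<Longrightarrow> x' \<in> carrier M \<Longrightarrow> y \<in> carrier N \<Longrightarrow>
      single R (x \<oplus>\<^bsub>M\<^esub> x', y) \<ominus>\<^bsub>FM.F\<^esub> (single R (x, y) \<oplus>\<^bsub>FM.F\<^esub> single R (x', y)) \<in> tensor_null R M N"
    and "x \<in> carrier M \<Longrightarrow> y \<in> carrier N \<Longrightarrow> y' \<in> carrier N \<Longrightarrow>
      single R (x, y \<oplus>\<^bsub>N\<^esub> y') \<ominus>\<^bsub>FM.F\<^esub> (single R (x, y) \<oplus>\<^bsub>FM.F\<^esub> single R (x, y')) \<in> tensor_null R M N"
    and "r \<in> carrier R \<Longrightarrow> x \<in> carrier M \<Longrightarrow> y \<in> carrier N \<Longrightarrow>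
      single R (r \<odot>\<^bsub>M\<^esub> x, y) \<ominus>\<^bsub>FM.F\<^esub> (r \<odot>\<^bsub>FM.F\<^esub> single R (x, y)) \<in> tensor_null R M N"
    and "r \<in> carrier R \<Longrightarrow> x \<in> carrier M \<Longrightarrow> y \<in> carrier N \<Longrightarrow>
      single R (x, r \<odot>\<^bsub>N\<^esub> y) \<ominus>\<^bsub>FM.F\<^esub> (r \<odot>\<^bsub>FM.F\<^esub> single R (x, y)) \<in> tensor_null R M N"
  unfolding tensor_null_def Let_def by blast+

lemma tensor_module: "module R (tensor R M N)"
  unfolding tensor_def by (rule TQ.quot_module)

lemma pure_closed: "x \<in> carrier M \<Longrightarrow> y \<in> carrier N \<Longrightarrow> pure R M N x y \<in> carrier (tensor R M N)"
  unfolding tensor_def pure_def by simp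

lemma pure_add_left:
  "x \<in> carrier M \<Longrightarrow> x' \<in> carrier M \<Longrightarrow> y \<in> carrier N \<Longrightarrow>
    pure R M N (x \<oplus>\<^bsub>M\<^esub> x') y = pure R M N x y \<oplus>\<^bsub>tensor R M N\<^esub> pure R M N x' y"
  using tensor_null_relations(1)[of x x' y]
  by (simp add: tensor_def pure_def TQ.coset_add TQ.coset_eq_iff)

lemma pure_add_right:
  "x \<in> carrier M \<Longrightarrow> y \<in> carrier N \<Longrightarrow> y' \<in> carrier N \<Longrightarrow>
    pure R M N x (y \<oplus>\<^bsub>N\<^esub> y') = pure R M N x y \<oplus>\<^bsub>tensor R M N\<^esub> pure R M N x y'"
  using tensor_null_relations(2)[of x y y']
  by (simp add: tensor_def pure_def TQ.coset_add TQ.coset_eq_iff)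

lemma pure_smult_left:
  "r \<in> carrier R \<Longrightarrow> x \<in> carrier M \<Longrightarrow> y \<in> carrier N \<Longrightarrow>
    pure R M N (r \<odot>\<^bsub>M\<^esub> x) y = r \<odot>\<^bsub>tensor R M N\<^esub> pure R M N x y"
  using tensor_null_relations(3)[of r x y]
  by (simp add: tensor_def pure_def TQ.coset_smult TQ.coset_eq_iff)

lemma pure_smult_right:
  "r \<in> carrier R \<Longrightarrow> x \<in> carrier M \<Longrightarrow> y \<in> carrier N \<Longrightarrow>
    pure R M N x (r \<odot>\<^bsub>N\<^esub> y) = r \<odot>\<^bsub>tensor R M N\<^esub> pure R M N x y"
  using tensor_null_relations(4)[of r x y]
  by (simp add: tensor_def pure_def TQ.coset_smult TQ.coset_eq_iff)

lemma pure_zero_left: "y \<in> carrier N \<Longrightarrow> pure R M N \<zero>\<^bsub>M\<^esub> y = \<zero>\<^bsub>tensor R M N\<^esub>"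
  using pure_smult_left[of "\<zero>\<^bsub>R\<^esub>" "\<zero>\<^bsub>M\<^esub>" y] module.smult_l_null[OF tensor_module] pure_closed by simp

lemma pure_zero_right: "x \<in> carrier M \<Longrightarrow> pure R M N x \<zero>\<^bsub>N\<^esub> = \<zero>\<^bsub>tensor R M N\<^esub>"
  using pure_smult_right[of "\<zero>\<^bsub>R\<^esub>" x "\<zero>\<^bsub>N\<^esub>"] module.smult_l_null[OF tensor_module] pure_closed by simp

lemma pure_lin_left: "y \<in> carrier N \<Longrightarrow> (\<lambda>x. pure R M N x y) \<in> lin_map R M (tensor R M N)"
  by (rule lin_mapI) (auto simp: pure_closed pure_add_left pure_smult_left)

lemma pure_lin_right: "x \<in> carrier M \<Longrightarrow> (\<lambda>y. pure R M N x y) \<in> lin_map R N (tensor R M N)"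
  by (rule lin_mapI) (auto simp: pure_closed pure_add_right pure_smult_right)

lemma tensor_induct [consumes 1, case_names pure add]:
  assumes "w \<in> carrier (tensor R M N)"
    and "\<And>x y. x \<in> carrier M \<Longrightarrow> y \<in> carrier N \<Longrightarrow> P (pure R M N x y)"
    and "\<And>v w. v \<in> carrier (tensor R M N) \<Longrightarrow> w \<in> carrier (tensor R M N) \<Longrightarrow> P v \<Longrightarrow> P w \<Longrightarrow>
      P (v \<oplus>\<^bsub>tensor R M N\<^esub> w)"
  shows "P w"
proof -
  interpret T: module R "tensor R M N" by (rule tensor_module)
  let ?c = "\<lambda>p. tensor_null R M N +>\<^bsub>FM.F\<^esub> p"
  have L: "?c \<in> lin_map R FM.F (tensor R M N)"
    unfolding tensor_def by (rule TQ.coset_lin)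
  have Z: "P \<zero>\<^bsub>tensor R M N\<^esub>"
    using assms(2)[of "\<zero>\<^bsub>M\<^esub>" "\<zero>\<^bsub>N\<^esub>"] by (simp add: pure_zero_left)
  \<comment> \<open>The scalar is part of the induction statement, since \<open>P\<close> is not assumed to be closed under it.\<close>
  have "\<forall>r\<in>carrier R. P (r \<odot>\<^bsub>tensor R M N\<^esub> ?c p)" if "p \<in> carrier FM.F" for p
    using that
  proof (induction rule: FM.F_induct)
    case zero
    then show ?case using Z lin_map_zero[OF FM.F_module T.module_axioms L] by simp
  next
    case (single m)
    then obtain x y where m: "m = (x, y)" "x \<in> carrier M" "y \<in> carrier N" by auto
    then show ?case
      using assms(2) pure_smult_left by (metis M.smult_closed pure_def)
  next
    case (add p q)
    then show ?case
      using assms(3) by (simp add: lin_map_add[OF L] lin_map_closed[OF L] T.smult_r_distr)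
  next
    case (smult a p)
    then show ?case
      by (simp add: lin_map_smult[OF L] lin_map_closed[OF L] T.smult_assoc1[symmetric])
  qed
  moreover obtain p where "p \<in> carrier FM.F" "w = ?c p"
    using assms(1) TQ.quot_elim unfolding tensor_def by blast
  ultimately show ?thesis using T.smult_one assms(1) M.R.one_closed by metis
qed

lemma lin_map_ext:
  assumes "f \<in> lin_map R (tensor R M N) P" "h \<in> lin_map R (tensor R M N) P"
    and "\<And>x y. x \<in> carrier M \<Longrightarrow> y \<in> carrier N \<Longrightarrow> f (pure R M N x y) = h (pure R M N x y)"
    and "w \<in> carrier (tensor R M N)"
  shows "f w = h w"
  using assms(4)
  by (induction rule: tensor_induct)
    (simp_all add: assms(3) lin_map_add[OF assms(1)] lin_map_add[OF assms(2)])

end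

definition bilinear ::
  "('a, 'r) ring_scheme \<Rightarrow> ('a, 'b, 's) module_scheme \<Rightarrow> ('a, 'c, 't) module_scheme \<Rightarrow>
   ('a, 'd, 'u) module_scheme \<Rightarrow> ('b \<Rightarrow> 'c \<Rightarrow> 'd) \<Rightarrow> bool"
  where "bilinear R M N P \<beta> \<longleftrightarrow>
    (\<forall>x\<in>carrier M. \<beta> x \<in> lin_map R N P) \<and> (\<forall>y\<in>carrier N. (\<lambda>x. \<beta> x y) \<in> lin_map R M P)"

lemma bilinearI:
  assumes "\<And>x y. x \<in> carrier M \<Longrightarrow> y \<in> carrier N \<Longrightarrow> \<beta> x y \<in> carrier P"
    and "\<And>x x' y. x \<in> carrier M \<Longrightarrow> x' \<in> carrier M \<Longrightarrow> y \<in> carrier N \<Longrightarrow> \<beta> (x \<oplus>\<^bsub>M\<^esub> x') y = \<beta> x y \<oplus>\<^bsub>P\<^esub> \<beta> x' y"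
    and "\<And>x y y'. x \<in> carrier M \<Longrightarrow> y \<in> carrier N \<Longrightarrow> y' \<in> carrier N \<Longrightarrow> \<beta> x (y \<oplus>\<^bsub>N\<^esub> y') = \<beta> x y \<oplus>\<^bsub>P\<^esub> \<beta> x y'"
    and "\<And>r x y. r \<in> carrier R \<Longrightarrow> x \<in> carrier M \<Longrightarrow> y \<in> carrier N \<Longrightarrow> \<beta> (r \<odot>\<^bsub>M\<^esub> x) y = r \<odot>\<^bsub>P\<^esub> \<beta> x y"
    and "\<And>r x y. r \<in> carrier R \<Longrightarrow> x \<in> carrier M \<Longrightarrow> y \<in> carrier N \<Longrightarrow> \<beta> x (r \<odot>\<^bsub>N\<^esub> y) = r \<odot>\<^bsub>P\<^esub> \<beta> x y"
  shows "bilinear R M N P \<beta>"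
  using assms by (auto simp: bilinear_def intro!: lin_mapI)

lemma bilinear_comp:
  assumes "bilinear R M N P \<beta>" "f \<in> lin_map R M' M" "h \<in> lin_map R N' N" "k \<in> lin_map R P P'"
  shows "bilinear R M' N' P' (\<lambda>x y. k (\<beta> (f x) (h y)))"
  using assms unfolding bilinear_def
  by (auto intro!: lin_map_comp[OF _ assms(4)] lin_map_comp[OF assms(2)] lin_map_comp[OF assms(3)]
      dest: lin_map_closed)

context tensor_product
begin

lemma pure_bilinear: "bilinear R M N (tensor R M N) (pure R M N)"
  unfolding bilinear_def by (auto simp: pure_lin_left pure_lin_right)

context
  fixes P \<beta> assumes P: "module R P" and \<beta>: "bilinear R M N P \<beta>"
begin

private lemma \<beta>_fun: "(\<lambda>(x, y). \<beta> x y) \<in> carrier (M \<times>\<times> N) \<rightarrow> carrier P"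
  using \<beta> by (auto simp: bilinear_def lin_map_def Pi_iff)

text \<open>The kernel of the linear extension is a submodule, and it contains the four kinds of
  relations because \<open>\<beta>\<close> is additive and homogeneous in each argument.\<close>

private lemma lin_ext_null:
  assumes "h \<in> tensor_null R M N" shows "lin_ext R P (\<lambda>(x, y). \<beta> x y) h = \<zero>\<^bsub>P\<^esub>"
proof -
  interpret P: module R P by (rule P)
  let ?f = "lin_ext R P (\<lambda>(x, y). \<beta> x y)"
  note L = FM.lin_ext_lin[OF P \<beta>_fun]
  note Ls = lin_map_closed[OF L] lin_map_add[OF L] lin_map_smult[OF L] lin_map_zero[OF FM.F_module P L]
    lin_map_uminus[OF FM.F_module P L] lin_map_minus[OF FM.F_module P L]
  note S = FM.lin_ext_single[OF P \<beta>_fun]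
  have B: "\<beta> x y \<in> carrier P" if "x \<in> carrier M" "y \<in> carrier N" for x y
    using \<beta> that by (auto simp: bilinear_def lin_map_def Pi_iff)
  have "tensor_null R M N \<subseteq> {p \<in> carrier FM.F. ?f p = \<zero>\<^bsub>P\<^esub>}"
  proof (rule tensor_null_least)
    show "submodule {p \<in> carrier FM.F. ?f p = \<zero>\<^bsub>P\<^esub>} R FM.F"
      by (rule FM.F.submoduleI) (auto simp: Ls)
  qed (use \<beta> in \<open>auto simp: Ls S B P.M.minus_eq_zero_iff bilinear_def lin_map_add lin_map_smult
         lin_map_add[of "\<lambda>x. \<beta> x y" for y] lin_map_smult[of "\<lambda>x. \<beta> x y" for y]\<close>)
  then show ?thesis using assms by auto
qed

lemma tensor_lift_lin: "tensor_lift R P \<beta> \<in> lin_map R (tensor R M N) P"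
  unfolding tensor_lift_def tensor_def
  by (rule TQ.induced_lin[OF P FM.lin_ext_lin[OF P \<beta>_fun] lin_ext_null])

lemma tensor_lift_pure:
  assumes "x \<in> carrier M" "y \<in> carrier N"
  shows "tensor_lift R P \<beta> (pure R M N x y) = \<beta> x y"
  unfolding tensor_lift_def pure_def
  using TQ.induced_coset[OF P FM.lin_ext_lin[OF P \<beta>_fun] lin_ext_null cross_closed[OF assms]]
    FM.lin_ext_single[OF P \<beta>_fun, of "(x, y)"] assms by simp

end

end

section \<open>Tensor products of algebras\<close>

lemma (in algebra) smult_mult_right:
  assumes "a \<in> carrier R" "x \<in> carrier M" "y \<in> carrier M"
  shows "x \<otimes>\<^bsub>M\<^esub> (a \<odot>\<^bsub>M\<^esub> y) = a \<odot>\<^bsub>M\<^esub> (x \<otimes>\<^bsub>M\<^esub> y)"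
  using assms by (metis m_comm smult_assoc2 smult_closed)

locale tensor_algebra = B: algebra A B + C: algebra A C
  for A :: "('a, 'r) ring_scheme" and B :: "('a, 'b, 's) module_scheme" and C :: "('a, 'c, 't) module_scheme"
begin

sublocale tensor_product A B C
  by (rule tensor_product.intro) (rule B.module_axioms C.module_axioms)+

lemma cross_monoid: "comm_monoid (B \<times>\<times> C)"
  by (rule comm_monoidI) (auto simp: B.m_ac C.m_ac)

sublocale FA: algebra A FM.F by (rule FM.F_algebra[OF cross_monoid])

text \<open>A bilinearity relation times a basis element \<open>(x, y)\<close> is again a
  bilinearity relation, with both of its arguments multiplied by \<open>x\<close> and
  \<open>y\<close>. So the elements that \<open>single A (x, y)\<close> multiplies into
  \<open>tensor_null\<close> form a submodule containing the relations; linearity then extends this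
  from \<open>single A (x, y)\<close> to all \<open>p\<close>.\<close>

lemma tensor_null_mult:
  assumes "p \<in> carrier FM.F" "h \<in> tensor_null A B C"
  shows "p \<otimes>\<^bsub>FM.F\<^esub> h \<in> tensor_null A B C"
proof -
  note SE = FM.F.submoduleE[OF tensor_null_submodule]
  have h: "h \<in> carrier FM.F" using assms SE by auto
  note Z = subgroup.one_closed[OF submodule.axioms(1)[OF tensor_null_submodule], simplified]
  have S: "single A (x, y) \<otimes>\<^bsub>FM.F\<^esub> h \<in> tensor_null A B C" if xy: "x \<in> carrier B" "y \<in> carrier C" for x y
  proof -
    note [simp] = FM.single_mult xy B.r_distr C.r_distr FA.r_distr FA.smult_mult_right
      B.smult_mult_right C.smult_mult_right FA.r_minus
    have "tensor_null A B C \<subseteq> {q \<in> carrier FM.F. single A (x, y) \<otimes>\<^bsub>FM.F\<^esub> q \<in> tensor_null A B C}"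
    proof (rule tensor_null_least)
      show "submodule {q \<in> carrier FM.F. single A (x, y) \<otimes>\<^bsub>FM.F\<^esub> q \<in> tensor_null A B C} A FM.F"
        by (rule FM.F.submoduleI) (use SE Z in simp_all)
    qed (use tensor_null_relations[unfolded a_minus_def] in \<open>simp_all add: a_minus_def\<close>)
    then show ?thesis using assms(2) by auto
  qed
  show ?thesis using assms(1)
  proof (induction rule: FM.F_induct)
    case zero
    then show ?case using h Z by simp
  next
    case (single m)
    then show ?case using S by auto
  next
    case (add p q)
    then show ?case using h SE by (simp add: FA.l_distr)
  next
    case (smult a p)
    then show ?case using h SE by (simp add: FA.smult_assoc2)
  qed
qed

lemma tensor_null_ideal: "ideal (tensor_null A B C) FM.F"
proof (rule idealI[OF FA.ring_axioms])
  show "subgroup (tensor_null A B C) (add_monoid FM.F)"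
    using submodule.axioms(1)[OF tensor_null_submodule] .
  fix h p assume hp: "h \<in> tensor_null A B C" "p \<in> carrier FM.F"
  show *: "p \<otimes>\<^bsub>FM.F\<^esub> h \<in> tensor_null A B C" by (rule tensor_null_mult[OF hp(2,1)])
  have "h \<in> carrier FM.F" using hp(1) FM.F.submoduleE(1)[OF tensor_null_submodule] by blast
  from FA.m_comm[OF this hp(2)] show "h \<otimes>\<^bsub>FM.F\<^esub> p \<in> tensor_null A B C" using * by (simp only:)
qed

sublocale TA: algebra_quotient A FM.F "tensor_null A B C"
  by (intro algebra_quotient.intro algebra_quotient_axioms.intro FA.algebra_axioms tensor_null_ideal)

lemma tensor_algebra: "algebra A (tensor A B C)"
  unfolding tensor_def by (rule TA.quot_algebra)

lemma pure_mult:
  assumes "x \<in> carrier B" "x' \<in> carrier B" "y \<in> carrier C" "y' \<in> carrier C"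
  shows "pure A B C x y \<otimes>\<^bsub>tensor A B C\<^esub> pure A B C x' y' = pure A B C (x \<otimes>\<^bsub>B\<^esub> x') (y \<otimes>\<^bsub>C\<^esub> y')"
  unfolding tensor_def pure_def using assms by (simp add: TA.coset_mult FM.single_mult)

lemma tensor_one: "\<one>\<^bsub>tensor A B C\<^esub> = pure A B C \<one>\<^bsub>B\<^esub> \<one>\<^bsub>C\<^esub>"
  unfolding tensor_def pure_def by (simp only: quot_sel monoid_algebra_sel one_DirProd)

lemma pure_left_hom: "(\<lambda>x. pure A B C x \<one>\<^bsub>C\<^esub>) \<in> alg_hom A B (tensor A B C)"
  by (rule alg_homI[OF pure_lin_left]) (simp_all add: tensor_one pure_mult)

lemma pure_right_hom: "(\<lambda>y. pure A B C \<one>\<^bsub>B\<^esub> y) \<in> alg_hom A C (tensor A B C)"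
  by (rule alg_homI[OF pure_lin_right]) (simp_all add: tensor_one pure_mult)

lemma pure_split:
  "x \<in> carrier B \<Longrightarrow> y \<in> carrier C \<Longrightarrow>
    pure A B C x y = pure A B C x \<one>\<^bsub>C\<^esub> \<otimes>\<^bsub>tensor A B C\<^esub> pure A B C \<one>\<^bsub>B\<^esub> y"
  by (simp add: pure_mult)

text \<open>Pure tensors generate additively, and multiplicativity is a biadditive
  condition.\<close>

lemma alg_hom_tensorI:
  assumes "algebra A D" "f \<in> lin_map A (tensor A B C) D" "f (pure A B C \<one>\<^bsub>B\<^esub> \<one>\<^bsub>C\<^esub>) = \<one>\<^bsub>D\<^esub>"
    and "\<And>x x' y y'. x \<in> carrier B \<Longrightarrow> x' \<in> carrier B \<Longrightarrow> y \<in> carrier C \<Longrightarrow> y' \<in> carrier C \<Longrightarrow>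
      f (pure A B C (x \<otimes>\<^bsub>B\<^esub> x') (y \<otimes>\<^bsub>C\<^esub> y')) = f (pure A B C x y) \<otimes>\<^bsub>D\<^esub> f (pure A B C x' y')"
  shows "f \<in> alg_hom A (tensor A B C) D"
proof (rule alg_homI[OF assms(2)])
  interpret T: algebra A "tensor A B C" by (rule tensor_algebra)
  interpret D: algebra A D by fact
  note Ls = lin_map_closed[OF assms(2)] lin_map_add[OF assms(2)]
  show "f \<one>\<^bsub>tensor A B C\<^esub> = \<one>\<^bsub>D\<^esub>" by (simp add: tensor_one assms(3))
  show "f (v \<otimes>\<^bsub>tensor A B C\<^esub> w) = f v \<otimes>\<^bsub>D\<^esub> f w"
    if "v \<in> carrier (tensor A B C)" "w \<in> carrier (tensor A B C)" for v w
    using that(1)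
  proof (induction rule: tensor_induct)
    case (pure x y)
    show ?case using that(2)
      by (induction rule: tensor_induct)
        (use pure in \<open>simp_all add: pure_mult assms(4) T.r_distr D.r_distr Ls pure_closed\<close>)
  qed (use that in \<open>simp_all add: T.l_distr D.l_distr Ls\<close>)
qed

text \<open>Since \<open>x \<otimes> y = (x \<otimes> 1)(1 \<otimes> y)\<close>, the tensor product
  is generated by its two factors: the uniqueness half of its coproduct property.\<close>

lemma alg_hom_tensor_ext:
  assumes "f \<in> alg_hom A (tensor A B C) D" "h \<in> alg_hom A (tensor A B C) D"
    and "\<And>x. x \<in> carrier B \<Longrightarrow> f (pure A B C x \<one>\<^bsub>C\<^esub>) = h (pure A B C x \<one>\<^bsub>C\<^esub>)"
    and "\<And>y. y \<in> carrier C \<Longrightarrow> f (pure A B C \<one>\<^bsub>B\<^esub> y) = h (pure A B C \<one>\<^bsub>B\<^esub> y)"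
    and "w \<in> carrier (tensor A B C)"
  shows "f w = h w"
  by (rule lin_map_ext[OF alg_hom_lin alg_hom_lin _ assms(5), OF assms(1,2)])
    (subst (1 2) pure_split, simp_all add: alg_hom_mult[OF assms(1)] alg_hom_mult[OF assms(2)] pure_closed assms(3,4))

context
  fixes D f h assumes D: "algebra A D" and f: "f \<in> alg_hom A B D" and h: "h \<in> alg_hom A C D"
begin

interpretation D: algebra A D by (rule D)

lemma pt_pair_bilinear: "bilinear A B C D (\<lambda>x y. f x \<otimes>\<^bsub>D\<^esub> h y)"
  by (rule bilinearI)
    (simp_all add: alg_hom_simps[OF f] alg_hom_simps[OF h] D.l_distr D.r_distr D.smult_assoc2 D.smult_mult_right)

lemma pt_pair_pure:
  "x \<in> carrier B \<Longrightarrow> y \<in> carrier C \<Longrightarrow> pt_pair A D f h (pure A B C x y) = f x \<otimes>\<^bsub>D\<^esub> h y"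
  unfolding pt_pair_def by (rule tensor_lift_pure[OF D.module_axioms pt_pair_bilinear])

text \<open>The existence half of the coproduct property. Commutativity of \<open>D\<close> brings
  \<open>f x f x' h y h y'\<close> into the order that multiplicativity requires.\<close>

lemma pt_pair_hom: "pt_pair A D f h \<in> alg_hom A (tensor A B C) D"
proof (rule alg_hom_tensorI[OF D])
  show "pt_pair A D f h \<in> lin_map A (tensor A B C) D"
    unfolding pt_pair_def by (rule tensor_lift_lin[OF D.module_axioms pt_pair_bilinear])
qed (simp_all add: pt_pair_pure alg_hom_simps[OF f] alg_hom_simps[OF h] D.m_ac)

end

end

context tensor_product
begin

context
  fixes M' N' f h assumes M': "module R M'" and N': "module R N'"
    and f: "f \<in> lin_map R M M'" and h: "h \<in> lin_map R N N'"
begin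

interpretation T': tensor_product R M' N' by (rule tensor_product.intro) (rule M' N')+

private lemma bil: "bilinear R M N (tensor R M' N') (\<lambda>x y. pure R M' N' (f x) (h y))"
  using bilinear_comp[OF T'.pure_bilinear f h lin_map_id] .

lemma tensor_map_lin: "tensor_map R M' N' f h \<in> lin_map R (tensor R M N) (tensor R M' N')"
  unfolding tensor_map_def by (rule tensor_lift_lin[OF T'.tensor_module bil])

lemma tensor_map_pure:
  "x \<in> carrier M \<Longrightarrow> y \<in> carrier N \<Longrightarrow>
    tensor_map R M' N' f h (pure R M N x y) = pure R M' N' (f x) (h y)"
  unfolding tensor_map_def by (rule tensor_lift_pure[OF T'.tensor_module bil])

end

end

context tensor_algebra
begin

lemma tensor_map_hom:
  assumes "algebra A B'" "algebra A C'" "f \<in> alg_hom A B B'" "h \<in> alg_hom A C C'"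
  shows "tensor_map A B' C' f h \<in> alg_hom A (tensor A B C) (tensor A B' C')"
proof -
  interpret B': algebra A B' by fact
  interpret C': algebra A C' by fact
  interpret T': tensor_algebra A B' C' by (rule tensor_algebra.intro) fact+
  note P = tensor_map_pure[OF B'.module_axioms C'.module_axioms alg_hom_lin[OF assms(3)] alg_hom_lin[OF assms(4)]]
  show ?thesis
    by (rule alg_hom_tensorI[OF T'.tensor_algebra tensor_map_lin[OF B'.module_axioms C'.module_axioms alg_hom_lin alg_hom_lin]])
      (simp_all add: assms P alg_hom_simps[OF assms(3)] alg_hom_simps[OF assms(4)] T'.pure_mult T'.tensor_one)
qed

lemmas tensor_map_pure_hom = tensor_map_pure[OF algebra_module algebra_module alg_hom_lin alg_hom_lin]

end

lemma bilinear_cong: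
  assumes "bilinear R M N P \<beta>" "module R M" "module R N"
    and "\<And>x y. x \<in> carrier M \<Longrightarrow> y \<in> carrier N \<Longrightarrow> \<gamma> x y = \<beta> x y"
  shows "bilinear R M N P \<gamma>"
proof -
  interpret M: module R M by fact
  interpret N: module R N by fact
  show ?thesis using assms(1,4) by (auto simp: bilinear_def lin_map_def Pi_iff)
qed

locale tensor_algebra3 = B: algebra A B + C: algebra A C + D: algebra A D
  for A :: "('a, 'r) ring_scheme" and B :: "('a, 'b, 's) module_scheme" and C :: "('a, 'c, 't) module_scheme"
    and D :: "('a, 'd, 'u) module_scheme"
begin

sublocale BC: tensor_algebra A B C by (rule tensor_algebra.intro) unfold_locales
sublocale CD: tensor_algebra A C D by (rule tensor_algebra.intro) unfold_locales
sublocale B_CD: tensor_algebra A B "tensor A C D"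
  by (rule tensor_algebra.intro) (rule B.algebra_axioms CD.tensor_algebra)+
sublocale BC_D: tensor_algebra A "tensor A B C" D
  by (rule tensor_algebra.intro) (rule D.algebra_axioms BC.tensor_algebra)+

abbreviation "P \<equiv> tensor A B (tensor A C D)"

sublocale P: algebra A P by (rule B_CD.tensor_algebra)

lemma assoc_right_hom: "(\<lambda>z. pure A B (tensor A C D) \<one>\<^bsub>B\<^esub> (pure A C D \<one>\<^bsub>C\<^esub> z)) \<in> alg_hom A D P"
  by (rule alg_hom_comp[OF CD.pure_right_hom B_CD.pure_right_hom])

lemma assoc_middle_hom: "(\<lambda>y. pure A B (tensor A C D) \<one>\<^bsub>B\<^esub> (pure A C D y \<one>\<^bsub>D\<^esub>)) \<in> alg_hom A C P"
  by (rule alg_hom_comp[OF CD.pure_left_hom B_CD.pure_right_hom])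

lemmas assoc_left_hom = BC.pt_pair_hom[OF P.algebra_axioms B_CD.pure_left_hom assoc_middle_hom]

context
begin

private lemma inner_bilinear: "z \<in> carrier D \<Longrightarrow> bilinear A B C P (\<lambda>x y. pure A B (tensor A C D) x (pure A C D y z))"
  using bilinear_comp[OF B_CD.pure_bilinear lin_map_id CD.pure_lin_left lin_map_id] .

text \<open>For a fixed \<open>z\<close> the inner map of \<open>tensor_assoc\<close> is not
  multiplicative in \<open>w\<close>. Writing it as an algebra homomorphism times the image of
  \<open>z\<close> exhibits the outer map as a pairing of two homomorphisms, whose bilinearity is
  known.\<close>

private lemma inner_eq:
  assumes "w \<in> carrier (tensor A B C)" "z \<in> carrier D"
  shows "tensor_lift A P (\<lambda>x y. pure A B (tensor A C D) x (pure A C D y z)) w =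
    pt_pair A P (\<lambda>x. pure A B (tensor A C D) x \<one>\<^bsub>tensor A C D\<^esub>)
      (\<lambda>y. pure A B (tensor A C D) \<one>\<^bsub>B\<^esub> (pure A C D y \<one>\<^bsub>D\<^esub>)) w
    \<otimes>\<^bsub>P\<^esub> pure A B (tensor A C D) \<one>\<^bsub>B\<^esub> (pure A C D \<one>\<^bsub>C\<^esub> z)"
proof -
  interpret CDT: algebra A "tensor A C D" by (rule CD.tensor_algebra)
  note L = BC.tensor_lift_lin[OF P.module_axioms inner_bilinear[OF assms(2)]]
  note M = BC.pt_pair_pure[OF P.algebra_axioms B_CD.pure_left_hom assoc_middle_hom]
  show ?thesis using assms(1)
  proof (induction rule: BC.tensor_induct)
    case (pure x y)
    then show ?case using assms(2)
      by (simp add: BC.tensor_lift_pure[OF P.module_axioms inner_bilinear[OF assms(2)]] M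
          B_CD.pure_mult CD.pure_mult CD.pure_closed)
  next
    case (add v w)
    then show ?case using assms(2)
      by (simp add: lin_map_add[OF L] alg_hom_simps[OF assoc_left_hom] P.l_distr B_CD.pure_closed CD.pure_closed)
  qed
qed

private lemma outer_bilinear: "bilinear A (tensor A B C) D P
    (\<lambda>w z. tensor_lift A P (\<lambda>x y. pure A B (tensor A C D) x (pure A C D y z)) w)"
  by (rule bilinear_cong[OF BC_D.pt_pair_bilinear[OF P.algebra_axioms assoc_left_hom assoc_right_hom]
        BC.tensor_module D.module_axioms inner_eq])

lemma tensor_assoc_pure:
  assumes "w \<in> carrier (tensor A B C)" "z \<in> carrier D"
  shows "tensor_assoc A B C D (pure A (tensor A B C) D w z) =
    pt_pair A P (\<lambda>x. pure A B (tensor A C D) x \<one>\<^bsub>tensor A C D\<^esub>)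
      (\<lambda>y. pure A B (tensor A C D) \<one>\<^bsub>B\<^esub> (pure A C D y \<one>\<^bsub>D\<^esub>)) w
    \<otimes>\<^bsub>P\<^esub> pure A B (tensor A C D) \<one>\<^bsub>B\<^esub> (pure A C D \<one>\<^bsub>C\<^esub> z)"
  unfolding tensor_assoc_def Let_def
  using BC_D.tensor_lift_pure[OF P.module_axioms outer_bilinear assms] inner_eq[OF assms] by simp

lemma tensor_assoc_hom: "tensor_assoc A B C D \<in> alg_hom A (tensor A (tensor A B C) D) P"
proof (rule alg_hom_cong[OF BC_D.tensor_algebra BC_D.pt_pair_hom[OF P.algebra_axioms assoc_left_hom assoc_right_hom]])
  fix w assume w: "w \<in> carrier (tensor A (tensor A B C) D)"
  have "tensor_assoc A B C D \<in> lin_map A (tensor A (tensor A B C) D) P"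
    unfolding tensor_assoc_def Let_def by (rule BC_D.tensor_lift_lin[OF P.module_axioms outer_bilinear])
  then show "tensor_assoc A B C D w = pt_pair A P (pt_pair A P (\<lambda>x. pure A B (tensor A C D) x \<one>\<^bsub>tensor A C D\<^esub>)
      (\<lambda>y. pure A B (tensor A C D) \<one>\<^bsub>B\<^esub> (pure A C D y \<one>\<^bsub>D\<^esub>)))
      (\<lambda>z. pure A B (tensor A C D) \<one>\<^bsub>B\<^esub> (pure A C D \<one>\<^bsub>C\<^esub> z)) w"
    by (rule BC_D.lin_map_ext[OF _ alg_hom_lin[OF BC_D.pt_pair_hom[OF P.algebra_axioms assoc_left_hom assoc_right_hom]] _ w])
      (simp add: tensor_assoc_pure BC_D.pt_pair_pure[OF P.algebra_axioms assoc_left_hom assoc_right_hom])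
qed

end

end

context tensor_algebra
begin

lemma pt_pair_cong:
  assumes "algebra A D" "f \<in> alg_hom A B D" "h \<in> alg_hom A C D"
    and "\<And>x. x \<in> carrier B \<Longrightarrow> f' x = f x" "\<And>y. y \<in> carrier C \<Longrightarrow> h' y = h y"
    and "w \<in> carrier (tensor A B C)"
  shows "pt_pair A D f' h' w = pt_pair A D f h w"
proof -
  have f': "f' \<in> alg_hom A B D" by (rule alg_hom_cong[OF B.algebra_axioms assms(2,4)])
  have h': "h' \<in> alg_hom A C D" by (rule alg_hom_cong[OF C.algebra_axioms assms(3,5)])
  show ?thesis
    by (rule lin_map_ext[OF alg_hom_lin[OF pt_pair_hom[OF assms(1) f' h']]
          alg_hom_lin[OF pt_pair_hom[OF assms(1-3)]] _ assms(6)])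
      (simp add: pt_pair_pure[OF assms(1) f' h'] pt_pair_pure[OF assms(1-3)] assms(4,5))
qed

lemma hom_pt_pair:
  assumes "algebra A D" "algebra A E" "f \<in> alg_hom A B D" "h \<in> alg_hom A C D" "k \<in> alg_hom A D E"
    and "w \<in> carrier (tensor A B C)"
  shows "k (pt_pair A D f h w) = pt_pair A E (\<lambda>x. k (f x)) (\<lambda>y. k (h y)) w"
proof -
  note 1 = alg_hom_comp[OF pt_pair_hom[OF assms(1,3,4)] assms(5)]
  note 2 = pt_pair_hom[OF assms(2) alg_hom_comp[OF assms(3,5)] alg_hom_comp[OF assms(4,5)]]
  show ?thesis
    by (rule lin_map_ext[OF alg_hom_lin[OF 1] alg_hom_lin[OF 2] _ assms(6)])
      (simp add: pt_pair_pure[OF assms(1,3,4)] pt_pair_pure[OF assms(2) alg_hom_comp[OF assms(3,5)] alg_hom_comp[OF assms(4,5)]]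
        alg_hom_simps[OF assms(3)] alg_hom_simps[OF assms(4)] alg_hom_simps[OF assms(5)])
qed

lemma pt_pair_tensor_map:
  assumes "algebra A B'" "algebra A C'" "algebra A D" "f' \<in> alg_hom A B B'" "h' \<in> alg_hom A C C'"
    and "f \<in> alg_hom A B' D" "h \<in> alg_hom A C' D" "w \<in> carrier (tensor A B C)"
  shows "pt_pair A D f h (tensor_map A B' C' f' h' w) = pt_pair A D (\<lambda>x. f (f' x)) (\<lambda>y. h (h' y)) w"
proof -
  interpret T': tensor_algebra A B' C' by (rule tensor_algebra.intro) fact+
  note 1 = alg_hom_comp[OF tensor_map_hom[OF assms(1,2,4,5)] T'.pt_pair_hom[OF assms(3,6,7)]]
  note 2 = pt_pair_hom[OF assms(3) alg_hom_comp[OF assms(4,6)] alg_hom_comp[OF assms(5,7)]]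
  show ?thesis
    by (rule lin_map_ext[OF alg_hom_lin[OF 1] alg_hom_lin[OF 2] _ assms(8)])
      (simp add: pt_pair_pure[OF assms(3) alg_hom_comp[OF assms(4,6)] alg_hom_comp[OF assms(5,7)]]
        T'.pt_pair_pure[OF assms(3,6,7)] tensor_map_pure_hom[OF assms(1,2,4,5)]
        alg_hom_simps[OF assms(4)] alg_hom_simps[OF assms(5)])
qed

text \<open>A map \<open>f \<otimes> h\<close> is the pair of its restrictions to the two factors,
  so maps between tensor products can be handled as points.\<close>

lemma tensor_map_pt_pair:
  assumes "algebra A B'" "algebra A C'" "f \<in> alg_hom A B B'" "h \<in> alg_hom A C C'" "w \<in> carrier (tensor A B C)"
  shows "tensor_map A B' C' f h w =
    pt_pair A (tensor A B' C') (\<lambda>x. pure A B' C' (f x) \<one>\<^bsub>C'\<^esub>) (\<lambda>y. pure A B' C' \<one>\<^bsub>B'\<^esub> (h y)) w"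
proof -
  interpret T': tensor_algebra A B' C' by (rule tensor_algebra.intro) fact+
  interpret B': algebra A B' by fact
  interpret C': algebra A C' by fact
  note 1 = tensor_map_hom[OF assms(1-4)]
  note 2 = alg_hom_comp[OF assms(3) T'.pure_left_hom] alg_hom_comp[OF assms(4) T'.pure_right_hom]
  show ?thesis
    by (rule lin_map_ext[OF alg_hom_lin[OF 1] alg_hom_lin[OF pt_pair_hom[OF T'.tensor_algebra 2]] _ assms(5)])
      (simp add: tensor_map_pure_hom[OF assms(1-4)] pt_pair_pure[OF T'.tensor_algebra 2] T'.pure_mult
        alg_hom_simps[OF assms(3)] alg_hom_simps[OF assms(4)])
qed

end

section \<open>Hopf algebras through their points\<close>

lemma alg_hom_id': "id \<in> alg_hom A B B"
  by (auto simp: alg_hom_def ring_hom_def)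

text \<open>The structure maps without the group axioms: products of points are available while
  those axioms are still being proved.\<close>

locale hopf_data = algebra A H
  for A :: "('a, 'r) ring_scheme" and H :: "('a, 'b, 's) hopf_scheme" +
  assumes comult_hom: "comult H \<in> alg_hom A H (tensor A H H)"
    and counit_hom: "counit H \<in> alg_hom A H (base_algebra A)"
    and antipode_hom: "antipode H \<in> alg_hom A H H"
begin

sublocale HHH: tensor_algebra3 A H H H by (rule tensor_algebra3.intro; unfold_locales)

lemma counit_point: "algebra A R \<Longrightarrow> (\<lambda>x. counit H x \<odot>\<^bsub>R\<^esub> \<one>\<^bsub>R\<^esub>) \<in> alg_hom A H R"
  by (rule alg_hom_comp[OF counit_hom alg_hom_unit])

lemma pt_mult_hom:
  "algebra A R \<Longrightarrow> f \<in> alg_hom A H R \<Longrightarrow> h \<in> alg_hom A H R \<Longrightarrow> pt_mult A H R f h \<in> alg_hom A H R"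
  unfolding pt_mult_def comp_def by (rule alg_hom_comp[OF comult_hom HHH.BC.pt_pair_hom])

lemma pt_inv_hom: "f \<in> alg_hom A H R \<Longrightarrow> pt_inv H f \<in> alg_hom A H R"
  unfolding pt_inv_def comp_def by (rule alg_hom_comp[OF antipode_hom])

lemma pt_mult_cong:
  assumes "algebra A R" "f \<in> alg_hom A H R" "h \<in> alg_hom A H R" "x \<in> carrier H"
    and "\<And>x. x \<in> carrier H \<Longrightarrow> f' x = f x" "\<And>x. x \<in> carrier H \<Longrightarrow> h' x = h x"
  shows "pt_mult A H R f' h' x = pt_mult A H R f h x"
  unfolding pt_mult_def comp_def
  by (rule HHH.BC.pt_pair_cong[OF assms(1-3,5,6) alg_hom_closed[OF comult_hom assms(4)]])

lemma hom_pt_mult: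
  assumes "algebra A R" "algebra A R'" "f \<in> alg_hom A H R" "h \<in> alg_hom A H R" "k \<in> alg_hom A R R'" "x \<in> carrier H"
  shows "k (pt_mult A H R f h x) = pt_mult A H R' (\<lambda>x. k (f x)) (\<lambda>x. k (h x)) x"
  unfolding pt_mult_def comp_def
  by (rule HHH.BC.hom_pt_pair[OF assms(1-5) alg_hom_closed[OF comult_hom assms(6)]])

text \<open>The counit axioms scale by \<open>counit H y\<close>. Multiplying by
  \<open>counit H y \<odot> \<one>\<close> instead makes them statements about products with the
  neutral point.\<close>

lemma counit_lift:
  assumes "w \<in> carrier (tensor A H H)"
  shows "tensor_lift A H (\<lambda>y z. counit H y \<odot>\<^bsub>H\<^esub> z) w = pt_pair A H (\<lambda>y. counit H y \<odot>\<^bsub>H\<^esub> \<one>\<^bsub>H\<^esub>) (\<lambda>z. z) w"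
    and "tensor_lift A H (\<lambda>y z. counit H z \<odot>\<^bsub>H\<^esub> y) w = pt_pair A H (\<lambda>z. z) (\<lambda>y. counit H y \<odot>\<^bsub>H\<^esub> \<one>\<^bsub>H\<^esub>) w"
proof -
  note e = counit_point[OF algebra_axioms]
  have c: "counit H x \<in> carrier A" if "x \<in> carrier H" for x
    using alg_hom_closed[OF counit_hom that] by simp
  note 1 = HHH.BC.pt_pair_bilinear[OF algebra_axioms e alg_hom_id]
  have b1: "bilinear A H H H (\<lambda>y z. counit H y \<odot>\<^bsub>H\<^esub> z)"
    by (rule bilinear_cong[OF 1]) (simp_all add: module_axioms smult_assoc2 c)
  note 2 = HHH.BC.pt_pair_bilinear[OF algebra_axioms alg_hom_id e]
  have b2: "bilinear A H H H (\<lambda>y z. counit H z \<odot>\<^bsub>H\<^esub> y)"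
    by (rule bilinear_cong[OF 2]) (simp_all add: module_axioms smult_mult_right c)
  show "tensor_lift A H (\<lambda>y z. counit H y \<odot>\<^bsub>H\<^esub> z) w = pt_pair A H (\<lambda>y. counit H y \<odot>\<^bsub>H\<^esub> \<one>\<^bsub>H\<^esub>) (\<lambda>z. z) w"
    by (rule HHH.BC.lin_map_ext[OF HHH.BC.tensor_lift_lin[OF module_axioms b1]
          alg_hom_lin[OF HHH.BC.pt_pair_hom[OF algebra_axioms e alg_hom_id]] _ assms])
      (simp add: HHH.BC.tensor_lift_pure[OF module_axioms b1] HHH.BC.pt_pair_pure[OF algebra_axioms e alg_hom_id] smult_assoc2 c)
  show "tensor_lift A H (\<lambda>y z. counit H z \<odot>\<^bsub>H\<^esub> y) w = pt_pair A H (\<lambda>z. z) (\<lambda>y. counit H y \<odot>\<^bsub>H\<^esub> \<one>\<^bsub>H\<^esub>) w"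
    by (rule HHH.BC.lin_map_ext[OF HHH.BC.tensor_lift_lin[OF module_axioms b2]
          alg_hom_lin[OF HHH.BC.pt_pair_hom[OF algebra_axioms alg_hom_id e]] _ assms])
      (simp add: HHH.BC.tensor_lift_pure[OF module_axioms b2] HHH.BC.pt_pair_pure[OF algebra_axioms alg_hom_id e] smult_mult_right c)
qed

text \<open>The comorphisms of the three projections from \<open>H x H x H\<close>. They form the
  universal triple of points: every other triple is a specialization of it.\<close>

definition "proj1 = (\<lambda>x. pure A H (tensor A H H) x \<one>\<^bsub>tensor A H H\<^esub>)"
definition "proj2 = (\<lambda>x. pure A H (tensor A H H) \<one>\<^bsub>H\<^esub> (pure A H H x \<one>\<^bsub>H\<^esub>))"
definition "proj3 = (\<lambda>x. pure A H (tensor A H H) \<one>\<^bsub>H\<^esub> (pure A H H \<one>\<^bsub>H\<^esub> x))"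

lemma proj_hom: "proj1 \<in> alg_hom A H HHH.P" "proj2 \<in> alg_hom A H HHH.P" "proj3 \<in> alg_hom A H HHH.P"
  unfolding proj1_def proj2_def proj3_def
  by (rule HHH.B_CD.pure_left_hom HHH.assoc_middle_hom HHH.assoc_right_hom)+

text \<open>\<open>tensor_assoc\<close> is itself a pairing of coordinate points, so the two sides
  of coassociativity turn out to be the two bracketings of the product of the universal
  triple.\<close>

lemma coassoc_points:
  assumes x: "x \<in> carrier H"
  shows "tensor_assoc A H H H (tensor_map A (tensor A H H) H (comult H) id (comult H x)) =
      pt_mult A H HHH.P (pt_mult A H HHH.P proj1 proj2) proj3 x"
    and "tensor_map A H (tensor A H H) id (comult H) (comult H x) =
      pt_mult A H HHH.P proj1 (pt_mult A H HHH.P proj2 proj3) x"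
proof -
  interpret HH: algebra A "tensor A H H" by (rule HHH.BC.tensor_algebra)
  note p = proj_hom
  note P = HHH.P.algebra_axioms
  note \<Delta>x = alg_hom_closed[OF comult_hom x]
  note tm = HHH.BC.tensor_map_hom[OF HHH.BC.tensor_algebra algebra_axioms comult_hom alg_hom_id']
  note pp = HHH.BC.pt_pair_hom[OF P p(1,2)]
  have eq: "tensor_assoc A H H H w = pt_pair A HHH.P (pt_pair A HHH.P proj1 proj2) proj3 w"
    if "w \<in> carrier (tensor A (tensor A H H) H)" for w
    by (rule HHH.BC_D.lin_map_ext[OF alg_hom_lin[OF HHH.tensor_assoc_hom]
          alg_hom_lin[OF HHH.BC_D.pt_pair_hom[OF P pp p(3)]] _ that])
      (simp add: HHH.BC_D.pt_pair_pure[OF P pp p(3)], simp add: HHH.tensor_assoc_pure proj1_def proj2_def proj3_def)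
  have "tensor_assoc A H H H (tensor_map A (tensor A H H) H (comult H) id (comult H x)) =
    pt_pair A HHH.P (\<lambda>x. pt_pair A HHH.P proj1 proj2 (comult H x)) (\<lambda>y. proj3 (id y)) (comult H x)"
    using eq[OF alg_hom_closed[OF tm \<Delta>x]]
      HHH.BC.pt_pair_tensor_map[OF HHH.BC.tensor_algebra algebra_axioms P comult_hom alg_hom_id' pp p(3) \<Delta>x]
    by simp
  then show "tensor_assoc A H H H (tensor_map A (tensor A H H) H (comult H) id (comult H x)) =
      pt_mult A H HHH.P (pt_mult A H HHH.P proj1 proj2) proj3 x"
    by (simp add: pt_mult_def comp_def)
  have q: "pure A H (tensor A H H) \<one>\<^bsub>H\<^esub> v = pt_pair A HHH.P proj2 proj3 v" if "v \<in> carrier (tensor A H H)" for v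
    by (rule HHH.BC.lin_map_ext[OF alg_hom_lin[OF HHH.B_CD.pure_right_hom] alg_hom_lin[OF HHH.BC.pt_pair_hom[OF P p(2,3)]] _ that])
      (simp add: HHH.BC.pt_pair_pure[OF P p(2,3)], simp add: proj2_def proj3_def HHH.B_CD.pure_mult HHH.BC.pure_mult HHH.BC.pure_closed)
  have "tensor_map A H (tensor A H H) id (comult H) (comult H x) =
    pt_pair A HHH.P (\<lambda>y. proj1 (id y)) (\<lambda>y. pure A H (tensor A H H) \<one>\<^bsub>H\<^esub> (comult H y)) (comult H x)"
    using HHH.BC.tensor_map_pt_pair[OF algebra_axioms HHH.BC.tensor_algebra alg_hom_id' comult_hom \<Delta>x]
    by (simp add: proj1_def)
  also have "\<dots> = pt_pair A HHH.P proj1 (pt_mult A H HHH.P proj2 proj3) (comult H x)"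
    by (rule HHH.BC.pt_pair_cong[OF P p(1) pt_mult_hom[OF P p(2,3)] _ _ \<Delta>x])
      (simp_all add: q alg_hom_closed[OF comult_hom] pt_mult_def)
  finally show "tensor_map A H (tensor A H H) id (comult H) (comult H x) =
      pt_mult A H HHH.P proj1 (pt_mult A H HHH.P proj2 proj3) x"
    by (simp add: pt_mult_def)
qed

text \<open>The group axioms may be verified on universal points.\<close>

lemma affine_group_schemeI:
  assumes "\<And>x. x \<in> carrier H \<Longrightarrow> pt_mult A H HHH.P (pt_mult A H HHH.P proj1 proj2) proj3 x =
      pt_mult A H HHH.P proj1 (pt_mult A H HHH.P proj2 proj3) x"
    and "\<And>x. x \<in> carrier H \<Longrightarrow> pt_mult A H H (\<lambda>x. counit H x \<odot>\<^bsub>H\<^esub> \<one>\<^bsub>H\<^esub>) (\<lambda>x. x) x = x"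
    and "\<And>x. x \<in> carrier H \<Longrightarrow> pt_mult A H H (\<lambda>x. x) (\<lambda>x. counit H x \<odot>\<^bsub>H\<^esub> \<one>\<^bsub>H\<^esub>) x = x"
    and "\<And>x. x \<in> carrier H \<Longrightarrow> pt_mult A H H (antipode H) (\<lambda>x. x) x = counit H x \<odot>\<^bsub>H\<^esub> \<one>\<^bsub>H\<^esub>"
    and "\<And>x. x \<in> carrier H \<Longrightarrow> pt_mult A H H (\<lambda>x. x) (antipode H) x = counit H x \<odot>\<^bsub>H\<^esub> \<one>\<^bsub>H\<^esub>"
  shows "affine_group_scheme A H"
proof (intro affine_group_scheme.intro affine_group_scheme_axioms.intro)
  fix x assume x: "x \<in> carrier H"
  note \<Delta>x = alg_hom_closed[OF comult_hom x]
  show "tensor_assoc A H H H (tensor_map A (tensor A H H) H (comult H) id (comult H x)) =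
      tensor_map A H (tensor A H H) id (comult H) (comult H x)"
    using coassoc_points[OF x] assms(1)[OF x] by simp
  show "tensor_lift A H (\<lambda>y z. counit H y \<odot>\<^bsub>H\<^esub> z) (comult H x) = x"
    using assms(2)[OF x] counit_lift(1)[OF \<Delta>x] by (simp add: pt_mult_def)
  show "tensor_lift A H (\<lambda>y z. counit H z \<odot>\<^bsub>H\<^esub> y) (comult H x) = x"
    using assms(3)[OF x] counit_lift(2)[OF \<Delta>x] by (simp add: pt_mult_def)
  show "tensor_lift A H (\<lambda>y z. antipode H y \<otimes>\<^bsub>H\<^esub> z) (comult H x) = counit H x \<odot>\<^bsub>H\<^esub> \<one>\<^bsub>H\<^esub>"
    using assms(4)[OF x] by (simp add: pt_mult_def pt_pair_def)
  show "tensor_lift A H (\<lambda>y z. y \<otimes>\<^bsub>H\<^esub> antipode H z) (comult H x) = counit H x \<odot>\<^bsub>H\<^esub> \<one>\<^bsub>H\<^esub>"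
    using assms(5)[OF x] by (simp add: pt_mult_def pt_pair_def)
qed (rule algebra_axioms comult_hom counit_hom antipode_hom)+

end

sublocale affine_group_scheme \<subseteq> hopf_data
  by (intro hopf_data.intro hopf_data_axioms.intro algebra_axioms comult_hom counit_hom antipode_hom)

section \<open>The group of points with values in an algebra\<close>

definition point_group ::
    "('a, 'r) ring_scheme \<Rightarrow> ('a, 'b, 's) hopf_scheme \<Rightarrow> ('a, 'd, 't) module_scheme \<Rightarrow> ('b \<Rightarrow> 'd) monoid"
  where "point_group A H R = \<lparr>carrier = alg_hom A H R \<inter> extensional (carrier H),
    mult = (\<lambda>f h. restrict (pt_mult A H R f h) (carrier H)),
    one = restrict (\<lambda>x. counit H x \<odot>\<^bsub>R\<^esub> \<one>\<^bsub>R\<^esub>) (carrier H)\<rparr>"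

context affine_group_scheme
begin

text \<open>\<open>?\<Phi>\<close> specializes the universal triple to \<open>(f, h, k)\<close>.
  Homomorphisms are compatible with products of points, so coassociativity at the universal triple
  is carried to this one.\<close>

lemma pt_mult_assoc:
  assumes "algebra A R" "f \<in> alg_hom A H R" "h \<in> alg_hom A H R" "k \<in> alg_hom A H R" "x \<in> carrier H"
  shows "pt_mult A H R (pt_mult A H R f h) k x = pt_mult A H R f (pt_mult A H R h k) x"
proof -
  note P = HHH.P.algebra_axioms
  note hk = HHH.BC.pt_pair_hom[OF assms(1,3,4)]
  let ?\<Phi> = "pt_pair A R f (pt_pair A R h k)"
  interpret RA: algebra A R by fact
  have \<Phi>: "?\<Phi> \<in> alg_hom A HHH.P R" by (rule HHH.B_CD.pt_pair_hom[OF assms(1,2) hk])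
  have v: "?\<Phi> (proj1 y) = f y" "?\<Phi> (proj2 y) = h y" "?\<Phi> (proj3 y) = k y" if "y \<in> carrier H" for y
    using that module.axioms(2)[OF HHH.BC.tensor_module]
    by (simp_all add: proj1_def proj2_def proj3_def HHH.B_CD.pt_pair_pure[OF assms(1,2) hk]
      HHH.BC.pt_pair_pure[OF assms(1,3,4)] HHH.BC.pure_closed alg_hom_simps[OF assms(2)] alg_hom_simps[OF assms(3)]
      alg_hom_simps[OF assms(4)] HHH.BC.tensor_one)
  note p = proj_hom
  have c: "?\<Phi> (pt_mult A H HHH.P a b y) = pt_mult A H R a' b' y"
    if "a \<in> alg_hom A H HHH.P" "b \<in> alg_hom A H HHH.P" "y \<in> carrier H"
      "\<And>y. y \<in> carrier H \<Longrightarrow> ?\<Phi> (a y) = a' y" "\<And>y. y \<in> carrier H \<Longrightarrow> ?\<Phi> (b y) = b' y" for a b a' b' y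
  proof -
    have "a' \<in> alg_hom A H R" "b' \<in> alg_hom A H R"
      using alg_hom_cong[OF algebra_axioms alg_hom_comp[OF that(1) \<Phi>]]
        alg_hom_cong[OF algebra_axioms alg_hom_comp[OF that(2) \<Phi>]] that(4,5) by metis+
    then show ?thesis
      using hom_pt_mult[OF P assms(1) that(1,2) \<Phi> that(3)] pt_mult_cong[OF assms(1) _ _ that(3) that(4,5)] by simp
  qed
  have "?\<Phi> (pt_mult A H HHH.P (pt_mult A H HHH.P proj1 proj2) proj3 x) = pt_mult A H R (pt_mult A H R f h) k x"
    by (intro c pt_mult_hom P p assms(5) v)
  moreover have "?\<Phi> (pt_mult A H HHH.P proj1 (pt_mult A H HHH.P proj2 proj3) x) = pt_mult A H R f (pt_mult A H R h k) x"
    by (intro c pt_mult_hom P p assms(5) v)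
  ultimately show ?thesis using coassoc[OF assms(5)] coassoc_points[OF assms(5)] by simp
qed

context
  fixes R f assumes R: "algebra A R" and f: "f \<in> alg_hom A H R"
begin

interpretation RA: algebra A R by (rule R)

private lemma e: "f (counit H x \<odot>\<^bsub>H\<^esub> \<one>\<^bsub>H\<^esub>) = counit H x \<odot>\<^bsub>R\<^esub> \<one>\<^bsub>R\<^esub>" if "x \<in> carrier H" for x
  using alg_hom_closed[OF counit_hom that] by (simp add: alg_hom_simps[OF f])

text \<open>The counit axioms are the case of the identity point of \<open>H\<close>; composing them
  with \<open>f\<close> gives the general case.\<close>

lemma pt_mult_one:
  assumes "x \<in> carrier H"
  shows "pt_mult A H R (\<lambda>x. counit H x \<odot>\<^bsub>R\<^esub> \<one>\<^bsub>R\<^esub>) f x = f x"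
    and "pt_mult A H R f (\<lambda>x. counit H x \<odot>\<^bsub>R\<^esub> \<one>\<^bsub>R\<^esub>) x = f x"
proof -
  note \<Delta>x = alg_hom_closed[OF comult_hom assms]
  note E = counit_point[OF algebra_axioms]
  have "f (pt_mult A H H (\<lambda>x. counit H x \<odot>\<^bsub>H\<^esub> \<one>\<^bsub>H\<^esub>) (\<lambda>x. x) x) = f x"
    using counit_left[OF assms] counit_lift(1)[OF \<Delta>x] by (simp add: pt_mult_def)
  moreover have "pt_mult A H R (\<lambda>x. counit H x \<odot>\<^bsub>R\<^esub> \<one>\<^bsub>R\<^esub>) f x = pt_mult A H R (\<lambda>x. f (counit H x \<odot>\<^bsub>H\<^esub> \<one>\<^bsub>H\<^esub>)) f x"
    by (rule pt_mult_cong[OF R alg_hom_comp[OF E f] f assms]) (simp_all add: e)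
  ultimately show "pt_mult A H R (\<lambda>x. counit H x \<odot>\<^bsub>R\<^esub> \<one>\<^bsub>R\<^esub>) f x = f x"
    using hom_pt_mult[OF algebra_axioms R E alg_hom_id f assms] by simp
  have "f (pt_mult A H H (\<lambda>x. x) (\<lambda>x. counit H x \<odot>\<^bsub>H\<^esub> \<one>\<^bsub>H\<^esub>) x) = f x"
    using counit_right[OF assms] counit_lift(2)[OF \<Delta>x] by (simp add: pt_mult_def)
  moreover have "pt_mult A H R f (\<lambda>x. counit H x \<odot>\<^bsub>R\<^esub> \<one>\<^bsub>R\<^esub>) x = pt_mult A H R f (\<lambda>x. f (counit H x \<odot>\<^bsub>H\<^esub> \<one>\<^bsub>H\<^esub>)) x"
    by (rule pt_mult_cong[OF R f alg_hom_comp[OF E f] assms]) (simp_all add: e)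
  ultimately show "pt_mult A H R f (\<lambda>x. counit H x \<odot>\<^bsub>R\<^esub> \<one>\<^bsub>R\<^esub>) x = f x"
    using hom_pt_mult[OF algebra_axioms R alg_hom_id E f assms] by simp
qed

lemma pt_mult_inv:
  assumes "x \<in> carrier H"
  shows "pt_mult A H R (pt_inv H f) f x = counit H x \<odot>\<^bsub>R\<^esub> \<one>\<^bsub>R\<^esub>"
    and "pt_mult A H R f (pt_inv H f) x = counit H x \<odot>\<^bsub>R\<^esub> \<one>\<^bsub>R\<^esub>"
  using hom_pt_mult[OF algebra_axioms R antipode_hom alg_hom_id f assms]
    hom_pt_mult[OF algebra_axioms R alg_hom_id antipode_hom f assms]
    antipode_left[OF assms] antipode_right[OF assms] e[OF assms]
  by (simp_all add: pt_mult_def pt_pair_def pt_inv_def comp_def)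

end

lemma point_group_carrier: "f \<in> alg_hom A H R \<Longrightarrow> restrict f (carrier H) \<in> carrier (point_group A H R)"
  by (auto simp: point_group_def intro: alg_hom_cong[OF algebra_axioms])

lemma point_group_mult:
  assumes "algebra A R" "f \<in> alg_hom A H R" "h \<in> alg_hom A H R"
  shows "restrict f (carrier H) \<otimes>\<^bsub>point_group A H R\<^esub> restrict h (carrier H) = restrict (pt_mult A H R f h) (carrier H)"
  unfolding point_group_def by (auto simp: restrict_def intro!: ext pt_mult_cong[OF assms])

lemma point_group_one: "\<one>\<^bsub>point_group A H R\<^esub> = restrict (\<lambda>x. counit H x \<odot>\<^bsub>R\<^esub> \<one>\<^bsub>R\<^esub>) (carrier H)"
  by (simp add: point_group_def)

lemma point_group_elim:
  assumes "f \<in> carrier (point_group A H R)" obtains "f \<in> alg_hom A H R" "f = restrict f (carrier H)"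
  using assms by (auto simp: point_group_def extensional_restrict)

lemma restrict_eqI: "(\<And>x. x \<in> S \<Longrightarrow> f x = h x) \<Longrightarrow> restrict f S = restrict h S"
  by (auto simp: restrict_def)

text \<open>Restriction to the carrier turns agreement on the carrier into equality. Identities
  between points can then be proved by cancellation and inversion in an ordinary group.\<close>

lemma point_group:
  assumes "algebra A R" shows "group (point_group A H R)"
proof (rule groupI)
  let ?G = "point_group A H R"
  note c = counit_point[OF assms]
  show "\<one>\<^bsub>?G\<^esub> \<in> carrier ?G" using c by (simp add: point_group_one point_group_carrier)
  fix f assume "f \<in> carrier ?G"
  then have f: "f \<in> alg_hom A H R" "f = restrict f (carrier H)" by (auto elim: point_group_elim)
  show "\<one>\<^bsub>?G\<^esub> \<otimes>\<^bsub>?G\<^esub> f = f"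
    by (subst (1 2) f(2), unfold point_group_one, subst point_group_mult[OF assms c f(1)])
      (auto intro!: restrict_eqI simp: pt_mult_one[OF assms f(1)])
  have i: "pt_inv H f \<in> alg_hom A H R" by (rule pt_inv_hom[OF f(1)])
  have "restrict (pt_inv H f) (carrier H) \<otimes>\<^bsub>?G\<^esub> f = \<one>\<^bsub>?G\<^esub>"
    by (subst f(2), unfold point_group_one, subst point_group_mult[OF assms i f(1)])
      (auto intro!: restrict_eqI simp: pt_mult_inv[OF assms f(1)])
  then show "\<exists>y\<in>carrier ?G. y \<otimes>\<^bsub>?G\<^esub> f = \<one>\<^bsub>?G\<^esub>" using point_group_carrier[OF i] by blast
  fix h assume "h \<in> carrier ?G"
  then have h: "h \<in> alg_hom A H R" "h = restrict h (carrier H)" by (auto elim: point_group_elim)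
  note fh = pt_mult_hom[OF assms f(1) h(1)]
  show "f \<otimes>\<^bsub>?G\<^esub> h \<in> carrier ?G"
    by (subst f(2), subst h(2), subst point_group_mult[OF assms f(1) h(1)]) (rule point_group_carrier[OF fh])
  fix k assume "k \<in> carrier ?G"
  then have k: "k \<in> alg_hom A H R" "k = restrict k (carrier H)" by (auto elim: point_group_elim)
  note hk = pt_mult_hom[OF assms h(1) k(1)]
  show "f \<otimes>\<^bsub>?G\<^esub> h \<otimes>\<^bsub>?G\<^esub> k = f \<otimes>\<^bsub>?G\<^esub> (h \<otimes>\<^bsub>?G\<^esub> k)"
    by (subst (1 2) f(2), subst (1 2) h(2), subst (1 2) k(2))
      (simp only: point_group_mult[OF assms] f(1) h(1) k(1) fh hk,
        auto intro!: restrict_eqI simp: pt_mult_assoc[OF assms f(1) h(1) k(1)])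
qed

lemma point_group_inv:
  assumes "algebra A R" "f \<in> alg_hom A H R"
  shows "inv\<^bsub>point_group A H R\<^esub> restrict f (carrier H) = restrict (pt_inv H f) (carrier H)"
proof -
  interpret G: group "point_group A H R" by (rule point_group[OF assms(1)])
  have "restrict (pt_inv H f) (carrier H) \<otimes>\<^bsub>point_group A H R\<^esub> restrict f (carrier H) = \<one>\<^bsub>point_group A H R\<^esub>"
    unfolding point_group_mult[OF assms(1) pt_inv_hom[OF assms(2)] assms(2)] point_group_one
    by (rule restrict_eqI) (rule pt_mult_inv[OF assms])
  then show ?thesis
    using G.inv_equality point_group_carrier[OF assms(2)] point_group_carrier[OF pt_inv_hom[OF assms(2)]] by metis
qed

end

section \<open>Transport of group scheme structures\<close>

text \<open>Equal truncations say that two records, possibly of different types, have the same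
  algebra structure. Tensor products and homomorphisms depend on nothing else, so Hopf records and
  bare algebras can be exchanged in them.\<close>

lemma truncate_eqD:
  assumes "module.truncate M = module.truncate M'"
  shows "carrier M = carrier M'" "mult M = mult M'" "\<one>\<^bsub>M\<^esub> = \<one>\<^bsub>M'\<^esub>" "\<zero>\<^bsub>M\<^esub> = \<zero>\<^bsub>M'\<^esub>"
    "add M = add M'" "smult M = smult M'"
  using assms by (auto simp: module.truncate_def)

lemma truncate_extend [simp]:
  "module.truncate (module.extend M x) = module.truncate M"
  by (simp add: module.truncate_def module.extend_def)

lemma truncate_module [simp]: "module.truncate (M :: ('a, 'b) module) = M"
  by (simp add: module.truncate_def)

context
  fixes M :: "('a, 'b, 's) module_scheme" and M' :: "('a, 'b, 's1) module_scheme"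
    and N :: "('a, 'c, 't) module_scheme" and N' :: "('a, 'c, 't1) module_scheme"
  assumes M: "module.truncate M = module.truncate M'" and N: "module.truncate N = module.truncate N'"
begin

private lemmas eqs = truncate_eqD[OF M] truncate_eqD[OF N]

lemma tensor_null_fields: "tensor_null R M N = tensor_null R M' N'"
  by (simp add: tensor_null_def DirProd_def eqs)

lemma tensor_fields: "tensor R M N = tensor R M' N'"
  by (simp add: tensor_def tensor_null_fields DirProd_def eqs)

lemma pure_fields: "pure R M N = pure R M' N'"
  by (intro ext) (simp add: pure_def tensor_null_fields DirProd_def eqs)

lemma tensor_map_fields: "tensor_map R M N = tensor_map R M' N'"
  by (intro ext) (simp add: tensor_map_def tensor_fields pure_fields)

lemma alg_hom_fields: "alg_hom A M N = alg_hom A M' N'"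
  by (simp add: alg_hom_def ring_hom_def eqs)

end

lemma algebra_fields:
  assumes "module.truncate M = module.truncate M'" "algebra A M'"
  shows "algebra A M"
proof -
  interpret algebra A M' by fact
  note eqs = truncate_eqD[OF assms(1)]
  show ?thesis
    by (rule algebraI[OF R_cring cring_ring_fields_cong[OF M_cring]])
      (simp_all add: eqs smult_l_distr smult_r_distr smult_assoc1 smult_assoc2)
qed

lemma pt_mult_comorphism:
  assumes "hopf_data A H" "hopf_data A K" "p \<in> alg_hom A H K"
    and "comult K (p x) = tensor_map A K K p p (comult H x)"
    and "algebra A R" "f \<in> alg_hom A K R" "h \<in> alg_hom A K R" "x \<in> carrier H"
  shows "pt_mult A K R f h (p x) = pt_mult A H R (\<lambda>x. f (p x)) (\<lambda>x. h (p x)) x"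
proof -
  interpret H: hopf_data A H by fact
  interpret K: hopf_data A K by fact
  show ?thesis
    using H.HHH.BC.pt_pair_tensor_map[OF K.algebra_axioms K.algebra_axioms assms(5,3,3,6,7)
        alg_hom_closed[OF H.comult_hom assms(8)]] assms(4)
    by (simp add: pt_mult_def)
qed

text \<open>Every element of \<open>K\<close> is some \<open>p x\<close>, and along \<open>p\<close>
  the points of \<open>K\<close> become points of \<open>H\<close> with the same products. Each
  axiom of \<open>K\<close> at \<open>p x\<close> is therefore a group law for points of
  \<open>H\<close> at \<open>x\<close>.\<close>

lemma affine_group_scheme_surj:
  fixes H :: "('a, 'b, 's) hopf_scheme" and K :: "('a, 'c, 't) hopf_scheme"
  assumes "affine_group_scheme A H" "algebra A K" "p \<in> alg_hom A H K" "p ` carrier H = carrier K"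
    and \<Delta>: "\<And>x. x \<in> carrier H \<Longrightarrow> comult K (p x) = tensor_map A K K p p (comult H x)"
    and \<epsilon>: "\<And>x. x \<in> carrier H \<Longrightarrow> counit K (p x) = counit H x"
    and S: "\<And>x. x \<in> carrier H \<Longrightarrow> antipode K (p x) = p (antipode H x)"
  shows "affine_group_scheme A K"
proof -
  interpret H: affine_group_scheme A H by fact
  interpret K: algebra A K by fact
  note surj = alg_hom_factor_surj[OF H.algebra_axioms assms(3,4)]
  have KD: "hopf_data A K"
  proof (intro hopf_data.intro hopf_data_axioms.intro assms(2))
    show "comult K \<in> alg_hom A K (tensor A K K)"
      by (rule surj[OF alg_hom_comp[OF H.comult_hom H.HHH.BC.tensor_map_hom[OF assms(2,2,3,3)]] \<Delta>])
    show "counit K \<in> alg_hom A K (base_algebra A)"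
      by (rule surj[OF H.counit_hom \<epsilon>])
    show "antipode K \<in> alg_hom A K K"
      by (rule surj[OF alg_hom_comp[OF H.antipode_hom assms(3)] S])
  qed
  then interpret K: hopf_data A K .
  note pt = pt_mult_comorphism[OF H.hopf_data_axioms KD assms(3) \<Delta>]
  have S_p: "\<exists>x\<in>carrier H. y = p x" if "y \<in> carrier K" for y using that assms(4) by auto
  note P = K.HHH.P.algebra_axioms and pr = K.proj_hom and hp = alg_hom_comp[OF assms(3)]
  show ?thesis
  proof (rule K.affine_group_schemeI)
    fix y assume "y \<in> carrier K"
    then obtain x where x: "x \<in> carrier H" "y = p x" using S_p by blast
    let ?m = "pt_mult A H K.HHH.P" and ?q1 = "\<lambda>x. K.proj1 (p x)" and ?q2 = "\<lambda>x. K.proj2 (p x)" and ?q3 = "\<lambda>x. K.proj3 (p x)"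
    note q = hp[OF pr(1)] hp[OF pr(2)] hp[OF pr(3)]
    have "pt_mult A K K.HHH.P (pt_mult A K K.HHH.P K.proj1 K.proj2) K.proj3 y = ?m (?m ?q1 ?q2) ?q3 x"
      unfolding x(2) pt[OF x(1) P K.pt_mult_hom[OF P pr(1,2)] pr(3) x(1)]
      by (rule H.pt_mult_cong[OF P H.pt_mult_hom[OF P q(1,2)] q(3) x(1)]) (simp_all add: pt[OF _ P pr(1,2)])
    also have "\<dots> = ?m ?q1 (?m ?q2 ?q3) x" by (rule H.pt_mult_assoc[OF P q x(1)])
    also have "\<dots> = pt_mult A K K.HHH.P K.proj1 (pt_mult A K K.HHH.P K.proj2 K.proj3) y"
      unfolding x(2) pt[OF x(1) P pr(1) K.pt_mult_hom[OF P pr(2,3)] x(1)]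
      by (rule H.pt_mult_cong[OF P q(1) H.pt_mult_hom[OF P q(2,3)] x(1), symmetric]) (simp_all add: pt[OF _ P pr(2,3)])
    finally show "pt_mult A K K.HHH.P (pt_mult A K K.HHH.P K.proj1 K.proj2) K.proj3 y =
        pt_mult A K K.HHH.P K.proj1 (pt_mult A K K.HHH.P K.proj2 K.proj3) y" .
    note e = K.counit_point[OF K.algebra_axioms] and id = alg_hom_id[of A K] and S' = K.antipode_hom
    note pK = pt[OF x(1) K.algebra_axioms _ _ x(1)]
    have e_p: "counit K (p z) \<odot>\<^bsub>K\<^esub> \<one>\<^bsub>K\<^esub> = counit H z \<odot>\<^bsub>K\<^esub> \<one>\<^bsub>K\<^esub>" if "z \<in> carrier H" for z
      using that by (simp add: \<epsilon>)
    note eH = H.counit_point[OF K.algebra_axioms] and iH = H.pt_inv_hom[OF assms(3)]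
    have inv: "antipode K (p z) = pt_inv H p z" if "z \<in> carrier H" for z
      using that by (simp add: S pt_inv_def)
    show "pt_mult A K K (\<lambda>x. counit K x \<odot>\<^bsub>K\<^esub> \<one>\<^bsub>K\<^esub>) (\<lambda>x. x) y = y"
      unfolding x(2) pK[OF e id]
      using H.pt_mult_cong[OF K.algebra_axioms eH assms(3) x(1) e_p] H.pt_mult_one(1)[OF K.algebra_axioms assms(3) x(1)] by simp
    show "pt_mult A K K (\<lambda>x. x) (\<lambda>x. counit K x \<odot>\<^bsub>K\<^esub> \<one>\<^bsub>K\<^esub>) y = y"
      unfolding x(2) pK[OF id e]
      using H.pt_mult_cong[OF K.algebra_axioms assms(3) eH x(1) _ e_p] H.pt_mult_one(2)[OF K.algebra_axioms assms(3) x(1)] by simp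
    show "pt_mult A K K (antipode K) (\<lambda>x. x) y = counit K y \<odot>\<^bsub>K\<^esub> \<one>\<^bsub>K\<^esub>"
      unfolding x(2) pK[OF S' id] e_p[OF x(1)]
      using H.pt_mult_cong[OF K.algebra_axioms iH assms(3) x(1) inv] H.pt_mult_inv(1)[OF K.algebra_axioms assms(3) x(1)] by simp
    show "pt_mult A K K (\<lambda>x. x) (antipode K) y = counit K y \<odot>\<^bsub>K\<^esub> \<one>\<^bsub>K\<^esub>"
      unfolding x(2) pK[OF id S'] e_p[OF x(1)]
      using H.pt_mult_cong[OF K.algebra_axioms assms(3) iH x(1) _ inv] H.pt_mult_inv(2)[OF K.algebra_axioms assms(3) x(1)] by simp
  qed
qed

text \<open>As \<open>i\<close> respects the comultiplication, a product of two points of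
  \<open>Q\<close> may be computed in \<open>N\<close> after extending both of them along
  \<open>i\<close>.\<close>

lemma pt_mult_extend:
  assumes "hopf_data A N" "hopf_data A Q" "i \<in> alg_hom A Q N"
    and "\<forall>x\<in>carrier Q. comult N (i x) = tensor_map A N N i i (comult Q x)"
    and "algebra A R" "f \<in> alg_hom A N R" "h \<in> alg_hom A N R" "x \<in> carrier Q"
    and "\<And>x. x \<in> carrier Q \<Longrightarrow> f' x = f (i x)" "\<And>x. x \<in> carrier Q \<Longrightarrow> h' x = h (i x)"
  shows "pt_mult A Q R f' h' x = pt_mult A N R f h (i x)"
proof -
  interpret Q: hopf_data A Q by fact
  show ?thesis
    using pt_mult_comorphism[OF assms(2,1,3) bspec[OF assms(4,8)] assms(5-8)]
      Q.pt_mult_cong[OF assms(5) alg_hom_comp[OF assms(3,6)] alg_hom_comp[OF assms(3,7)] assms(8-10)] by simp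
qed

text \<open>
  With a retraction \<open>r\<close>, every point of \<open>Q\<close> extends to a point of \<open>N\<close>, although the extension need not
  be compatible with the multiplication.
\<close>

lemma affine_group_scheme_retract:
  fixes N :: "('a, 'b, 's) hopf_scheme" and Q :: "('a, 'c, 't) hopf_scheme"
  assumes "affine_group_scheme A N" "hopf_data A Q" "i \<in> alg_hom A Q N" "r \<in> alg_hom A N Q"
    and ri: "\<And>x. x \<in> carrier Q \<Longrightarrow> r (i x) = x"
    and \<Delta>: "\<And>x. x \<in> carrier Q \<Longrightarrow> comult N (i x) = tensor_map A N N i i (comult Q x)"
    and \<epsilon>: "\<And>x. x \<in> carrier Q \<Longrightarrow> counit N (i x) = counit Q x"
    and S: "\<And>x. x \<in> carrier Q \<Longrightarrow> antipode N (i x) = i (antipode Q x)"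
  shows "affine_group_scheme A Q"
proof -
  interpret N: affine_group_scheme A N by fact
  interpret Q: hopf_data A Q by fact
  have "\<forall>x\<in>carrier Q. comult N (i x) = tensor_map A N N i i (comult Q x)" using \<Delta> by blast
  note pt = pt_mult_extend[OF N.hopf_data_axioms assms(2,3) this]
  note P = Q.HHH.P.algebra_axioms and pr = Q.proj_hom and hr = alg_hom_comp[OF assms(4)]
  note q = hr[OF pr(1)] hr[OF pr(2)] hr[OF pr(3)]
  show ?thesis
  proof (rule Q.affine_group_schemeI)
    fix x assume x: "x \<in> carrier Q"
    note ix = alg_hom_closed[OF assms(3) x]
    let ?m = "pt_mult A N Q.HHH.P" and ?q1 = "\<lambda>x. Q.proj1 (r x)" and ?q2 = "\<lambda>x. Q.proj2 (r x)" and ?q3 = "\<lambda>x. Q.proj3 (r x)"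
    have "pt_mult A Q Q.HHH.P (pt_mult A Q Q.HHH.P Q.proj1 Q.proj2) Q.proj3 x = ?m (?m ?q1 ?q2) ?q3 (i x)"
      by (rule pt[OF P N.pt_mult_hom[OF P q(1,2)] q(3) x]) (rule pt[OF P q(1,2)], simp_all add: ri)
    also have "\<dots> = ?m ?q1 (?m ?q2 ?q3) (i x)" by (rule N.pt_mult_assoc[OF P q ix])
    also have "\<dots> = pt_mult A Q Q.HHH.P Q.proj1 (pt_mult A Q Q.HHH.P Q.proj2 Q.proj3) x"
      by (rule pt[OF P q(1) N.pt_mult_hom[OF P q(2,3)] x, symmetric]) (simp_all add: ri, rule pt[OF P q(2,3)], simp_all add: ri)
    finally show "pt_mult A Q Q.HHH.P (pt_mult A Q Q.HHH.P Q.proj1 Q.proj2) Q.proj3 x =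
        pt_mult A Q Q.HHH.P Q.proj1 (pt_mult A Q Q.HHH.P Q.proj2 Q.proj3) x" .
    note Qa = Q.algebra_axioms
    note e = N.counit_point[OF Qa] and inv = N.pt_inv_hom[OF assms(4)]
    have "pt_mult A Q Q (\<lambda>x. counit Q x \<odot>\<^bsub>Q\<^esub> \<one>\<^bsub>Q\<^esub>) (\<lambda>x. x) x = pt_mult A N Q (\<lambda>x. counit N x \<odot>\<^bsub>Q\<^esub> \<one>\<^bsub>Q\<^esub>) r (i x)"
      by (rule pt[OF Qa e assms(4) x]) (simp_all add: ri \<epsilon>)
    then show "pt_mult A Q Q (\<lambda>x. counit Q x \<odot>\<^bsub>Q\<^esub> \<one>\<^bsub>Q\<^esub>) (\<lambda>x. x) x = x"
      using N.pt_mult_one(1)[OF Qa assms(4) ix] ri[OF x] by simp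
    have "pt_mult A Q Q (\<lambda>x. x) (\<lambda>x. counit Q x \<odot>\<^bsub>Q\<^esub> \<one>\<^bsub>Q\<^esub>) x = pt_mult A N Q r (\<lambda>x. counit N x \<odot>\<^bsub>Q\<^esub> \<one>\<^bsub>Q\<^esub>) (i x)"
      by (rule pt[OF Qa assms(4) e x]) (simp_all add: ri \<epsilon>)
    then show "pt_mult A Q Q (\<lambda>x. x) (\<lambda>x. counit Q x \<odot>\<^bsub>Q\<^esub> \<one>\<^bsub>Q\<^esub>) x = x"
      using N.pt_mult_one(2)[OF Qa assms(4) ix] ri[OF x] by simp
    have S': "antipode Q x = pt_inv N r (i x)" if "x \<in> carrier Q" for x
      using that by (simp add: pt_inv_def S ri alg_hom_closed[OF Q.antipode_hom])
    have "pt_mult A Q Q (antipode Q) (\<lambda>x. x) x = pt_mult A N Q (pt_inv N r) r (i x)"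
      by (rule pt[OF Qa inv assms(4) x]) (simp_all add: ri S')
    then show "pt_mult A Q Q (antipode Q) (\<lambda>x. x) x = counit Q x \<odot>\<^bsub>Q\<^esub> \<one>\<^bsub>Q\<^esub>"
      using N.pt_mult_inv(1)[OF Qa assms(4) ix] by (simp add: \<epsilon>[OF x])
    have "pt_mult A Q Q (\<lambda>x. x) (antipode Q) x = pt_mult A N Q r (pt_inv N r) (i x)"
      by (rule pt[OF Qa assms(4) inv x]) (simp_all add: ri S')
    then show "pt_mult A Q Q (\<lambda>x. x) (antipode Q) x = counit Q x \<odot>\<^bsub>Q\<^esub> \<one>\<^bsub>Q\<^esub>"
      using N.pt_mult_inv(2)[OF Qa assms(4) ix] by (simp add: \<epsilon>[OF x])
  qed
qed

text \<open>In the group of \<open>K\<close>-valued points of \<open>H\<close>, both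
  \<open>antipode K \<circ> p\<close> and \<open>p \<circ> antipode H\<close> are inverse to
  \<open>p\<close>. So a homomorphism, defined by comultiplication and counit alone, respects
  antipodes.\<close>

lemma antipode_comorphism:
  fixes H :: "('a, 'b, 's) hopf_scheme" and K :: "('a, 'c, 't) hopf_scheme"
  assumes "group_scheme_hom A K H p" "x \<in> carrier H"
  shows "antipode K (p x) = p (antipode H x)"
proof -
  interpret H: affine_group_scheme A H using assms(1) by (simp add: group_scheme_hom_def)
  interpret K: affine_group_scheme A K using assms(1) by (simp add: group_scheme_hom_def)
  have p: "p \<in> alg_hom A H K" and \<Delta>: "\<And>x. x \<in> carrier H \<Longrightarrow> comult K (p x) = tensor_map A K K p p (comult H x)"
    and \<epsilon>: "\<And>x. x \<in> carrier H \<Longrightarrow> counit K (p x) = counit H x"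
    using assms(1) by (auto simp: group_scheme_hom_def)
  note Ka = K.algebra_axioms
  interpret G: group "point_group A H K" by (rule H.point_group[OF Ka])
  let ?S = "\<lambda>x. antipode K (p x)"
  have S: "?S \<in> alg_hom A H K" by (rule alg_hom_comp[OF p K.antipode_hom])
  have "restrict ?S (carrier H) \<otimes>\<^bsub>point_group A H K\<^esub> restrict p (carrier H) = \<one>\<^bsub>point_group A H K\<^esub>"
    unfolding H.point_group_mult[OF Ka S p] H.point_group_one
    using pt_mult_comorphism[OF H.hopf_data_axioms K.hopf_data_axioms p \<Delta> Ka K.antipode_hom alg_hom_id]
      K.pt_mult_inv(1)[OF Ka alg_hom_id] alg_hom_closed[OF p]
    by (auto intro!: H.restrict_eqI simp: \<epsilon> pt_inv_def comp_def)
  then have "restrict (pt_inv H p) (carrier H) = restrict ?S (carrier H)"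
    using G.inv_equality H.point_group_carrier[OF p] H.point_group_carrier[OF S] H.point_group_inv[OF Ka p] by metis
  then show ?thesis using assms(2) by (metis comp_apply pt_inv_def restrict_apply')
qed

section \<open>Closed subgroup schemes\<close>

lemma hopf_extend_sel [simp]:
  "comult (module.extend K (hopf.fields c e a)) = c"
  "counit (module.extend K (hopf.fields c e a)) = e"
  "antipode (module.extend K (hopf.fields c e a)) = a"
  by (simp_all add: module.extend_def hopf.fields_def)

lemma truncate_closed_subgroup: "module.truncate (closed_subgroup A H J) = module.truncate (quot H J)"
  by (simp only: closed_subgroup_def Let_def truncate_extend)

text \<open>The usual condition that the comultiplication maps \<open>J\<close> into
  \<open>J \<otimes> H + H \<otimes> J\<close> is replaced by vanishing in the tensor square of the
  quotient, which is exactly what the induced comultiplication requires.\<close>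

locale hopf_ideal = affine_group_scheme A H
  for A :: "('a, 'r) ring_scheme" and H :: "('a, 'b, 's) hopf_scheme" +
  fixes J
  assumes J: "ideal J H"
    and comult_J: "x \<in> J \<Longrightarrow> tensor_map A (quot H J) (quot H J) (\<lambda>x. J +>\<^bsub>H\<^esub> x) (\<lambda>x. J +>\<^bsub>H\<^esub> x) (comult H x) =
      \<zero>\<^bsub>tensor A (quot H J) (quot H J)\<^esub>"
    and counit_J: "x \<in> J \<Longrightarrow> counit H x = \<zero>\<^bsub>A\<^esub>"
    and antipode_J: "x \<in> J \<Longrightarrow> antipode H x \<in> J"
begin

abbreviation "C \<equiv> closed_subgroup A H J"
abbreviation "p \<equiv> (\<lambda>x. J +>\<^bsub>H\<^esub> x)"

sublocale B: algebra_quotient A H J by (intro algebra_quotient.intro algebra_quotient_axioms.intro algebra_axioms J)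

lemma truncate_C: "module.truncate C = module.truncate (quot H J)"
  by (rule truncate_closed_subgroup)

lemmas C_fields = truncate_eqD[OF truncate_C]

lemma C_algebra: "algebra A C"
  by (rule algebra_fields[OF truncate_C B.quot_algebra])

lemma coset_hom: "p \<in> alg_hom A H C"
  using B.coset_hom alg_hom_fields[OF refl truncate_C, of A H] by simp

lemma coset_surj: "p ` carrier H = carrier C"
  by (simp add: C_fields B.Q.quot_carrier)

lemma tensor_map_C: "tensor_map A C C = tensor_map A (quot H J) (quot H J)"
  by (rule tensor_map_fields[OF truncate_C truncate_C])

lemma closed_subgroup_sel:
  assumes "x \<in> carrier H"
  shows "comult C (p x) = tensor_map A C C p p (comult H x)"
    and "counit C (p x) = counit H x"
    and "antipode C (p x) = p (antipode H x)"
proof -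
  note h = HHH.BC.tensor_map_hom[OF B.quot_algebra B.quot_algebra B.coset_hom B.coset_hom]
  interpret QQ: tensor_algebra A "quot H J" "quot H J"
    by (rule tensor_algebra.intro) (rule B.quot_algebra)+
  have "comult C (p x) = tensor_map A (quot H J) (quot H J) p p (comult H x)"
    using B.induced_hom(2)[OF QQ.tensor_algebra alg_hom_comp[OF comult_hom h] comult_J assms]
    by (simp add: closed_subgroup_def Let_def)
  then show "comult C (p x) = tensor_map A C C p p (comult H x)" by (simp add: tensor_map_C)
  show "counit C (p x) = counit H x"
    using B.induced_hom(2)[OF algebra_base[OF R_cring] counit_hom _ assms] counit_J
    by (simp add: closed_subgroup_def Let_def)
  show "antipode C (p x) = p (antipode H x)"
    using B.induced_hom(2)[OF B.quot_algebra alg_hom_comp[OF antipode_hom B.coset_hom] _ assms] antipode_J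
      B.Q.coset_eq_zero_iff alg_hom_closed[OF antipode_hom] B.Q.H_subset
    by (simp add: closed_subgroup_def Let_def subset_iff)
qed

lemma closed_subgroup_scheme: "affine_group_scheme A C"
  by (rule affine_group_scheme_surj[OF affine_group_scheme_axioms C_algebra coset_hom coset_surj closed_subgroup_sel])

lemma closed_subgroup_induced:
  assumes "algebra A D" "f \<in> alg_hom A H D" "\<And>x. x \<in> J \<Longrightarrow> f x = \<zero>\<^bsub>D\<^esub>"
  shows "induced f \<in> alg_hom A C D" "\<And>x. x \<in> carrier H \<Longrightarrow> induced f (p x) = f x"
  using B.induced_hom[OF assms] alg_hom_fields[OF truncate_C refl, of A D] by simp_all

end

section \<open>Split extensions are semidirect products\<close>

lemma restrict_eqD: "restrict f S = restrict h S \<Longrightarrow> x \<in> S \<Longrightarrow> f x = h x"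
  by (metis restrict_apply')

text \<open>In terms of schemes, \<open>i\<close> belongs to a projection
  \<open>\<pi> : N \<rightarrow> Q\<close> and \<open>s\<close> to a section of it. The last three
  conditions say that \<open>\<pi>\<close> is trivial on \<open>T\<close>, that
  \<open>s(h) t s(h)^-1\<close> lies in \<open>T\<close>, and that \<open>x s(\<pi>(x))^-1\<close>
  lies in \<open>T\<close> for every \<open>x\<close> in \<open>N\<close>; lying in \<open>T\<close>
  means that the comorphism kills the kernel of \<open>\<iota>\<close>.\<close>

locale split_extension =
  fixes A :: "('a, 'r) ring_scheme" and N :: "('a, 'n, 's) hopf_scheme" and T :: "('a, 't, 'u) hopf_scheme"
    and Q :: "('a, 'q, 'v) hopf_scheme" and \<iota> i s
  assumes \<iota>: "group_scheme_hom A T N \<iota>" and \<iota>_surj: "\<iota> ` carrier N = carrier T"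
    and i: "group_scheme_hom A N Q i" and s: "group_scheme_hom A Q N s"
    and s_i: "y \<in> carrier Q \<Longrightarrow> s (i y) = y"
    and trivial: "y \<in> carrier Q \<Longrightarrow> \<iota> (i y) = counit Q y \<odot>\<^bsub>T\<^esub> \<one>\<^bsub>T\<^esub>"
    and normal: "x \<in> carrier N \<Longrightarrow> \<iota> x = \<zero>\<^bsub>T\<^esub> \<Longrightarrow>
      pt_mult A N (tensor A Q T) (pt_mult A N (tensor A Q T) (\<lambda>x. pure A Q T (s x) \<one>\<^bsub>T\<^esub>)
        (\<lambda>x. pure A Q T \<one>\<^bsub>Q\<^esub> (\<iota> x))) (pt_inv N (\<lambda>x. pure A Q T (s x) \<one>\<^bsub>T\<^esub>)) x = \<zero>\<^bsub>tensor A Q T\<^esub>"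
    and retract: "x \<in> carrier N \<Longrightarrow> \<iota> x = \<zero>\<^bsub>T\<^esub> \<Longrightarrow>
      pt_mult A N N (\<lambda>x. x) (pt_inv N (\<lambda>x. i (s x))) x = \<zero>\<^bsub>N\<^esub>"
begin

sublocale N: affine_group_scheme A N using \<iota> by (simp add: group_scheme_hom_def)
sublocale T: affine_group_scheme A T using \<iota> by (simp add: group_scheme_hom_def)
sublocale Q: affine_group_scheme A Q using i by (simp add: group_scheme_hom_def)
sublocale TQ: tensor_algebra A T Q by (rule tensor_algebra.intro) (rule T.algebra_axioms Q.algebra_axioms)+
sublocale QT: tensor_algebra A Q T by (rule tensor_algebra.intro) (rule T.algebra_axioms Q.algebra_axioms)+

lemma homs: "\<iota> \<in> alg_hom A N T" "i \<in> alg_hom A Q N" "s \<in> alg_hom A N Q"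
  using \<iota> i s by (auto simp: group_scheme_hom_def)

lemma counits: "x \<in> carrier N \<Longrightarrow> counit T (\<iota> x) = counit N x" "y \<in> carrier Q \<Longrightarrow> counit N (i y) = counit Q y"
    "x \<in> carrier N \<Longrightarrow> counit Q (s x) = counit N x"
  using \<iota> i s by (auto simp: group_scheme_hom_def)

lemma pt_\<iota>:
  assumes "algebra A R" "f \<in> alg_hom A T R" "h \<in> alg_hom A T R" "x \<in> carrier N"
  shows "pt_mult A T R f h (\<iota> x) = pt_mult A N R (\<lambda>x. f (\<iota> x)) (\<lambda>x. h (\<iota> x)) x"
  by (rule pt_mult_comorphism[OF N.hopf_data_axioms T.hopf_data_axioms homs(1) _ assms])
    (use \<iota> assms(4) in \<open>auto simp: group_scheme_hom_def\<close>)

lemma pt_s: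
  assumes "algebra A R" "f \<in> alg_hom A Q R" "h \<in> alg_hom A Q R" "x \<in> carrier N"
  shows "pt_mult A Q R f h (s x) = pt_mult A N R (\<lambda>x. f (s x)) (\<lambda>x. h (s x)) x"
  by (rule pt_mult_comorphism[OF N.hopf_data_axioms Q.hopf_data_axioms homs(3) _ assms])
    (use s assms(4) in \<open>auto simp: group_scheme_hom_def\<close>)

lemma pt_i:
  assumes "algebra A R" "f \<in> alg_hom A N R" "h \<in> alg_hom A N R" "y \<in> carrier Q"
  shows "pt_mult A N R f h (i y) = pt_mult A Q R (\<lambda>y. f (i y)) (\<lambda>y. h (i y)) y"
  by (rule pt_mult_comorphism[OF Q.hopf_data_axioms N.hopf_data_axioms homs(2) _ assms])
    (use i assms(4) in \<open>auto simp: group_scheme_hom_def\<close>)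

text \<open>Lets \<open>c\<close> and \<open>c'\<close> descend through the surjection
  \<open>\<iota>\<close>: two preimages of an element differ by an element of the kernel, on which
  the map vanishes.\<close>

lemma factor_\<iota>:
  assumes "algebra A R" "f \<in> alg_hom A N R" "\<And>x. x \<in> carrier N \<Longrightarrow> \<iota> x = \<zero>\<^bsub>T\<^esub> \<Longrightarrow> f x = \<zero>\<^bsub>R\<^esub>" "x \<in> carrier N"
  shows "the_elem (f ` {z \<in> carrier N. \<iota> z = \<iota> x}) = f x"
proof -
  interpret R: algebra A R by fact
  have "f z = f x" if "z \<in> carrier N" "\<iota> z = \<iota> x" for z
  proof -
    have "\<iota> (z \<ominus>\<^bsub>N\<^esub> x) = \<zero>\<^bsub>T\<^esub>"
      using alg_hom_minus[OF N.algebra_axioms T.algebra_axioms homs(1)] that assms(4)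
        alg_hom_closed[OF homs(1)] T.M.minus_eq_zero_iff by simp
    then have "f (z \<ominus>\<^bsub>N\<^esub> x) = \<zero>\<^bsub>R\<^esub>" using assms(3,4) that by simp
    then show ?thesis
      using alg_hom_minus[OF N.algebra_axioms assms(1,2)] that assms(4)
        alg_hom_closed[OF assms(2)] R.M.minus_eq_zero_iff by simp
  qed
  then have "f ` {z \<in> carrier N. \<iota> z = \<iota> x} = {f x}" using assms(4) by blast
  then show ?thesis by simp
qed

abbreviation "P \<equiv> tensor A T Q"
abbreviation "R0 \<equiv> tensor A Q T"
abbreviation "t \<equiv> \<lambda>a. pure A T Q a \<one>\<^bsub>Q\<^esub>"
abbreviation "h \<equiv> \<lambda>b. pure A T Q \<one>\<^bsub>T\<^esub> b"
abbreviation "\<alpha> \<equiv> conj_action A N T \<iota> Q s"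
abbreviation "SD \<equiv> semidirect A T Q \<alpha>"
abbreviation "br f \<equiv> restrict f (carrier N)"

sublocale PA: algebra A P by (rule TQ.tensor_algebra)
sublocale PP: tensor_algebra A P P by (rule tensor_algebra.intro) (rule PA.algebra_axioms)+

lemma th: "t \<in> alg_hom A T P" "h \<in> alg_hom A Q P"
  by (rule TQ.pure_left_hom TQ.pure_right_hom)+

abbreviation "R \<equiv> tensor A P P"
abbreviation "i1 \<equiv> \<lambda>w. pure A P P w \<one>\<^bsub>P\<^esub>"
abbreviation "i2 \<equiv> \<lambda>w. pure A P P \<one>\<^bsub>P\<^esub> w"

lemma R: "algebra A R" by (rule PP.tensor_algebra)

lemma ii: "i1 \<in> alg_hom A P R" "i2 \<in> alg_hom A P R"
  by (rule PP.pure_left_hom PP.pure_right_hom)+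

text \<open>The comorphism of \<open>(t, h) \<mapsto> t s(h)\<close> from \<open>T x Q\<close> to
  \<open>N\<close>.\<close>

definition "m = pt_mult A N P (\<lambda>x. t (\<iota> x)) (\<lambda>x. h (s x))"

lemma t\<iota>: "(\<lambda>x. t (\<iota> x)) \<in> alg_hom A N P" by (rule alg_hom_comp[OF homs(1) th(1)])
lemma hs: "(\<lambda>x. h (s x)) \<in> alg_hom A N P" by (rule alg_hom_comp[OF homs(3) th(2)])

lemma m_hom: "m \<in> alg_hom A N P"
  unfolding m_def by (rule N.pt_mult_hom[OF PA.algebra_axioms t\<iota> hs])

definition "hq = (\<lambda>x. pure A Q T (s x) \<one>\<^bsub>T\<^esub>)"
definition "tq = (\<lambda>x. pure A Q T \<one>\<^bsub>Q\<^esub> (\<iota> x))"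
definition "c = pt_mult A N R0 (pt_mult A N R0 hq tq) (pt_inv N hq)"

lemma hq: "hq \<in> alg_hom A N R0" unfolding hq_def by (rule alg_hom_comp[OF homs(3) QT.pure_left_hom])
lemma tq: "tq \<in> alg_hom A N R0" unfolding tq_def by (rule alg_hom_comp[OF homs(1) QT.pure_right_hom])

lemma c_hom: "c \<in> alg_hom A N R0"
  unfolding c_def
  by (intro N.pt_mult_hom N.pt_inv_hom QT.tensor_algebra hq tq)

lemma \<alpha>_\<iota>: "x \<in> carrier N \<Longrightarrow> \<alpha> (\<iota> x) = c x"
  unfolding conj_action_def Let_def
  using factor_\<iota>[OF QT.tensor_algebra c_hom normal[folded hq_def tq_def, folded c_def]]
  by (simp add: hq_def tq_def c_def)

lemma \<alpha>_hom: "\<alpha> \<in> alg_hom A T R0"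
  by (rule alg_hom_factor_surj[OF N.algebra_axioms homs(1) \<iota>_surj c_hom \<alpha>_\<iota>])

text \<open>Products and inverses of points are natural in the value algebra, so the universal
  conjugation \<open>c\<close> specializes to conjugation at any point \<open>(f, k)\<close> of
  \<open>Q x T\<close>.\<close>

lemma hom_c:
  assumes "algebra A D" "f \<in> alg_hom A Q D" "k \<in> alg_hom A T D" "x \<in> carrier N"
  shows "pt_pair A D f k (\<alpha> (\<iota> x)) =
    pt_mult A N D (pt_mult A N D (\<lambda>x. f (s x)) (\<lambda>x. k (\<iota> x))) (pt_inv N (\<lambda>x. f (s x))) x"
proof -
  interpret D: algebra A D by fact
  let ?K = "pt_pair A D f k"
  note K = QT.pt_pair_hom[OF assms(1-3)]
  have 1: "?K (hq z) = f (s z)" and 2: "?K (tq z) = k (\<iota> z)" if "z \<in> carrier N" for z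
    using that by (simp_all add: hq_def tq_def QT.pt_pair_pure[OF assms(1-3)] alg_hom_simps[OF assms(2)]
        alg_hom_simps[OF assms(3)] alg_hom_closed[OF homs(1)] alg_hom_closed[OF homs(3)])
  note fs = alg_hom_comp[OF homs(3) assms(2)] and kt = alg_hom_comp[OF homs(1) assms(3)]
  note hqtq = N.pt_mult_hom[OF QT.tensor_algebra hq tq]
  have 3: "?K (pt_mult A N R0 hq tq z) = pt_mult A N D (\<lambda>x. f (s x)) (\<lambda>x. k (\<iota> x)) z" if z: "z \<in> carrier N" for z
    unfolding N.hom_pt_mult[OF QT.tensor_algebra assms(1) hq tq K z]
    by (rule N.pt_mult_cong[OF assms(1) fs kt z 1 2])
  have 4: "?K (pt_inv N hq z) = pt_inv N (\<lambda>x. f (s x)) z" if z: "z \<in> carrier N" for z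
    using 1[OF alg_hom_closed[OF N.antipode_hom z]] by (simp add: pt_inv_def)
  show ?thesis
    unfolding \<alpha>_\<iota>[OF assms(4)] c_def N.hom_pt_mult[OF QT.tensor_algebra assms(1) hqtq N.pt_inv_hom[OF hq] K assms(4)]
    by (rule N.pt_mult_cong[OF assms(1) N.pt_mult_hom[OF assms(1) fs kt] N.pt_inv_hom[OF fs] assms(4) 3 4])
qed

lemma br_hom_c:
  assumes "algebra A D" "f \<in> alg_hom A Q D" "k \<in> alg_hom A T D"
  defines "G \<equiv> point_group A N D"
  shows "br (\<lambda>x. pt_pair A D f k (\<alpha> (\<iota> x))) =
    br (\<lambda>x. f (s x)) \<otimes>\<^bsub>G\<^esub> br (\<lambda>x. k (\<iota> x)) \<otimes>\<^bsub>G\<^esub> inv\<^bsub>G\<^esub> br (\<lambda>x. f (s x))"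
proof -
  note fs = alg_hom_comp[OF homs(3) assms(2)] and kt = alg_hom_comp[OF homs(1) assms(3)]
  show ?thesis
    unfolding G_def N.point_group_mult[OF assms(1) fs kt] N.point_group_inv[OF assms(1) fs]
      N.point_group_mult[OF assms(1) N.pt_mult_hom[OF assms(1) fs kt] N.pt_inv_hom[OF fs]]
    by (rule N.restrict_eqI) (rule hom_c[OF assms(1-3)])
qed

lemma hom_m:
  assumes "algebra A D" "k \<in> alg_hom A P D"
    and "\<And>a. a \<in> carrier T \<Longrightarrow> k (t a) = f a" "\<And>b. b \<in> carrier Q \<Longrightarrow> k (h b) = f' b"
  shows "br (\<lambda>x. k (m x)) = br (\<lambda>x. f (\<iota> x)) \<otimes>\<^bsub>point_group A N D\<^esub> br (\<lambda>x. f' (s x))"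
proof -
  have 1: "k (t (\<iota> x)) = f (\<iota> x)" "k (h (s x)) = f' (s x)" if "x \<in> carrier N" for x
    using assms(3,4) alg_hom_closed[OF homs(1) that] alg_hom_closed[OF homs(3) that] by auto
  note kt = alg_hom_comp[OF t\<iota> assms(2)] and kh = alg_hom_comp[OF hs assms(2)]
  have "br (\<lambda>x. f (\<iota> x)) = br (\<lambda>x. k (t (\<iota> x)))" "br (\<lambda>x. f' (s x)) = br (\<lambda>x. k (h (s x)))"
    by (rule N.restrict_eqI, simp add: 1)+
  then show ?thesis
    by (simp only: N.point_group_mult[OF assms(1) kt kh])
      (rule N.restrict_eqI, simp only: m_def, rule N.hom_pt_mult[OF PA.algebra_axioms assms(1) t\<iota> hs assms(2)])
qed

lemma truncate_SD: "module.truncate SD = module.truncate P"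
  by (simp only: semidirect_def Let_def truncate_extend)

lemmas SD_fields = truncate_eqD[OF truncate_SD]

lemma SD_tensor_map: "tensor_map A SD SD = tensor_map A P P"
  by (rule tensor_map_fields[OF truncate_SD truncate_SD])

lemma comult_SD: "comult SD = pt_pair A R
    (pt_mult A T R (\<lambda>a. i1 (t a)) (pt_pair A R (\<lambda>b. i1 (h b)) (\<lambda>a. i2 (t a)) \<circ> \<alpha>))
    (pt_mult A Q R (\<lambda>b. i1 (h b)) (\<lambda>b. i2 (h b)))"
  and counit_SD: "counit SD = pt_pair A (base_algebra A) (counit T) (counit Q)"
  and antipode_SD: "antipode SD = pt_pair A P (pt_pair A P (pt_inv Q h) (pt_inv T t) \<circ> \<alpha>) (pt_inv Q h)"
  by (simp_all only: semidirect_def Let_def hopf_extend_sel)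

text \<open>This says that \<open>(t, h) \<mapsto> t s(h)\<close> is multiplicative. It is verified
  at the universal pair of points of \<open>T x Q\<close>, where both sides are products of four
  elements \<open>a1\<close>, \<open>b1\<close>, \<open>a2\<close>, \<open>b2\<close> of one
  group.\<close>

lemma comult_SD_m:
  assumes x: "x \<in> carrier N"
  shows "comult SD (m x) = tensor_map A P P m m (comult N x)"
proof -
  note t1 = alg_hom_comp[OF th(1) ii(1)] and t2 = alg_hom_comp[OF th(1) ii(2)]
    and h1 = alg_hom_comp[OF th(2) ii(1)] and h2 = alg_hom_comp[OF th(2) ii(2)]
  interpret R: algebra A R by (rule R)
  note k = QT.pt_pair_hom[OF R h1 t2]
  define F where "F = pt_mult A T R (\<lambda>a. i1 (t a)) (\<lambda>a. pt_pair A R (\<lambda>b. i1 (h b)) (\<lambda>a. i2 (t a)) (\<alpha> a))"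
  define E where "E = pt_mult A Q R (\<lambda>b. i1 (h b)) (\<lambda>b. i2 (h b))"
  note k\<alpha> = alg_hom_comp[OF \<alpha>_hom k]
  have F: "F \<in> alg_hom A T R" unfolding F_def by (rule T.pt_mult_hom[OF R t1 k\<alpha>])
  have E: "E \<in> alg_hom A Q R" unfolding E_def by (rule Q.pt_mult_hom[OF R h1 h2])
  let ?G = "point_group A N R"
  interpret G: group ?G by (rule N.point_group[OF R])
  have eq: "comult SD = pt_pair A R F E" by (simp add: comult_SD F_def E_def comp_def)
  have FE: "\<And>a. a \<in> carrier T \<Longrightarrow> pt_pair A R F E (t a) = F a" "\<And>b. b \<in> carrier Q \<Longrightarrow> pt_pair A R F E (h b) = E b"
    by (simp_all add: TQ.pt_pair_pure[OF R F E] alg_hom_simps[OF F] alg_hom_simps[OF E])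
  have l: "br (\<lambda>x. comult SD (m x)) = br (\<lambda>x. F (\<iota> x)) \<otimes>\<^bsub>?G\<^esub> br (\<lambda>x. E (s x))"
    unfolding eq by (rule hom_m[OF R TQ.pt_pair_hom[OF R F E]]) (simp_all add: FE)
  define a1 b1 a2 b2 where ab: "a1 = br (\<lambda>x. i1 (t (\<iota> x)))" "b1 = br (\<lambda>x. i1 (h (s x)))"
    "a2 = br (\<lambda>x. i2 (t (\<iota> x)))" "b2 = br (\<lambda>x. i2 (h (s x)))"
  note c1 = alg_hom_comp[OF t\<iota> ii(1)] and d1 = alg_hom_comp[OF hs ii(1)]
    and c2 = alg_hom_comp[OF t\<iota> ii(2)] and d2 = alg_hom_comp[OF hs ii(2)]
  have cl: "a1 \<in> carrier ?G" "b1 \<in> carrier ?G" "a2 \<in> carrier ?G" "b2 \<in> carrier ?G"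
    unfolding ab by (rule N.point_group_carrier c1 d1 c2 d2)+
  note ka = alg_hom_comp[OF homs(1) k\<alpha>]
  have "br (\<lambda>x. F (\<iota> x)) = a1 \<otimes>\<^bsub>?G\<^esub> br (\<lambda>x. pt_pair A R (\<lambda>b. i1 (h b)) (\<lambda>a. i2 (t a)) (\<alpha> (\<iota> x)))"
    unfolding ab N.point_group_mult[OF R c1 ka]
    by (rule N.restrict_eqI) (simp only: F_def pt_\<iota>[OF R t1 k\<alpha>])
  also have "\<dots> = a1 \<otimes>\<^bsub>?G\<^esub> (b1 \<otimes>\<^bsub>?G\<^esub> a2 \<otimes>\<^bsub>?G\<^esub> inv\<^bsub>?G\<^esub> b1)"
    unfolding br_hom_c[OF R h1 t2] ab ..
  finally have F': "br (\<lambda>x. F (\<iota> x)) = a1 \<otimes>\<^bsub>?G\<^esub> (b1 \<otimes>\<^bsub>?G\<^esub> a2 \<otimes>\<^bsub>?G\<^esub> inv\<^bsub>?G\<^esub> b1)" .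
  have E': "br (\<lambda>x. E (s x)) = b1 \<otimes>\<^bsub>?G\<^esub> b2"
    unfolding ab N.point_group_mult[OF R d1 d2]
    by (rule N.restrict_eqI) (simp only: E_def pt_s[OF R h1 h2])
  \<comment> \<open>The inverse left by the action cancels against the next factor:
    \<open>a1 (b1 a2 b1^-1) (b1 b2) = (a1 b1) (a2 b2)\<close>.\<close>
  have "br (\<lambda>x. comult SD (m x)) = (a1 \<otimes>\<^bsub>?G\<^esub> b1) \<otimes>\<^bsub>?G\<^esub> (a2 \<otimes>\<^bsub>?G\<^esub> b2)"
    unfolding l F' E' using cl by (simp add: G.m_assoc G.inv_solve_left' flip: G.m_assoc[of "inv\<^bsub>?G\<^esub> b1" b1 b2])
  also have "\<dots> = br (\<lambda>x. i1 (m x)) \<otimes>\<^bsub>?G\<^esub> br (\<lambda>x. i2 (m x))"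
    unfolding ab hom_m[OF R ii(1) refl refl] hom_m[OF R ii(2) refl refl] ..
  also have "\<dots> = br (\<lambda>x. tensor_map A P P m m (comult N x))"
    unfolding N.point_group_mult[OF R alg_hom_comp[OF m_hom ii(1)] alg_hom_comp[OF m_hom ii(2)]]
    by (rule N.restrict_eqI)
      (simp only: pt_mult_def comp_def N.HHH.BC.tensor_map_pt_pair[OF PA.algebra_axioms PA.algebra_axioms m_hom m_hom]
        alg_hom_closed[OF N.comult_hom])
  finally show ?thesis by (rule restrict_eqD[OF _ x])
qed

lemma counit_SD_m:
  assumes x: "x \<in> carrier N"
  shows "counit SD (m x) = counit N x"
proof -
  note B = algebra_base[OF N.R_cring]
  interpret B: algebra A "base_algebra A" by (rule B)
  note e = TQ.pt_pair_hom[OF B T.counit_hom Q.counit_hom]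
  have E: "\<And>a. a \<in> carrier T \<Longrightarrow> pt_pair A (base_algebra A) (counit T) (counit Q) (t a) = counit T a"
    "\<And>b. b \<in> carrier Q \<Longrightarrow> pt_pair A (base_algebra A) (counit T) (counit Q) (h b) = counit Q b"
    using alg_hom_simps[OF T.counit_hom] alg_hom_simps[OF Q.counit_hom]
    by (simp_all add: TQ.pt_pair_pure[OF B T.counit_hom Q.counit_hom])
  have "br (\<lambda>x. counit SD (m x)) = br (\<lambda>x. counit T (\<iota> x)) \<otimes>\<^bsub>point_group A N (base_algebra A)\<^esub> br (\<lambda>x. counit Q (s x))"
    unfolding counit_SD by (rule hom_m[OF B e]) (simp_all add: E)
  also have "\<dots> = br (counit N) \<otimes>\<^bsub>point_group A N (base_algebra A)\<^esub> br (counit N)"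
    by (intro arg_cong2[of _ _ _ _ "\<lambda>x y. x \<otimes>\<^bsub>point_group A N (base_algebra A)\<^esub> y"] N.restrict_eqI) (simp_all add: counits)
  also have "br (counit N) = \<one>\<^bsub>point_group A N (base_algebra A)\<^esub>"
    unfolding N.point_group_one by (rule N.restrict_eqI) (use alg_hom_closed[OF N.counit_hom] in simp)
  finally have "br (\<lambda>x. counit SD (m x)) = br (counit N)"
    using N.point_group_carrier[OF N.counit_hom] group.is_monoid[OF N.point_group[OF B]] monoid.l_one
      \<open>br (counit N) = \<one>\<^bsub>point_group A N (base_algebra A)\<^esub>\<close> by metis
  then show ?thesis by (rule restrict_eqD[OF _ x])
qed

lemma antipode_SD_m:
  assumes x: "x \<in> carrier N"
  shows "antipode SD (m x) = m (antipode N x)"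
proof -
  note PA = PA.algebra_axioms
  note hi = Q.pt_inv_hom[OF th(2)] and ti = T.pt_inv_hom[OF th(1)]
  note k = QT.pt_pair_hom[OF PA hi ti]
  define F where "F = (pt_pair A P (pt_inv Q h) (pt_inv T t) \<circ> \<alpha>)"
  have F: "F \<in> alg_hom A T P" unfolding F_def comp_def by (rule alg_hom_comp[OF \<alpha>_hom k])
  let ?G = "point_group A N P"
  interpret G: group ?G by (rule N.point_group[OF PA])
  have FE: "\<And>a. a \<in> carrier T \<Longrightarrow> pt_pair A P F (pt_inv Q h) (t a) = F a"
    "\<And>b. b \<in> carrier Q \<Longrightarrow> pt_pair A P F (pt_inv Q h) (h b) = pt_inv Q h b"
    by (simp_all add: TQ.pt_pair_pure[OF PA F hi] alg_hom_simps[OF F] alg_hom_simps[OF hi])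
  define a b where ab: "a = br (\<lambda>x. t (\<iota> x))" "b = br (\<lambda>x. h (s x))"
  have cl: "a \<in> carrier ?G" "b \<in> carrier ?G"
    unfolding ab by (rule N.point_group_carrier t\<iota> hs)+
  have bi: "br (\<lambda>x. pt_inv Q h (s x)) = inv\<^bsub>?G\<^esub> b"
    unfolding ab N.point_group_inv[OF PA hs]
    by (rule N.restrict_eqI) (simp add: pt_inv_def antipode_comorphism[OF s])
  have ai: "br (\<lambda>x. pt_inv T t (\<iota> x)) = inv\<^bsub>?G\<^esub> a"
    unfolding ab N.point_group_inv[OF PA t\<iota>]
    by (rule N.restrict_eqI) (simp add: pt_inv_def antipode_comorphism[OF \<iota>])
  have mab: "br m = a \<otimes>\<^bsub>?G\<^esub> b"
    unfolding ab using hom_m[OF PA alg_hom_id refl refl] by simp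
  have "br (\<lambda>x. antipode SD (m x)) = br (\<lambda>x. F (\<iota> x)) \<otimes>\<^bsub>?G\<^esub> br (\<lambda>x. pt_inv Q h (s x))"
    unfolding antipode_SD F_def[symmetric] by (rule hom_m[OF PA TQ.pt_pair_hom[OF PA F hi]]) (simp_all add: FE)
  also have "br (\<lambda>x. F (\<iota> x)) = inv\<^bsub>?G\<^esub> b \<otimes>\<^bsub>?G\<^esub> inv\<^bsub>?G\<^esub> a \<otimes>\<^bsub>?G\<^esub> inv\<^bsub>?G\<^esub> (inv\<^bsub>?G\<^esub> b)"
    unfolding F_def comp_def br_hom_c[OF PA hi ti] bi ai ..
  \<comment> \<open>The action of \<open>h^-1\<close> leaves a trailing \<open>b\<close>, which the
    second component removes: \<open>(b^-1 a^-1 b) b^-1 = (a b)^-1\<close>.\<close>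
  also have "\<dots> \<otimes>\<^bsub>?G\<^esub> br (\<lambda>x. pt_inv Q h (s x)) = inv\<^bsub>?G\<^esub> (a \<otimes>\<^bsub>?G\<^esub> b)"
    unfolding bi using cl by (simp add: G.m_assoc G.inv_mult_group)
  also have "\<dots> = br (\<lambda>x. m (antipode N x))"
    unfolding mab[symmetric] N.point_group_inv[OF PA m_hom] by (simp add: pt_inv_def comp_def)
  finally show ?thesis by (rule restrict_eqD[OF _ x])
qed

text \<open>\<open>c'\<close> is the comorphism of \<open>x \<mapsto> x s(\<pi>(x))^-1\<close>, and
  \<open>\<tau>\<close> is its factorization through \<open>T\<close>, possible by
  \<open>retract\<close>. Thus \<open>n\<close> belongs to
  \<open>x \<mapsto> (x s(\<pi>(x))^-1, \<pi>(x))\<close>, the inverse of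
  \<open>(t, h) \<mapsto> t s(h)\<close>.\<close>

definition "c' = pt_mult A N N (\<lambda>x. x) (pt_inv N (\<lambda>x. i (s x)))"
definition "\<tau> a = the_elem (c' ` {z \<in> carrier N. \<iota> z = a})"
definition "n = pt_pair A N \<tau> i"

lemma is_hom: "(\<lambda>x. i (s x)) \<in> alg_hom A N N"
  by (rule alg_hom_comp[OF homs(3,2)])

lemma c'_hom: "c' \<in> alg_hom A N N"
  unfolding c'_def by (rule N.pt_mult_hom[OF N.algebra_axioms alg_hom_id N.pt_inv_hom[OF is_hom]])

lemma \<tau>_\<iota>: "x \<in> carrier N \<Longrightarrow> \<tau> (\<iota> x) = c' x"
  unfolding \<tau>_def by (rule factor_\<iota>[OF N.algebra_axioms c'_hom retract[folded c'_def]])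

lemma \<tau>_hom: "\<tau> \<in> alg_hom A T N"
  by (rule alg_hom_factor_surj[OF N.algebra_axioms homs(1) \<iota>_surj c'_hom \<tau>_\<iota>])

lemma n_hom: "n \<in> alg_hom A P N"
  unfolding n_def by (rule TQ.pt_pair_hom[OF N.algebra_axioms \<tau>_hom homs(2)])

lemma n_th: "a \<in> carrier T \<Longrightarrow> n (t a) = \<tau> a" "b \<in> carrier Q \<Longrightarrow> n (h b) = i b"
  by (simp_all add: n_def TQ.pt_pair_pure[OF N.algebra_axioms \<tau>_hom homs(2)] alg_hom_simps[OF \<tau>_hom] alg_hom_simps[OF homs(2)])

lemma br_c': "br c' = br (\<lambda>x. x) \<otimes>\<^bsub>point_group A N N\<^esub> inv\<^bsub>point_group A N N\<^esub> br (\<lambda>x. i (s x))"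
  unfolding N.point_group_inv[OF N.algebra_axioms is_hom]
    N.point_group_mult[OF N.algebra_axioms alg_hom_id N.pt_inv_hom[OF is_hom]] c'_def ..

lemma n_m:
  assumes "x \<in> carrier N" shows "n (m x) = x"
proof -
  let ?G = "point_group A N N"
  interpret G: group ?G by (rule N.point_group[OF N.algebra_axioms])
  have cl: "br (\<lambda>x. x) \<in> carrier ?G" "br (\<lambda>x. i (s x)) \<in> carrier ?G"
    by (rule N.point_group_carrier alg_hom_id is_hom)+
  have "br (\<lambda>x. n (m x)) = br (\<lambda>x. \<tau> (\<iota> x)) \<otimes>\<^bsub>?G\<^esub> br (\<lambda>x. i (s x))"
    by (rule hom_m[OF N.algebra_axioms n_hom n_th])
  also have "br (\<lambda>x. \<tau> (\<iota> x)) = br c'" by (rule N.restrict_eqI) (rule \<tau>_\<iota>)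
  also have "br c' \<otimes>\<^bsub>?G\<^esub> br (\<lambda>x. i (s x)) = br (\<lambda>x. x)"
    unfolding br_c' using cl by (simp add: G.m_assoc)
  finally show ?thesis by (rule restrict_eqD[OF _ assms])
qed

text \<open>The identity \<open>\<pi>(t s(h)) = h\<close>: the factor \<open>t\<close> becomes
  trivial in \<open>Q\<close>, and \<open>s\<close> is a section.\<close>

lemma m_i:
  assumes "y \<in> carrier Q" shows "m (i y) = h y"
proof -
  note PA = PA.algebra_axioms
  have "m (i y) = pt_mult A Q P (\<lambda>y. t (\<iota> (i y))) (\<lambda>y. h (s (i y))) y"
    unfolding m_def by (rule pt_i[OF PA t\<iota> hs assms])
  also have "\<dots> = pt_mult A Q P (\<lambda>x. counit Q x \<odot>\<^bsub>P\<^esub> \<one>\<^bsub>P\<^esub>) h y"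
    by (rule Q.pt_mult_cong[OF PA Q.counit_point[OF PA] th(2) assms])
      (use alg_hom_closed[OF Q.counit_hom] in \<open>simp_all add: trivial s_i alg_hom_simps[OF th(1)]\<close>)
  also have "\<dots> = h y" by (rule Q.pt_mult_one(1)[OF PA th(2) assms])
  finally show ?thesis .
qed

text \<open>The identity \<open>(t s(h)) s(h)^-1 = t\<close>; that the projection of
  \<open>t s(h)\<close> is \<open>h\<close> is supplied by \<open>m_i\<close>.\<close>

lemma m_\<tau>:
  assumes "x \<in> carrier N" shows "m (\<tau> (\<iota> x)) = t (\<iota> x)"
proof -
  note PA = PA.algebra_axioms
  let ?G = "point_group A N P"
  interpret G: group ?G by (rule N.point_group[OF PA])
  have cl: "br (\<lambda>x. t (\<iota> x)) \<in> carrier ?G" "br (\<lambda>x. h (s x)) \<in> carrier ?G"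
    by (rule N.point_group_carrier t\<iota> hs)+
  have mab: "br m = br (\<lambda>x. t (\<iota> x)) \<otimes>\<^bsub>?G\<^esub> br (\<lambda>x. h (s x))"
    using hom_m[OF PA alg_hom_id refl refl] by simp
  have mi: "m (pt_inv N (\<lambda>x. i (s x)) z) = pt_inv N (\<lambda>x. h (s x)) z" if "z \<in> carrier N" for z
    using m_i alg_hom_closed[OF homs(3) alg_hom_closed[OF N.antipode_hom that]] by (simp add: pt_inv_def)
  have "br (\<lambda>x. m (c' x)) = br (pt_mult A N P m (pt_inv N (\<lambda>x. h (s x))))"
    by (rule N.restrict_eqI)
      (simp add: c'_def N.hom_pt_mult[OF N.algebra_axioms PA alg_hom_id N.pt_inv_hom[OF is_hom] m_hom]
        N.pt_mult_cong[OF PA m_hom N.pt_inv_hom[OF hs] _ refl mi])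
  also have "\<dots> = br m \<otimes>\<^bsub>?G\<^esub> inv\<^bsub>?G\<^esub> br (\<lambda>x. h (s x))"
    unfolding N.point_group_inv[OF PA hs] N.point_group_mult[OF PA m_hom N.pt_inv_hom[OF hs]] ..
  also have "\<dots> = br (\<lambda>x. t (\<iota> x))"
    unfolding mab using cl by (simp add: G.m_assoc)
  finally show ?thesis unfolding \<tau>_\<iota>[OF assms] by (rule restrict_eqD[OF _ assms])
qed

lemma m_n:
  assumes "w \<in> carrier P" shows "m (n w) = w"
proof (rule TQ.alg_hom_tensor_ext[OF alg_hom_comp[OF n_hom m_hom] alg_hom_id _ _ assms])
  show "m (n (t a)) = t a" if a: "a \<in> carrier T" for a
  proof -
    obtain x where "x \<in> carrier N" "a = \<iota> x" using a \<iota>_surj by auto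
    then show ?thesis using n_th(1)[OF a] m_\<tau> by simp
  qed
  show "m (n (h b)) = h b" if "b \<in> carrier Q" for b
    using n_th(2)[OF that] m_i[OF that] by simp
qed

text \<open>The group axioms of the semidirect product need no separate verification:
  \<open>m\<close> is a surjection from the coordinate ring of \<open>N\<close> compatible with the
  structure maps, so the axioms are inherited from \<open>N\<close>. Compatibility of
  \<open>n\<close> follows because \<open>n\<close> is inverse to \<open>m\<close>.\<close>

theorem semidirect_iso: "group_scheme_iso A N SD n"
proof -
  have bij: "bij_betw n (carrier P) (carrier N)"
    by (rule bij_betw_byWitness[of _ m])
      (use n_m m_n alg_hom_closed[OF n_hom] alg_hom_closed[OF m_hom] in auto)
  have m_surj: "m ` carrier N = carrier SD"
    unfolding SD_fields using m_n alg_hom_closed[OF n_hom] alg_hom_closed[OF m_hom] by (auto simp: image_iff)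
  have m_SD: "m \<in> alg_hom A N SD" using m_hom alg_hom_fields[OF refl truncate_SD, of A N] by simp
  have SD: "affine_group_scheme A SD"
    by (rule affine_group_scheme_surj[OF N.affine_group_scheme_axioms algebra_fields[OF truncate_SD PA.algebra_axioms]
          m_SD m_surj])
      (simp_all add: SD_tensor_map comult_SD_m counit_SD_m antipode_SD_m)
  have n_SD: "n \<in> alg_hom A SD N" using n_hom alg_hom_fields[OF truncate_SD refl, of A N] by simp
  have "comult N (n w) = tensor_map A N N n n (comult SD w) \<and> counit N (n w) = counit SD w" if w: "w \<in> carrier SD" for w
  proof -
    have w': "w \<in> carrier P" using w SD_fields by simp
    note x = alg_hom_closed[OF n_hom w']
    note mm = N.HHH.BC.tensor_map_hom[OF PA.algebra_axioms PA.algebra_axioms m_hom m_hom]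
    note nn = PP.tensor_map_hom[OF N.algebra_axioms N.algebra_axioms n_hom n_hom]
    have "tensor_map A N N n n (tensor_map A P P m m v) = v" if "v \<in> carrier (tensor A N N)" for v
      by (rule N.HHH.BC.lin_map_ext[OF alg_hom_lin[OF alg_hom_comp[OF mm nn]] lin_map_id _ that])
        (simp add: N.HHH.BC.tensor_map_pure_hom[OF PA.algebra_axioms PA.algebra_axioms m_hom m_hom]
          PP.tensor_map_pure_hom[OF N.algebra_axioms N.algebra_axioms n_hom n_hom] alg_hom_closed[OF m_hom] n_m)
    then show ?thesis
      using comult_SD_m[OF x] counit_SD_m[OF x] m_n[OF w'] alg_hom_closed[OF N.comult_hom x] by simp
  qed
  then show ?thesis
    unfolding group_scheme_iso_def group_scheme_hom_def
    using N.affine_group_scheme_axioms SD n_SD bij SD_fields by simp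
qed

end

section \<open>Matrices over commutative rings\<close>

fun mat_mult :: "('b, 's) ring_scheme \<Rightarrow> (coord \<Rightarrow> 'b) \<Rightarrow> (coord \<Rightarrow> 'b) \<Rightarrow> coord \<Rightarrow> 'b"
  where
    "mat_mult R x y X11 = (x X11 \<otimes>\<^bsub>R\<^esub> y X11) \<oplus>\<^bsub>R\<^esub> (x X12 \<otimes>\<^bsub>R\<^esub> y X21)"
  | "mat_mult R x y X12 = (x X11 \<otimes>\<^bsub>R\<^esub> y X12) \<oplus>\<^bsub>R\<^esub> (x X12 \<otimes>\<^bsub>R\<^esub> y X22)"
  | "mat_mult R x y X21 = (x X21 \<otimes>\<^bsub>R\<^esub> y X11) \<oplus>\<^bsub>R\<^esub> (x X22 \<otimes>\<^bsub>R\<^esub> y X21)"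
  | "mat_mult R x y X22 = (x X21 \<otimes>\<^bsub>R\<^esub> y X12) \<oplus>\<^bsub>R\<^esub> (x X22 \<otimes>\<^bsub>R\<^esub> y X22)"
  | "mat_mult R x y Dinv = x Dinv \<otimes>\<^bsub>R\<^esub> y Dinv"

fun det_inv :: "('b, 's) ring_scheme \<Rightarrow> matrix_group \<Rightarrow> (coord \<Rightarrow> 'b) \<Rightarrow> 'b"
  where
    "det_inv R GL2 x = x Dinv"
  | "det_inv R SL2 x = \<one>\<^bsub>R\<^esub>"

fun mat_inv :: "('b, 's) ring_scheme \<Rightarrow> matrix_group \<Rightarrow> (coord \<Rightarrow> 'b) \<Rightarrow> coord \<Rightarrow> 'b"
  where
    "mat_inv R g x X11 = det_inv R g x \<otimes>\<^bsub>R\<^esub> x X22"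
  | "mat_inv R g x X12 = \<ominus>\<^bsub>R\<^esub> (det_inv R g x \<otimes>\<^bsub>R\<^esub> x X12)"
  | "mat_inv R g x X21 = \<ominus>\<^bsub>R\<^esub> (det_inv R g x \<otimes>\<^bsub>R\<^esub> x X21)"
  | "mat_inv R g x X22 = det_inv R g x \<otimes>\<^bsub>R\<^esub> x X11"
  | "mat_inv R g x Dinv = det2 R x"

text \<open>The \<open>R\<close>-points of the group. An entry counts only if its index lies in
  \<open>coords g\<close>, so for \<open>SL2\<close> the value at \<open>Dinv\<close> is arbitrary
  and matrices are compared on \<open>coords g\<close> only.\<close>

definition matrix_point :: "('b, 's) ring_scheme \<Rightarrow> matrix_group \<Rightarrow> (coord \<Rightarrow> 'b) \<Rightarrow> bool"
  where "matrix_point R g x \<longleftrightarrow> x \<in> coords g \<rightarrow> carrier R \<and> det2 R x \<otimes>\<^bsub>R\<^esub> det_inv R g x = \<one>\<^bsub>R\<^esub>"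

definition diagonal :: "('b, 's) ring_scheme \<Rightarrow> (coord \<Rightarrow> 'b) \<Rightarrow> bool"
  where "diagonal R x \<longleftrightarrow> x X12 = \<zero>\<^bsub>R\<^esub> \<and> x X21 = \<zero>\<^bsub>R\<^esub>"

text \<open>The equations of the product ideal, one for each pair of generators. Over a ring with
  nontrivial idempotents they are weaker than being diagonal or antidiagonal.\<close>

definition monomial :: "('b, 's) ring_scheme \<Rightarrow> (coord \<Rightarrow> 'b) \<Rightarrow> bool"
  where "monomial R x \<longleftrightarrow> x X12 \<otimes>\<^bsub>R\<^esub> x X11 = \<zero>\<^bsub>R\<^esub> \<and> x X12 \<otimes>\<^bsub>R\<^esub> x X22 = \<zero>\<^bsub>R\<^esub> \<and>
    x X21 \<otimes>\<^bsub>R\<^esub> x X11 = \<zero>\<^bsub>R\<^esub> \<and> x X21 \<otimes>\<^bsub>R\<^esub> x X22 = \<zero>\<^bsub>R\<^esub>"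

lemma coords_entries [simp]: "X11 \<in> coords g" "X12 \<in> coords g" "X21 \<in> coords g" "X22 \<in> coords g"
  by (cases g; simp)+

lemma coords_cases:
  assumes "v \<in> coords g" and "v = X11 \<Longrightarrow> P" "v = X12 \<Longrightarrow> P" "v = X21 \<Longrightarrow> P" "v = X22 \<Longrightarrow> P"
    and "g = GL2 \<Longrightarrow> v = Dinv \<Longrightarrow> P"
  shows P
  using assms by (cases g; cases v) auto

lemma matrix_pointD:
  assumes "matrix_point R g x"
  shows "v \<in> coords g \<Longrightarrow> x v \<in> carrier R" "x X11 \<in> carrier R" "x X12 \<in> carrier R" "x X21 \<in> carrier R"
    "x X22 \<in> carrier R" "g = GL2 \<Longrightarrow> x Dinv \<in> carrier R" "det2 R x \<otimes>\<^bsub>R\<^esub> det_inv R g x = \<one>\<^bsub>R\<^esub>"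
  using assms coords_entries[of g] by (auto simp: matrix_point_def Pi_iff)

context cring
begin

lemma det_inv_closed_Pi: "x \<in> coords g \<rightarrow> carrier R \<Longrightarrow> det_inv R g x \<in> carrier R"
  by (cases g) auto

lemma det_inv_closed: "matrix_point R g x \<Longrightarrow> det_inv R g x \<in> carrier R"
  using matrix_pointD(6)[of R g x] by (cases g) auto

lemma det2_closed: "matrix_point R g x \<Longrightarrow> det2 R x \<in> carrier R"
  using matrix_pointD[of R g x] by (simp add: det2_def)

lemmas ring_expand = minus_eq l_distr r_distr l_minus r_minus minus_add minus_minus m_ac

text \<open>The ordered rewriting by \<open>m_ac\<close> makes the factors of a null product adjacent, in either order.\<close>

lemma null_product:
  assumes "x \<otimes> y = \<zero>" "x \<in> carrier R" "y \<in> carrier R"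
  shows "y \<otimes> x = \<zero>" "w \<in> carrier R \<Longrightarrow> x \<otimes> (y \<otimes> w) = \<zero>" "w \<in> carrier R \<Longrightarrow> y \<otimes> (x \<otimes> w) = \<zero>"
  using assms by (simp_all add: m_comm[of y x] m_lcomm[of y x] flip: m_assoc)

context
  fixes a11 a12 a21 a22 b11 b12 b21 b22 d e
  assumes a: "a11 \<in> carrier R" "a12 \<in> carrier R" "a21 \<in> carrier R" "a22 \<in> carrier R"
    and b: "b11 \<in> carrier R" "b12 \<in> carrier R" "b21 \<in> carrier R" "b22 \<in> carrier R"
    and d: "d \<in> carrier R" and e: "e \<in> carrier R"
begin

text \<open>\<open>d\<close> and \<open>e\<close> stand for the inverse determinants. They stay
  free, so that one identity serves \<open>GL2\<close> and \<open>SL2\<close>.\<close>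

lemma det_mult_identity:
  "((a11 \<otimes> b11 \<oplus> a12 \<otimes> b21) \<otimes> (a21 \<otimes> b12 \<oplus> a22 \<otimes> b22) \<ominus> (a11 \<otimes> b12 \<oplus> a12 \<otimes> b22) \<otimes> (a21 \<otimes> b11 \<oplus> a22 \<otimes> b21)) \<otimes> (d \<otimes> e) =
   ((a11 \<otimes> a22 \<ominus> a12 \<otimes> a21) \<otimes> d) \<otimes> ((b11 \<otimes> b22 \<ominus> b12 \<otimes> b21) \<otimes> e)"
  using a b d e by algebra

lemma det_inv_identity:
  "((d \<otimes> a22) \<otimes> (d \<otimes> a11) \<ominus> (\<ominus> (d \<otimes> a12)) \<otimes> (\<ominus> (d \<otimes> a21))) \<otimes> e =
   ((a11 \<otimes> a22 \<ominus> a12 \<otimes> a21) \<otimes> d) \<otimes> (d \<otimes> e)"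
  using a b d e by algebra

lemma inv_left_identities:
  "(d \<otimes> a22) \<otimes> a11 \<oplus> (\<ominus> (d \<otimes> a12)) \<otimes> a21 = (a11 \<otimes> a22 \<ominus> a12 \<otimes> a21) \<otimes> d"
  "(d \<otimes> a22) \<otimes> a12 \<oplus> (\<ominus> (d \<otimes> a12)) \<otimes> a22 = \<zero>"
  "(\<ominus> (d \<otimes> a21)) \<otimes> a11 \<oplus> (d \<otimes> a11) \<otimes> a21 = \<zero>"
  "(\<ominus> (d \<otimes> a21)) \<otimes> a12 \<oplus> (d \<otimes> a11) \<otimes> a22 = (a11 \<otimes> a22 \<ominus> a12 \<otimes> a21) \<otimes> d"
  using a d by algebra+

lemma inv_right_identities:
  "a11 \<otimes> (d \<otimes> a22) \<oplus> a12 \<otimes> (\<ominus> (d \<otimes> a21)) = (a11 \<otimes> a22 \<ominus> a12 \<otimes> a21) \<otimes> d"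
  "a11 \<otimes> (\<ominus> (d \<otimes> a12)) \<oplus> a12 \<otimes> (d \<otimes> a11) = \<zero>"
  "a21 \<otimes> (d \<otimes> a22) \<oplus> a22 \<otimes> (\<ominus> (d \<otimes> a21)) = \<zero>"
  "a21 \<otimes> (\<ominus> (d \<otimes> a12)) \<oplus> a22 \<otimes> (d \<otimes> a11) = (a11 \<otimes> a22 \<ominus> a12 \<otimes> a21) \<otimes> d"
  using a d by algebra+

text \<open>Every term of each expansion contains a diagonal and an antidiagonal entry of the same
  factor.\<close>

lemma monomial_mult_identities:
  assumes z: "a12 \<otimes> a11 = \<zero>" "a12 \<otimes> a22 = \<zero>" "a21 \<otimes> a11 = \<zero>" "a21 \<otimes> a22 = \<zero>"
    "b12 \<otimes> b11 = \<zero>" "b12 \<otimes> b22 = \<zero>" "b21 \<otimes> b11 = \<zero>" "b21 \<otimes> b22 = \<zero>"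
  shows "(a11 \<otimes> b12 \<oplus> a12 \<otimes> b22) \<otimes> (a11 \<otimes> b11 \<oplus> a12 \<otimes> b21) = \<zero>"
    "(a11 \<otimes> b12 \<oplus> a12 \<otimes> b22) \<otimes> (a21 \<otimes> b12 \<oplus> a22 \<otimes> b22) = \<zero>"
    "(a21 \<otimes> b11 \<oplus> a22 \<otimes> b21) \<otimes> (a11 \<otimes> b11 \<oplus> a12 \<otimes> b21) = \<zero>"
    "(a21 \<otimes> b11 \<oplus> a22 \<otimes> b21) \<otimes> (a21 \<otimes> b12 \<oplus> a22 \<otimes> b22) = \<zero>"
  using a b by (simp_all add: ring_expand z z[THEN null_product(1)] z[THEN null_product(2)] z[THEN null_product(3)])

lemma monomial_inv_identities:
  assumes z: "a12 \<otimes> a11 = \<zero>" "a12 \<otimes> a22 = \<zero>" "a21 \<otimes> a11 = \<zero>" "a21 \<otimes> a22 = \<zero>"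
  shows "(\<ominus> (d \<otimes> a12)) \<otimes> (d \<otimes> a22) = \<zero>" "(\<ominus> (d \<otimes> a12)) \<otimes> (d \<otimes> a11) = \<zero>"
    "(\<ominus> (d \<otimes> a21)) \<otimes> (d \<otimes> a22) = \<zero>" "(\<ominus> (d \<otimes> a21)) \<otimes> (d \<otimes> a11) = \<zero>"
  using a d by (simp_all add: ring_expand z z[THEN null_product(1)] z[THEN null_product(2)] z[THEN null_product(3)])

end

lemma matrix_point_mult:
  assumes "matrix_point R g x" "matrix_point R g y"
  shows "matrix_point R g (mat_mult R x y)"
proof -
  note cl = matrix_pointD(2-6)[OF assms(1)] matrix_pointD(2-6)[OF assms(2)]
    det_inv_closed[OF assms(1)] det_inv_closed[OF assms(2)]
  have "mat_mult R x y v \<in> carrier R" if "v \<in> coords g" for v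
    using that cl by (elim coords_cases) auto
  moreover have "det_inv R g (mat_mult R x y) = det_inv R g x \<otimes> det_inv R g y"
    by (cases g) auto
  ultimately show ?thesis
    using cl det_mult_identity[OF cl(1-4) cl(6-9) cl(11,12)] matrix_pointD(7)[OF assms(1)] matrix_pointD(7)[OF assms(2)]
    by (simp add: matrix_point_def det2_def)
qed

lemma matrix_point_inv:
  assumes "matrix_point R g x"
  shows "matrix_point R g (mat_inv R g x)"
proof -
  note cl = matrix_pointD(2-5)[OF assms] det_inv_closed[OF assms]
  have "mat_inv R g x v \<in> carrier R" if "v \<in> coords g" for v
    using that cl det2_closed[OF assms] by (elim coords_cases) auto
  moreover have "det_inv R g x \<otimes> det_inv R g (mat_inv R g x) = \<one>"
    using matrix_pointD(7)[OF assms] cl det2_closed[OF assms] m_comm by (cases g) auto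
  moreover have "det_inv R g (mat_inv R g x) \<in> carrier R"
    using det2_closed[OF assms] by (cases g) auto
  ultimately show ?thesis
    using cl det_inv_identity[OF cl(1-4) cl(1-4) cl(5)] matrix_pointD(7)[OF assms]
    by (simp add: matrix_point_def det2_def)
qed

lemma matrix_point_one: "matrix_point R g (counit_coord R)"
  unfolding matrix_point_def
  by (cases g) (auto simp: det2_def a_minus_def)

lemma mat_mult_assoc:
  assumes "matrix_point R g x" "matrix_point R g y" "matrix_point R g z" "v \<in> coords g"
  shows "mat_mult R (mat_mult R x y) z v = mat_mult R x (mat_mult R y z) v"
  using assms(4) matrix_pointD(2-6)[OF assms(1)] matrix_pointD(2-6)[OF assms(2)] matrix_pointD(2-6)[OF assms(3)]
  by (elim coords_cases) (simp_all add: l_distr r_distr m_assoc a_ac)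

lemma mat_mult_one:
  assumes "matrix_point R g x" "v \<in> coords g"
  shows "mat_mult R (counit_coord R) x v = x v" "mat_mult R x (counit_coord R) v = x v"
  using assms(2) matrix_pointD(2-6)[OF assms(1)] by (auto elim!: coords_cases)

lemma mat_mult_inv:
  assumes "matrix_point R g x" "v \<in> coords g"
  shows "mat_mult R (mat_inv R g x) x v = counit_coord R v" "mat_mult R x (mat_inv R g x) v = counit_coord R v"
proof -
  note cl = matrix_pointD(2-5)[OF assms(1)] det_inv_closed[OF assms(1)]
  note D = matrix_pointD(7)[OF assms(1)]
  note l = inv_left_identities[OF cl(1-4) cl(1-4) cl(5,5)] and r = inv_right_identities[OF cl(1-4) cl(1-4) cl(5,5)]
  note D' = D[unfolded det2_def]
  have D2: "det_inv R g x \<otimes> det2 R x = \<one>" using D cl det2_closed[OF assms(1)] m_comm by simp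
  show "mat_mult R (mat_inv R g x) x v = counit_coord R v"
    using assms(2) l D D' by (elim coords_cases) simp_all
  show "mat_mult R x (mat_inv R g x) v = counit_coord R v"
    using assms(2) r D2 D' by (elim coords_cases) simp_all
qed

lemma monomial_mult:
  assumes "matrix_point R g x" "matrix_point R g y" "monomial R x" "monomial R y"
  shows "monomial R (mat_mult R x y)"
proof -
  note cl = matrix_pointD(2-5)[OF assms(1)] matrix_pointD(2-5)[OF assms(2)]
  show ?thesis
    using monomial_mult_identities[OF cl(1-8) cl(1,1)] assms(3,4) by (simp add: monomial_def)
qed

lemma monomial_inv:
  assumes "matrix_point R g x" "monomial R x"
  shows "monomial R (mat_inv R g x)"
proof -
  note cl = matrix_pointD(2-5)[OF assms(1)] det_inv_closed[OF assms(1)]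
  show ?thesis
    using monomial_inv_identities[OF cl(1-4) cl(1-4) cl(5,5)] assms(2) by (simp add: monomial_def)
qed

lemma monomial_one: "monomial R (counit_coord R)"
  by (simp add: monomial_def)

lemma diagonal_mult:
  assumes "matrix_point R g x" "matrix_point R g y" "diagonal R x" "diagonal R y"
  shows "diagonal R (mat_mult R x y)"
  using matrix_pointD(2-5)[OF assms(1)] matrix_pointD(2-5)[OF assms(2)] assms(3,4) by (simp add: diagonal_def)

lemma diagonal_inv:
  assumes "matrix_point R g x" "diagonal R x"
  shows "diagonal R (mat_inv R g x)"
  using det_inv_closed[OF assms(1)] assms(2) by (simp add: diagonal_def)

lemma diagonal_one: "diagonal R (counit_coord R)"
  by (simp add: diagonal_def)

lemma diagonal_monomial: "matrix_point R g x \<Longrightarrow> diagonal R x \<Longrightarrow> monomial R x"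
  using matrix_pointD(2-5)[of R g x] by (simp add: monomial_def diagonal_def)

end

lemma hom_det2:
  assumes "algebra A B" "algebra A C" "k \<in> alg_hom A B C" "x \<in> {X11, X12, X21, X22} \<rightarrow> carrier B"
  shows "k (det2 B x) = det2 C (\<lambda>v. k (x v))"
proof -
  interpret B: algebra A B by fact
  have "x X11 \<in> carrier B" "x X12 \<in> carrier B" "x X21 \<in> carrier B" "x X22 \<in> carrier B" using assms(4) by auto
  then show ?thesis
    by (simp add: det2_def alg_hom_minus[OF assms(1-3)] alg_hom_simps[OF assms(3)])
qed

text \<open>All these constructions are polynomial in the entries, \<open>Dinv\<close> included, and
  hence natural in the ring.\<close>

lemma hom_mat:
  assumes "algebra A B" "algebra A C" "k \<in> alg_hom A B C" "matrix_point B g x"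
  shows "matrix_point B g y \<Longrightarrow> v \<in> coords g \<Longrightarrow> k (mat_mult B x y v) = mat_mult C (\<lambda>v. k (x v)) (\<lambda>v. k (y v)) v"
    and "v \<in> coords g \<Longrightarrow> k (mat_inv B g x v) = mat_inv C g (\<lambda>v. k (x v)) v"
    and "k (counit_coord B v) = counit_coord C v"
    and "matrix_point C g (\<lambda>v. k (x v))"
    and "monomial B x \<Longrightarrow> monomial C (\<lambda>v. k (x v))"
    and "diagonal B x \<Longrightarrow> diagonal C (\<lambda>v. k (x v))"
proof -
  interpret B: algebra A B by fact
  interpret C: algebra A C by fact
  note k = alg_hom_simps[OF assms(3)] alg_hom_uminus[OF assms(1-3)] alg_hom_zero[OF assms(1-3)]
  note cl = matrix_pointD(2-5)[OF assms(4)] B.det_inv_closed[OF assms(4)]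
  have di: "k (det_inv B g x) = det_inv C g (\<lambda>v. k (x v))" by (cases g) (simp_all add: k)
  have dt: "k (det2 B x) = det2 C (\<lambda>v. k (x v))" by (rule hom_det2[OF assms(1-3)]) (use cl in auto)
  show "k (mat_mult B x y v) = mat_mult C (\<lambda>v. k (x v)) (\<lambda>v. k (y v)) v" if y: "matrix_point B g y" and v: "v \<in> coords g"
    using v cl matrix_pointD(2-6)[OF assms(4)] matrix_pointD(2-6)[OF y] by (elim coords_cases) (simp_all add: k)
  show "k (mat_inv B g x v) = mat_inv C g (\<lambda>v. k (x v)) v" if v: "v \<in> coords g"
    using v cl by (elim coords_cases) (simp_all add: k di dt)
  show "k (counit_coord B v) = counit_coord C v" by (cases v) (simp_all add: k)
  show "matrix_point C g (\<lambda>v. k (x v))"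
    using assms(4) k(3)[OF B.det2_closed[OF assms(4)] cl(5)] k(4) k(1) di dt by (auto simp: matrix_point_def)
  show "monomial B x \<Longrightarrow> monomial C (\<lambda>v. k (x v))"
    using cl by (auto simp: monomial_def k simp flip: k(3))
  show "diagonal B x \<Longrightarrow> diagonal C (\<lambda>v. k (x v))" by (simp add: diagonal_def k)
qed

lemma mat_mult_cong:
  assumes "\<And>v. v \<in> coords g \<Longrightarrow> x v = x' v" "\<And>v. v \<in> coords g \<Longrightarrow> y v = y' v" "v \<in> coords g"
  shows "mat_mult R x y v = mat_mult R x' y' v"
  using assms(3,1,2) by (elim coords_cases) simp_all

lemma det_cong:
  assumes "\<And>v. v \<in> coords g \<Longrightarrow> x v = x' v"
  shows "det2 R x = det2 R x'" "det_inv R g x = det_inv R g x'"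
  using assms by (auto simp: det2_def, cases g, auto)

lemma matrix_point_cong:
  assumes "\<And>v. v \<in> coords g \<Longrightarrow> x v = x' v"
  shows "matrix_point R g x \<longleftrightarrow> matrix_point R g x'"
  using det_cong[of g x x' R, OF assms] assms by (auto simp: matrix_point_def Pi_iff)

lemma monomial_cong:
  assumes "\<And>v. v \<in> coords g \<Longrightarrow> x v = x' v"
  shows "monomial R x \<longleftrightarrow> monomial R x'" "diagonal R x \<longleftrightarrow> diagonal R x'"
  using assms by (auto simp: monomial_def diagonal_def)

section \<open>The coordinate rings\<close>

context
  fixes A :: "('a, 'r) ring_scheme" assumes A: "cring A"
begin

interpretation A: cring A by (rule A)

lemma coord_monoid: "comm_monoid \<lparr>carrier = {m. set_mset m \<subseteq> V}, mult = (+), one = {#}\<rparr>"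
  by (rule comm_monoidI) (auto simp: ac_simps)

lemma poly_algebra: "algebra A (poly_algebra A V)"
  unfolding poly_algebra_def by (rule free_module.F_algebra[OF free_module.intro[OF A] coord_monoid])

lemma var_closed: "v \<in> V \<Longrightarrow> var A v \<in> carrier (poly_algebra A V)"
  unfolding poly_algebra_def var_def by (rule free_module.single_closed[OF free_module.intro[OF A]]) simp

lemma finite_coords: "finite (V :: coord set)"
proof -
  have "(UNIV :: coord set) = {X11, X12, X21, X22, Dinv}"
    by (auto intro: coord.exhaust)
  then show ?thesis by (metis finite.emptyI finite_insert finite_subset subset_UNIV)
qed

lemma poly_eval_hom:
  assumes "algebra A B" "\<phi> \<in> V \<rightarrow> carrier B"
  shows "poly_eval A B \<phi> \<in> alg_hom A (poly_algebra A V) B"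
    and "\<And>v. v \<in> V \<Longrightarrow> poly_eval A B \<phi> (var A v) = \<phi> v"
proof -
  interpret B: algebra A B by fact
  let ?M = "\<lparr>carrier = {m. set_mset m \<subseteq> V}, mult = (+), one = {#}\<rparr>"
  let ?\<psi> = "\<lambda>m. finprod B (\<lambda>v. \<phi> v [^]\<^bsub>B\<^esub> count m v) (set_mset m)"
  have c: "(\<lambda>v. \<phi> v [^]\<^bsub>B\<^esub> count m v) \<in> V \<rightarrow> carrier B" for m using assms(2) by auto
  \<comment> \<open>Extending the product from the support of \<open>m\<close> to the finite set
    \<open>V\<close> gives \<open>m\<close>, \<open>n\<close> and \<open>m + n\<close> the same
    index set, so multiplicativity can be checked factor by factor.\<close>
  have \<psi>: "?\<psi> m = finprod B (\<lambda>v. \<phi> v [^]\<^bsub>B\<^esub> count m v) V" if "set_mset m \<subseteq> V" for m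
    by (rule B.finprod_mono_neutral_cong_left[OF finite_coords that _ _ c])
      (simp_all add: not_in_iff)
  have cl: "?\<psi> \<in> carrier ?M \<rightarrow> carrier B" using \<psi> B.finprod_closed[OF c] by auto
  have mult: "?\<psi> (m \<otimes>\<^bsub>?M\<^esub> n) = ?\<psi> m \<otimes>\<^bsub>B\<^esub> ?\<psi> n" if "m \<in> carrier ?M" "n \<in> carrier ?M" for m n
  proof -
    have "?\<psi> (m + n) = finprod B (\<lambda>v. \<phi> v [^]\<^bsub>B\<^esub> count (m + n) v) V" using that by (intro \<psi>) auto
    also have "\<dots> = finprod B (\<lambda>v. \<phi> v [^]\<^bsub>B\<^esub> count m v \<otimes>\<^bsub>B\<^esub> \<phi> v [^]\<^bsub>B\<^esub> count n v) V"
      by (rule B.finprod_cong') (use assms(2) in \<open>simp_all add: B.nat_pow_mult Pi_iff\<close>)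
    also have "\<dots> = ?\<psi> m \<otimes>\<^bsub>B\<^esub> ?\<psi> n"
      using that \<psi>[of m] \<psi>[of n] B.finprod_multf[OF c c] by simp
    finally show ?thesis by simp
  qed
  show "poly_eval A B \<phi> \<in> alg_hom A (poly_algebra A V) B"
    unfolding poly_eval_def poly_algebra_def
    by (rule free_module.lin_ext_hom[OF free_module.intro[OF A] coord_monoid assms(1) cl _ mult]) auto
  fix v assume v: "v \<in> V"
  have "?\<psi> {#v#} = \<phi> v" using v assms(2) by (auto simp: Pi_iff)
  then show "poly_eval A B \<phi> (var A v) = \<phi> v"
    unfolding poly_eval_def var_def
    using free_module.lin_ext_single[OF free_module.intro[OF A] algebra_module[OF assms(1)] cl, of "{#v#}"] v by simp
qed

lemma poly_hom_ext:
  assumes "f \<in> alg_hom A (poly_algebra A V) C" "h \<in> alg_hom A (poly_algebra A V) C" "algebra A C"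
    and "\<And>v. v \<in> V \<Longrightarrow> f (var A v) = h (var A v)" "p \<in> carrier (poly_algebra A V)"
  shows "f p = h p"
proof -
  let ?M = "\<lparr>carrier = {m. set_mset m \<subseteq> V}, mult = (+), one = {#}\<rparr>"
  interpret M: free_module A ?M by (rule free_module.intro[OF A])
  have F: "poly_algebra A V = M.F" by (simp add: poly_algebra_def)
  have FA: "algebra A M.F" unfolding F[symmetric] by (rule poly_algebra)
  note f = assms(1)[unfolded F] and h = assms(2)[unfolded F]
  have one: "single A {#} = \<one>\<^bsub>M.F\<^esub>" by (simp add: monoid_algebra_sel)
  have S: "f (single A m) = h (single A m)" if "set_mset m \<subseteq> V" for m
    using that
  proof (induction m)
    case empty
    then show ?case by (simp add: one alg_hom_one[OF f] alg_hom_one[OF h])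
  next
    case (add v m)
    then have v: "{#v#} \<in> carrier ?M" "m \<in> carrier ?M" by auto
    have "single A (add_mset v m) = single A {#v#} \<otimes>\<^bsub>M.F\<^esub> single A m"
      using M.single_mult[OF v] by simp
    then show ?case
      using add assms(4)[of v] M.single_closed[OF v(1)] M.single_closed[OF v(2)]
      by (simp add: alg_hom_mult[OF f] alg_hom_mult[OF h] var_def)
  qed
  show ?thesis using assms(5)[unfolded F]
    by (induction rule: M.F_induct)
      (simp_all add: S alg_hom_simps[OF f] alg_hom_simps[OF h] alg_hom_zero[OF FA assms(3) f] alg_hom_zero[OF FA assms(3) h])
qed

lemma det2_var_closed: "det2 (poly_algebra A (coords g)) (var A) \<in> carrier (poly_algebra A (coords g))"
proof -
  interpret P: algebra A "poly_algebra A (coords g)" by (rule poly_algebra)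
  show ?thesis by (simp add: det2_def var_closed)
qed

lemma det_inv_var_closed: "det_inv (poly_algebra A (coords g)) g (var A) \<in> carrier (poly_algebra A (coords g))"
proof -
  interpret P: algebra A "poly_algebra A (coords g)" by (rule poly_algebra)
  show ?thesis by (rule P.det_inv_closed_Pi) (auto intro: var_closed)
qed

text \<open>One form for both groups, since \<open>det_inv\<close> is \<open>1\<close> for
  \<open>SL2\<close>.\<close>

lemma relation_eq:
  "relation A g = (let P = poly_algebra A (coords g) in (det2 P (var A) \<otimes>\<^bsub>P\<^esub> det_inv P g (var A)) \<ominus>\<^bsub>P\<^esub> \<one>\<^bsub>P\<^esub>)"
proof -
  interpret P: algebra A "poly_algebra A (coords g)" by (rule poly_algebra)
  show ?thesis
    using P.r_one[OF det2_var_closed] by (cases g) (simp_all add: Let_def)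
qed

lemma relation_closed: "relation A g \<in> carrier (poly_algebra A (coords g))"
proof -
  interpret P: algebra A "poly_algebra A (coords g)" by (rule poly_algebra)
  show ?thesis
    using det2_var_closed det_inv_var_closed unfolding relation_eq Let_def by simp
qed

text \<open>The image of the relation vanishes exactly when the images of the variables satisfy the
  determinant equation. This yields both that the generic matrix is a point and that evaluation at a
  point descends to \<open>k[G]\<close>.\<close>

lemma hom_relation:
  assumes "algebra A B" "f \<in> alg_hom A (poly_algebra A (coords g)) B"
  shows "f (relation A g) = (det2 B (\<lambda>v. f (var A v)) \<otimes>\<^bsub>B\<^esub> det_inv B g (\<lambda>v. f (var A v))) \<ominus>\<^bsub>B\<^esub> \<one>\<^bsub>B\<^esub>"
proof -
  interpret B: algebra A B by fact
  interpret P: algebra A "poly_algebra A (coords g)" by (rule poly_algebra)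
  have "f (det2 (poly_algebra A (coords g)) (var A)) = det2 B (\<lambda>v. f (var A v))"
    by (rule hom_det2[OF poly_algebra assms]) (auto intro: var_closed)
  moreover have "f (det_inv (poly_algebra A (coords g)) g (var A)) = det_inv B g (\<lambda>v. f (var A v))"
    using alg_hom_one[OF assms(2)] by (cases g) simp_all
  ultimately show ?thesis
    unfolding relation_eq Let_def using det2_var_closed det_inv_var_closed
    by (simp add: alg_hom_minus[OF poly_algebra assms] alg_hom_simps[OF assms(2)])
qed

lemma relation_quotient: "algebra_quotient A (poly_algebra A (coords g)) (relation_ideal A g)"
proof -
  interpret P: algebra A "poly_algebra A (coords g)" by (rule poly_algebra)
  show ?thesis unfolding relation_ideal_def
    by (intro algebra_quotient.intro algebra_quotient_axioms.intro poly_algebra P.genideal_ideal)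
      (use relation_closed in simp)
qed

lemma coord_algebra: "algebra A (coord_algebra A g)"
  unfolding coord_algebra_def by (rule algebra_quotient.quot_algebra[OF relation_quotient])

lemma cvar_closed: "v \<in> coords g \<Longrightarrow> cvar A g v \<in> carrier (coord_algebra A g)"
  unfolding coord_algebra_def cvar_def
  by (rule alg_hom_closed[OF algebra_quotient.coset_hom[OF relation_quotient] var_closed])

lemma cvar_point: "matrix_point (coord_algebra A g) g (cvar A g)"
proof -
  interpret Q: algebra_quotient A "poly_algebra A (coords g)" "relation_ideal A g" by (rule relation_quotient)
  interpret B: algebra A "coord_algebra A g" by (rule coord_algebra)
  note h = Q.coset_hom[folded coord_algebra_def]
  have "relation A g \<in> relation_ideal A g"
    unfolding relation_ideal_def using relation_closed by (intro Q.genideal_self') auto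
  then have "relation_ideal A g +>\<^bsub>poly_algebra A (coords g)\<^esub> relation A g = \<zero>\<^bsub>coord_algebra A g\<^esub>"
    using Q.Q.coset_eq_zero_iff[OF relation_closed] by (simp add: coord_algebra_def)
  then have *: "det2 (coord_algebra A g) (cvar A g) \<otimes>\<^bsub>coord_algebra A g\<^esub> det_inv (coord_algebra A g) g (cvar A g)
      \<ominus>\<^bsub>coord_algebra A g\<^esub> \<one>\<^bsub>coord_algebra A g\<^esub> = \<zero>\<^bsub>coord_algebra A g\<^esub>"
    using hom_relation[OF coord_algebra h] by (simp add: cvar_def[abs_def])
  have "det2 (coord_algebra A g) (cvar A g) \<in> carrier (coord_algebra A g)"
    by (simp add: det2_def cvar_closed)
  moreover have "det_inv (coord_algebra A g) g (cvar A g) \<in> carrier (coord_algebra A g)"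
    by (rule B.det_inv_closed_Pi) (auto intro: cvar_closed)
  ultimately show ?thesis using * cvar_closed by (auto simp: matrix_point_def B.M.minus_eq_zero_iff)
qed

text \<open>Evaluation at a point kills the relation and hence the ideal it generates:
  \<open>k[G]\<close> represents \<open>matrix_point\<close>.\<close>

lemma coord_lift:
  assumes "algebra A B" "matrix_point B g \<phi>"
  shows "induced (poly_eval A B \<phi>) \<in> alg_hom A (coord_algebra A g) B"
    and "\<And>v. v \<in> coords g \<Longrightarrow> induced (poly_eval A B \<phi>) (cvar A g v) = \<phi> v"
proof -
  interpret B: algebra A B by fact
  have \<phi>: "\<phi> \<in> coords g \<rightarrow> carrier B" using assms(2) by (simp add: matrix_point_def)
  note h = poly_eval_hom[OF assms(1) \<phi>]
  have "matrix_point B g (\<lambda>v. poly_eval A B \<phi> (var A v))"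
    using matrix_point_cong[of g _ \<phi> B] h(2) assms(2) by simp
  then have "poly_eval A B \<phi> (relation A g) = \<zero>\<^bsub>B\<^esub>"
    using hom_relation[OF assms(1) h(1)] B.M.minus_eq_zero_iff by (simp add: matrix_point_def)
  then have Z: "poly_eval A B \<phi> p = \<zero>\<^bsub>B\<^esub>" if "p \<in> relation_ideal A g" for p
    using alg_hom_zero_on_genideal[OF poly_algebra assms(1) h(1), of "{relation A g}" p] relation_closed that
    by (simp add: relation_ideal_def)
  note I = algebra_quotient.induced_hom[OF relation_quotient assms(1) h(1)]
  show "induced (poly_eval A B \<phi>) \<in> alg_hom A (coord_algebra A g) B"
    using I(1) Z by (simp add: coord_algebra_def)
  show "induced (poly_eval A B \<phi>) (cvar A g v) = \<phi> v" if "v \<in> coords g" for v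
    using I(2)[OF _ var_closed[OF that]] Z h(2)[OF that] by (simp add: cvar_def)
qed

lemma coord_hom_ext:
  assumes "f \<in> alg_hom A (coord_algebra A g) C" "h \<in> alg_hom A (coord_algebra A g) C" "algebra A C"
    and "\<And>v. v \<in> coords g \<Longrightarrow> f (cvar A g v) = h (cvar A g v)" "x \<in> carrier (coord_algebra A g)"
  shows "f x = h x"
proof -
  interpret Q: algebra_quotient A "poly_algebra A (coords g)" "relation_ideal A g" by (rule relation_quotient)
  obtain p where p: "p \<in> carrier (poly_algebra A (coords g))" "x = relation_ideal A g +>\<^bsub>poly_algebra A (coords g)\<^esub> p"
    using assms(5) Q.Q.quot_elim unfolding coord_algebra_def by blast
  note c = Q.coset_hom[folded coord_algebra_def]
  show ?thesis unfolding p(2)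
    by (rule poly_hom_ext[OF alg_hom_comp[OF c assms(1)] alg_hom_comp[OF c assms(2)] assms(3) _ p(1)])
      (use assms(4) in \<open>simp add: cvar_def\<close>)
qed

end

section \<open>The matrix group schemes and their closed subgroup schemes\<close>

lemma matrix_fields:
  assumes "module.truncate M = module.truncate M'"
  shows "det2 M y = det2 M' y" "det_inv M g y = det_inv M' g y" "matrix_point M g y \<longleftrightarrow> matrix_point M' g y"
    "mat_inv M g y v = mat_inv M' g y v"
proof -
  note eqs = truncate_eqD[OF assms]
  have i: "\<ominus>\<^bsub>M\<^esub> a = \<ominus>\<^bsub>M'\<^esub> a" for a by (simp add: a_inv_def m_inv_def eqs)
  show d: "det2 M y = det2 M' y" by (simp add: det2_def a_minus_def eqs i)
  show e: "det_inv M g y = det_inv M' g y" by (cases g) (simp_all add: eqs)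
  show "matrix_point M g y \<longleftrightarrow> matrix_point M' g y" by (simp add: matrix_point_def eqs d e)
  show "mat_inv M g y v = mat_inv M' g y v" by (cases v) (simp_all add: eqs i d e)
qed

lemma counit_coord_base: "counit_coord (base_algebra A) = counit_coord A"
proof
  show "counit_coord (base_algebra A) v = counit_coord A v" for v by (cases v) simp_all
qed

lemma (in affine_group_scheme) is_hopf_data: "hopf_data A H"
  by (rule hopf_data_axioms)

locale matrix_setting = cring A for A :: "('a, 'r) ring_scheme" +
  fixes g :: matrix_group
begin

abbreviation "G \<equiv> matrix_scheme A g"
abbreviation "B \<equiv> coord_algebra A g"
abbreviation "x \<equiv> cvar A g"
abbreviation "BB \<equiv> tensor A B B"

lemmas B_algebra = coord_algebra[OF is_cring, of g]
lemmas x_point = cvar_point[OF is_cring, of g]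
lemmas x_closed = cvar_closed[OF is_cring, of _ g]

lemma truncate_G: "module.truncate G = module.truncate B"
  by (simp only: matrix_scheme_def Let_def truncate_extend)

lemmas G_fields = truncate_eqD[OF truncate_G]

lemma G_algebra: "algebra A G"
  by (rule algebra_fields[OF truncate_G B_algebra])

lemma tensor_G: "tensor A G G = BB"
  by (rule tensor_fields[OF truncate_G truncate_G])

lemma pure_G: "pure A G G = pure A B B"
  by (rule pure_fields[OF truncate_G truncate_G])

lemma alg_hom_G: "alg_hom A G C = alg_hom A B C"
  by (rule alg_hom_fields[OF truncate_G refl])

lemma matrix_point_G: "matrix_point G g y \<longleftrightarrow> matrix_point B g y"
  by (rule matrix_fields(3)[OF truncate_G])

lemma G_hom_ext:
  assumes "f \<in> alg_hom A G C" "h \<in> alg_hom A G C" "algebra A C"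
    and "\<And>v. v \<in> coords g \<Longrightarrow> f (x v) = h (x v)" "y \<in> carrier G"
  shows "f y = h y"
  by (rule coord_hom_ext[OF is_cring assms(1,2)[unfolded alg_hom_G] assms(3,4) assms(5)[unfolded G_fields]])

text \<open>The formulas for the comultiplication are the product of the two generic matrices over
  \<open>k[G] \<otimes> k[G]\<close>; products of points being points, they define a
  homomorphism.\<close>

lemma comult_coord_eq:
  assumes "v \<in> coords g"
  shows "comult_coord A g v = mat_mult BB (\<lambda>v. pure A B B (x v) \<one>\<^bsub>B\<^esub>) (\<lambda>v. pure A B B \<one>\<^bsub>B\<^esub> (x v)) v"
proof -
  interpret B: algebra A B by (rule B_algebra)
  interpret BB: tensor_algebra A B B by (rule tensor_algebra.intro) (rule B_algebra)+
  show ?thesis using assms x_closed by (cases v) (simp_all add: Let_def BB.pure_mult)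
qed

lemma antipode_coord_eq: "antipode_coord A g v = mat_inv B g x v"
proof -
  have "det_inverse A g = det_inv B g x" by (cases g) simp_all
  then show ?thesis by (cases v) simp_all
qed

lemma G_sel:
  shows "comult G \<in> alg_hom A G (tensor A G G)"
    and "\<And>v. v \<in> coords g \<Longrightarrow> comult G (x v) =
      mat_mult (tensor A G G) (\<lambda>v. pure A G G (x v) \<one>\<^bsub>G\<^esub>) (\<lambda>v. pure A G G \<one>\<^bsub>G\<^esub> (x v)) v"
    and "counit G \<in> alg_hom A G (base_algebra A)"
    and "\<And>v. v \<in> coords g \<Longrightarrow> counit G (x v) = counit_coord A v"
    and "antipode G \<in> alg_hom A G G"
    and "\<And>v. v \<in> coords g \<Longrightarrow> antipode G (x v) = mat_inv B g x v"
proof -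
  interpret B: algebra A B by (rule B_algebra)
  interpret BB: tensor_algebra A B B by (rule tensor_algebra.intro) (rule B_algebra)+
  interpret BBA: algebra A BB by (rule BB.tensor_algebra)
  note l = hom_mat(4)[OF B_algebra BB.tensor_algebra BB.pure_left_hom x_point]
  note r = hom_mat(4)[OF B_algebra BB.tensor_algebra BB.pure_right_hom x_point]
  have "matrix_point BB g (comult_coord A g)"
    using BBA.matrix_point_mult[OF l r] matrix_point_cong[of g "comult_coord A g"] comult_coord_eq by metis
  note c = coord_lift[OF is_cring BB.tensor_algebra this]
  have cG: "comult G = induced (poly_eval A BB (comult_coord A g))"
    "counit G = induced (poly_eval A (base_algebra A) (counit_coord A))"
    "antipode G = induced (poly_eval A B (antipode_coord A g))"
    by (simp_all add: matrix_scheme_def Let_def)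
  show "comult G \<in> alg_hom A G (tensor A G G)" unfolding tensor_G alg_hom_G cG by (rule c(1))
  show "comult G (x v) = mat_mult (tensor A G G) (\<lambda>v. pure A G G (x v) \<one>\<^bsub>G\<^esub>) (\<lambda>v. pure A G G \<one>\<^bsub>G\<^esub> (x v)) v"
    if "v \<in> coords g" for v
    unfolding tensor_G pure_G cG using c(2)[OF that] comult_coord_eq[OF that] by (simp add: G_fields)
  have "matrix_point (base_algebra A) g (counit_coord A)"
    using cring.matrix_point_one[OF algebra.M_cring[OF algebra_base[OF is_cring]], of g] by (simp add: counit_coord_base)
  note c = coord_lift[OF is_cring algebra_base[OF is_cring] this]
  show "counit G \<in> alg_hom A G (base_algebra A)" unfolding alg_hom_G cG by (rule c(1))
  show "counit G (x v) = counit_coord A v" if "v \<in> coords g" for v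
    unfolding cG by (rule c(2)[OF that])
  have "matrix_point B g (antipode_coord A g)"
    unfolding antipode_coord_eq[abs_def] by (rule B.matrix_point_inv[OF x_point])
  note c = coord_lift[OF is_cring B_algebra this]
  have "alg_hom A B G = alg_hom A B B" by (rule alg_hom_fields[OF refl truncate_G])
  then show "antipode G \<in> alg_hom A G G" unfolding alg_hom_G cG using c(1) by simp
  show "antipode G (x v) = mat_inv B g x v" if "v \<in> coords g" for v
    unfolding cG using c(2)[OF that] antipode_coord_eq by simp
qed

lemma mat_inv_G: "mat_inv G g y v = mat_inv B g y v"
  by (rule matrix_fields(4)[OF truncate_G])

sublocale G: hopf_data A G
  by (intro hopf_data.intro hopf_data_axioms.intro G_algebra G_sel)

text \<open>The bridge from Hopf algebras to matrices. It is stated for any \<open>H\<close> with a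
  matrix \<open>y\<close> of coordinates, so that it applies to \<open>G\<close> and to its closed
  subgroups alike.\<close>

lemma hom_mat_mult_tensor:
  assumes "hopf_data A H" "algebra A R" "f \<in> alg_hom A H R" "h \<in> alg_hom A H R" "matrix_point H g y" "v \<in> coords g"
    and "comult H z = mat_mult (tensor A H H) (\<lambda>v. pure A H H (y v) \<one>\<^bsub>H\<^esub>) (\<lambda>v. pure A H H \<one>\<^bsub>H\<^esub> (y v)) v"
  shows "pt_mult A H R f h z = mat_mult R (\<lambda>v. f (y v)) (\<lambda>v. h (y v)) v"
proof -
  have "algebra A H" using assms(1) by (rule hopf_data.axioms)
  then interpret HH: tensor_algebra A H H by (intro tensor_algebra.intro)
  interpret R: algebra A R by fact
  note T = HH.tensor_algebra
  note l = hom_mat(4)[OF \<open>algebra A H\<close> T HH.pure_left_hom assms(5)]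
    and r = hom_mat(4)[OF \<open>algebra A H\<close> T HH.pure_right_hom assms(5)]
  have "pt_mult A H R f h z = mat_mult R (\<lambda>v. pt_pair A R f h (pure A H H (y v) \<one>\<^bsub>H\<^esub>)) (\<lambda>v. pt_pair A R f h (pure A H H \<one>\<^bsub>H\<^esub> (y v))) v"
    using hom_mat(1)[OF T assms(2) HH.pt_pair_hom[OF assms(2-4)] l r assms(6)] by (simp add: pt_mult_def assms(7))
  also have "\<dots> = mat_mult R (\<lambda>v. f (y v)) (\<lambda>v. h (y v)) v"
    by (rule mat_mult_cong[OF _ _ assms(6)])
      (simp_all add: HH.pt_pair_pure[OF assms(2-4)] matrix_pointD(1)[OF assms(5)] alg_hom_simps[OF assms(3)] alg_hom_simps[OF assms(4)])
  finally show ?thesis .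
qed

lemmas pt_mult_x = hom_mat_mult_tensor[OF G.hopf_data_axioms _ _ _ x_point[folded matrix_point_G] _ G_sel(2)]

lemmas hom_x_point = hom_mat(4)[OF G_algebra _ _ x_point[folded matrix_point_G]]

text \<open>Each group axiom compares two algebra homomorphisms on \<open>k[G]\<close>. They agree
  once they agree on the coordinates, where the axiom is the corresponding law for matrices over a
  commutative ring.\<close>

lemma matrix_scheme_group: "affine_group_scheme A G"
proof (rule G.affine_group_schemeI)
  fix y assume y: "y \<in> carrier G"
  note P = G.HHH.P.algebra_axioms and p = G.proj_hom
  note p12 = G.pt_mult_hom[OF P p(1,2)] and p23 = G.pt_mult_hom[OF P p(2,3)]
  show "pt_mult A G G.HHH.P (pt_mult A G G.HHH.P G.proj1 G.proj2) G.proj3 y =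
      pt_mult A G G.HHH.P G.proj1 (pt_mult A G G.HHH.P G.proj2 G.proj3) y"
  proof (rule G_hom_ext[OF G.pt_mult_hom[OF P p12 p(3)] G.pt_mult_hom[OF P p(1) p23] P _ y])
    fix v assume v: "v \<in> coords g"
    let ?p1 = "\<lambda>v. G.proj1 (x v)" and ?p2 = "\<lambda>v. G.proj2 (x v)" and ?p3 = "\<lambda>v. G.proj3 (x v)"
    have "pt_mult A G G.HHH.P (pt_mult A G G.HHH.P G.proj1 G.proj2) G.proj3 (x v) =
        mat_mult G.HHH.P (mat_mult G.HHH.P ?p1 ?p2) ?p3 v"
      unfolding pt_mult_x[OF P p12 p(3) v v] by (rule mat_mult_cong[OF _ refl v]) (rule pt_mult_x[OF P p(1,2)])
    also have "\<dots> = mat_mult G.HHH.P ?p1 (mat_mult G.HHH.P ?p2 ?p3) v"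
      by (rule G.HHH.P.mat_mult_assoc[OF hom_x_point[OF P p(1)] hom_x_point[OF P p(2)] hom_x_point[OF P p(3)] v])
    also have "\<dots> = pt_mult A G G.HHH.P G.proj1 (pt_mult A G G.HHH.P G.proj2 G.proj3) (x v)"
      unfolding pt_mult_x[OF P p(1) p23 v v] by (rule mat_mult_cong[OF refl _ v]) (rule pt_mult_x[OF P p(2,3), symmetric])
    finally show "pt_mult A G G.HHH.P (pt_mult A G G.HHH.P G.proj1 G.proj2) G.proj3 (x v) =
      pt_mult A G G.HHH.P G.proj1 (pt_mult A G G.HHH.P G.proj2 G.proj3) (x v)" .
  qed
  note Ga = G.algebra_axioms and e = G.counit_point[OF G.algebra_axioms] and id = alg_hom_id[of A G] and S = G.antipode_hom
  have ev: "counit G (x v) \<odot>\<^bsub>G\<^esub> \<one>\<^bsub>G\<^esub> = counit_coord G v" if "v \<in> coords g" for v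
    using that by (cases v) (simp_all add: G_sel(4))
  have Sv: "antipode G (x v) = mat_inv G g x v" if "v \<in> coords g" for v
    using that by (simp add: G_sel(6) mat_inv_G)
  note xG = x_point[folded matrix_point_G]
  show "pt_mult A G G (\<lambda>x. counit G x \<odot>\<^bsub>G\<^esub> \<one>\<^bsub>G\<^esub>) (\<lambda>x. x) y = y"
  proof (rule G_hom_ext[OF G.pt_mult_hom[OF Ga e id] id Ga _ y])
    fix v assume v: "v \<in> coords g"
    show "pt_mult A G G (\<lambda>x. counit G x \<odot>\<^bsub>G\<^esub> \<one>\<^bsub>G\<^esub>) (\<lambda>x. x) (x v) = x v"
      unfolding pt_mult_x[OF Ga e id v v] by (rule trans[OF mat_mult_cong[OF _ _ v] G.mat_mult_one(1)[OF xG v]]) (simp_all add: ev Sv)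
  qed
  show "pt_mult A G G (\<lambda>x. x) (\<lambda>x. counit G x \<odot>\<^bsub>G\<^esub> \<one>\<^bsub>G\<^esub>) y = y"
  proof (rule G_hom_ext[OF G.pt_mult_hom[OF Ga id e] id Ga _ y])
    fix v assume v: "v \<in> coords g"
    show "pt_mult A G G (\<lambda>x. x) (\<lambda>x. counit G x \<odot>\<^bsub>G\<^esub> \<one>\<^bsub>G\<^esub>) (x v) = x v"
      unfolding pt_mult_x[OF Ga id e v v] by (rule trans[OF mat_mult_cong[OF _ _ v] G.mat_mult_one(2)[OF xG v]]) (simp_all add: ev Sv)
  qed
  show "pt_mult A G G (antipode G) (\<lambda>x. x) y = counit G y \<odot>\<^bsub>G\<^esub> \<one>\<^bsub>G\<^esub>"
  proof (rule G_hom_ext[OF G.pt_mult_hom[OF Ga S id] e Ga _ y])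
    fix v assume v: "v \<in> coords g"
    show "pt_mult A G G (antipode G) (\<lambda>x. x) (x v) = counit G (x v) \<odot>\<^bsub>G\<^esub> \<one>\<^bsub>G\<^esub>"
      unfolding pt_mult_x[OF Ga S id v v] ev[OF v] by (rule trans[OF mat_mult_cong[OF _ _ v] G.mat_mult_inv(1)[OF xG v]]) (simp_all add: ev Sv)
  qed
  show "pt_mult A G G (\<lambda>x. x) (antipode G) y = counit G y \<odot>\<^bsub>G\<^esub> \<one>\<^bsub>G\<^esub>"
  proof (rule G_hom_ext[OF G.pt_mult_hom[OF Ga id S] e Ga _ y])
    fix v assume v: "v \<in> coords g"
    show "pt_mult A G G (\<lambda>x. x) (antipode G) (x v) = counit G (x v) \<odot>\<^bsub>G\<^esub> \<one>\<^bsub>G\<^esub>"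
      unfolding pt_mult_x[OF Ga id S v v] ev[OF v] by (rule trans[OF mat_mult_cong[OF _ _ v] G.mat_mult_inv(2)[OF xG v]]) (simp_all add: ev Sv)
  qed
qed

end

text \<open>A common setting for \<open>T\<close> and \<open>N\<close>; \<open>y\<close> is the
  restriction of the generic matrix to the subgroup.\<close>

locale matrix_subgroup = matrix_setting A g + hopf_ideal A "matrix_scheme A g" J
  for A :: "('a, 'r) ring_scheme" and g J
begin

definition "y v = J +>\<^bsub>G\<^esub> x v"

lemma y_point: "matrix_point C g y"
  unfolding y_def by (rule hom_x_point[OF C_algebra coset_hom])

lemma subgroup_data: "hopf_data A C"
  by (rule affine_group_scheme.is_hopf_data[OF closed_subgroup_scheme])

lemma subgroup_ext:
  assumes "f \<in> alg_hom A C D" "h \<in> alg_hom A C D" "algebra A D"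
    and "\<And>v. v \<in> coords g \<Longrightarrow> f (y v) = h (y v)" "z \<in> carrier C"
  shows "f z = h z"
proof -
  obtain w where w: "w \<in> carrier G" "z = J +>\<^bsub>G\<^esub> w" using assms(5) coset_surj by auto
  show ?thesis unfolding w(2)
    by (rule G_hom_ext[OF alg_hom_comp[OF coset_hom assms(1)] alg_hom_comp[OF coset_hom assms(2)] assms(3) _ w(1)])
      (use assms(4) in \<open>simp add: y_def\<close>)
qed

lemma x_closed_G: "v \<in> coords g \<Longrightarrow> x v \<in> carrier G" using x_closed by (simp add: G_fields)

lemma subgroup_comult:
  assumes "v \<in> coords g"
  shows "comult C (y v) = mat_mult (tensor A C C) (\<lambda>v. pure A C C (y v) \<one>\<^bsub>C\<^esub>) (\<lambda>v. pure A C C \<one>\<^bsub>C\<^esub> (y v)) v"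
proof -
  interpret CC: tensor_algebra A C C by (rule tensor_algebra.intro) (rule C_algebra)+
  note xG = x_point[folded matrix_point_G]
  note l = hom_mat(4)[OF G_algebra G.HHH.BC.tensor_algebra G.HHH.BC.pure_left_hom xG]
    and r = hom_mat(4)[OF G_algebra G.HHH.BC.tensor_algebra G.HHH.BC.pure_right_hom xG]
  note tm = G.HHH.BC.tensor_map_hom[OF C_algebra C_algebra coset_hom coset_hom]
  note tp = G.HHH.BC.tensor_map_pure_hom[OF C_algebra C_algebra coset_hom coset_hom]
  have "comult C (y v) = tensor_map A C C p p (mat_mult (tensor A G G) (\<lambda>v. pure A G G (x v) \<one>\<^bsub>G\<^esub>) (\<lambda>v. pure A G G \<one>\<^bsub>G\<^esub> (x v)) v)"
    using closed_subgroup_sel(1)[OF x_closed_G[OF assms]] G_sel(2)[OF assms] by (simp add: y_def)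
  also have "\<dots> = mat_mult (tensor A C C) (\<lambda>v. tensor_map A C C p p (pure A G G (x v) \<one>\<^bsub>G\<^esub>)) (\<lambda>v. tensor_map A C C p p (pure A G G \<one>\<^bsub>G\<^esub> (x v))) v"
    by (rule hom_mat(1)[OF G.HHH.BC.tensor_algebra CC.tensor_algebra tm l r assms])
  also have "\<dots> = mat_mult (tensor A C C) (\<lambda>v. pure A C C (y v) \<one>\<^bsub>C\<^esub>) (\<lambda>v. pure A C C \<one>\<^bsub>C\<^esub> (y v)) v"
    by (rule mat_mult_cong[OF _ _ assms]) (simp_all add: tp x_closed_G y_def alg_hom_one[OF coset_hom])
  finally show ?thesis .
qed

lemma subgroup_counit: "v \<in> coords g \<Longrightarrow> counit C (y v) = counit_coord A v"
  using closed_subgroup_sel(2)[OF x_closed_G] G_sel(4) by (simp add: y_def)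

lemma subgroup_antipode: "v \<in> coords g \<Longrightarrow> antipode C (y v) = mat_inv C g y v"
  using closed_subgroup_sel(3)[OF x_closed_G] G_sel(6) hom_mat(2)[OF G_algebra C_algebra coset_hom x_point[folded matrix_point_G]]
  by (simp add: y_def[abs_def] mat_inv_G)

lemmas subgroup_pt_mult = hom_mat_mult_tensor[OF subgroup_data _ _ _ y_point _ subgroup_comult]

lemma subgroup_pt_inv:
  assumes "algebra A R" "f \<in> alg_hom A C R" "v \<in> coords g"
  shows "pt_inv C f (y v) = mat_inv R g (\<lambda>v. f (y v)) v"
  using hom_mat(2)[OF C_algebra assms(1,2) y_point assms(3)] by (simp add: pt_inv_def subgroup_antipode[OF assms(3)])

text \<open>Both sides of the two compatibilities are algebra homomorphisms, so they need to be
  compared only on the coordinates.\<close>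

lemma subgroup_hom:
  assumes K: "affine_group_scheme A K" and f: "f \<in> alg_hom A C K"
    and \<Delta>: "\<And>v. v \<in> coords g \<Longrightarrow> comult K (f (y v)) =
      mat_mult (tensor A K K) (\<lambda>v. pure A K K (f (y v)) \<one>\<^bsub>K\<^esub>) (\<lambda>v. pure A K K \<one>\<^bsub>K\<^esub> (f (y v))) v"
    and \<epsilon>: "\<And>v. v \<in> coords g \<Longrightarrow> counit K (f (y v)) = counit_coord A v"
  shows "group_scheme_hom A K C f"
proof -
  interpret C: algebra A C by (rule C_algebra)
  have Ka: "algebra A K" using K by (rule affine_group_scheme.axioms)
  interpret Ka: algebra A K by (rule Ka)
  have KD: "comult K \<in> alg_hom A K (tensor A K K)" "counit K \<in> alg_hom A K (base_algebra A)"
    using K by (auto simp: affine_group_scheme_def affine_group_scheme_axioms_def)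
  have CD: "comult C \<in> alg_hom A C (tensor A C C)" "counit C \<in> alg_hom A C (base_algebra A)"
    using subgroup_data by (auto simp: hopf_data_def hopf_data_axioms_def)
  interpret CC: tensor_algebra A C C by (rule tensor_algebra.intro) (rule C_algebra)+
  interpret KK: tensor_algebra A K K by (rule tensor_algebra.intro) (rule Ka)+
  note ff = CC.tensor_map_hom[OF Ka Ka f f] and fp = CC.tensor_map_pure_hom[OF Ka Ka f f]
  note l = hom_mat(4)[OF C_algebra CC.tensor_algebra CC.pure_left_hom y_point]
    and r = hom_mat(4)[OF C_algebra CC.tensor_algebra CC.pure_right_hom y_point]
  have "comult K (f z) = tensor_map A K K f f (comult C z)" if z: "z \<in> carrier C" for z
  proof (rule subgroup_ext[OF alg_hom_comp[OF f KD(1)] alg_hom_comp[OF CD(1) ff] KK.tensor_algebra _ z])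
    fix v assume v: "v \<in> coords g"
    have "tensor_map A K K f f (comult C (y v)) =
        mat_mult (tensor A K K) (\<lambda>v. tensor_map A K K f f (pure A C C (y v) \<one>\<^bsub>C\<^esub>)) (\<lambda>v. tensor_map A K K f f (pure A C C \<one>\<^bsub>C\<^esub> (y v))) v"
      unfolding subgroup_comult[OF v] by (rule hom_mat(1)[OF CC.tensor_algebra KK.tensor_algebra ff l r v])
    also have "\<dots> = comult K (f (y v))" unfolding \<Delta>[OF v]
      by (rule mat_mult_cong[OF _ _ v]) (simp_all add: fp matrix_pointD(1)[OF y_point] alg_hom_one[OF f])
    finally show "comult K (f (y v)) = tensor_map A K K f f (comult C (y v))" by simp
  qed
  moreover have "counit K (f z) = counit C z" if z: "z \<in> carrier C" for z
    by (rule subgroup_ext[OF alg_hom_comp[OF f KD(2)] CD(2) algebra_base[OF is_cring] _ z])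
      (simp add: \<epsilon> subgroup_counit)
  ultimately show ?thesis
    using K f closed_subgroup_scheme by (simp add: group_scheme_hom_def)
qed

end

section \<open>The Hopf ideals of the torus and of its normalizer\<close>

context matrix_setting
begin

abbreviation "J1 \<equiv> I1 A g"
abbreviation "J12 \<equiv> ideal_prod G (I1 A g) (I2 A g)"

lemma x_in_G: "v \<in> coords g \<Longrightarrow> x v \<in> carrier G" using x_closed by (simp add: G_fields)

lemma gens_closed: "{x X12, x X21} \<subseteq> carrier G" "{x X11, x X22} \<subseteq> carrier G"
  using x_in_G by auto

lemma ideals: "ideal J1 G" "ideal (I2 A g) G" "ideal J12 G"
proof -
  show 1: "ideal J1 G" "ideal (I2 A g) G"
    unfolding I1_def I2_def by (rule G.genideal_ideal[OF gens_closed(1)] G.genideal_ideal[OF gens_closed(2)])+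
  show "ideal J12 G" by (rule G.ideal_prod_is_ideal[OF 1])
qed

lemma gens_in: "x X12 \<in> J1" "x X21 \<in> J1" "x X11 \<in> I2 A g" "x X22 \<in> I2 A g"
  unfolding I1_def I2_def using G.genideal_self[OF gens_closed(1)] G.genideal_self[OF gens_closed(2)] by auto

lemma diagonal_kills:
  assumes "algebra A R" "f \<in> alg_hom A G R" "diagonal R (\<lambda>v. f (x v))" "z \<in> J1"
  shows "f z = \<zero>\<^bsub>R\<^esub>"
  by (rule alg_hom_zero_on_genideal[OF G_algebra assms(1,2) gens_closed(1) _ assms(4)[unfolded I1_def]])
    (use assms(3) in \<open>auto simp: diagonal_def\<close>)

text \<open>Lets a vanishing product be extended in one factor from generators to the whole
  generated ideal.\<close>

lemma annihilator_ideal: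
  assumes "algebra A R" "f \<in> alg_hom A G R" "c \<in> carrier R"
  shows "ideal {z \<in> carrier G. c \<otimes>\<^bsub>R\<^esub> f z = \<zero>\<^bsub>R\<^esub>} G"
proof -
  interpret R: algebra A R by fact
  note k = alg_hom_simps[OF assms(2)] alg_hom_zero[OF G_algebra assms(1,2)] alg_hom_uminus[OF G_algebra assms(1,2)]
  have lc: "c \<otimes>\<^bsub>R\<^esub> (f a \<otimes>\<^bsub>R\<^esub> f b) = \<zero>\<^bsub>R\<^esub>" if "c \<otimes>\<^bsub>R\<^esub> f a = \<zero>\<^bsub>R\<^esub>" "a \<in> carrier G" "b \<in> carrier G" for a b
    using that assms(3) R.m_assoc[of c "f a" "f b", symmetric] by (simp add: k)
  show ?thesis
  proof (rule idealI[OF G.ring_axioms])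
    show "subgroup {z \<in> carrier G. c \<otimes>\<^bsub>R\<^esub> f z = \<zero>\<^bsub>R\<^esub>} (add_monoid G)"
      by (rule G.add.subgroupI)
        (use assms(3) in \<open>auto simp: k R.r_distr R.r_minus a_inv_def[symmetric] intro!: exI[of _ "\<zero>\<^bsub>G\<^esub>"]\<close>)
    fix a b assume ab: "a \<in> {z \<in> carrier G. c \<otimes>\<^bsub>R\<^esub> f z = \<zero>\<^bsub>R\<^esub>}" "b \<in> carrier G"
    then show "a \<otimes>\<^bsub>G\<^esub> b \<in> {z \<in> carrier G. c \<otimes>\<^bsub>R\<^esub> f z = \<zero>\<^bsub>R\<^esub>}" by (simp add: k lc)
    then show "b \<otimes>\<^bsub>G\<^esub> a \<in> {z \<in> carrier G. c \<otimes>\<^bsub>R\<^esub> f z = \<zero>\<^bsub>R\<^esub>}" using G.m_comm ab by simp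
  qed
qed

text \<open>The annihilator of the image of a generator of \<open>I2\<close> contains the generators
  of \<open>I1\<close>, hence all of \<open>I1\<close>. So the annihilator of the image of any
  element of \<open>I1\<close> contains the generators of \<open>I2\<close>, hence all of
  \<open>I2\<close>.\<close>

lemma monomial_kills:
  assumes "algebra A R" "f \<in> alg_hom A G R" "monomial R (\<lambda>v. f (x v))" "z \<in> J12"
  shows "f z = \<zero>\<^bsub>R\<^esub>"
proof -
  interpret R: algebra A R by fact
  note k = alg_hom_simps[OF assms(2)]
  have fx: "f (x v) \<in> carrier R" if "v \<in> coords g" for v using k(1) x_in_G[OF that] by simp
  have 1: "f a \<otimes>\<^bsub>R\<^esub> f (x v) = \<zero>\<^bsub>R\<^esub>" if a: "a \<in> J1" and v: "v = X11 \<or> v = X22" for a v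
  proof -
    have fv: "f (x v) \<in> carrier R" "f (x X12) \<in> carrier R" "f (x X21) \<in> carrier R" using fx v by auto
    have "f (x v) \<otimes>\<^bsub>R\<^esub> f (x X12) = \<zero>\<^bsub>R\<^esub>" "f (x v) \<otimes>\<^bsub>R\<^esub> f (x X21) = \<zero>\<^bsub>R\<^esub>"
      using assms(3) v fv R.m_comm by (auto simp: monomial_def)
    then have "J1 \<subseteq> {z \<in> carrier G. f (x v) \<otimes>\<^bsub>R\<^esub> f z = \<zero>\<^bsub>R\<^esub>}"
      unfolding I1_def by (intro G.genideal_minimal annihilator_ideal[OF assms(1,2) fv(1)]) (use gens_closed in auto)
    then show ?thesis using a R.m_comm[OF fv(1)] k(1) by auto
  qed
  have 2: "f a \<otimes>\<^bsub>R\<^esub> f b = \<zero>\<^bsub>R\<^esub>" if a: "a \<in> J1" and b: "b \<in> I2 A g" for a b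
  proof -
    have "a \<in> carrier G" using a ideal.Icarr[OF ideals(1)] by auto
    then have "I2 A g \<subseteq> {z \<in> carrier G. f a \<otimes>\<^bsub>R\<^esub> f z = \<zero>\<^bsub>R\<^esub>}"
      unfolding I2_def by (intro G.genideal_minimal annihilator_ideal[OF assms(1,2)] k(1)) (use gens_closed 1[OF a] in auto)
    then show ?thesis using b by auto
  qed
  show ?thesis using assms(4)
  proof (induction rule: ideal_prod.induct)
    case (prod i j)
    then show ?case using 2[OF prod] ideal.Icarr[OF ideals(1) prod(1)] ideal.Icarr[OF ideals(2) prod(2)] by (simp add: k)
  next
    case (sum a b)
    then show ?case using G.ideal_prod_in_carrier[OF ideals(1,2)] by (simp add: k subset_iff)
  qed
qed

lemma monomial_coset:
  assumes "ideal J G" "J12 \<subseteq> J"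
  shows "monomial (quot G J) (\<lambda>v. J +>\<^bsub>G\<^esub> x v)"
proof -
  interpret Q: algebra_quotient A G J by (intro algebra_quotient.intro algebra_quotient_axioms.intro G_algebra assms)
  have "x v \<otimes>\<^bsub>G\<^esub> x w \<in> J" if "v = X12 \<or> v = X21" "w = X11 \<or> w = X22" for v w
    using assms(2) ideal_prod.prod[of "x v" J1 "x w" "I2 A g" G] gens_in that by auto
  then show ?thesis
    using Q.Q.coset_eq_zero_iff x_in_G by (simp add: monomial_def Q.coset_mult)
qed

text \<open>In this form all three conditions say that an algebra homomorphism kills
  \<open>J\<close>, which can be decided by its matrix.\<close>

lemma hopf_idealI:
  assumes J: "ideal J G"
    and kills: "\<And>z. z \<in> J \<Longrightarrow> tensor_map A (quot G J) (quot G J) (\<lambda>x. J +>\<^bsub>G\<^esub> x) (\<lambda>x. J +>\<^bsub>G\<^esub> x) (comult G z) =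
      \<zero>\<^bsub>tensor A (quot G J) (quot G J)\<^esub>" "\<And>z. z \<in> J \<Longrightarrow> counit G z = \<zero>\<^bsub>A\<^esub>"
      "\<And>z. z \<in> J \<Longrightarrow> J +>\<^bsub>G\<^esub> antipode G z = \<zero>\<^bsub>quot G J\<^esub>"
  shows "hopf_ideal A G J"
proof -
  interpret Q: algebra_quotient A G J by (intro algebra_quotient.intro algebra_quotient_axioms.intro G_algebra assms)
  have "antipode G z \<in> J" if "z \<in> J" for z
    using kills(3)[OF that] Q.Q.coset_eq_zero_iff alg_hom_closed[OF G.antipode_hom] that Q.Q.H_subset by blast
  then show ?thesis
    by (intro hopf_ideal.intro hopf_ideal_axioms.intro matrix_scheme_group J kills)
qed

text \<open>Modulo any ideal, comultiplication and antipode become the product of two generic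
  matrices and the inverse of one. Only the shape of these matrices distinguishes the torus from the
  normalizer.\<close>

lemma structure_mod:
  assumes J: "ideal J G"
  defines "p \<equiv> (\<lambda>x. J +>\<^bsub>G\<^esub> x)" and "K \<equiv> quot G J"
  defines "l \<equiv> (\<lambda>v. pure A K K (p (x v)) \<one>\<^bsub>K\<^esub>)" and "r \<equiv> (\<lambda>v. pure A K K \<one>\<^bsub>K\<^esub> (p (x v)))"
  shows "algebra A K" "algebra A (tensor A K K)" "p \<in> alg_hom A G K"
    and "(\<lambda>z. tensor_map A K K p p (comult G z)) \<in> alg_hom A G (tensor A K K)"
    and "matrix_point (tensor A K K) g l" "matrix_point (tensor A K K) g r"
    and "monomial K (\<lambda>v. p (x v)) \<Longrightarrow> monomial (tensor A K K) l" "monomial K (\<lambda>v. p (x v)) \<Longrightarrow> monomial (tensor A K K) r"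
    and "diagonal K (\<lambda>v. p (x v)) \<Longrightarrow> diagonal (tensor A K K) l" "diagonal K (\<lambda>v. p (x v)) \<Longrightarrow> diagonal (tensor A K K) r"
    and "\<And>v. v \<in> coords g \<Longrightarrow> tensor_map A K K p p (comult G (x v)) = mat_mult (tensor A K K) l r v"
    and "\<And>v. v \<in> coords g \<Longrightarrow> p (antipode G (x v)) = mat_inv K g (\<lambda>v. p (x v)) v"
    and "matrix_point K g (\<lambda>v. p (x v))"
proof -
  interpret Q: algebra_quotient A G J by (intro algebra_quotient.intro algebra_quotient_axioms.intro G_algebra assms)
  show K: "algebra A K" unfolding K_def by (rule Q.quot_algebra)
  show p: "p \<in> alg_hom A G K" unfolding K_def p_def by (rule Q.coset_hom)
  interpret KK: tensor_algebra A K K by (rule tensor_algebra.intro) (rule K)+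
  show T: "algebra A (tensor A K K)" by (rule KK.tensor_algebra)
  note pp = G.HHH.BC.tensor_map_hom[OF K K p p]
  show "(\<lambda>z. tensor_map A K K p p (comult G z)) \<in> alg_hom A G (tensor A K K)"
    by (rule alg_hom_comp[OF G.comult_hom pp])
  note xG = x_point[folded matrix_point_G]
  show px: "matrix_point K g (\<lambda>v. p (x v))" by (rule hom_x_point[OF K p])
  note hl = hom_mat[OF K T KK.pure_left_hom px] and hr = hom_mat[OF K T KK.pure_right_hom px]
  show "matrix_point (tensor A K K) g l" "matrix_point (tensor A K K) g r"
    "monomial K (\<lambda>v. p (x v)) \<Longrightarrow> monomial (tensor A K K) l" "monomial K (\<lambda>v. p (x v)) \<Longrightarrow> monomial (tensor A K K) r"
    "diagonal K (\<lambda>v. p (x v)) \<Longrightarrow> diagonal (tensor A K K) l" "diagonal K (\<lambda>v. p (x v)) \<Longrightarrow> diagonal (tensor A K K) r"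
    unfolding l_def r_def by (fact hl(4) hr(4) | erule hl(5,6) hr(5,6))+
  note gl = hom_mat(4)[OF G_algebra G.HHH.BC.tensor_algebra G.HHH.BC.pure_left_hom xG]
    and gr = hom_mat(4)[OF G_algebra G.HHH.BC.tensor_algebra G.HHH.BC.pure_right_hom xG]
  fix v assume v: "v \<in> coords g"
  have "tensor_map A K K p p (comult G (x v)) = mat_mult (tensor A K K) (\<lambda>v. tensor_map A K K p p (pure A G G (x v) \<one>\<^bsub>G\<^esub>)) (\<lambda>v. tensor_map A K K p p (pure A G G \<one>\<^bsub>G\<^esub> (x v))) v"
    unfolding G_sel(2)[OF v] by (rule hom_mat(1)[OF G.HHH.BC.tensor_algebra T pp gl gr v])
  also have "\<dots> = mat_mult (tensor A K K) l r v"
    unfolding l_def r_def by (rule mat_mult_cong[OF _ _ v])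
      (simp_all add: G.HHH.BC.tensor_map_pure_hom[OF K K p p] x_in_G alg_hom_one[OF p])
  finally show "tensor_map A K K p p (comult G (x v)) = mat_mult (tensor A K K) l r v" .
  show "p (antipode G (x v)) = mat_inv K g (\<lambda>v. p (x v)) v"
    using hom_mat(2)[OF G_algebra K p xG v] by (simp add: G_sel(6)[OF v] mat_inv_G)
qed

text \<open>Diagonal matrices are closed under product and inverse and contain the identity, and a
  homomorphism with a diagonal matrix kills \<open>J1\<close>.\<close>

lemma torus_hopf_ideal: "hopf_ideal A G J1"
proof (rule hopf_idealI[OF ideals(1)])
  note M = structure_mod[OF ideals(1)]
  let ?K = "quot G J1"
  interpret Q: algebra_quotient A G J1 by (intro algebra_quotient.intro algebra_quotient_axioms.intro G_algebra ideals)
  interpret K: algebra A ?K by (rule M(1))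
  interpret KK: algebra A "tensor A ?K ?K" by (rule M(2))
  have d: "diagonal ?K (\<lambda>v. J1 +>\<^bsub>G\<^esub> x v)"
    using gens_in x_in_G by (simp add: diagonal_def Q.Q.coset_eq_zero_iff)
  fix z assume z: "z \<in> J1"
  show "tensor_map A ?K ?K (\<lambda>x. J1 +>\<^bsub>G\<^esub> x) (\<lambda>x. J1 +>\<^bsub>G\<^esub> x) (comult G z) = \<zero>\<^bsub>tensor A ?K ?K\<^esub>"
    by (rule diagonal_kills[OF M(2,4) _ z], subst monomial_cong(2)[of g, OF M(11)], assumption)
      (rule KK.diagonal_mult[OF M(5,6) M(9)[OF d] M(10)[OF d]])
  show "counit G z = \<zero>\<^bsub>A\<^esub>"
    using diagonal_kills[OF algebra_base[OF is_cring] G.counit_hom _ z] G_sel(4) diagonal_one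
    by (simp add: diagonal_def)
  show "J1 +>\<^bsub>G\<^esub> antipode G z = \<zero>\<^bsub>?K\<^esub>"
    by (rule diagonal_kills[OF M(1) alg_hom_comp[OF G.antipode_hom M(3)] _ z], subst monomial_cong(2)[of g, OF M(12)], assumption)
      (rule K.diagonal_inv[OF M(13) d])
qed

lemma normalizer_hopf_ideal: "hopf_ideal A G J12"
proof (rule hopf_idealI[OF ideals(3)])
  note M = structure_mod[OF ideals(3)]
  let ?K = "quot G J12"
  interpret K: algebra A ?K by (rule M(1))
  interpret KK: algebra A "tensor A ?K ?K" by (rule M(2))
  note d = monomial_coset[OF ideals(3) subset_refl]
  fix z assume z: "z \<in> J12"
  show "tensor_map A ?K ?K (\<lambda>x. J12 +>\<^bsub>G\<^esub> x) (\<lambda>x. J12 +>\<^bsub>G\<^esub> x) (comult G z) = \<zero>\<^bsub>tensor A ?K ?K\<^esub>"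
    by (rule monomial_kills[OF M(2,4) _ z], subst monomial_cong(1)[of g, OF M(11)], assumption)
      (rule KK.monomial_mult[OF M(5,6) M(7)[OF d] M(8)[OF d]])
  show "counit G z = \<zero>\<^bsub>A\<^esub>"
    using monomial_kills[OF algebra_base[OF is_cring] G.counit_hom _ z] G_sel(4) monomial_one
    by (simp add: monomial_def)
  show "J12 +>\<^bsub>G\<^esub> antipode G z = \<zero>\<^bsub>?K\<^esub>"
    by (rule monomial_kills[OF M(1) alg_hom_comp[OF G.antipode_hom M(3)] _ z], subst monomial_cong(1)[of g, OF M(12)], assumption)
      (rule K.monomial_inv[OF M(13) d])
qed

end

section \<open>The normalizer of the torus\<close>

definition idem_diag :: "('b, 's) ring_scheme \<Rightarrow> matrix_group \<Rightarrow> (coord \<Rightarrow> 'b) \<Rightarrow> 'b"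
  where "idem_diag R g x = det_inv R g x \<otimes>\<^bsub>R\<^esub> (x X11 \<otimes>\<^bsub>R\<^esub> x X22)"

definition idem_anti :: "('b, 's) ring_scheme \<Rightarrow> matrix_group \<Rightarrow> (coord \<Rightarrow> 'b) \<Rightarrow> 'b"
  where "idem_anti R g x = \<ominus>\<^bsub>R\<^esub> (det_inv R g x \<otimes>\<^bsub>R\<^esub> (x X12 \<otimes>\<^bsub>R\<^esub> x X21))"

context cring
begin

context
  fixes a11 a12 a21 a22 d
  assumes a: "a11 \<in> carrier R" "a12 \<in> carrier R" "a21 \<in> carrier R" "a22 \<in> carrier R" and d: "d \<in> carrier R"
    and z: "a12 \<otimes> a11 = \<zero>" "a12 \<otimes> a22 = \<zero>" "a21 \<otimes> a11 = \<zero>" "a21 \<otimes> a22 = \<zero>"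
begin

lemma idem_identities:
  "(d \<otimes> (a11 \<otimes> a22)) \<oplus> (\<ominus> (d \<otimes> (a12 \<otimes> a21))) = (a11 \<otimes> a22 \<ominus> a12 \<otimes> a21) \<otimes> d"
  "(d \<otimes> (a11 \<otimes> a22)) \<otimes> (\<ominus> (d \<otimes> (a12 \<otimes> a21))) = \<zero>"
  "(d \<otimes> (a11 \<otimes> a22)) \<otimes> a12 = \<zero>" "(d \<otimes> (a11 \<otimes> a22)) \<otimes> a21 = \<zero>"
  "(\<ominus> (d \<otimes> (a12 \<otimes> a21))) \<otimes> a11 = \<zero>" "(\<ominus> (d \<otimes> (a12 \<otimes> a21))) \<otimes> a22 = \<zero>"
  using a d by (simp_all add: ring_expand z z[THEN null_product(1)] z[THEN null_product(2)] z[THEN null_product(3)])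

lemma idem_mult_identities:
  assumes b: "b11 \<in> carrier R" "b12 \<in> carrier R" "b21 \<in> carrier R" "b22 \<in> carrier R" and e: "e \<in> carrier R"
    and z': "b12 \<otimes> b11 = \<zero>" "b12 \<otimes> b22 = \<zero>" "b21 \<otimes> b11 = \<zero>" "b21 \<otimes> b22 = \<zero>"
  shows "(d \<otimes> e) \<otimes> ((a11 \<otimes> b11 \<oplus> a12 \<otimes> b21) \<otimes> (a21 \<otimes> b12 \<oplus> a22 \<otimes> b22)) =
      (d \<otimes> (a11 \<otimes> a22)) \<otimes> (e \<otimes> (b11 \<otimes> b22)) \<oplus> (\<ominus> (d \<otimes> (a12 \<otimes> a21))) \<otimes> (\<ominus> (e \<otimes> (b12 \<otimes> b21)))"
    "\<ominus> ((d \<otimes> e) \<otimes> ((a11 \<otimes> b12 \<oplus> a12 \<otimes> b22) \<otimes> (a21 \<otimes> b11 \<oplus> a22 \<otimes> b21))) =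
      (d \<otimes> (a11 \<otimes> a22)) \<otimes> (\<ominus> (e \<otimes> (b12 \<otimes> b21))) \<oplus> (\<ominus> (d \<otimes> (a12 \<otimes> a21))) \<otimes> (e \<otimes> (b11 \<otimes> b22))"
  using a b d e by (simp_all add: ring_expand a_ac z z[THEN null_product(1)] z[THEN null_product(2)] z[THEN null_product(3)]
      z' z'[THEN null_product(1)] z'[THEN null_product(2)] z'[THEN null_product(3)])

end

context
  fixes x g assumes x: "matrix_point R g x" "monomial R x"
begin

private lemmas cl = matrix_pointD(2-5)[OF x(1)] det_inv_closed[OF x(1)]
private lemma mz: "x X12 \<otimes> x X11 = \<zero>" "x X12 \<otimes> x X22 = \<zero>" "x X21 \<otimes> x X11 = \<zero>" "x X21 \<otimes> x X22 = \<zero>"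
  using x(2) by (auto simp: monomial_def)
private lemmas I = idem_identities[OF cl mz, folded idem_diag_def idem_anti_def det2_def, unfolded matrix_pointD(7)[OF x(1)]]

lemma idem_closed: "idem_diag R g x \<in> carrier R" "idem_anti R g x \<in> carrier R"
  using cl by (auto simp: idem_diag_def idem_anti_def)

lemma idem_sum: "idem_diag R g x \<oplus> idem_anti R g x = \<one>"
  and idem_orth: "idem_diag R g x \<otimes> idem_anti R g x = \<zero>"
  and idem_zero: "idem_diag R g x \<otimes> x X12 = \<zero>" "idem_diag R g x \<otimes> x X21 = \<zero>"
    "idem_anti R g x \<otimes> x X11 = \<zero>" "idem_anti R g x \<otimes> x X22 = \<zero>"
  by (rule I)+

text \<open>Each entry is annihilated by one of the two idempotents, and their sum is
  \<open>1\<close>, so the other one fixes it.\<close>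

lemma idem_fix: "idem_diag R g x \<otimes> x X11 = x X11" "idem_diag R g x \<otimes> x X22 = x X22"
    "idem_anti R g x \<otimes> x X12 = x X12" "idem_anti R g x \<otimes> x X21 = x X21"
proof -
  have s: "(idem_diag R g x \<oplus> idem_anti R g x) \<otimes> x v = x v" if "v \<in> {X11, X12, X21, X22}" for v
    using that cl idem_sum by auto
  show "idem_diag R g x \<otimes> x X11 = x X11" "idem_diag R g x \<otimes> x X22 = x X22"
    "idem_anti R g x \<otimes> x X12 = x X12" "idem_anti R g x \<otimes> x X21 = x X21"
    using s[of X11] s[of X12] s[of X21] s[of X22] idem_zero cl idem_closed by (simp_all add: l_distr)
qed

lemma idem_inv: "idem_diag R g (mat_inv R g x) = idem_diag R g x" "idem_anti R g (mat_inv R g x) = idem_anti R g x"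
proof -
  define D where "D = det_inv R g (mat_inv R g x)"
  have D: "D \<in> carrier R" unfolding D_def by (rule det_inv_closed[OF matrix_point_inv[OF x(1)]])
  have one: "D \<otimes> det_inv R g x = \<one>"
    using matrix_pointD(7)[OF x(1)] det2_closed[OF x(1)] by (cases g) (auto simp: D_def)
  \<comment> \<open>A product of two entries of the inverse matrix carries the factor
    \<open>det_inv R g x\<close> twice; \<open>D\<close> cancels one of them.\<close>
  have *: "D \<otimes> ((det_inv R g x \<otimes> p) \<otimes> (det_inv R g x \<otimes> q)) = det_inv R g x \<otimes> (q \<otimes> p)" if "p \<in> carrier R" "q \<in> carrier R" for p q
  proof -
    have "D \<otimes> ((det_inv R g x \<otimes> p) \<otimes> (det_inv R g x \<otimes> q)) = (D \<otimes> det_inv R g x) \<otimes> (det_inv R g x \<otimes> (q \<otimes> p))"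
      using D cl that by (simp add: m_ac)
    then show ?thesis using one cl that by simp
  qed
  show "idem_diag R g (mat_inv R g x) = idem_diag R g x"
    using *[OF cl(4) cl(1)] by (simp add: idem_diag_def D_def[symmetric])
  show "idem_anti R g (mat_inv R g x) = idem_anti R g x"
    using *[OF cl(2) cl(3)] cl m_comm[OF cl(2,3)] by (simp add: idem_anti_def D_def[symmetric] l_minus r_minus)
qed

end

text \<open>The idempotents are the indicator functions of the two components, which multiply like
  the group of order two: the product is diagonal exactly where both factors are on the same
  component. The other terms vanish by \<open>monomial\<close>.\<close>

lemma idem_mult:
  assumes x: "matrix_point R g x" "monomial R x" and y: "matrix_point R g y" "monomial R y"
  shows "idem_diag R g (mat_mult R x y) = idem_diag R g x \<otimes> idem_diag R g y \<oplus> idem_anti R g x \<otimes> idem_anti R g y"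
    "idem_anti R g (mat_mult R x y) = idem_diag R g x \<otimes> idem_anti R g y \<oplus> idem_anti R g x \<otimes> idem_diag R g y"
proof -
  note cx = matrix_pointD(2-5)[OF x(1)] det_inv_closed[OF x(1)] and cy = matrix_pointD(2-5)[OF y(1)] det_inv_closed[OF y(1)]
  have "det_inv R g (mat_mult R x y) = det_inv R g x \<otimes> det_inv R g y" by (cases g) auto
  then show "idem_diag R g (mat_mult R x y) = idem_diag R g x \<otimes> idem_diag R g y \<oplus> idem_anti R g x \<otimes> idem_anti R g y"
    "idem_anti R g (mat_mult R x y) = idem_diag R g x \<otimes> idem_anti R g y \<oplus> idem_anti R g x \<otimes> idem_diag R g y"
    using idem_mult_identities[OF cx _ _ _ _ cy] x(2) y(2) by (simp_all add: idem_diag_def idem_anti_def monomial_def)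
qed

lemma idem_diagonal:
  assumes "matrix_point R g y" "diagonal R y"
  shows "idem_diag R g y = \<one>" "idem_anti R g y = \<zero>"
proof -
  note cl = matrix_pointD(2-5)[OF assms(1)] det_inv_closed[OF assms(1)]
  show "idem_anti R g y = \<zero>" using assms(2) cl by (simp add: idem_anti_def diagonal_def)
  then show "idem_diag R g y = \<one>"
    using idem_sum[OF assms(1) diagonal_monomial[OF assms]] idem_closed[OF assms(1) diagonal_monomial[OF assms]] by simp
qed

end

lemma hom_idem:
  assumes "algebra A B" "algebra A C" "k \<in> alg_hom A B C" "matrix_point B g x"
  shows "k (idem_diag B g x) = idem_diag C g (\<lambda>v. k (x v))" "k (idem_anti B g x) = idem_anti C g (\<lambda>v. k (x v))"
proof -
  interpret B: algebra A B by fact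
  note k = alg_hom_simps[OF assms(3)] alg_hom_uminus[OF assms(1-3)]
  note cl = matrix_pointD(2-5)[OF assms(4)] B.det_inv_closed[OF assms(4)]
  have "k (det_inv B g x) = det_inv C g (\<lambda>v. k (x v))" by (cases g) (simp_all add: k)
  then show "k (idem_diag B g x) = idem_diag C g (\<lambda>v. k (x v))" "k (idem_anti B g x) = idem_anti C g (\<lambda>v. k (x v))"
    using cl by (simp_all add: idem_diag_def idem_anti_def k)
qed

lemma idem_cong:
  assumes "\<And>v. v \<in> coords g \<Longrightarrow> x v = x' v"
  shows "idem_diag R g x = idem_diag R g x'" "idem_anti R g x = idem_anti R g x'"
  using det_cong(2)[of g x x' R, OF assms] assms by (auto simp: idem_diag_def idem_anti_def)

text \<open>Complementary orthogonal idempotents split \<open>C\<close> as a product of two rings;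
  the combined map follows \<open>f\<close> into one factor and \<open>h\<close> into the
  other.\<close>

lemma alg_hom_idem_combine:
  assumes "algebra A B" "algebra A C" "f \<in> alg_hom A B C" "h \<in> alg_hom A B C"
    and "e \<in> carrier C" "e' \<in> carrier C" "e \<oplus>\<^bsub>C\<^esub> e' = \<one>\<^bsub>C\<^esub>" "e \<otimes>\<^bsub>C\<^esub> e' = \<zero>\<^bsub>C\<^esub>"
  shows "(\<lambda>z. e \<otimes>\<^bsub>C\<^esub> f z \<oplus>\<^bsub>C\<^esub> e' \<otimes>\<^bsub>C\<^esub> h z) \<in> alg_hom A B C"
proof -
  interpret C: algebra A C by fact
  note k = alg_hom_simps[OF assms(3)] alg_hom_simps[OF assms(4)]
  have "e \<otimes>\<^bsub>C\<^esub> (e \<oplus>\<^bsub>C\<^esub> e') = e" "e' \<otimes>\<^bsub>C\<^esub> (e \<oplus>\<^bsub>C\<^esub> e') = e'" using assms(5-7) by simp_all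
  then have ee: "e \<otimes>\<^bsub>C\<^esub> e = e" "e' \<otimes>\<^bsub>C\<^esub> e' = e'" "e' \<otimes>\<^bsub>C\<^esub> e = \<zero>\<^bsub>C\<^esub>"
    using assms(5,6,8) C.m_comm[of e' e] by (simp_all add: C.r_distr)
  show ?thesis
  proof (rule alg_homI, rule lin_mapI)
    fix x y assume x: "x \<in> carrier B" and y: "y \<in> carrier B"
    have cl: "f x \<in> carrier C" "f y \<in> carrier C" "h x \<in> carrier C" "h y \<in> carrier C" using x y by (simp_all add: k)
    have 1: "(e \<otimes>\<^bsub>C\<^esub> a) \<otimes>\<^bsub>C\<^esub> (e \<otimes>\<^bsub>C\<^esub> b) = e \<otimes>\<^bsub>C\<^esub> (a \<otimes>\<^bsub>C\<^esub> b)" "(e' \<otimes>\<^bsub>C\<^esub> a) \<otimes>\<^bsub>C\<^esub> (e' \<otimes>\<^bsub>C\<^esub> b) = e' \<otimes>\<^bsub>C\<^esub> (a \<otimes>\<^bsub>C\<^esub> b)"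
      "(e \<otimes>\<^bsub>C\<^esub> a) \<otimes>\<^bsub>C\<^esub> (e' \<otimes>\<^bsub>C\<^esub> b) = \<zero>\<^bsub>C\<^esub>" "(e' \<otimes>\<^bsub>C\<^esub> a) \<otimes>\<^bsub>C\<^esub> (e \<otimes>\<^bsub>C\<^esub> b) = \<zero>\<^bsub>C\<^esub>"
      if "a \<in> carrier C" "b \<in> carrier C" for a b
    proof -
      have "(c \<otimes>\<^bsub>C\<^esub> a) \<otimes>\<^bsub>C\<^esub> (c' \<otimes>\<^bsub>C\<^esub> b) = (c \<otimes>\<^bsub>C\<^esub> c') \<otimes>\<^bsub>C\<^esub> (a \<otimes>\<^bsub>C\<^esub> b)" if "c \<in> carrier C" "c' \<in> carrier C" for c c'
        using that \<open>a \<in> carrier C\<close> \<open>b \<in> carrier C\<close> by (simp add: C.m_ac)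
      then show "(e \<otimes>\<^bsub>C\<^esub> a) \<otimes>\<^bsub>C\<^esub> (e \<otimes>\<^bsub>C\<^esub> b) = e \<otimes>\<^bsub>C\<^esub> (a \<otimes>\<^bsub>C\<^esub> b)" "(e' \<otimes>\<^bsub>C\<^esub> a) \<otimes>\<^bsub>C\<^esub> (e' \<otimes>\<^bsub>C\<^esub> b) = e' \<otimes>\<^bsub>C\<^esub> (a \<otimes>\<^bsub>C\<^esub> b)"
        "(e \<otimes>\<^bsub>C\<^esub> a) \<otimes>\<^bsub>C\<^esub> (e' \<otimes>\<^bsub>C\<^esub> b) = \<zero>\<^bsub>C\<^esub>" "(e' \<otimes>\<^bsub>C\<^esub> a) \<otimes>\<^bsub>C\<^esub> (e \<otimes>\<^bsub>C\<^esub> b) = \<zero>\<^bsub>C\<^esub>"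
        using assms(5,6,8) ee that by simp_all
    qed
    show "e \<otimes>\<^bsub>C\<^esub> f (x \<otimes>\<^bsub>B\<^esub> y) \<oplus>\<^bsub>C\<^esub> e' \<otimes>\<^bsub>C\<^esub> h (x \<otimes>\<^bsub>B\<^esub> y) =
        (e \<otimes>\<^bsub>C\<^esub> f x \<oplus>\<^bsub>C\<^esub> e' \<otimes>\<^bsub>C\<^esub> h x) \<otimes>\<^bsub>C\<^esub> (e \<otimes>\<^bsub>C\<^esub> f y \<oplus>\<^bsub>C\<^esub> e' \<otimes>\<^bsub>C\<^esub> h y)"
      using x y cl assms(5,6) by (simp add: k C.l_distr C.r_distr 1)
    show "e \<otimes>\<^bsub>C\<^esub> f (x \<oplus>\<^bsub>B\<^esub> y) \<oplus>\<^bsub>C\<^esub> e' \<otimes>\<^bsub>C\<^esub> h (x \<oplus>\<^bsub>B\<^esub> y) =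
        (e \<otimes>\<^bsub>C\<^esub> f x \<oplus>\<^bsub>C\<^esub> e' \<otimes>\<^bsub>C\<^esub> h x) \<oplus>\<^bsub>C\<^esub> (e \<otimes>\<^bsub>C\<^esub> f y \<oplus>\<^bsub>C\<^esub> e' \<otimes>\<^bsub>C\<^esub> h y)"
      using x y cl assms(5,6) by (simp add: k C.r_distr C.a_ac)
  qed (use assms(5-7) in \<open>simp_all add: k C.smult_r_distr C.smult_mult_right\<close>)
qed

text \<open>The sign making \<open>(0, 1; sign, 0)\<close> a point of the group.\<close>

fun weyl_sign :: "('b, 's) ring_scheme \<Rightarrow> matrix_group \<Rightarrow> 'b"
  where "weyl_sign R GL2 = \<one>\<^bsub>R\<^esub>" | "weyl_sign R SL2 = \<ominus>\<^bsub>R\<^esub> \<one>\<^bsub>R\<^esub>"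

text \<open>The determinant is \<open>- weyl_sign R g\<close>, which is its own inverse; hence the
  value at \<open>Dinv\<close>.\<close>

fun weyl_coord :: "('b, 's) ring_scheme \<Rightarrow> matrix_group \<Rightarrow> coord \<Rightarrow> 'b"
  where
    "weyl_coord R g X11 = \<zero>\<^bsub>R\<^esub>"
  | "weyl_coord R g X12 = \<one>\<^bsub>R\<^esub>"
  | "weyl_coord R g X21 = weyl_sign R g"
  | "weyl_coord R g X22 = \<zero>\<^bsub>R\<^esub>"
  | "weyl_coord R g Dinv = \<ominus>\<^bsub>R\<^esub> weyl_sign R g"

context cring
begin

lemma weyl_sign: "weyl_sign R g \<in> carrier R" "weyl_sign R g \<otimes> weyl_sign R g = \<one>"
  by (cases g; simp add: l_minus r_minus)+

lemma weyl_point: "matrix_point R g (weyl_coord R g)"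
  unfolding matrix_point_def
  by (cases g) (auto simp: det2_def a_minus_def l_minus r_minus)

lemma weyl_monomial: "monomial R (weyl_coord R g)"
  by (simp add: monomial_def weyl_sign)

lemma weyl_idem: "idem_diag R g (weyl_coord R g) = \<zero>" "idem_anti R g (weyl_coord R g) = \<one>"
  by (cases g; simp add: idem_diag_def idem_anti_def l_minus r_minus)+

lemma one_idem: "idem_diag R g (counit_coord R) = \<one>" "idem_anti R g (counit_coord R) = \<zero>"
  by (cases g; simp add: idem_diag_def idem_anti_def)+

end

lemma hom_weyl_coord:
  assumes "algebra A B" "algebra A C" "k \<in> alg_hom A B C"
  shows "k (weyl_coord B g v) = weyl_coord C g v"
proof -
  interpret B: algebra A B by fact
  note k = alg_hom_simps[OF assms(3)] alg_hom_uminus[OF assms] alg_hom_zero[OF assms]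
  have "k (weyl_sign B g) = weyl_sign C g" by (cases g) (simp_all add: k)
  then show ?thesis by (cases v) (simp_all add: k B.weyl_sign)
qed

text \<open>The homomorphism from \<open>k[T]\<close> or \<open>k[N]\<close> given by a matrix.\<close>

definition lift ::
    "('a, 'r) ring_scheme \<Rightarrow> ('a, 'b, 's) module_scheme \<Rightarrow> (coord \<Rightarrow> 'b) \<Rightarrow> (coord multiset \<Rightarrow> 'a) set set \<Rightarrow> 'b"
  where "lift A R \<phi> = induced (induced (poly_eval A R \<phi>))"

section \<open>Universal properties of \<open>k[T]\<close> and \<open>k[N]\<close>\<close>

context matrix_setting
begin

sublocale T: matrix_subgroup A g J1
  by (rule matrix_subgroup.intro[OF matrix_setting_axioms torus_hopf_ideal])

sublocale N: matrix_subgroup A g J12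
  by (rule matrix_subgroup.intro[OF matrix_setting_axioms normalizer_hopf_ideal])

abbreviation "t \<equiv> T.y"
abbreviation "n \<equiv> N.y"
abbreviation "T \<equiv> torus A g"
abbreviation "N \<equiv> normalizer A g"

lemma T_eq: "T.C = T" and N_eq: "N.C = N"
  by (simp_all only: torus_def normalizer_def)

lemmas T_group = T.closed_subgroup_scheme[unfolded T_eq] and N_group = N.closed_subgroup_scheme[unfolded N_eq]
lemmas T_algebra = T.C_algebra[unfolded T_eq] and N_algebra = N.C_algebra[unfolded N_eq]
lemmas t_point = T.y_point[unfolded T_eq] and n_point = N.y_point[unfolded N_eq]
lemmas N_ext = N.subgroup_ext[unfolded N_eq]
lemmas N_data = N.subgroup_data[unfolded N_eq]
lemmas N_pt_mult = N.subgroup_pt_mult[unfolded N_eq] and N_pt_inv = N.subgroup_pt_inv[unfolded N_eq]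
lemmas N_counit = N.subgroup_counit[unfolded N_eq]

lemma n_monomial: "monomial N n"
  using monomial_coset[OF ideals(3) subset_refl] by (simp add: monomial_def N.y_def N.C_fields flip: N_eq)

lemma t_diagonal: "diagonal T t"
  using T.B.Q.coset_eq_zero_iff gens_in(1,2) x_in_G by (simp add: diagonal_def T.y_def T.C_fields flip: T_eq)

text \<open>Evaluation descends twice, through the determinant relation and then through
  \<open>J12\<close>, which a monomial matrix kills. So \<open>k[N]\<close> represents the monomial
  points.\<close>

lemma N_lift:
  assumes "algebra A R" "matrix_point R g \<phi>" "monomial R \<phi>"
  shows "lift A R \<phi> \<in> alg_hom A N R" "\<And>v. v \<in> coords g \<Longrightarrow> lift A R \<phi> (n v) = \<phi> v"
proof -
  note c = coord_lift[OF is_cring assms(1,2), folded alg_hom_G]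
  have "monomial R (\<lambda>v. induced (poly_eval A R \<phi>) (x v))"
    using assms(3) monomial_cong(1)[of g "\<lambda>v. induced (poly_eval A R \<phi>) (x v)" \<phi> R] c(2) by simp
  then have Z: "induced (poly_eval A R \<phi>) z = \<zero>\<^bsub>R\<^esub>" if "z \<in> J12" for z
    using monomial_kills[OF assms(1) c(1)] that by simp
  show "lift A R \<phi> \<in> alg_hom A N R"
    unfolding lift_def by (rule N.closed_subgroup_induced(1)[OF assms(1) c(1) Z, unfolded N_eq])
  show "lift A R \<phi> (n v) = \<phi> v" if "v \<in> coords g" for v
    using N.closed_subgroup_induced(2)[OF assms(1) c(1) _ x_in_G[OF that]] Z c(2)[OF that] by (simp add: lift_def N.y_def)
qed

lemma T_lift:
  assumes "algebra A R" "matrix_point R g \<phi>" "diagonal R \<phi>"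
  shows "lift A R \<phi> \<in> alg_hom A T R" "\<And>v. v \<in> coords g \<Longrightarrow> lift A R \<phi> (t v) = \<phi> v"
proof -
  note c = coord_lift[OF is_cring assms(1,2), folded alg_hom_G]
  have "diagonal R (\<lambda>v. induced (poly_eval A R \<phi>) (x v))"
    using assms(3) monomial_cong(2)[of g "\<lambda>v. induced (poly_eval A R \<phi>) (x v)" \<phi> R] c(2) by simp
  then have Z: "induced (poly_eval A R \<phi>) z = \<zero>\<^bsub>R\<^esub>" if "z \<in> J1" for z
    using diagonal_kills[OF assms(1) c(1)] that by simp
  show "lift A R \<phi> \<in> alg_hom A T R"
    unfolding lift_def by (rule T.closed_subgroup_induced(1)[OF assms(1) c(1) Z, unfolded T_eq])
  show "lift A R \<phi> (t v) = \<phi> v" if "v \<in> coords g" for v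
    using T.closed_subgroup_induced(2)[OF assms(1) c(1) _ x_in_G[OF that]] Z c(2)[OF that] by (simp add: lift_def T.y_def)
qed

abbreviation "\<iota> \<equiv> torus_incl A g"

text \<open>A diagonal matrix is monomial, so the reduction from \<open>k[G]\<close> to
  \<open>k[T]\<close> kills \<open>J12\<close> and factors through \<open>k[N]\<close>.\<close>

lemma \<iota>_hom: "\<iota> \<in> alg_hom A N T"
  and \<iota>_coset: "\<And>z. z \<in> carrier G \<Longrightarrow> \<iota> (J12 +>\<^bsub>G\<^esub> z) = J1 +>\<^bsub>G\<^esub> z"
proof -
  interpret Ta: algebra A T by (rule T_algebra)
  have Z: "J1 +>\<^bsub>G\<^esub> z = \<zero>\<^bsub>T\<^esub>" if "z \<in> J12" for z
    by (rule monomial_kills[OF T_algebra T.coset_hom[unfolded T_eq] _ that])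
      (rule Ta.diagonal_monomial[OF t_point t_diagonal, unfolded T.y_def[abs_def]])
  note I = N.closed_subgroup_induced[OF T_algebra T.coset_hom[unfolded T_eq] Z, unfolded N_eq, folded torus_incl_def]
  show "\<iota> \<in> alg_hom A N T" by (rule I(1))
  show "\<And>z. z \<in> carrier G \<Longrightarrow> \<iota> (J12 +>\<^bsub>G\<^esub> z) = J1 +>\<^bsub>G\<^esub> z" by (rule I(2))
qed

lemma \<iota>_n: "v \<in> coords g \<Longrightarrow> \<iota> (n v) = t v"
  by (simp add: N.y_def T.y_def \<iota>_coset x_in_G)

lemma \<iota>_surj: "\<iota> ` carrier N = carrier T"
proof -
  have "\<iota> ` carrier N = (\<lambda>z. \<iota> (J12 +>\<^bsub>G\<^esub> z)) ` carrier G"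
    unfolding N.coset_surj[unfolded N_eq, symmetric] by (simp add: image_image)
  also have "\<dots> = (\<lambda>z. J1 +>\<^bsub>G\<^esub> z) ` carrier G" by (rule image_cong) (simp_all add: \<iota>_coset)
  also have "\<dots> = carrier T" by (rule T.coset_surj[unfolded T_eq])
  finally show ?thesis .
qed

lemma \<iota>_group_hom: "group_scheme_hom A T N \<iota>"
proof (rule N.subgroup_hom[OF T_group, unfolded N_eq, OF \<iota>_hom])
  fix v assume v: "v \<in> coords g"
  show "comult T (\<iota> (n v)) = mat_mult (tensor A T T) (\<lambda>v. pure A T T (\<iota> (n v)) \<one>\<^bsub>T\<^esub>) (\<lambda>v. pure A T T \<one>\<^bsub>T\<^esub> (\<iota> (n v))) v"
    unfolding \<iota>_n[OF v] T.subgroup_comult[OF v, unfolded T_eq] by (rule mat_mult_cong[OF _ _ v]) (simp_all add: \<iota>_n)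
  show "counit T (\<iota> (n v)) = counit_coord A v"
    unfolding \<iota>_n[OF v] by (rule T.subgroup_counit[OF v, unfolded T_eq])
qed

end

section \<open>Laurent polynomials\<close>

context cring
begin

text \<open>When \<open>e + e' = 1\<close>, the element \<open>e - s e'\<close> is its own inverse.
  It is the unit by which \<open>u y\<close> differs from the determinant.\<close>

lemma sign_idem_square:
  assumes "e \<in> carrier R" "e' \<in> carrier R" "s \<in> carrier R"
    and z: "e \<otimes> e = e" "e' \<otimes> e' = e'" "e \<otimes> e' = \<zero>" "s \<otimes> s = \<one>"
  shows "(e \<ominus> s \<otimes> e') \<otimes> (e \<ominus> s \<otimes> e') = e \<oplus> e'"
proof -
  have "(e \<ominus> s \<otimes> e') \<otimes> (e \<ominus> s \<otimes> e') = (e \<otimes> e) \<oplus> (s \<otimes> s) \<otimes> (e' \<otimes> e') \<ominus> s \<otimes> (e \<otimes> e') \<ominus> s \<otimes> (e \<otimes> e')"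
    using assms(1-3) by algebra
  then show ?thesis using assms(1-3) by (simp add: z minus_eq)
qed

text \<open>On the diagonal component \<open>u y\<close> is the determinant, on the other one it is
  \<open>- s\<close> times the determinant. With \<open>d\<close> the inverse determinant the result
  is therefore \<open>e - s e'\<close>.\<close>

lemma unit_product:
  assumes a: "a11 \<in> carrier R" "a12 \<in> carrier R" "a21 \<in> carrier R" "a22 \<in> carrier R" and s: "s \<in> carrier R" and d: "d \<in> carrier R"
    and z: "a12 \<otimes> a11 = \<zero>" "a12 \<otimes> a22 = \<zero>" "a21 \<otimes> a11 = \<zero>" "a21 \<otimes> a22 = \<zero>"
  shows "((a11 \<oplus> s \<otimes> a21) \<otimes> (a22 \<oplus> a12)) \<otimes> d = d \<otimes> (a11 \<otimes> a22) \<ominus> s \<otimes> (\<ominus> (d \<otimes> (a12 \<otimes> a21)))"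
  using a d s by (simp_all add: ring_expand z z[THEN null_product(1)] z[THEN null_product(2)] z[THEN null_product(3)])

text \<open>
  On the diagonal matrices the pair \<open>(u, y)\<close> is \<open>(x\<^sub>1\<^sub>1, x\<^sub>2\<^sub>2)\<close>, on the antidiagonal ones \<open>(s x\<^sub>2\<^sub>1, x\<^sub>1\<^sub>2)\<close>;
  \<open>laurent_inv\<close> is the inverse of \<open>u y\<close>.
\<close>

definition "laurent_u g x = x X11 \<oplus> weyl_sign R g \<otimes> x X21"
definition "laurent_y x = x X22 \<oplus> x X12"
definition "laurent_inv g x = det_inv R g x \<otimes> (idem_diag R g x \<ominus> weyl_sign R g \<otimes> idem_anti R g x)"

text \<open>The diagonal matrix \<open>diag(u, y)\<close>. On the component of \<open>e\<close> the
  given matrix equals it, on that of \<open>e'\<close> it equals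
  \<open>w diag(u, y)\<close>.\<close>

fun laurent_coord where
  "laurent_coord g x X11 = laurent_u g x"
| "laurent_coord g x X12 = \<zero>"
| "laurent_coord g x X21 = \<zero>"
| "laurent_coord g x X22 = laurent_y x"
| "laurent_coord g x Dinv = laurent_inv g x"

context
  fixes x g assumes x: "matrix_point R g x" "monomial R x"
begin

private lemmas entries_closed = matrix_pointD(2-5)[OF x(1)] det_inv_closed[OF x(1)] idem_closed[OF x] weyl_sign[of g]

private lemma entries_orth: "x X12 \<otimes> x X11 = \<zero>" "x X12 \<otimes> x X22 = \<zero>" "x X21 \<otimes> x X11 = \<zero>" "x X21 \<otimes> x X22 = \<zero>"
  using x(2) by (auto simp: monomial_def)

lemma idem_idem: "idem_diag R g x \<otimes> idem_diag R g x = idem_diag R g x" "idem_anti R g x \<otimes> idem_anti R g x = idem_anti R g x"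
proof -
  have "idem_diag R g x \<otimes> (idem_diag R g x \<oplus> idem_anti R g x) = idem_diag R g x"
    "idem_anti R g x \<otimes> (idem_diag R g x \<oplus> idem_anti R g x) = idem_anti R g x"
    using idem_sum[OF x] entries_closed by simp_all
  then show "idem_diag R g x \<otimes> idem_diag R g x = idem_diag R g x" "idem_anti R g x \<otimes> idem_anti R g x = idem_anti R g x"
    using idem_orth[OF x] entries_closed m_comm[of "idem_anti R g x" "idem_diag R g x"] by (simp_all add: r_distr)
qed

lemma laurent_closed: "laurent_u g x \<in> carrier R" "laurent_y x \<in> carrier R" "laurent_inv g x \<in> carrier R"
  using entries_closed by (simp_all add: laurent_u_def laurent_y_def laurent_inv_def)

lemma laurent_product: "laurent_u g x \<otimes> laurent_y x \<otimes> laurent_inv g x = \<one>"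
proof -
  let ?D = "idem_diag R g x \<ominus> weyl_sign R g \<otimes> idem_anti R g x"
  have D: "?D \<in> carrier R" using entries_closed by simp
  have uyd: "laurent_u g x \<otimes> laurent_y x \<otimes> det_inv R g x = ?D"
    unfolding laurent_u_def laurent_y_def idem_diag_def idem_anti_def
    by (rule unit_product[OF entries_closed(1-4) entries_closed(8,5) entries_orth])
  have "laurent_u g x \<otimes> laurent_y x \<otimes> laurent_inv g x = (laurent_u g x \<otimes> laurent_y x \<otimes> det_inv R g x) \<otimes> ?D"
    unfolding laurent_inv_def using laurent_closed entries_closed D by (simp add: m_assoc)
  also have "\<dots> = idem_diag R g x \<oplus> idem_anti R g x"
    unfolding uyd by (rule sign_idem_square[OF entries_closed(6-8) idem_idem idem_orth[OF x] entries_closed(9)])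
  finally show ?thesis using idem_sum[OF x] by simp
qed

text \<open>Here \<open>s = - 1\<close>, so \<open>e - s e'\<close> is \<open>e + e' = 1\<close>.
  Thus \<open>y\<close> is the inverse of \<open>u\<close>, and one Laurent variable
  suffices.\<close>

lemma laurent_SL2: "g = SL2 \<Longrightarrow> laurent_u g x \<otimes> laurent_y x = \<one>"
proof -
  assume g: "g = SL2"
  have "((x X11 \<oplus> weyl_sign R g \<otimes> x X21) \<otimes> (x X22 \<oplus> x X12)) \<otimes> \<one> = idem_diag R g x \<oplus> idem_anti R g x"
    unfolding unit_product[OF entries_closed(1-4) entries_closed(8) one_closed entries_orth] using entries_closed g
    by (simp add: idem_diag_def idem_anti_def a_minus_def l_minus r_minus)
  then show ?thesis using idem_sum[OF x] entries_closed by (simp add: laurent_u_def laurent_y_def)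
qed

text \<open>Each idempotent removes the summand of \<open>u\<close> or \<open>y\<close> that belongs
  to the other component. In the lower left entry the sign of \<open>w\<close> meets the sign in
  \<open>u\<close>, and \<open>s s = 1\<close>.\<close>

lemma laurent_decomposition:
  assumes "v \<in> coords g"
  shows "idem_diag R g x \<otimes> laurent_coord g x v \<oplus>
    idem_anti R g x \<otimes> mat_mult R (weyl_coord R g) (laurent_coord g x) v = x v"
  using assms
proof (cases rule: coords_cases[consumes 1])
  \<comment> \<open>Only \<open>GL2\<close> has this coordinate, so \<open>s = 1\<close>. The entry
    of \<open>diag(u, y)\<close> is \<open>d (e - e')\<close>, that of \<open>w\<close> is
    \<open>- 1\<close>, and the combination becomes \<open>d (e - e')^2 = d\<close>.\<close>
  case 5
  then have D: "x Dinv \<in> carrier R" using matrix_pointD(6)[OF x(1)] by simp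
  let ?e = "idem_diag R g x" and ?e' = "idem_anti R g x"
  have "?e \<otimes> (x Dinv \<otimes> (?e \<ominus> ?e')) \<oplus> ?e' \<otimes> (\<ominus> \<one> \<otimes> (x Dinv \<otimes> (?e \<ominus> ?e'))) =
      x Dinv \<otimes> ((?e \<ominus> \<one> \<otimes> ?e') \<otimes> (?e \<ominus> \<one> \<otimes> ?e'))"
    using D entries_closed by (simp add: a_minus_def l_distr r_distr l_minus r_minus m_ac a_ac)
  also have "\<dots> = x Dinv"
    using sign_idem_square[OF entries_closed(6,7) one_closed idem_idem idem_orth[OF x]] idem_sum[OF x] D by simp
  finally show ?thesis using 5 D entries_closed by (simp add: laurent_inv_def)
next
  case 1
  have "idem_diag R g x \<otimes> (x X11 \<oplus> weyl_sign R g \<otimes> x X21) =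
      idem_diag R g x \<otimes> x X11 \<oplus> weyl_sign R g \<otimes> (idem_diag R g x \<otimes> x X21)"
    using entries_closed by (simp add: r_distr m_ac)
  then show ?thesis using 1 entries_closed idem_fix[OF x] idem_zero[OF x] laurent_closed by (simp add: laurent_u_def)
next
  case 3
  have "idem_anti R g x \<otimes> (weyl_sign R g \<otimes> (x X11 \<oplus> weyl_sign R g \<otimes> x X21)) =
      weyl_sign R g \<otimes> (idem_anti R g x \<otimes> x X11) \<oplus> (weyl_sign R g \<otimes> weyl_sign R g) \<otimes> (idem_anti R g x \<otimes> x X21)"
    using entries_closed(1-8) by (simp add: r_distr m_ac)
  then show ?thesis using 3 entries_closed idem_fix[OF x] idem_zero[OF x] laurent_closed by (simp add: laurent_u_def)
qed (use entries_closed idem_fix[OF x] idem_zero[OF x] laurent_closed in \<open>simp_all add: laurent_y_def r_distr\<close>)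

end

end

text \<open>The lattice of exponents; its monoid algebra is the ring of Laurent polynomials in two
  variables.\<close>

definition Zsq :: "(int \<times> int) monoid"
  where "Zsq = \<lparr>carrier = UNIV, mult = (\<lambda>(a, b) (c, d). (a + c, b + d)), one = (0, 0)\<rparr>"

lemma Zsq_sel [simp]: "carrier Zsq = UNIV" "(a, b) \<otimes>\<^bsub>Zsq\<^esub> (c, d) = (a + c, b + d)" "\<one>\<^bsub>Zsq\<^esub> = (0, 0)"
  by (simp_all add: Zsq_def)

lemma Zsq_monoid: "comm_monoid Zsq"
  by (rule comm_monoidI) (auto simp: ac_simps)

text \<open>For \<open>SL\<^sub>2\<close> only the first Laurent variable is used, and the value at \<^const>\<open>Dinv\<close> is irrelevant.\<close>

fun laurent_torus :: "('a, 'r) ring_scheme \<Rightarrow> matrix_group \<Rightarrow> coord \<Rightarrow> int \<times> int \<Rightarrow> 'a"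
  where
    "laurent_torus A g X11 = single A (1, 0)"
  | "laurent_torus A g X12 = (\<lambda>m. \<zero>\<^bsub>A\<^esub>)"
  | "laurent_torus A g X21 = (\<lambda>m. \<zero>\<^bsub>A\<^esub>)"
  | "laurent_torus A g X22 = single A (case g of GL2 \<Rightarrow> (0, 1) | SL2 \<Rightarrow> (-1, 0))"
  | "laurent_torus A g Dinv = single A (-1, -1)"

lemma (in monoid) Units_factor:
  assumes "comm_monoid G" "a \<in> carrier G" "b \<in> carrier G" "a \<otimes> b = \<one>" shows "a \<in> Units G"
  using assms comm_monoid.m_comm[OF assms(1-3)] unfolding Units_def by auto

lemma (in monoid) Units_int_pow:
  assumes "u \<in> Units G"
  shows "u [^]\<^bsub>units_of G\<^esub> (i :: int) \<in> carrier G"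
    and "u [^]\<^bsub>units_of G\<^esub> (i + j :: int) = u [^]\<^bsub>units_of G\<^esub> i \<otimes> u [^]\<^bsub>units_of G\<^esub> j"
    and "u [^]\<^bsub>units_of G\<^esub> (0 :: int) = \<one>" and "u [^]\<^bsub>units_of G\<^esub> (1 :: int) = u"
    and "u [^]\<^bsub>units_of G\<^esub> (-1 :: int) \<otimes> u = \<one>"
proof -
  interpret U: group "units_of G" by (rule units_group)
  have u: "u \<in> carrier (units_of G)" using assms by (simp add: units_of_carrier)
  show "u [^]\<^bsub>units_of G\<^esub> (i :: int) \<in> carrier G"
    using U.int_pow_closed[OF u] by (auto simp: units_of_carrier)
  show "u [^]\<^bsub>units_of G\<^esub> (i + j :: int) = u [^]\<^bsub>units_of G\<^esub> i \<otimes> u [^]\<^bsub>units_of G\<^esub> j"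
    using U.int_pow_mult[OF u] by (simp add: units_of_mult)
  show 0: "u [^]\<^bsub>units_of G\<^esub> (0 :: int) = \<one>" by (simp add: units_of_one)
  show 1: "u [^]\<^bsub>units_of G\<^esub> (1 :: int) = u" using U.int_pow_1[OF u] .
  show "u [^]\<^bsub>units_of G\<^esub> (-1 :: int) \<otimes> u = \<one>"
    using U.int_pow_mult[OF u, of "-1" 1] 0 1 by (simp add: units_of_mult)
qed

section \<open>Restriction to the two cosets and Laurent expansion on \<open>N\<close>\<close>

context matrix_setting
begin

abbreviation "L \<equiv> monoid_algebra A Zsq"
abbreviation "E \<equiv> idem_diag N g n"
abbreviation "E' \<equiv> idem_anti N g n"

sublocale L: free_module A Zsq by (rule free_module.intro[OF is_cring])

lemma L_algebra: "algebra A L" by (rule L.F_algebra[OF Zsq_monoid])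

lemma laurent_torus_point: "matrix_point L g (laurent_torus A g)"
proof -
  interpret La: algebra A L by (rule L_algebra)
  have s: "single A m \<in> carrier L" for m by (rule L.single_closed) simp
  have m: "single A m \<otimes>\<^bsub>L\<^esub> single A m' = single A (m \<otimes>\<^bsub>Zsq\<^esub> m')" for m m'
    by (rule L.single_mult) simp_all
  have Z: "\<zero>\<^bsub>L\<^esub> = (\<lambda>m. \<zero>\<^bsub>A\<^esub>)" by (simp add: monoid_algebra_sel)
  have one: "\<one>\<^bsub>L\<^esub> = single A (0, 0)" by (simp add: monoid_algebra_sel)
  have "det2 L (laurent_torus A g) = single A (case g of GL2 \<Rightarrow> (1, 1) | SL2 \<Rightarrow> (0, 0))"
    using s by (cases g) (simp_all add: det2_def m a_minus_def flip: Z)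
  then show ?thesis using s one L.F.M.zero_closed[unfolded Z]
    by (cases g) (auto simp: matrix_point_def m)
qed

lemma laurent_torus_diagonal: "diagonal L (laurent_torus A g)"
  by (simp add: diagonal_def monoid_algebra_sel)

definition "\<kappa>1 = lift A L (laurent_torus A g)"
definition "\<kappa>2 = lift A L (mat_mult L (weyl_coord L g) (laurent_torus A g))"

lemma \<kappa>_points: "matrix_point L g (mat_mult L (weyl_coord L g) (laurent_torus A g))"
    "monomial L (mat_mult L (weyl_coord L g) (laurent_torus A g))" "monomial L (laurent_torus A g)"
proof -
  interpret La: algebra A L by (rule L_algebra)
  show 1: "monomial L (laurent_torus A g)" by (rule La.diagonal_monomial[OF laurent_torus_point laurent_torus_diagonal])
  show "matrix_point L g (mat_mult L (weyl_coord L g) (laurent_torus A g))"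
    by (rule La.matrix_point_mult[OF La.weyl_point laurent_torus_point])
  show "monomial L (mat_mult L (weyl_coord L g) (laurent_torus A g))"
    by (rule La.monomial_mult[OF La.weyl_point laurent_torus_point La.weyl_monomial 1])
qed

lemmas \<kappa>1 = N_lift[OF L_algebra laurent_torus_point \<kappa>_points(3), folded \<kappa>1_def]
lemmas \<kappa>2 = N_lift[OF L_algebra \<kappa>_points(1,2), folded \<kappa>2_def]

definition "laurent_basis = (\<lambda>(i, j). cring.laurent_u N g n [^]\<^bsub>units_of N\<^esub> (i :: int) \<otimes>\<^bsub>N\<^esub>
  cring.laurent_y N n [^]\<^bsub>units_of N\<^esub> (j :: int))"

definition "\<beta> = lin_ext A N laurent_basis"

text \<open>\<open>laurent_product\<close> makes \<open>u\<close> and \<open>y\<close> units of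
  \<open>k[N]\<close>, so integral powers exist and multiply like exponents. Uniqueness of inverses
  identifies the two remaining coordinates: for \<open>SL2\<close> the inverse of \<open>u\<close>
  is \<open>y\<close>, and for \<open>GL2\<close> the inverse of \<open>u y\<close> is
  \<open>laurent_inv\<close>.\<close>

lemma laurent_basis: "laurent_basis m \<in> carrier N"
  and \<beta>_hom: "\<beta> \<in> alg_hom A L N"
  and \<beta>_torus: "v \<in> coords g \<Longrightarrow> \<beta> (laurent_torus A g v) = cring.laurent_coord N g n v"
proof -
  interpret Na: algebra A N by (rule N_algebra)
  let ?u = "Na.laurent_u g n" and ?y = "Na.laurent_y n" and ?w = "Na.laurent_inv g n"
  note cl = Na.laurent_closed[OF n_point n_monomial] and p = Na.laurent_product[OF n_point n_monomial]
  have u: "?u \<in> Units N"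
    by (rule Na.Units_factor[OF Na.comm_monoid_axioms cl(1), of "?y \<otimes>\<^bsub>N\<^esub> ?w"]) (use cl p in \<open>simp_all add: Na.m_assoc\<close>)
  have y: "?y \<in> Units N"
    by (rule Na.Units_factor[OF Na.comm_monoid_axioms cl(2), of "?u \<otimes>\<^bsub>N\<^esub> ?w"]) (use cl p in \<open>simp_all add: Na.m_ac\<close>)
  note U = Na.Units_int_pow[OF u] and Y = Na.Units_int_pow[OF y]
  show b: "laurent_basis m \<in> carrier N" for m
    by (cases m) (simp add: laurent_basis_def U Y units_of_one)
  have mult: "laurent_basis (m \<otimes>\<^bsub>Zsq\<^esub> m') = laurent_basis m \<otimes>\<^bsub>N\<^esub> laurent_basis m'" for m m'
    by (cases m; cases m') (simp add: laurent_basis_def U(2) Y(2) U(1) Y(1) Na.m_ac)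
  have one: "laurent_basis \<one>\<^bsub>Zsq\<^esub> = \<one>\<^bsub>N\<^esub>" by (simp add: laurent_basis_def U Y units_of_one)
  show h: "\<beta> \<in> alg_hom A L N"
    unfolding \<beta>_def by (rule L.lin_ext_hom[OF Zsq_monoid N_algebra _ one mult]) (simp add: b)
  have s: "\<beta> (single A m) = laurent_basis m" for m
    unfolding \<beta>_def by (rule L.lin_ext_single[OF Na.module_axioms]) (simp_all add: b)
  have inv_unique: "a = b" if "a \<in> carrier N" "b \<in> carrier N" "c \<in> carrier N" "a \<otimes>\<^bsub>N\<^esub> c = \<one>\<^bsub>N\<^esub>" "c \<otimes>\<^bsub>N\<^esub> b = \<one>\<^bsub>N\<^esub>" for a b c
    using that Na.inv_unique by metis
  show "\<beta> (laurent_torus A g v) = Na.laurent_coord g n v" if "v \<in> coords g"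
    using that
  proof (cases rule: coords_cases[consumes 1])
    case 1
    then show ?thesis by (simp add: s laurent_basis_def U Y cl units_of_one)
  next
    case 4
    show ?thesis
    proof (cases g)
      case GL2
      then have "laurent_torus A g X22 = single A (0, 1)" by simp
      then show ?thesis unfolding 4 using cl by (simp add: s laurent_basis_def U Y units_of_one)
    next
      case SL2
      have "?u [^]\<^bsub>units_of N\<^esub> (-1 :: int) = ?y"
        by (rule inv_unique[OF U(1) cl(2,1) U(5)]) (rule Na.laurent_SL2[OF n_point n_monomial SL2])
      moreover have "laurent_torus A g X22 = single A (-1, 0)" using SL2 by simp
      ultimately show ?thesis unfolding 4 using cl by (simp add: s laurent_basis_def Y units_of_one)
    qed
  next
    case 5
    let ?i = "?u [^]\<^bsub>units_of N\<^esub> (-1 :: int)" and ?j = "?y [^]\<^bsub>units_of N\<^esub> (-1 :: int)"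
    have "(?i \<otimes>\<^bsub>N\<^esub> ?j) \<otimes>\<^bsub>N\<^esub> (?u \<otimes>\<^bsub>N\<^esub> ?y) = (?i \<otimes>\<^bsub>N\<^esub> ?u) \<otimes>\<^bsub>N\<^esub> (?j \<otimes>\<^bsub>N\<^esub> ?y)"
      using U(1) Y(1) cl by (simp add: Na.m_ac)
    then have "(?i \<otimes>\<^bsub>N\<^esub> ?j) \<otimes>\<^bsub>N\<^esub> (?u \<otimes>\<^bsub>N\<^esub> ?y) = \<one>\<^bsub>N\<^esub>" by (simp add: U(5) Y(5))
    then have "?i \<otimes>\<^bsub>N\<^esub> ?j = ?w"
      by (rule inv_unique[rotated 3]) (use U(1) Y(1) cl p in simp_all)
    then show ?thesis unfolding 5(2) by (simp add: s laurent_basis_def)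
  qed (use alg_hom_zero[OF L_algebra N_algebra h] in \<open>simp_all add: monoid_algebra_sel\<close>)
qed

lemma idem_facts:
  "E \<in> carrier N" "E' \<in> carrier N" "E \<oplus>\<^bsub>N\<^esub> E' = \<one>\<^bsub>N\<^esub>" "E \<otimes>\<^bsub>N\<^esub> E' = \<zero>\<^bsub>N\<^esub>"
  "E \<otimes>\<^bsub>N\<^esub> E = E" "E' \<otimes>\<^bsub>N\<^esub> E' = E'"
proof -
  interpret Na: algebra A N by (rule N_algebra)
  show "E \<in> carrier N" "E' \<in> carrier N" "E \<oplus>\<^bsub>N\<^esub> E' = \<one>\<^bsub>N\<^esub>" "E \<otimes>\<^bsub>N\<^esub> E' = \<zero>\<^bsub>N\<^esub>"
    "E \<otimes>\<^bsub>N\<^esub> E = E" "E' \<otimes>\<^bsub>N\<^esub> E' = E'"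
    by (rule Na.idem_closed Na.idem_sum Na.idem_orth Na.idem_idem n_point n_monomial)+
qed

text \<open>The left hand side is an algebra homomorphism in \<open>z\<close>, being glued along
  \<open>E\<close> and \<open>E'\<close>, so it suffices to treat the coordinates. There
  \<open>\<beta>\<close> turns the generic torus point into \<open>diag(u, y)\<close> and fixes the
  entries of \<open>w\<close>, which leaves \<open>laurent_decomposition\<close>.\<close>

theorem laurent_expansion:
  assumes "z \<in> carrier N"
  shows "E \<otimes>\<^bsub>N\<^esub> \<beta> (\<kappa>1 z) \<oplus>\<^bsub>N\<^esub> E' \<otimes>\<^bsub>N\<^esub> \<beta> (\<kappa>2 z) = z"
proof -
  interpret Na: algebra A N by (rule N_algebra)
  interpret La: algebra A L by (rule L_algebra)
  have h: "(\<lambda>z. E \<otimes>\<^bsub>N\<^esub> \<beta> (\<kappa>1 z) \<oplus>\<^bsub>N\<^esub> E' \<otimes>\<^bsub>N\<^esub> \<beta> (\<kappa>2 z)) \<in> alg_hom A N N"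
    by (rule alg_hom_idem_combine[OF N_algebra N_algebra alg_hom_comp[OF \<kappa>1(1) \<beta>_hom] alg_hom_comp[OF \<kappa>2(1) \<beta>_hom] idem_facts(1-4)])
  show ?thesis
  proof (rule N_ext[OF h alg_hom_id N_algebra _ assms])
    fix v assume v: "v \<in> coords g"
    have "\<beta> (\<kappa>2 (n v)) = mat_mult N (\<lambda>v. \<beta> (weyl_coord L g v)) (\<lambda>v. \<beta> (laurent_torus A g v)) v"
      unfolding \<kappa>2(2)[OF v] by (rule hom_mat(1)[OF L_algebra N_algebra \<beta>_hom La.weyl_point laurent_torus_point v])
    also have "\<dots> = mat_mult N (weyl_coord N g) (Na.laurent_coord g n) v"
      by (rule mat_mult_cong[OF _ _ v]) (simp_all add: \<beta>_torus hom_weyl_coord[OF L_algebra N_algebra \<beta>_hom])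
    finally show "E \<otimes>\<^bsub>N\<^esub> \<beta> (\<kappa>1 (n v)) \<oplus>\<^bsub>N\<^esub> E' \<otimes>\<^bsub>N\<^esub> \<beta> (\<kappa>2 (n v)) = n v"
      using Na.laurent_decomposition[OF n_point n_monomial v] by (simp add: \<kappa>1(2)[OF v] \<beta>_torus[OF v])
  qed
qed

end

section \<open>The quotient by the torus\<close>

context matrix_setting
begin

abbreviation "W \<equiv> weyl A g"
abbreviation "NT \<equiv> tensor A N T"

definition "\<epsilon>w = lift A (base_algebra A) (weyl_coord (base_algebra A) g)"

lemmas base = algebra_base[OF is_cring]

lemma \<epsilon>w: "\<epsilon>w \<in> alg_hom A N (base_algebra A)" "\<And>v. v \<in> coords g \<Longrightarrow> \<epsilon>w (n v) = weyl_coord (base_algebra A) g v"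
proof -
  interpret Z: algebra A "base_algebra A" by (rule base)
  show "\<epsilon>w \<in> alg_hom A N (base_algebra A)" "\<And>v. v \<in> coords g \<Longrightarrow> \<epsilon>w (n v) = weyl_coord (base_algebra A) g v"
    unfolding \<epsilon>w_def by (rule N_lift[OF base Z.weyl_point Z.weyl_monomial]; assumption?)+
qed

abbreviation "\<epsilon> \<equiv> counit N"

lemma \<epsilon>_hom: "\<epsilon> \<in> alg_hom A N (base_algebra A)"
  using N_data by (simp add: hopf_data_def hopf_data_axioms_def)

lemma \<epsilon>_closed: "z \<in> carrier N \<Longrightarrow> \<epsilon> z \<in> carrier A" "z \<in> carrier N \<Longrightarrow> \<epsilon>w z \<in> carrier A"
  using alg_hom_closed[OF \<epsilon>_hom] alg_hom_closed[OF \<epsilon>w(1)] by auto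

lemma idem_values: "\<epsilon> E = \<one>\<^bsub>A\<^esub>" "\<epsilon> E' = \<zero>\<^bsub>A\<^esub>" "\<epsilon>w E = \<zero>\<^bsub>A\<^esub>" "\<epsilon>w E' = \<one>\<^bsub>A\<^esub>"
proof -
  interpret Z: algebra A "base_algebra A" by (rule base)
  have 1: "\<epsilon> (n v) = counit_coord (base_algebra A) v" if "v \<in> coords g" for v
    by (simp add: N_counit[OF that] counit_coord_base)
  show "\<epsilon> E = \<one>\<^bsub>A\<^esub>" "\<epsilon> E' = \<zero>\<^bsub>A\<^esub>"
    using hom_idem[OF N_algebra base \<epsilon>_hom n_point] idem_cong[of g "\<lambda>v. \<epsilon> (n v)" "counit_coord (base_algebra A)" "base_algebra A", OF 1]
      Z.one_idem[of g] by simp_all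
  show "\<epsilon>w E = \<zero>\<^bsub>A\<^esub>" "\<epsilon>w E' = \<one>\<^bsub>A\<^esub>"
    using hom_idem[OF N_algebra base \<epsilon>w(1) n_point] idem_cong[of g "\<lambda>v. \<epsilon>w (n v)" "weyl_coord (base_algebra A) g" "base_algebra A", OF \<epsilon>w(2)]
      Z.weyl_idem[of g] by simp_all
qed

definition "r z = \<epsilon> z \<odot>\<^bsub>N\<^esub> E \<oplus>\<^bsub>N\<^esub> \<epsilon>w z \<odot>\<^bsub>N\<^esub> E'"

lemma r_hom: "r \<in> alg_hom A N N"
proof -
  interpret Na: algebra A N by (rule N_algebra)
  have "(\<lambda>z. E \<otimes>\<^bsub>N\<^esub> (\<epsilon> z \<odot>\<^bsub>N\<^esub> \<one>\<^bsub>N\<^esub>) \<oplus>\<^bsub>N\<^esub> E' \<otimes>\<^bsub>N\<^esub> (\<epsilon>w z \<odot>\<^bsub>N\<^esub> \<one>\<^bsub>N\<^esub>)) \<in> alg_hom A N N"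
    by (rule alg_hom_idem_combine[OF N_algebra N_algebra alg_hom_comp[OF \<epsilon>_hom alg_hom_unit[OF N_algebra]]
          alg_hom_comp[OF \<epsilon>w(1) alg_hom_unit[OF N_algebra]] idem_facts(1-4)])
  then show ?thesis
    by (rule alg_hom_cong[OF N_algebra]) (simp add: r_def Na.smult_mult_right idem_facts \<epsilon>_closed)
qed

lemma r_idem: "r E = E" "r E' = E'"
proof -
  interpret Na: algebra A N by (rule N_algebra)
  show "r E = E" "r E' = E'" by (simp_all add: r_def idem_values idem_facts)
qed

lemma r_r: "z \<in> carrier N \<Longrightarrow> r (r z) = r z"
proof -
  interpret Na: algebra A N by (rule N_algebra)
  assume z: "z \<in> carrier N"
  have "r (\<epsilon> z \<odot>\<^bsub>N\<^esub> E \<oplus>\<^bsub>N\<^esub> \<epsilon>w z \<odot>\<^bsub>N\<^esub> E') = \<epsilon> z \<odot>\<^bsub>N\<^esub> r E \<oplus>\<^bsub>N\<^esub> \<epsilon>w z \<odot>\<^bsub>N\<^esub> r E'"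
    using z by (simp add: alg_hom_simps[OF r_hom] idem_facts \<epsilon>_closed)
  then show ?thesis by (simp add: r_idem flip: r_def)
qed

sublocale NTa: tensor_algebra A N T
  by (rule tensor_algebra.intro) (rule N_algebra T_algebra)+

abbreviation "\<sigma> \<equiv> act A N T \<iota>"

lemma right_hom: "(\<lambda>z. pure A N T \<one>\<^bsub>N\<^esub> (\<iota> z)) \<in> alg_hom A N NT"
  by (rule alg_hom_comp[OF \<iota>_hom NTa.pure_right_hom])

text \<open>Exhibits the action as the product of the generic point of \<open>N\<close> and the
  generic point of \<open>T\<close>, so that it can be computed with matrices.\<close>

lemma \<sigma>_pt_mult:
  assumes "z \<in> carrier N"
  shows "\<sigma> z = pt_mult A N NT (\<lambda>z. pure A N T z \<one>\<^bsub>T\<^esub>) (\<lambda>z. pure A N T \<one>\<^bsub>N\<^esub> (\<iota> z)) z"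
proof -
  interpret Nh: hopf_data A N by (rule N_data)
  show ?thesis
    using Nh.HHH.BC.tensor_map_pt_pair[OF N_algebra T_algebra alg_hom_id' \<iota>_hom alg_hom_closed[OF Nh.comult_hom assms]]
    by (simp add: act_def pt_mult_def)
qed

lemma \<sigma>_hom: "\<sigma> \<in> alg_hom A N NT"
  by (rule alg_hom_cong[OF N_algebra hopf_data.pt_mult_hom[OF N_data NTa.tensor_algebra NTa.pure_left_hom right_hom] \<sigma>_pt_mult])

lemma n_closed: "v \<in> coords g \<Longrightarrow> n v \<in> carrier N"
  by (rule matrix_pointD(1)[OF n_point])

lemma \<sigma>_n:
  assumes "v \<in> coords g"
  shows "\<sigma> (n v) = mat_mult NT (\<lambda>v. pure A N T (n v) \<one>\<^bsub>T\<^esub>) (\<lambda>v. pure A N T \<one>\<^bsub>N\<^esub> (t v)) v"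
  unfolding \<sigma>_pt_mult[OF n_closed[OF assms]] N_pt_mult[OF NTa.tensor_algebra NTa.pure_left_hom right_hom assms assms]
  by (rule mat_mult_cong[OF _ _ assms]) (simp_all add: \<iota>_n)

text \<open>A diagonal matrix has idempotents \<open>1\<close> and \<open>0\<close>, so by
  \<open>idem_mult\<close> right translation by the torus preserves the two components.\<close>

lemma \<sigma>_idem: "\<sigma> E = pure A N T E \<one>\<^bsub>T\<^esub>" "\<sigma> E' = pure A N T E' \<one>\<^bsub>T\<^esub>"
proof -
  note NT = NTa.tensor_algebra
  interpret NTA: algebra A NT by (rule NT)
  let ?a = "\<lambda>v. pure A N T (n v) \<one>\<^bsub>T\<^esub>" and ?b = "\<lambda>v. pure A N T \<one>\<^bsub>N\<^esub> (t v)"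
  note a = hom_mat(4)[OF N_algebra NT NTa.pure_left_hom n_point] hom_mat(5)[OF N_algebra NT NTa.pure_left_hom n_point n_monomial]
  note b = hom_mat(4)[OF T_algebra NT NTa.pure_right_hom t_point] hom_mat(6)[OF T_algebra NT NTa.pure_right_hom t_point t_diagonal]
  note i = NTA.idem_mult[OF a b(1) NTA.diagonal_monomial[OF b]] NTA.idem_diagonal[OF b] NTA.idem_closed[OF a]
  note l = hom_idem[OF N_algebra NT NTa.pure_left_hom n_point]
  have "\<sigma> E = idem_diag NT g (mat_mult NT ?a ?b)" "\<sigma> E' = idem_anti NT g (mat_mult NT ?a ?b)"
    using hom_idem[OF N_algebra NT \<sigma>_hom n_point] idem_cong[of g "\<lambda>v. \<sigma> (n v)" "mat_mult NT ?a ?b" NT, OF \<sigma>_n] by simp_all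
  then show "\<sigma> E = pure A N T E \<one>\<^bsub>T\<^esub>" "\<sigma> E' = pure A N T E' \<one>\<^bsub>T\<^esub>" using i l by simp_all
qed

lemma invariant_r:
  assumes "z \<in> carrier N" "r z = z"
  shows "\<sigma> z = pure A N T z \<one>\<^bsub>T\<^esub>"
proof -
  have "\<sigma> (r z) = pure A N T (r z) \<one>\<^bsub>T\<^esub>"
    unfolding r_def using assms(1)
    by (simp add: alg_hom_simps[OF \<sigma>_hom] alg_hom_simps[OF NTa.pure_left_hom] idem_facts \<epsilon>_closed \<sigma>_idem)
  then show ?thesis by (simp add: assms(2))
qed

text \<open>Evaluating an invariant \<open>z(n t) = z(n)\<close> at \<open>n = 1\<close> and \<open>n = w\<close> determines it on both cosets.\<close>

lemma invariant_constant:
  assumes z: "z \<in> carrier N" "\<sigma> z = pure A N T z \<one>\<^bsub>T\<^esub>"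
  shows "r z = z"
proof -
  interpret La: algebra A L by (rule L_algebra)
  define \<kappa> where "\<kappa> = lift A L (laurent_torus A g)"
  note \<kappa> = T_lift[OF L_algebra laurent_torus_point laurent_torus_diagonal, folded \<kappa>_def]
  have *: "k z = e z \<odot>\<^bsub>L\<^esub> \<one>\<^bsub>L\<^esub>"
    if e: "e \<in> alg_hom A N (base_algebra A)" and ev: "\<And>v. v \<in> coords g \<Longrightarrow> e (n v) \<odot>\<^bsub>L\<^esub> \<one>\<^bsub>L\<^esub> = p v"
      and k: "k \<in> alg_hom A N L" "\<And>v. v \<in> coords g \<Longrightarrow> k (n v) = mat_mult L p (laurent_torus A g) v" for e k p
  proof -
    note eL = alg_hom_comp[OF e alg_hom_unit[OF L_algebra]]
    \<comment> \<open>The \<open>L\<close>-valued point of \<open>N x T\<close> consisting of the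
      constant matrix \<open>p\<close> and the generic torus point. It sends
      \<open>\<sigma> z\<close> to the value of \<open>z\<close> at their product and
      \<open>z \<otimes> 1\<close> to the constant \<open>e z\<close>.\<close>
    let ?\<phi> = "pt_pair A L (\<lambda>z. e z \<odot>\<^bsub>L\<^esub> \<one>\<^bsub>L\<^esub>) \<kappa>"
    note \<phi> = NTa.pt_pair_hom[OF L_algebra eL \<kappa>(1)]
    note pp = NTa.pt_pair_pure[OF L_algebra eL \<kappa>(1)]
    note NT = NTa.tensor_algebra
    note a = hom_mat(4)[OF N_algebra NT NTa.pure_left_hom n_point]
    note b = hom_mat(4)[OF T_algebra NT NTa.pure_right_hom t_point]
    have pc: "p v \<in> carrier L" if "v \<in> coords g" for v
      using alg_hom_closed[OF eL n_closed[OF that]] ev[OF that] by simp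
    have "?\<phi> (\<sigma> y) = k y" if y: "y \<in> carrier N" for y
    proof (rule N_ext[OF alg_hom_comp[OF \<sigma>_hom \<phi>] k(1) L_algebra _ y])
      fix v assume v: "v \<in> coords g"
      have "?\<phi> (\<sigma> (n v)) = mat_mult L (\<lambda>v. ?\<phi> (pure A N T (n v) \<one>\<^bsub>T\<^esub>)) (\<lambda>v. ?\<phi> (pure A N T \<one>\<^bsub>N\<^esub> (t v))) v"
        unfolding \<sigma>_n[OF v] by (rule hom_mat(1)[OF NT L_algebra \<phi> a b v])
      also have "\<dots> = mat_mult L p (laurent_torus A g) v"
        by (rule mat_mult_cong[OF _ _ v])
          (simp_all add: pp n_closed matrix_pointD(1)[OF t_point] alg_hom_simps[OF \<kappa>(1)] \<kappa>(2) ev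
            alg_hom_one[OF eL] pc matrix_pointD(1)[OF laurent_torus_point])
      finally show "?\<phi> (\<sigma> (n v)) = k (n v)" by (simp add: k(2)[OF v])
    qed
    moreover have "?\<phi> (pure A N T z \<one>\<^bsub>T\<^esub>) = e z \<odot>\<^bsub>L\<^esub> \<one>\<^bsub>L\<^esub>"
      using z(1) by (simp add: pp alg_hom_one[OF \<kappa>(1)] alg_hom_closed[OF eL] La.r_one)
    ultimately show ?thesis using z by metis
  qed
  have "\<kappa>1 z = \<epsilon> z \<odot>\<^bsub>L\<^esub> \<one>\<^bsub>L\<^esub>"
  proof (rule *[OF \<epsilon>_hom _ \<kappa>1(1)])
    show "\<epsilon> (n v) \<odot>\<^bsub>L\<^esub> \<one>\<^bsub>L\<^esub> = counit_coord L v" if "v \<in> coords g" for v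
      using hom_mat(3)[OF base L_algebra alg_hom_unit[OF L_algebra] cring.matrix_point_one[OF algebra.M_cring[OF base], of g], of v]
      by (simp add: N_counit[OF that] counit_coord_base)
    show "\<kappa>1 (n v) = mat_mult L (counit_coord L) (laurent_torus A g) v" if "v \<in> coords g" for v
      using La.mat_mult_one(1)[OF laurent_torus_point that] \<kappa>1(2)[OF that] by simp
  qed
  moreover have "\<kappa>2 z = \<epsilon>w z \<odot>\<^bsub>L\<^esub> \<one>\<^bsub>L\<^esub>"
    by (rule *[OF \<epsilon>w(1) _ \<kappa>2]) (simp_all add: \<epsilon>w(2) hom_weyl_coord[OF base L_algebra alg_hom_unit[OF L_algebra]])
  \<comment> \<open>The restrictions of \<open>z\<close> to both cosets are constants, which
    \<open>\<beta>\<close> maps to scalars; so the Laurent expansion of \<open>z\<close> is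
    \<open>r z\<close>.\<close>
  ultimately have "r z = E \<otimes>\<^bsub>N\<^esub> \<beta> (\<kappa>1 z) \<oplus>\<^bsub>N\<^esub> E' \<otimes>\<^bsub>N\<^esub> \<beta> (\<kappa>2 z)"
    using z(1) by (simp add: r_def alg_hom_simps[OF \<beta>_hom] \<epsilon>_closed idem_facts NTa.B.smult_mult_right)
  then show ?thesis using laurent_expansion[OF z(1)] by simp
qed

text \<open>Replaces invariance, an equation in \<open>k[N] \<otimes> k[T]\<close>, by a fixed point
  condition in \<open>k[N]\<close>. As \<open>r\<close> is an algebra homomorphism, the closure
  properties of \<open>W\<close> follow at once.\<close>

lemma W_carrier: "carrier W = {z \<in> carrier N. r z = z}"
  using invariant_r invariant_constant
  by (auto simp: weyl_def quotient_scheme_def Let_def invariants_def proj_def)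

lemma W_sel: "mult W = mult N" "\<one>\<^bsub>W\<^esub> = \<one>\<^bsub>N\<^esub>" "\<zero>\<^bsub>W\<^esub> = \<zero>\<^bsub>N\<^esub>" "add W = add N" "smult W = smult N"
    "counit W = counit N" "antipode W = antipode N"
  by (simp_all add: weyl_def quotient_scheme_def Let_def)

lemma W_algebra: "algebra A W"
proof -
  note k = alg_hom_simps[OF r_hom] alg_hom_zero[OF N_algebra N_algebra r_hom] alg_hom_uminus[OF N_algebra N_algebra r_hom]
  show ?thesis
  proof (rule algebraI[OF is_cring])
    show "cring W"
    proof (rule cringI)
      show "abelian_group W"
      proof (rule abelian_groupI)
        show "\<exists>y\<in>carrier W. y \<oplus>\<^bsub>W\<^esub> x = \<zero>\<^bsub>W\<^esub>" if "x \<in> carrier W" for x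
          using that by (intro bexI[of _ "\<ominus>\<^bsub>N\<^esub> x"]) (simp_all add: W_carrier W_sel k NTa.B.l_neg)
      qed (simp_all add: W_carrier W_sel k NTa.B.a_ac)
      show "Group.comm_monoid W" by (rule comm_monoidI) (simp_all add: W_carrier W_sel k NTa.B.m_ac)
    qed (simp_all add: W_carrier W_sel k NTa.B.l_distr)
  qed (simp_all add: W_carrier W_sel k NTa.B.smult_l_distr NTa.B.smult_r_distr NTa.B.smult_assoc1 NTa.B.smult_assoc2)
qed

lemma r_W: "z \<in> carrier N \<Longrightarrow> r z \<in> carrier W"
  by (simp add: W_carrier r_r alg_hom_closed[OF r_hom])

lemma alg_hom_W: "f \<in> alg_hom A B' N \<Longrightarrow> (\<And>z. z \<in> carrier B' \<Longrightarrow> f z \<in> carrier W) \<Longrightarrow> f \<in> alg_hom A B' W"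
  by (simp add: alg_hom_def ring_hom_def W_sel Pi_iff)

lemma r_hom_W: "r \<in> alg_hom A N W"
  by (rule alg_hom_W[OF r_hom r_W])

lemma incl_hom: "(\<lambda>z. z) \<in> alg_hom A W N"
  by (simp add: alg_hom_def ring_hom_def W_sel W_carrier)

lemma idem_W: "E \<in> carrier W" "E' \<in> carrier W"
  by (simp_all add: W_carrier r_idem idem_facts)

section \<open>The group structure of the quotient\<close>

sublocale WW: tensor_algebra A W W
  by (rule tensor_algebra.intro) (rule W_algebra)+

sublocale NN: tensor_algebra A N N
  by (rule tensor_algebra.intro) (rule N_algebra)+

lemma incl2: "tensor_map A N N id id \<in> alg_hom A (tensor A W W) (tensor A N N)"
    "a \<in> carrier W \<Longrightarrow> b \<in> carrier W \<Longrightarrow> tensor_map A N N id id (pure A W W a b) = pure A N N a b"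
proof -
  have i: "id \<in> alg_hom A W N" using incl_hom by (simp add: id_def)
  show "tensor_map A N N id id \<in> alg_hom A (tensor A W W) (tensor A N N)"
    by (rule WW.tensor_map_hom[OF N_algebra N_algebra i i])
  show "a \<in> carrier W \<Longrightarrow> b \<in> carrier W \<Longrightarrow> tensor_map A N N id id (pure A W W a b) = pure A N N a b"
    using WW.tensor_map_pure_hom[OF N_algebra N_algebra i i] by simp
qed

lemma r2: "tensor_map A W W r r \<in> alg_hom A (tensor A N N) (tensor A W W)"
  by (rule NN.tensor_map_hom[OF W_algebra W_algebra r_hom_W r_hom_W])

text \<open>Makes \<open>k[N/T] \<otimes> k[N/T] \<rightarrow> k[N] \<otimes> k[N]\<close> injective
  over an arbitrary base, so the comultiplication of \<open>W\<close>, a definite description, has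
  at most one candidate.\<close>

lemma r2_incl2:
  assumes "w \<in> carrier (tensor A W W)"
  shows "tensor_map A W W r r (tensor_map A N N id id w) = w"
  by (rule WW.lin_map_ext[OF alg_hom_lin[OF alg_hom_comp[OF incl2(1) r2]] lin_map_id _ assms])
    (simp add: incl2(2) NN.tensor_map_pure_hom[OF W_algebra W_algebra r_hom_W r_hom_W] W_carrier)

text \<open>\<open>idem_mult\<close> at two generic matrices. With these formulas
  \<open>k[N/T]\<close> is the algebra of functions on the group of order two.\<close>

lemma comult_idem:
  "comult N E = pure A N N E E \<oplus>\<^bsub>tensor A N N\<^esub> pure A N N E' E'"
  "comult N E' = pure A N N E E' \<oplus>\<^bsub>tensor A N N\<^esub> pure A N N E' E"
proof -
  interpret NNA: algebra A "tensor A N N" by (rule NN.tensor_algebra)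
  have \<Delta>: "comult N \<in> alg_hom A N (tensor A N N)" using N_data by (simp add: hopf_data_def hopf_data_axioms_def)
  let ?a = "\<lambda>v. pure A N N (n v) \<one>\<^bsub>N\<^esub>" and ?b = "\<lambda>v. pure A N N \<one>\<^bsub>N\<^esub> (n v)"
  note NN = NN.tensor_algebra
  note a = hom_mat(4)[OF N_algebra NN NN.pure_left_hom n_point] hom_mat(5)[OF N_algebra NN NN.pure_left_hom n_point n_monomial]
  note b = hom_mat(4)[OF N_algebra NN NN.pure_right_hom n_point] hom_mat(5)[OF N_algebra NN NN.pure_right_hom n_point n_monomial]
  note l = hom_idem[OF N_algebra NN NN.pure_left_hom n_point, symmetric] and r = hom_idem[OF N_algebra NN NN.pure_right_hom n_point, symmetric]
  have "comult N E = idem_diag (tensor A N N) g (mat_mult (tensor A N N) ?a ?b)"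
    "comult N E' = idem_anti (tensor A N N) g (mat_mult (tensor A N N) ?a ?b)"
    using hom_idem[OF N_algebra NN \<Delta> n_point]
      idem_cong[of g "\<lambda>v. comult N (n v)" "mat_mult (tensor A N N) ?a ?b" "tensor A N N", OF N.subgroup_comult[unfolded N_eq]] by simp_all
  then show "comult N E = pure A N N E E \<oplus>\<^bsub>tensor A N N\<^esub> pure A N N E' E'"
    "comult N E' = pure A N N E E' \<oplus>\<^bsub>tensor A N N\<^esub> pure A N N E' E"
    using NNA.idem_mult[OF a b] by (simp_all add: l r NN.pure_mult idem_facts)
qed

lemma antipode_idem: "antipode N E = E" "antipode N E' = E'"
proof -
  have S: "antipode N \<in> alg_hom A N N" using N_data by (simp add: hopf_data_def hopf_data_axioms_def)
  have "antipode N E = idem_diag N g (mat_inv N g n)" "antipode N E' = idem_anti N g (mat_inv N g n)"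
    using hom_idem[OF N_algebra N_algebra S n_point]
      idem_cong[of g "\<lambda>v. antipode N (n v)" "mat_inv N g n" N, OF N.subgroup_antipode[unfolded N_eq]] by simp_all
  then show "antipode N E = E" "antipode N E' = E'" using NTa.B.idem_inv[OF n_point n_monomial] by simp_all
qed

lemma W_expand: "z \<in> carrier W \<Longrightarrow> z = \<epsilon> z \<odot>\<^bsub>N\<^esub> E \<oplus>\<^bsub>N\<^esub> \<epsilon>w z \<odot>\<^bsub>N\<^esub> E'"
  by (simp add: W_carrier r_def)

lemma comult_W:
  assumes "z \<in> carrier W"
  shows "comult W z \<in> carrier (tensor A W W)" "tensor_map A N N id id (comult W z) = comult N z"
    "comult W z = tensor_map A W W r r (comult N z)"
proof -
  let ?Q = "N\<lparr>carrier := invariants A N T \<iota>\<rparr>"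
  \<comment> \<open>The definition forms the tensor square of the record whose comultiplication is
    not yet replaced; it has the same algebra fields as \<open>W\<close>.\<close>
  have q: "module.truncate ?Q = module.truncate W"
    by (simp add: weyl_def quotient_scheme_def Let_def module.truncate_def)
  have C: "comult W z = (THE w. w \<in> carrier (tensor A W W) \<and> tensor_map A N N id id w = comult N z)"
    unfolding tensor_fields[OF q q, symmetric]
    by (simp add: weyl_def quotient_scheme_def Let_def)
  have \<Delta>: "comult N \<in> alg_hom A N (tensor A N N)" using N_data by (simp add: hopf_data_def hopf_data_axioms_def)
  interpret WWA: algebra A "tensor A W W" by (rule WW.tensor_algebra)
  have zN: "z \<in> carrier N" using assms by (simp add: W_carrier)
  \<comment> \<open>The preimage is found by expanding \<open>z\<close> in \<open>E\<close> and
    \<open>E'\<close> and reading the formulas for their comultiplication in the tensor square of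
    \<open>W\<close>.\<close>
  let ?w = "\<epsilon> z \<odot>\<^bsub>tensor A W W\<^esub> (pure A W W E E \<oplus>\<^bsub>tensor A W W\<^esub> pure A W W E' E') \<oplus>\<^bsub>tensor A W W\<^esub>
    \<epsilon>w z \<odot>\<^bsub>tensor A W W\<^esub> (pure A W W E E' \<oplus>\<^bsub>tensor A W W\<^esub> pure A W W E' E)"
  have cl: "pure A W W a b \<in> carrier (tensor A W W)" if "a \<in> {E, E'}" "b \<in> {E, E'}" for a b
    using that idem_W by (auto intro: WW.pure_closed)
  have w: "?w \<in> carrier (tensor A W W)" using cl \<epsilon>_closed[OF zN] by simp
  have "comult N z = comult N (\<epsilon> z \<odot>\<^bsub>N\<^esub> E \<oplus>\<^bsub>N\<^esub> \<epsilon>w z \<odot>\<^bsub>N\<^esub> E')" using W_expand[OF assms] by simp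
  also have "\<dots> = \<epsilon> z \<odot>\<^bsub>tensor A N N\<^esub> comult N E \<oplus>\<^bsub>tensor A N N\<^esub> \<epsilon>w z \<odot>\<^bsub>tensor A N N\<^esub> comult N E'"
    using \<epsilon>_closed[OF zN] idem_facts algebra_module[OF N_algebra] by (simp add: alg_hom_simps[OF \<Delta>] module.smult_closed)
  also have "\<dots> = tensor_map A N N id id ?w"
    using cl \<epsilon>_closed[OF zN] by (simp add: alg_hom_simps[OF incl2(1)] comult_idem incl2(2) idem_W)
  finally have eq: "tensor_map A N N id id ?w = comult N z" by simp
  have "comult W z = ?w"
    unfolding C by (rule the_equality) (use w eq r2_incl2 in metis)+
  then show "comult W z \<in> carrier (tensor A W W)" "tensor_map A N N id id (comult W z) = comult N z"
    "comult W z = tensor_map A W W r r (comult N z)"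
    using w eq r2_incl2[OF w] by simp_all
qed

lemma W_hopf_data: "hopf_data A W"
proof (intro hopf_data.intro hopf_data_axioms.intro W_algebra)
  have h: "comult N \<in> alg_hom A N (tensor A N N)" "counit N \<in> alg_hom A N (base_algebra A)" "antipode N \<in> alg_hom A N N"
    using N_data by (simp_all add: hopf_data_def hopf_data_axioms_def)
  show "comult W \<in> alg_hom A W (tensor A W W)"
    by (rule alg_hom_cong[OF W_algebra alg_hom_comp[OF incl_hom alg_hom_comp[OF h(1) r2]] comult_W(3)])
  show "counit W \<in> alg_hom A W (base_algebra A)"
    unfolding W_sel by (rule alg_hom_comp[OF incl_hom h(2), simplified])
  show "antipode W \<in> alg_hom A W W"
    unfolding W_sel
  proof (rule alg_hom_W[OF alg_hom_comp[OF incl_hom h(3), simplified]])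
    fix z assume z: "z \<in> carrier W"
    then have zN: "z \<in> carrier N" by (simp add: W_carrier)
    have "antipode N (\<epsilon> z \<odot>\<^bsub>N\<^esub> E \<oplus>\<^bsub>N\<^esub> \<epsilon>w z \<odot>\<^bsub>N\<^esub> E') = \<epsilon> z \<odot>\<^bsub>N\<^esub> E \<oplus>\<^bsub>N\<^esub> \<epsilon>w z \<odot>\<^bsub>N\<^esub> E'"
      using \<epsilon>_closed[OF zN] idem_facts algebra_module[OF N_algebra] by (simp add: alg_hom_simps[OF h(3)] module.smult_closed antipode_idem)
    \<comment> \<open>Each component of \<open>N\<close> is closed under inversion, so the antipode
      is the identity on invariants.\<close>
    then have "antipode N z = z" using W_expand[OF z] by simp
    then show "antipode N z \<in> carrier W" using z by simp
  qed
qed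

lemma tensor_map_id: "tensor_map A N N (\<lambda>z. z) (\<lambda>z. z) = tensor_map A N N id id"
  by (simp add: id_def)

theorem W_group: "affine_group_scheme A W"
  by (rule affine_group_scheme_retract[OF N_group W_hopf_data incl_hom r_hom_W])
    (simp_all add: W_carrier[THEN eqset_imp_iff] W_sel comult_W(2) tensor_map_id)

lemma incl_group_hom: "group_scheme_hom A N W (\<lambda>z. z)"
  unfolding group_scheme_hom_def
  by (simp add: N_group W_group incl_hom comult_W(2) tensor_map_id W_sel)

end

section \<open>Faithful flatness from a dual basis\<close>

lemma lin_map_finsum:
  assumes "module R M" "module R N" "u \<in> lin_map R M N" "finite I" "f \<in> I \<rightarrow> carrier M"
  shows "u (finsum M f I) = finsum N (\<lambda>i. u (f i)) I"
proof -
  interpret M: module R M by fact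
  interpret N: module R N by fact
  show ?thesis using assms(4,5)
  proof (induction I)
    case empty
    then show ?case using lin_map_zero[OF assms(1-3)] by simp
  next
    case (insert i I)
    then show ?case
      by (simp add: lin_map_add[OF assms(3)] lin_map_closed[OF assms(3)] Pi_iff)
  qed
qed

lemma restrict_scalars_sel [simp]:
  "carrier (restrict_scalars S \<phi>) = carrier S" "mult (restrict_scalars S \<phi>) = mult S" "\<one>\<^bsub>restrict_scalars S \<phi>\<^esub> = \<one>\<^bsub>S\<^esub>"
  "\<zero>\<^bsub>restrict_scalars S \<phi>\<^esub> = \<zero>\<^bsub>S\<^esub>" "add (restrict_scalars S \<phi>) = add S"
  "smult (restrict_scalars S \<phi>) = (\<lambda>r s. \<phi> r \<otimes>\<^bsub>S\<^esub> s)"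
  by (simp_all add: restrict_scalars_def)

lemma restrict_scalars_module:
  assumes "cring R" "cring S" "\<phi> \<in> ring_hom R S"
  shows "module R (restrict_scalars S \<phi>)"
proof -
  interpret S: cring S by fact
  note h = ring_hom_closed[OF assms(3)] ring_hom_mult[OF assms(3)] ring_hom_add[OF assms(3)] ring_hom_one[OF assms(3)]
  show ?thesis
    by (rule moduleI[OF assms(1) abelian_group_fields_cong[OF S.abelian_group_axioms]])
      (simp_all add: h S.l_distr S.r_distr S.m_assoc)
qed

context
  fixes R :: "('b, 'r) ring_scheme" and S :: "('c, 's) ring_scheme" and \<phi>
  assumes R: "cring R" and S: "cring S" and \<phi>: "\<phi> \<in> ring_hom R S"
begin

private abbreviation "S' \<equiv> restrict_scalars S \<phi>"
private abbreviation "c_hom \<equiv> lin_map R S' (base_algebra R)"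

text \<open>The map \<open>f \<otimes> id\<close> followed by the isomorphism of
  \<open>R \<otimes> M\<close> with \<open>M\<close>.\<close>

definition contract :: "('b, 'm, 't) module_scheme \<Rightarrow> ('c \<Rightarrow> 'b) \<Rightarrow> ('c \<times> 'm \<Rightarrow> 'b) set \<Rightarrow> 'm"
  where "contract M f = tensor_lift R M (\<lambda>s x. f s \<odot>\<^bsub>M\<^esub> x)"

lemma contract:
  assumes M: "module R M" and f: "f \<in> c_hom"
  shows "contract M f \<in> lin_map R (tensor R S' M) M"
    and "s \<in> carrier S \<Longrightarrow> x \<in> carrier M \<Longrightarrow> contract M f (pure R S' M s x) = f s \<odot>\<^bsub>M\<^esub> x"
proof -
  interpret M: module R M by fact
  interpret SM: tensor_product R S' M
    by (rule tensor_product.intro[OF restrict_scalars_module[OF R S \<phi>] M])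
  have f': "f s \<in> carrier R" "f (s \<oplus>\<^bsub>S\<^esub> t) = f s \<oplus>\<^bsub>R\<^esub> f t" "a \<in> carrier R \<Longrightarrow> f (\<phi> a \<otimes>\<^bsub>S\<^esub> s) = a \<otimes>\<^bsub>R\<^esub> f s"
    if "s \<in> carrier S" "t \<in> carrier S" for s t a
    using lin_map_closed[OF f] lin_map_add[OF f] lin_map_smult[OF f] that by auto
  have b: "bilinear R S' M M (\<lambda>s x. f s \<odot>\<^bsub>M\<^esub> x)"
    by (rule bilinearI)
      (simp_all add: f' M.smult_l_distr M.smult_r_distr M.smult_assoc1 M.R.m_comm flip: M.smult_assoc1)
  show "contract M f \<in> lin_map R (tensor R S' M) M"
    unfolding contract_def by (rule SM.tensor_lift_lin[OF M b])
  show "contract M f (pure R S' M s x) = f s \<odot>\<^bsub>M\<^esub> x" if "s \<in> carrier S" "x \<in> carrier M"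
    unfolding contract_def using SM.tensor_lift_pure[OF M b] that by simp
qed

lemma contract_natural:
  assumes M: "module R M" and N: "module R N" and f: "f \<in> c_hom" and u: "u \<in> lin_map R M N"
    and w: "w \<in> carrier (tensor R S' M)"
  shows "contract N f (tensor_map R S' N id u w) = u (contract M f w)"
proof -
  note S' = restrict_scalars_module[OF R S \<phi>]
  interpret SM: tensor_product R S' M by (rule tensor_product.intro[OF S' M])
  have i: "id \<in> lin_map R S' S'" using lin_map_id[of R S'] by (simp add: id_def)
  note tm = SM.tensor_map_lin[OF S' N i u] and tp = SM.tensor_map_pure[OF S' N i u]
  have fs: "f s \<in> carrier R" if "s \<in> carrier S" for s using lin_map_closed[OF f] that by simp
  show ?thesis
    by (rule SM.lin_map_ext[OF lin_map_comp[OF tm contract(1)[OF N f]] lin_map_comp[OF contract(1)[OF M f] u] _ w])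
      (simp add: tp contract(2)[OF M f] contract(2)[OF N f] lin_map_closed[OF u] lin_map_smult[OF u] fs)
qed

context
  fixes c :: "'i \<Rightarrow> 'c \<Rightarrow> 'b" and b :: "'i \<Rightarrow> 'c"
  assumes b: "\<And>i. b i \<in> carrier S" and c: "\<And>i. c i \<in> c_hom"
    and expand: "\<And>s. s \<in> carrier S \<Longrightarrow> \<exists>I. finite I \<and> (\<forall>i. i \<notin> I \<longrightarrow> c i s = \<zero>\<^bsub>R\<^esub>) \<and> s = finsum S (\<lambda>i. \<phi> (c i s) \<otimes>\<^bsub>S\<^esub> b i) I"
begin

text \<open>The dual basis survives the base change: the scalars \<open>c i s\<close> move from the
  left factor to the right one. Vanishing outside \<open>I\<close> is part of the statement so that
  two expansions can be padded to a common index set before they are added.\<close>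

lemma tensor_expand:
  assumes M: "module R M" and w: "w \<in> carrier (tensor R S' M)"
  shows "\<exists>I. finite I \<and> (\<forall>i. i \<notin> I \<longrightarrow> contract M (c i) w = \<zero>\<^bsub>M\<^esub>) \<and>
    w = finsum (tensor R S' M) (\<lambda>i. pure R S' M (b i) (contract M (c i) w)) I"
  using w
proof -
  note S' = restrict_scalars_module[OF R S \<phi>]
  interpret M: module R M by fact
  interpret S: cring S by (rule S)
  interpret S': module R S' by (rule S')
  interpret SM: tensor_product R S' M by (rule tensor_product.intro[OF S' M])
  interpret T: module R "tensor R S' M" by (rule SM.tensor_module)
  have cc: "c i s \<in> carrier R" if "s \<in> carrier S" for i s using lin_map_closed[OF c] that by simp
  note C = contract[OF M c]
  note Cl = lin_map_closed[OF C(1)] lin_map_add[OF C(1)]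
  have cl: "(\<lambda>i. pure R S' M (b i) (contract M (c i) w)) \<in> I \<rightarrow> carrier (tensor R S' M)"
    if "w \<in> carrier (tensor R S' M)" for w I
    using SM.pure_closed b Cl(1) that by auto
  show ?thesis using w
  proof (induction rule: SM.tensor_induct)
    case (pure s x)
    then have s: "s \<in> carrier S" by simp
    obtain I where I: "finite I" "\<forall>i. i \<notin> I \<longrightarrow> c i s = \<zero>\<^bsub>R\<^esub>" "s = finsum S (\<lambda>i. \<phi> (c i s) \<otimes>\<^bsub>S\<^esub> b i) I"
      using expand[OF s] by auto
    have \<phi>c: "\<phi> (c i s) \<in> carrier S" for i using ring_hom_closed[OF \<phi> cc[OF s]] .
    have "finsum S f I = finsum S' f I" for f :: "'i \<Rightarrow> 'c"
      by (simp add: finsum_def finprod_def)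
    then have "pure R S' M s x = pure R S' M (finsum S' (\<lambda>i. \<phi> (c i s) \<otimes>\<^bsub>S\<^esub> b i) I) x" using I(3) by simp
    also have "\<dots> = finsum (tensor R S' M) (\<lambda>i. pure R S' M (\<phi> (c i s) \<otimes>\<^bsub>S\<^esub> b i) x) I"
      by (rule lin_map_finsum[OF S' SM.tensor_module SM.pure_lin_left[OF pure(2)] I(1)]) (simp add: \<phi>c b)
    also have "\<dots> = finsum (tensor R S' M) (\<lambda>i. pure R S' M (b i) (contract M (c i) (pure R S' M s x))) I"
    proof (rule T.M.finsum_cong'[OF refl cl[OF SM.pure_closed[OF pure]]])
      fix i
      have "pure R S' M (\<phi> (c i s) \<otimes>\<^bsub>S\<^esub> b i) x = pure R S' M (b i) (c i s \<odot>\<^bsub>M\<^esub> x)"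
        using SM.pure_smult_left[of "c i s" "b i" x] SM.pure_smult_right[of "c i s" "b i" x] cc[OF s] b pure by simp
      then show "pure R S' M (\<phi> (c i s) \<otimes>\<^bsub>S\<^esub> b i) x = pure R S' M (b i) (contract M (c i) (pure R S' M s x))"
        using C(2)[OF s pure(2)] by simp
    qed
    finally have "pure R S' M s x = finsum (tensor R S' M) (\<lambda>i. pure R S' M (b i) (contract M (c i) (pure R S' M s x))) I" .
    moreover have "contract M (c i) (pure R S' M s x) = \<zero>\<^bsub>M\<^esub>" if "i \<notin> I" for i
      using C(2)[OF s pure(2)] I(2) that pure by simp
    ultimately show ?case using I(1) by blast
  next
    case (add v w)
    obtain I where I: "finite I" "\<forall>i. i \<notin> I \<longrightarrow> contract M (c i) v = \<zero>\<^bsub>M\<^esub>"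
      "v = finsum (tensor R S' M) (\<lambda>i. pure R S' M (b i) (contract M (c i) v)) I" using add by blast
    obtain J where J: "finite J" "\<forall>i. i \<notin> J \<longrightarrow> contract M (c i) w = \<zero>\<^bsub>M\<^esub>"
      "w = finsum (tensor R S' M) (\<lambda>i. pure R S' M (b i) (contract M (c i) w)) J" using add by blast
    let ?f = "\<lambda>w i. pure R S' M (b i) (contract M (c i) w)"
    have z: "pure R S' M (b i) \<zero>\<^bsub>M\<^esub> = \<zero>\<^bsub>tensor R S' M\<^esub>" for i
      by (rule SM.pure_zero_right) (simp add: b)
    have v': "v = finsum (tensor R S' M) (?f v) (I \<union> J)"
      by (rule trans[OF I(3) T.M.add.finprod_mono_neutral_cong_left[OF _ _ _ _ cl[OF add(1)]]])
        (use I J z in auto)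
    have w': "w = finsum (tensor R S' M) (?f w) (I \<union> J)"
      by (rule trans[OF J(3) T.M.add.finprod_mono_neutral_cong_left[OF _ _ _ _ cl[OF add(2)]]])
        (use I J z in auto)
    have "v \<oplus>\<^bsub>tensor R S' M\<^esub> w = finsum (tensor R S' M) (\<lambda>i. ?f v i \<oplus>\<^bsub>tensor R S' M\<^esub> ?f w i) (I \<union> J)"
      unfolding T.M.finsum_addf[OF cl[OF add(1)] cl[OF add(2)]] using v' w' by (rule arg_cong2)
    also have "\<dots> = finsum (tensor R S' M) (?f (v \<oplus>\<^bsub>tensor R S' M\<^esub> w)) (I \<union> J)"
      by (rule T.M.finsum_cong'[OF refl cl]) (simp_all add: add Cl SM.pure_add_right b)
    finally have eq: "v \<oplus>\<^bsub>tensor R S' M\<^esub> w = finsum (tensor R S' M) (?f (v \<oplus>\<^bsub>tensor R S' M\<^esub> w)) (I \<union> J)" .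
    have "\<forall>i. i \<notin> I \<union> J \<longrightarrow> contract M (c i) (v \<oplus>\<^bsub>tensor R S' M\<^esub> w) = \<zero>\<^bsub>M\<^esub>"
      using I(2) J(2) add(1,2) by (simp add: Cl)
    then show ?case using I(1) J(1) eq by (intro exI[of _ "I \<union> J"] conjI finite_UnI)
  qed
qed

text \<open>The dual basis makes tensoring preserve exactness, since kernels and images can be
  computed coefficient by coefficient. The functional \<open>r\<close>, normalized at
  \<open>1\<close>, makes \<open>R\<close> a direct summand of \<open>S\<close>, so exactness can
  also be recovered.\<close>

theorem faithfully_flatI:
  assumes r: "r \<in> c_hom" "r \<one>\<^bsub>S\<^esub> = \<one>\<^bsub>R\<^esub>"
  shows "faithfully_flat TYPE('m1) TYPE('m2) TYPE('m3) R S \<phi>"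
  unfolding faithfully_flat_def Let_def
proof (intro conjI allI impI \<phi>; elim conjE)
  note S' = restrict_scalars_module[OF R S \<phi>]
  interpret S: cring S by (rule S)
  fix M1 :: "('b, 'm1) module" and M2 :: "('b, 'm2) module" and M3 :: "('b, 'm3) module" and u v
  assume M: "module R M1" "module R M2" "module R M3" and u: "u \<in> lin_map R M1 M2" and v: "v \<in> lin_map R M2 M3"
  interpret M1: module R M1 by fact
  interpret M2: module R M2 by fact
  interpret M3: module R M3 by fact
  interpret T1: tensor_product R S' M1 by (rule tensor_product.intro[OF S' M(1)])
  interpret T2: tensor_product R S' M2 by (rule tensor_product.intro[OF S' M(2)])
  interpret T3: tensor_product R S' M3 by (rule tensor_product.intro[OF S' M(3)])
  interpret T3': module R "tensor R S' M3" by (rule T3.tensor_module)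
  have i: "id \<in> lin_map R S' S'" using lin_map_id[of R S'] by (simp add: id_def)
  define U V where UV: "U = tensor_map R S' M2 id u" "V = tensor_map R S' M3 id v"
  note tu = T1.tensor_map_lin[OF S' M(2) i u, folded UV] and pu = T1.tensor_map_pure[OF S' M(2) i u, folded UV]
  note tv = T2.tensor_map_lin[OF S' M(3) i v, folded UV] and pv = T2.tensor_map_pure[OF S' M(3) i v, folded UV]
  note nu = contract_natural[OF M(1,2) _ u, folded UV] and nv = contract_natural[OF M(2,3) _ v, folded UV]
  have one: "contract M r (pure R S' M \<one>\<^bsub>S\<^esub> x) = x" if "module R M" "x \<in> carrier M" for M :: "('b, 'm1) module" and x
    using contract(2)[OF that(1) r(1) S.one_closed that(2)] r(2) module.smult_one[OF that] by simp
  have one2: "contract M r (pure R S' M \<one>\<^bsub>S\<^esub> x) = x" if "module R M" "x \<in> carrier M" for M :: "('b, 'm2) module" and x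
    using contract(2)[OF that(1) r(1) S.one_closed that(2)] r(2) module.smult_one[OF that] by simp
  show "exact_at M1 u M2 v M3 \<longleftrightarrow> exact_at (tensor R S' M1) (tensor_map R S' M2 id u) (tensor R S' M2) (tensor_map R S' M3 id v) (tensor R S' M3)"
    unfolding UV[symmetric]
  proof
    assume e: "exact_at M1 u M2 v M3"
    have vu: "v (u x) = \<zero>\<^bsub>M3\<^esub>" if "x \<in> carrier M1" for x
      using e that by (auto simp: exact_at_def)
    have "V (U w) = \<zero>\<^bsub>tensor R S' M3\<^esub>" if "w \<in> carrier (tensor R S' M1)" for w
      using that
    proof (induction rule: T1.tensor_induct)
      case (pure s x)
      then show ?case by (simp add: pu pv lin_map_closed[OF u] vu T3.pure_zero_right)
    next
      case (add w w')
      then show ?case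
        by (simp add: lin_map_add[OF tu] lin_map_closed[OF tu] lin_map_add[OF tv])
    qed
    moreover have "w \<in> U ` carrier (tensor R S' M1)" if w: "w \<in> carrier (tensor R S' M2)" "V w = \<zero>\<^bsub>tensor R S' M3\<^esub>" for w
    proof -
      obtain I where I: "finite I" "w = finsum (tensor R S' M2) (\<lambda>i. pure R S' M2 (b i) (contract M2 (c i) w)) I"
        using tensor_expand[OF M(2) w(1)] by blast
      \<comment> \<open>Contraction is natural, so each coefficient of \<open>w\<close> lies in the
        kernel of \<open>v\<close> and lifts along \<open>u\<close>; the lifts are then reassembled
        with the elements \<open>b i\<close>.\<close>
      have "\<exists>x\<in>carrier M1. u x = contract M2 (c i) w" for i
      proof -
        have "v (contract M2 (c i) w) = contract M3 (c i) (V w)"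
          by (rule nv[OF c w(1), symmetric])
        also have "\<dots> = \<zero>\<^bsub>M3\<^esub>"
          unfolding w(2) by (rule lin_map_zero[OF T3.tensor_module M(3) contract(1)[OF M(3) c]])
        finally have "contract M2 (c i) w \<in> u ` carrier M1"
          using e lin_map_closed[OF contract(1)[OF M(2) c] w(1)] unfolding exact_at_def by simp
        then show ?thesis by (metis imageE)
      qed
      then obtain x where x: "\<And>i. x i \<in> carrier M1" "\<And>i. u (x i) = contract M2 (c i) w" by metis
      let ?z = "finsum (tensor R S' M1) (\<lambda>i. pure R S' M1 (b i) (x i)) I"
      have cl: "(\<lambda>i. pure R S' M1 (b i) (x i)) \<in> I \<rightarrow> carrier (tensor R S' M1)" using T1.pure_closed b x by auto
      have "U ?z = finsum (tensor R S' M2) (\<lambda>i. U (pure R S' M1 (b i) (x i))) I"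
        by (rule lin_map_finsum[OF T1.tensor_module T2.tensor_module tu I(1) cl])
      also have "\<dots> = w" using I(2) b x by (simp add: pu)
      finally have "U ?z = w" .
      moreover have "?z \<in> carrier (tensor R S' M1)"
        using abelian_monoid.finsum_closed[OF abelian_group.axioms(1)[OF module.axioms(2)[OF T1.tensor_module]] cl] .
      ultimately show ?thesis by blast
    qed
    ultimately show "exact_at (tensor R S' M1) U (tensor R S' M2) V (tensor R S' M3)"
      using lin_map_closed[OF tu] by (auto simp: exact_at_def)
  next
    assume e: "exact_at (tensor R S' M1) U (tensor R S' M2) V (tensor R S' M3)"
    \<comment> \<open>Contraction along \<open>r\<close> sends \<open>1 \<otimes> x\<close> back to
      \<open>x\<close> and commutes with \<open>u\<close> and \<open>v\<close>, so an equation may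
      be checked after tensoring.\<close>
    have "v (u x) = \<zero>\<^bsub>M3\<^esub>" if x: "x \<in> carrier M1" for x
    proof -
      have w: "pure R S' M1 \<one>\<^bsub>S\<^esub> x \<in> carrier (tensor R S' M1)" using x by (intro T1.pure_closed) simp_all
      have "v (u x) = v (contract M2 r (U (pure R S' M1 \<one>\<^bsub>S\<^esub> x)))"
        using nu[OF r(1) w] one[OF M(1) x] by simp
      also have "\<dots> = contract M3 r (V (U (pure R S' M1 \<one>\<^bsub>S\<^esub> x)))"
        by (rule nv[OF r(1) lin_map_closed[OF tu w], symmetric])
      also have "V (U (pure R S' M1 \<one>\<^bsub>S\<^esub> x)) = \<zero>\<^bsub>tensor R S' M3\<^esub>" using e w by (auto simp: exact_at_def)
      finally show ?thesis using lin_map_zero[OF T3.tensor_module M(3) contract(1)[OF M(3) r(1)]] by simp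
    qed
    moreover have "y \<in> u ` carrier M1" if y: "y \<in> carrier M2" "v y = \<zero>\<^bsub>M3\<^esub>" for y
    proof -
      have w: "pure R S' M2 \<one>\<^bsub>S\<^esub> y \<in> carrier (tensor R S' M2)" using y by (intro T2.pure_closed) simp_all
      have "V (pure R S' M2 \<one>\<^bsub>S\<^esub> y) = \<zero>\<^bsub>tensor R S' M3\<^esub>" using y by (simp add: pv T3.pure_zero_right)
      then have "pure R S' M2 \<one>\<^bsub>S\<^esub> y \<in> U ` carrier (tensor R S' M1)"
        using e w unfolding exact_at_def by simp
      then obtain z where z: "z \<in> carrier (tensor R S' M1)" "U z = pure R S' M2 \<one>\<^bsub>S\<^esub> y"
        by auto
      have "y = u (contract M1 r z)"
        using nu[OF r(1) z(1)] one2[OF M(2) y(1)] z(2) by simp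
      then show ?thesis using lin_map_closed[OF contract(1)[OF M(1) r(1)] z(1)] by blast
    qed
    ultimately show "exact_at M1 u M2 v M3"
      using lin_map_closed[OF u] by (auto simp: exact_at_def)
  qed
qed

end

end

section \<open>Kernels of surjective comorphisms\<close>

text \<open>The isomorphism theorem for the surjection \<open>\<iota>\<close>, with the Hopf
  structure included. Its kernel is a Hopf ideal because the structure maps of \<open>N\<close>
  induce those of \<open>T\<close>.\<close>

lemma kernel_closed_subgroup:
  fixes N :: "('a, 'n, 's) hopf_scheme" and T :: "('a, 't, 'u) hopf_scheme"
  assumes \<iota>: "group_scheme_hom A T N \<iota>" and surj: "\<iota> ` carrier N = carrier T"
  defines "K \<equiv> {z \<in> carrier N. \<iota> z = \<zero>\<^bsub>T\<^esub>}"
  shows "group_scheme_iso A T (closed_subgroup A N K) (induced \<iota>)"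
    and "\<And>z. z \<in> carrier N \<Longrightarrow> induced \<iota> (K +>\<^bsub>N\<^esub> z) = \<iota> z"
proof -
  interpret N: affine_group_scheme A N using \<iota> by (simp add: group_scheme_hom_def)
  have Tg: "affine_group_scheme A T" using \<iota> by (simp add: group_scheme_hom_def)
  have Ta: "algebra A T" using Tg by (rule affine_group_scheme.axioms)
  interpret Ta: algebra A T by (rule Ta)
  have h: "\<iota> \<in> alg_hom A N T" and \<Delta>: "\<And>x. x \<in> carrier N \<Longrightarrow> comult T (\<iota> x) = tensor_map A T T \<iota> \<iota> (comult N x)"
    and \<epsilon>: "\<And>x. x \<in> carrier N \<Longrightarrow> counit T (\<iota> x) = counit N x"
    using \<iota> by (auto simp: group_scheme_hom_def)
  have \<Delta>T: "comult T \<in> alg_hom A T (tensor A T T)" and \<epsilon>T: "counit T \<in> alg_hom A T (base_algebra A)"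
    and ST: "antipode T \<in> alg_hom A T T"
    using Tg by (auto simp: affine_group_scheme_def affine_group_scheme_axioms_def)
  have K: "ideal K N" unfolding K_def by (rule alg_hom_kernel_ideal[OF N.algebra_axioms Ta h])
  interpret B: algebra_quotient A N K by (intro algebra_quotient.intro algebra_quotient_axioms.intro N.algebra_axioms K)
  have Z: "\<iota> z = \<zero>\<^bsub>T\<^esub>" if "z \<in> K" for z using that by (simp add: K_def)
  let ?q = "quot N K" and ?p = "\<lambda>z. K +>\<^bsub>N\<^esub> z" and ?\<theta> = "induced \<iota>"
  note qa = B.quot_algebra
  have \<theta>: "?\<theta> \<in> alg_hom A ?q T" by (rule B.induced_hom(1)[OF Ta h Z])
  show \<theta>p: "?\<theta> (?p z) = \<iota> z" if "z \<in> carrier N" for z using B.induced_hom(2)[OF Ta h _ that] Z by simp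
  have bij: "bij_betw ?\<theta> (carrier ?q) (carrier T)"
    unfolding bij_betw_def
  proof
    show "inj_on ?\<theta> (carrier ?q)"
    proof (rule inj_onI)
      fix X Y assume XY: "X \<in> carrier ?q" "Y \<in> carrier ?q" "?\<theta> X = ?\<theta> Y"
      then obtain x y where xy: "x \<in> carrier N" "X = ?p x" "y \<in> carrier N" "Y = ?p y" by (metis B.Q.quot_elim)
      then have "\<iota> x = \<iota> y" using XY(3) \<theta>p by simp
      then have "x \<ominus>\<^bsub>N\<^esub> y \<in> K"
        using xy alg_hom_minus[OF N.algebra_axioms Ta h] alg_hom_closed[OF h] Ta.M.minus_eq_zero_iff by (simp add: K_def)
      then show "X = Y" using B.Q.coset_eq_iff xy by simp
    qed
    show "?\<theta> ` carrier ?q = carrier T"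
      unfolding B.Q.quot_carrier image_image surj[symmetric] using \<theta>p by (intro image_cong) auto
  qed
  \<comment> \<open>The inverse of the induced bijection. Since the coset map is
    \<open>j \<circ> \<iota>\<close>, its tensor square factors through that of
    \<open>\<iota>\<close>, which gives the comultiplication condition for \<open>K\<close>.\<close>
  define j where "j = inv_into (carrier ?q) ?\<theta>"
  have j\<theta>: "j (?\<theta> X) = X" if "X \<in> carrier ?q" for X
    unfolding j_def using bij that by (simp add: bij_betw_def)
  have j: "j \<in> alg_hom A T ?q"
    by (rule alg_hom_factor_surj[OF qa \<theta> _ alg_hom_id j\<theta>]) (use bij in \<open>auto simp: bij_betw_def\<close>)
  have j\<iota>: "j (\<iota> z) = ?p z" if "z \<in> carrier N" for z
    using j\<theta>[of "?p z"] \<theta>p that by simp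
  have TT: "tensor_algebra A T T" by (rule tensor_algebra.intro) (rule Ta)+
  have QQ: "tensor_algebra A ?q ?q" by (rule tensor_algebra.intro) (rule qa)+
  note jj = tensor_algebra.tensor_map_hom[OF TT qa qa j j] and jp = tensor_algebra.tensor_map_pure_hom[OF TT qa qa j j]
  note \<iota>\<iota> = N.HHH.BC.tensor_map_hom[OF Ta Ta h h] and \<iota>p = N.HHH.BC.tensor_map_pure_hom[OF Ta Ta h h]
  note pp = N.HHH.BC.tensor_map_hom[OF qa qa B.coset_hom B.coset_hom] and pq = N.HHH.BC.tensor_map_pure_hom[OF qa qa B.coset_hom B.coset_hom]
  note \<theta>\<theta> = tensor_algebra.tensor_map_hom[OF QQ Ta Ta \<theta> \<theta>] and \<theta>q = tensor_algebra.tensor_map_pure_hom[OF QQ Ta Ta \<theta> \<theta>]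
  have fac: "tensor_map A ?q ?q ?p ?p w = tensor_map A ?q ?q j j (tensor_map A T T \<iota> \<iota> w)" if "w \<in> carrier (tensor A N N)" for w
    by (rule N.HHH.BC.lin_map_ext[OF alg_hom_lin[OF pp] alg_hom_lin[OF alg_hom_comp[OF \<iota>\<iota> jj]] _ that])
      (simp add: pq \<iota>p jp alg_hom_closed[OF h] j\<iota>)
  have fac': "tensor_map A T T ?\<theta> ?\<theta> (tensor_map A ?q ?q ?p ?p w) = tensor_map A T T \<iota> \<iota> w" if "w \<in> carrier (tensor A N N)" for w
    by (rule N.HHH.BC.lin_map_ext[OF alg_hom_lin[OF alg_hom_comp[OF pp \<theta>\<theta>]] alg_hom_lin[OF \<iota>\<iota>] _ that])
      (simp add: pq \<iota>p \<theta>q alg_hom_closed[OF B.coset_hom] \<theta>p)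
  have "hopf_ideal A N K"
  proof (intro hopf_ideal.intro hopf_ideal_axioms.intro N.affine_group_scheme_axioms K)
    fix z assume z: "z \<in> K"
    then have zN: "z \<in> carrier N" by (simp add: K_def)
    show "tensor_map A ?q ?q ?p ?p (comult N z) = \<zero>\<^bsub>tensor A ?q ?q\<^esub>"
      unfolding fac[OF alg_hom_closed[OF N.comult_hom zN]] \<Delta>[OF zN, symmetric] Z[OF z]
      by (simp add: alg_hom_zero[OF Ta tensor_algebra.tensor_algebra[OF TT] \<Delta>T]
          alg_hom_zero[OF tensor_algebra.tensor_algebra[OF TT] tensor_algebra.tensor_algebra[OF QQ] jj])
    show "counit N z = \<zero>\<^bsub>A\<^esub>"
      using \<epsilon>[OF zN] Z[OF z] alg_hom_zero[OF Ta algebra_base[OF N.R_cring] \<epsilon>T] by simp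
    show "antipode N z \<in> K"
      using antipode_comorphism[OF \<iota> zN] Z[OF z] alg_hom_zero[OF Ta Ta ST] alg_hom_closed[OF N.antipode_hom zN] by (simp add: K_def)
  qed
  then interpret J: hopf_ideal A N K .
  have \<theta>C: "?\<theta> \<in> alg_hom A J.C T" using \<theta> alg_hom_fields[OF J.truncate_C refl, of A T] by simp
  have "comult T (?\<theta> X) = tensor_map A T T ?\<theta> ?\<theta> (comult J.C X) \<and> counit T (?\<theta> X) = counit J.C X" if X: "X \<in> carrier J.C" for X
  proof -
    obtain x where x: "x \<in> carrier N" "X = ?p x" using X J.coset_surj by auto
    show ?thesis unfolding x(2) J.closed_subgroup_sel(1,2)[OF x(1)] J.tensor_map_C \<theta>p[OF x(1)]
      using \<Delta>[OF x(1)] \<epsilon>[OF x(1)] fac'[OF alg_hom_closed[OF N.comult_hom x(1)]] by simp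
  qed
  then show "group_scheme_iso A T (closed_subgroup A N K) (induced \<iota>)"
    unfolding group_scheme_iso_def group_scheme_hom_def
    using Tg J.closed_subgroup_scheme \<theta>C bij by (simp add: J.C_fields)
qed

section \<open>The exact sequence\<close>

context cring
begin

text \<open>With the formulas for the comultiplication of the idempotents, this makes
  \<open>E - E'\<close> multiplicative: it is the sign character of the group of order two.\<close>

lemma sign_product:
  assumes "a \<in> carrier R" "b \<in> carrier R" "c \<in> carrier R" "d \<in> carrier R"
  shows "(a \<otimes> c \<oplus> b \<otimes> d) \<ominus> (a \<otimes> d \<oplus> b \<otimes> c) = (a \<ominus> b) \<otimes> (c \<ominus> d)"
  using assms by algebra

text \<open>The off-diagonal entries of the conjugate are multiples of \<open>a12 a11\<close> and of
  \<open>a21 a22\<close>, products that vanish for a monomial matrix. So conjugation by points of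
  \<open>N\<close> preserves \<open>T\<close>.\<close>

lemma diagonal_conj:
  assumes "matrix_point R g a" "monomial R a" "matrix_point R g b" "diagonal R b"
  shows "diagonal R (mat_mult R (mat_mult R a b) (mat_inv R g a))"
proof -
  have id: "(p \<otimes> q) \<otimes> (\<ominus> (d \<otimes> u)) \<oplus> (u \<otimes> w) \<otimes> (d \<otimes> p) = \<zero>" "(u \<otimes> q) \<otimes> (d \<otimes> p) \<oplus> (p \<otimes> w) \<otimes> (\<ominus> (d \<otimes> u)) = \<zero>"
    if z: "u \<otimes> p = \<zero>" and cl: "p \<in> carrier R" "q \<in> carrier R" "d \<in> carrier R" "u \<in> carrier R" "w \<in> carrier R" for p q d u w
  proof -
    have "(p \<otimes> q) \<otimes> (\<ominus> (d \<otimes> u)) \<oplus> (u \<otimes> w) \<otimes> (d \<otimes> p) = (u \<otimes> p) \<otimes> (w \<otimes> d \<ominus> q \<otimes> d)"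
      "(u \<otimes> q) \<otimes> (d \<otimes> p) \<oplus> (p \<otimes> w) \<otimes> (\<ominus> (d \<otimes> u)) = (u \<otimes> p) \<otimes> (q \<otimes> d \<ominus> w \<otimes> d)"
      using cl by algebra+
    then show "(p \<otimes> q) \<otimes> (\<ominus> (d \<otimes> u)) \<oplus> (u \<otimes> w) \<otimes> (d \<otimes> p) = \<zero>" "(u \<otimes> q) \<otimes> (d \<otimes> p) \<oplus> (p \<otimes> w) \<otimes> (\<ominus> (d \<otimes> u)) = \<zero>"
      using cl by (simp_all add: z)
  qed
  note cl = matrix_pointD(2-5)[OF assms(1)] matrix_pointD(2-5)[OF assms(3)] det_inv_closed[OF assms(1)]
  show ?thesis
    using assms(2,4) cl id by (simp add: diagonal_def monomial_def)
qed

text \<open>\<open>y\<close> is the permutation matrix of the component of \<open>x\<close>, written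
  with the idempotents. The off-diagonal entries consist of terms in which an idempotent meets an
  entry of the other component.\<close>

lemma diagonal_retract:
  assumes "matrix_point R g x" "monomial R x" "matrix_point R g y"
    and y: "y X11 = idem_diag R g x" "y X12 = idem_anti R g x" "y X21 = idem_anti R g x" "y X22 = idem_diag R g x"
  shows "diagonal R (mat_mult R x (mat_inv R g y))"
proof -
  have id: "u \<otimes> (\<ominus> (d \<otimes> p)) \<oplus> w \<otimes> (d \<otimes> q) = \<zero>" "w \<otimes> (d \<otimes> q) \<oplus> u \<otimes> (\<ominus> (d \<otimes> p)) = \<zero>"
    if z: "p \<otimes> u = \<zero>" "q \<otimes> w = \<zero>" and cl: "p \<in> carrier R" "q \<in> carrier R" "d \<in> carrier R" "u \<in> carrier R" "w \<in> carrier R" for p q d u w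
    using cl by (simp_all add: ring_expand z z[THEN null_product(1)] z[THEN null_product(2)] z[THEN null_product(3)])
  note cl = matrix_pointD(2-5)[OF assms(1)] idem_closed[OF assms(1,2)] det_inv_closed[OF assms(3)]
  show ?thesis
    using id(1)[OF idem_zero(3)[OF assms(1,2)] idem_zero(1)[OF assms(1,2)] cl(6,5,7,1,2)]
      id(2)[OF idem_zero(4)[OF assms(1,2)] idem_zero(2)[OF assms(1,2)] cl(6,5,7,4,3)]
    by (simp add: diagonal_def y)
qed

end

context matrix_setting
begin

lemma quotient_map_eq: "quotient_map A g = (\<lambda>z. z)"
  by (simp add: quotient_map_def)

section \<open>A dual basis of \<open>k[N]\<close> over \<open>k[N/T]\<close>\<close>

lemma \<kappa>_idem: "\<kappa>1 E = \<one>\<^bsub>L\<^esub>" "\<kappa>1 E' = \<zero>\<^bsub>L\<^esub>" "\<kappa>2 E = \<zero>\<^bsub>L\<^esub>" "\<kappa>2 E' = \<one>\<^bsub>L\<^esub>"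
proof -
  interpret La: algebra A L by (rule L_algebra)
  note p = laurent_torus_point and d = laurent_torus_diagonal
  have "idem_diag L g (\<lambda>v. \<kappa>1 (n v)) = idem_diag L g (laurent_torus A g)" "idem_anti L g (\<lambda>v. \<kappa>1 (n v)) = idem_anti L g (laurent_torus A g)"
    by (rule idem_cong; simp add: \<kappa>1(2))+
  then show "\<kappa>1 E = \<one>\<^bsub>L\<^esub>" "\<kappa>1 E' = \<zero>\<^bsub>L\<^esub>"
    using hom_idem[OF N_algebra L_algebra \<kappa>1(1) n_point] La.idem_diagonal[OF p d] by simp_all
  let ?q = "mat_mult L (weyl_coord L g) (laurent_torus A g)"
  have "idem_diag L g (\<lambda>v. \<kappa>2 (n v)) = idem_diag L g ?q" "idem_anti L g (\<lambda>v. \<kappa>2 (n v)) = idem_anti L g ?q"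
    by (rule idem_cong; simp add: \<kappa>2(2))+
  then show "\<kappa>2 E = \<zero>\<^bsub>L\<^esub>" "\<kappa>2 E' = \<one>\<^bsub>L\<^esub>"
    using hom_idem[OF N_algebra L_algebra \<kappa>2(1) n_point]
      La.idem_mult[OF La.weyl_point La.weyl_monomial p \<kappa>_points(3)] La.idem_diagonal[OF p d] La.weyl_idem[of g]
    by simp_all
qed

lemma \<kappa>_W:
  assumes "q \<in> carrier W"
  shows "\<kappa>1 q = \<epsilon> q \<odot>\<^bsub>L\<^esub> \<one>\<^bsub>L\<^esub>" "\<kappa>2 q = \<epsilon>w q \<odot>\<^bsub>L\<^esub> \<one>\<^bsub>L\<^esub>"
proof -
  interpret La: algebra A L by (rule L_algebra)
  have q: "q \<in> carrier N" using assms by (simp add: W_carrier)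
  have "\<kappa>1 (\<epsilon> q \<odot>\<^bsub>N\<^esub> E \<oplus>\<^bsub>N\<^esub> \<epsilon>w q \<odot>\<^bsub>N\<^esub> E') = \<epsilon> q \<odot>\<^bsub>L\<^esub> \<one>\<^bsub>L\<^esub>" "\<kappa>2 (\<epsilon> q \<odot>\<^bsub>N\<^esub> E \<oplus>\<^bsub>N\<^esub> \<epsilon>w q \<odot>\<^bsub>N\<^esub> E') = \<epsilon>w q \<odot>\<^bsub>L\<^esub> \<one>\<^bsub>L\<^esub>"
    using \<epsilon>_closed[OF q] by (simp_all add: alg_hom_simps[OF \<kappa>1(1)] alg_hom_simps[OF \<kappa>2(1)] idem_facts \<kappa>_idem)
  then show "\<kappa>1 q = \<epsilon> q \<odot>\<^bsub>L\<^esub> \<one>\<^bsub>L\<^esub>" "\<kappa>2 q = \<epsilon>w q \<odot>\<^bsub>L\<^esub> \<one>\<^bsub>L\<^esub>" using W_expand[OF assms] by simp_all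
qed

definition "laurent_coeff m z = \<kappa>1 z m \<odot>\<^bsub>N\<^esub> E \<oplus>\<^bsub>N\<^esub> \<kappa>2 z m \<odot>\<^bsub>N\<^esub> E'"

lemma \<kappa>_closed: "z \<in> carrier N \<Longrightarrow> \<kappa>1 z m \<in> carrier A" "z \<in> carrier N \<Longrightarrow> \<kappa>2 z m \<in> carrier A"
  using L.F_closed alg_hom_closed[OF \<kappa>1(1)] alg_hom_closed[OF \<kappa>2(1)] by auto

lemma combination_W:
  assumes "a \<in> carrier A" "b \<in> carrier A"
  shows "a \<odot>\<^bsub>N\<^esub> E \<oplus>\<^bsub>N\<^esub> b \<odot>\<^bsub>N\<^esub> E' \<in> carrier W"
  using assms by (simp add: W_carrier alg_hom_simps[OF r_hom] r_idem idem_facts)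

text \<open>An invariant \<open>q\<close> restricts to the constants \<open>\<epsilon> q\<close> and
  \<open>\<epsilon>w q\<close> on the two cosets, so it scales all coefficients of
  \<open>\<kappa>1 z\<close> by the one and those of \<open>\<kappa>2 z\<close> by the other. That
  is multiplication by \<open>q = \<epsilon> q E + \<epsilon>w q E'\<close>.\<close>

lemma laurent_coeff_lin:
  "laurent_coeff m \<in> lin_map W (restrict_scalars N (\<lambda>z. z)) (base_algebra W)"
proof (rule lin_mapI; simp)
  fix z assume z: "z \<in> carrier N"
  show "laurent_coeff m z \<in> carrier W"
    unfolding laurent_coeff_def by (rule combination_W) (rule \<kappa>_closed[OF z])+
  fix q assume "q \<in> carrier W"
  then have q: "q \<in> carrier W" "q \<in> carrier N" by (simp_all add: W_carrier)
  interpret La: algebra A L by (rule L_algebra)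
  have "\<kappa>1 (q \<otimes>\<^bsub>N\<^esub> z) = \<epsilon> q \<odot>\<^bsub>L\<^esub> \<kappa>1 z" "\<kappa>2 (q \<otimes>\<^bsub>N\<^esub> z) = \<epsilon>w q \<odot>\<^bsub>L\<^esub> \<kappa>2 z"
    using q z \<epsilon>_closed[OF q(2)] by (simp_all add: alg_hom_simps[OF \<kappa>1(1)] alg_hom_simps[OF \<kappa>2(1)] \<kappa>_W La.smult_assoc2)
  then have 1: "\<kappa>1 (q \<otimes>\<^bsub>N\<^esub> z) m = \<epsilon> q \<otimes>\<^bsub>A\<^esub> \<kappa>1 z m" "\<kappa>2 (q \<otimes>\<^bsub>N\<^esub> z) m = \<epsilon>w q \<otimes>\<^bsub>A\<^esub> \<kappa>2 z m"
    by (simp_all add: monoid_algebra_sel)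
  have sc: "a \<odot>\<^bsub>N\<^esub> (b \<odot>\<^bsub>N\<^esub> y) = b \<odot>\<^bsub>N\<^esub> (a \<odot>\<^bsub>N\<^esub> y)" if "a \<in> carrier A" "b \<in> carrier A" "y \<in> carrier N" for a b y
    using that NTa.B.smult_assoc1 m_comm by metis
  note E'E = NTa.B.m_comm[OF idem_facts(2,1)]
  have "(\<epsilon> q \<odot>\<^bsub>N\<^esub> E \<oplus>\<^bsub>N\<^esub> \<epsilon>w q \<odot>\<^bsub>N\<^esub> E') \<otimes>\<^bsub>N\<^esub> laurent_coeff m z = laurent_coeff m (q \<otimes>\<^bsub>N\<^esub> z)"
    unfolding laurent_coeff_def 1 using \<epsilon>_closed[OF q(2)] \<kappa>_closed[OF z]
    by (simp add: sc[of "\<kappa>1 z m" "\<epsilon> q"] sc[of "\<kappa>2 z m" "\<epsilon>w q"] NTa.B.l_distr NTa.B.r_distr NTa.B.smult_assoc2 NTa.B.smult_mult_right idem_facts E'E NTa.B.smult_assoc1)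
  then show "laurent_coeff m (q \<otimes>\<^bsub>N\<^esub> z) = q \<otimes>\<^bsub>W\<^esub> laurent_coeff m z"
    using W_expand[OF q(1)] by (simp add: W_sel)
next
  fix z y assume "z \<in> carrier N" "y \<in> carrier N"
  note zy = this
  have "\<kappa>1 (z \<oplus>\<^bsub>N\<^esub> y) m = \<kappa>1 z m \<oplus>\<^bsub>A\<^esub> \<kappa>1 y m" "\<kappa>2 (z \<oplus>\<^bsub>N\<^esub> y) m = \<kappa>2 z m \<oplus>\<^bsub>A\<^esub> \<kappa>2 y m"
    using zy by (simp_all add: alg_hom_add[OF \<kappa>1(1)] alg_hom_add[OF \<kappa>2(1)], simp_all add: monoid_algebra_sel)
  then show "laurent_coeff m (z \<oplus>\<^bsub>N\<^esub> y) = laurent_coeff m z \<oplus>\<^bsub>W\<^esub> laurent_coeff m y"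
    using \<kappa>_closed[OF zy(1)] \<kappa>_closed[OF zy(2)] idem_facts
    by (simp add: laurent_coeff_def W_sel NTa.B.smult_l_distr NTa.B.M.a_ac)
qed

lemma laurent_coeff_expand:
  assumes z: "z \<in> carrier N"
  shows "\<exists>I. finite I \<and> (\<forall>m. m \<notin> I \<longrightarrow> laurent_coeff m z = \<zero>\<^bsub>W\<^esub>) \<and>
    z = finsum N (\<lambda>m. laurent_coeff m z \<otimes>\<^bsub>N\<^esub> laurent_basis m) I"
proof -
  \<comment> \<open>The union of the supports, so that the expansions on both cosets are sums over
    one index set and can be merged term by term.\<close>
  define I where "I = {m. \<kappa>1 z m \<noteq> \<zero>\<^bsub>A\<^esub>} \<union> {m. \<kappa>2 z m \<noteq> \<zero>\<^bsub>A\<^esub>}"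
  have k: "\<kappa>1 z \<in> carrier L" "\<kappa>2 z \<in> carrier L" using alg_hom_closed[OF \<kappa>1(1) z] alg_hom_closed[OF \<kappa>2(1) z] .
  have I: "finite I" unfolding I_def using L.F_support(1)[OF k(1)] L.F_support(1)[OF k(2)] by simp
  have z0: "\<kappa>1 z m = \<zero>\<^bsub>A\<^esub>" "\<kappa>2 z m = \<zero>\<^bsub>A\<^esub>" if "m \<notin> I" for m using that by (auto simp: I_def)
  have b: "laurent_basis \<in> carrier Zsq \<rightarrow> carrier N" using laurent_basis by simp
  note ex = L.lin_ext_eq[OF NTa.B.module_axioms b _ I, folded \<beta>_def]
  have \<beta>: "\<beta> (\<kappa>1 z) = finsum N (\<lambda>m. \<kappa>1 z m \<odot>\<^bsub>N\<^esub> laurent_basis m) I" "\<beta> (\<kappa>2 z) = finsum N (\<lambda>m. \<kappa>2 z m \<odot>\<^bsub>N\<^esub> laurent_basis m) I"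
    by (rule ex[OF k(1)] ex[OF k(2)]; auto simp: I_def)+
  have m: "e \<otimes>\<^bsub>N\<^esub> finsum N (\<lambda>m. c m \<odot>\<^bsub>N\<^esub> laurent_basis m) I = finsum N (\<lambda>m. c m \<odot>\<^bsub>N\<^esub> e \<otimes>\<^bsub>N\<^esub> laurent_basis m) I"
    if "e \<in> carrier N" "\<And>m. c m \<in> carrier A" for e c
  proof -
    have "e \<otimes>\<^bsub>N\<^esub> finsum N (\<lambda>m. c m \<odot>\<^bsub>N\<^esub> laurent_basis m) I = finsum N (\<lambda>m. e \<otimes>\<^bsub>N\<^esub> (c m \<odot>\<^bsub>N\<^esub> laurent_basis m)) I"
      by (rule NTa.B.finsum_rdistr[OF I that(1)]) (use that laurent_basis in auto)
    also have "\<dots> = finsum N (\<lambda>m. c m \<odot>\<^bsub>N\<^esub> e \<otimes>\<^bsub>N\<^esub> laurent_basis m) I"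
      by (rule NTa.B.M.finsum_cong') (use that laurent_basis in \<open>simp_all add: NTa.B.smult_mult_right NTa.B.smult_assoc2\<close>)
    finally show ?thesis .
  qed
  have "z = finsum N (\<lambda>m. \<kappa>1 z m \<odot>\<^bsub>N\<^esub> E \<otimes>\<^bsub>N\<^esub> laurent_basis m) I \<oplus>\<^bsub>N\<^esub> finsum N (\<lambda>m. \<kappa>2 z m \<odot>\<^bsub>N\<^esub> E' \<otimes>\<^bsub>N\<^esub> laurent_basis m) I"
    using laurent_expansion[OF z] unfolding \<beta> m[OF idem_facts(1) \<kappa>_closed(1)[OF z]] m[OF idem_facts(2) \<kappa>_closed(2)[OF z]] by simp
  also have "\<dots> = finsum N (\<lambda>m. \<kappa>1 z m \<odot>\<^bsub>N\<^esub> E \<otimes>\<^bsub>N\<^esub> laurent_basis m \<oplus>\<^bsub>N\<^esub> \<kappa>2 z m \<odot>\<^bsub>N\<^esub> E' \<otimes>\<^bsub>N\<^esub> laurent_basis m) I"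
    by (rule NTa.B.M.finsum_addf[symmetric]) (use \<kappa>_closed[OF z] idem_facts laurent_basis in auto)
  also have "\<dots> = finsum N (\<lambda>m. laurent_coeff m z \<otimes>\<^bsub>N\<^esub> laurent_basis m) I"
    by (rule NTa.B.M.finsum_cong') (use \<kappa>_closed[OF z] idem_facts laurent_basis in \<open>simp_all add: laurent_coeff_def NTa.B.l_distr\<close>)
  finally have "z = finsum N (\<lambda>m. laurent_coeff m z \<otimes>\<^bsub>N\<^esub> laurent_basis m) I" .
  moreover have "laurent_coeff m z = \<zero>\<^bsub>W\<^esub>" if "m \<notin> I" for m
    by (simp add: laurent_coeff_def z0[OF that] idem_facts W_sel)
  ultimately show ?thesis using I by blast
qed

lemma N_faithfully_flat:
  "faithfully_flat TYPE('m1) TYPE('m2) TYPE('m3) W N (\<lambda>z. z)"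
proof (rule faithfully_flatI[where c = laurent_coeff and b = laurent_basis and r = r])
  show "cring W" by (rule algebra.M_cring[OF W_algebra])
  show "cring N" by (rule algebra.M_cring[OF N_algebra])
  show "(\<lambda>z. z) \<in> ring_hom W N" using incl_hom by (simp add: alg_hom_def)
  show "r \<in> lin_map W (restrict_scalars N (\<lambda>z. z)) (base_algebra W)"
    by (rule lin_mapI) (simp_all add: r_W r_r alg_hom_simps[OF r_hom] W_sel W_carrier)
  show "r \<one>\<^bsub>N\<^esub> = \<one>\<^bsub>W\<^esub>" by (simp add: alg_hom_one[OF r_hom] W_sel)
qed (rule laurent_basis laurent_coeff_lin laurent_coeff_expand; assumption?)+

section \<open>The kernel of the quotient map\<close>

lemma \<iota>_idem: "\<iota> E = \<one>\<^bsub>T\<^esub>" "\<iota> E' = \<zero>\<^bsub>T\<^esub>"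
proof -
  interpret Ta: algebra A T by (rule T_algebra)
  have "idem_diag T g (\<lambda>v. \<iota> (n v)) = idem_diag T g t" "idem_anti T g (\<lambda>v. \<iota> (n v)) = idem_anti T g t"
    by (rule idem_cong; simp add: \<iota>_n)+
  then show "\<iota> E = \<one>\<^bsub>T\<^esub>" "\<iota> E' = \<zero>\<^bsub>T\<^esub>"
    using hom_idem[OF N_algebra T_algebra \<iota>_hom n_point] cring.idem_diagonal[OF algebra.M_cring[OF T_algebra] t_point t_diagonal] by simp_all
qed

lemma \<iota>_kernel_iff:
  assumes "z \<in> carrier N"
  shows "\<iota> z = \<zero>\<^bsub>T\<^esub> \<longleftrightarrow> (\<exists>w\<in>carrier G. w \<in> J1 \<and> z = J12 +>\<^bsub>G\<^esub> w)"
proof -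
  obtain w where w: "w \<in> carrier G" "z = J12 +>\<^bsub>G\<^esub> w" using assms N.coset_surj[unfolded N_eq] by auto
  have *: "\<iota> (J12 +>\<^bsub>G\<^esub> w) = \<zero>\<^bsub>T\<^esub> \<longleftrightarrow> w \<in> J1" if "w \<in> carrier G" for w
    using \<iota>_coset[OF that] T.B.Q.coset_eq_zero_iff[OF that] T.C_fields[unfolded T_eq] by simp
  show ?thesis using w * by blast
qed

text \<open>The kernel of \<open>\<iota>\<close> is the image of \<open>J1\<close>, so the criterion
  by diagonal matrices passes from \<open>k[G]\<close> to \<open>k[N]\<close>.\<close>

lemma diagonal_kills_kernel:
  assumes "algebra A R" "f \<in> alg_hom A N R" "diagonal R (\<lambda>v. f (n v))" "z \<in> carrier N" "\<iota> z = \<zero>\<^bsub>T\<^esub>"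
  shows "f z = \<zero>\<^bsub>R\<^esub>"
proof -
  obtain w where w: "w \<in> J1" "z = J12 +>\<^bsub>G\<^esub> w" using assms(4,5) \<iota>_kernel_iff by blast
  show ?thesis unfolding w(2)
    by (rule diagonal_kills[OF assms(1) alg_hom_comp[OF N.coset_hom[unfolded N_eq] assms(2)] _ w(1)])
      (use assms(3) in \<open>simp add: N.y_def\<close>)
qed

text \<open>Both ideals are generated by \<open>E'\<close>. An invariant that vanishes at the
  identity is a multiple of \<open>E'\<close>, and \<open>\<iota> E' = 0\<close>. Conversely, if
  \<open>\<iota> z = 0\<close> then \<open>z\<close> vanishes on the first coset, and its Laurent
  expansion reduces to \<open>E' \<beta> (\<kappa>2 z)\<close>.\<close>

lemma kernel_ideal_eq: "kernel_ideal N (\<lambda>z. z) A W = {z \<in> carrier N. \<iota> z = \<zero>\<^bsub>T\<^esub>}"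
proof -
  interpret La: algebra A L by (rule L_algebra)
  let ?S = "(\<lambda>z. z) ` {y \<in> carrier W. counit W y = \<zero>\<^bsub>A\<^esub>}"
  have S: "?S \<subseteq> carrier N" by (auto simp: W_carrier)
  show ?thesis
  proof
    show "kernel_ideal N (\<lambda>z. z) A W \<subseteq> {z \<in> carrier N. \<iota> z = \<zero>\<^bsub>T\<^esub>}"
      unfolding kernel_ideal_def
    proof (rule NTa.B.genideal_minimal[OF alg_hom_kernel_ideal[OF N_algebra T_algebra \<iota>_hom]], rule subsetI)
      fix y assume "y \<in> ?S"
      then have y: "y \<in> carrier W" "\<epsilon> y = \<zero>\<^bsub>A\<^esub>" "y \<in> carrier N" by (auto simp: W_sel W_carrier)
      have "y = \<epsilon>w y \<odot>\<^bsub>N\<^esub> E'" using W_expand[OF y(1)] y(2) \<epsilon>_closed[OF y(3)] idem_facts by simp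
      then have "\<iota> y = \<epsilon>w y \<odot>\<^bsub>T\<^esub> \<iota> E'" using alg_hom_smult[OF \<iota>_hom \<epsilon>_closed(2)[OF y(3)] idem_facts(2)] by metis
      then show "y \<in> {z \<in> carrier N. \<iota> z = \<zero>\<^bsub>T\<^esub>}"
        using y(3) \<iota>_idem module.smult_r_null[OF algebra_module[OF T_algebra] \<epsilon>_closed(2)[OF y(3)]] by simp
    qed
    show "{z \<in> carrier N. \<iota> z = \<zero>\<^bsub>T\<^esub>} \<subseteq> kernel_ideal N (\<lambda>z. z) A W"
    proof
      fix z assume "z \<in> {z \<in> carrier N. \<iota> z = \<zero>\<^bsub>T\<^esub>}"
      then have z: "z \<in> carrier N" "\<iota> z = \<zero>\<^bsub>T\<^esub>" by auto
      have "diagonal L (\<lambda>v. \<kappa>1 (n v))" using laurent_torus_diagonal \<kappa>1(2) by (simp add: diagonal_def)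
      then have "\<kappa>1 z = \<zero>\<^bsub>L\<^esub>" by (rule diagonal_kills_kernel[OF L_algebra \<kappa>1(1) _ z])
      then have "z = E' \<otimes>\<^bsub>N\<^esub> \<beta> (\<kappa>2 z)"
        using laurent_expansion[OF z(1)] alg_hom_closed[OF \<beta>_hom alg_hom_closed[OF \<kappa>2(1) z(1)]] idem_facts
        by (simp add: alg_hom_zero[OF L_algebra N_algebra \<beta>_hom])
      moreover have "E' \<in> ?S" using idem_W idem_values by (simp add: W_sel)
      ultimately show "z \<in> kernel_ideal N (\<lambda>z. z) A W"
        unfolding kernel_ideal_def
        using ideal.I_r_closed[OF NTa.B.genideal_ideal[OF S], of E' "\<beta> (\<kappa>2 z)"] NTa.B.genideal_self[OF S]
          alg_hom_closed[OF \<beta>_hom alg_hom_closed[OF \<kappa>2(1) z(1)]] by auto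
    qed
  qed
qed

lemma exact_sequence:
  "short_exact TYPE('m1) TYPE('m2) TYPE('m3) A T \<iota> N (quotient_map A g) W"
  unfolding short_exact_def quotient_map_eq kernel_scheme_def kernel_ideal_eq
  using \<iota>_group_hom incl_group_hom N_faithfully_flat kernel_closed_subgroup[OF \<iota>_group_hom \<iota>_surj] by blast

section \<open>The universal property\<close>

text \<open>An equivariant \<open>f\<close> already takes values in the invariants, so it is its own
  factorization; cutting it off outside the carrier makes it unique as a function.\<close>

lemma categorical_quotient_W: "categorical_quotient TYPE('z) A N T \<iota> W (quotient_map A g)"
  unfolding categorical_quotient_def quotient_map_eq
proof (intro conjI allI impI ballI W_algebra incl_hom; (elim conjE)?)
  show "\<sigma> y = proj A N T y" if "y \<in> carrier W" for y
    using invariant_r that by (simp add: W_carrier proj_def)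
  fix Z :: "('a, 'z) module" and f
  assume Z: "algebra A Z" and f: "f \<in> alg_hom A Z N" and inv: "\<forall>z\<in>carrier Z. \<sigma> (f z) = proj A N T (f z)"
  have fW: "f z \<in> carrier W" if "z \<in> carrier Z" for z
    using invariant_constant alg_hom_closed[OF f that] inv that by (simp add: W_carrier proj_def)
  have "restrict f (carrier Z) \<in> alg_hom A Z W"
    by (rule alg_hom_cong[OF Z alg_hom_W[OF f fW]]) simp_all
  then show "\<exists>!h. h \<in> alg_hom A Z W \<inter> extensional (carrier Z) \<and> (\<forall>z\<in>carrier Z. h z = f z)"
    by (intro ex1I[of _ "restrict f (carrier Z)"]) (auto intro: extensionalityI)
qed

lemma categorical_quotientD:
  assumes "categorical_quotient TYPE('z) A N' T' j Q p" "algebra A (Z :: ('a, 'z) module)" "f \<in> alg_hom A Z N'"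
    and "\<And>z. z \<in> carrier Z \<Longrightarrow> act A N' T' j (f z) = proj A N' T' (f z)"
  shows "\<exists>!h. h \<in> alg_hom A Z Q \<inter> extensional (carrier Z) \<and> (\<forall>z\<in>carrier Z. p (h z) = f z)"
  using assms unfolding categorical_quotient_def by blast

lemma alg_hom_truncate: "alg_hom A (module.truncate M) C = alg_hom A M C"
  by (rule alg_hom_fields) simp_all

lemma carrier_truncate: "carrier (module.truncate M) = carrier M"
  by (simp add: module.truncate_def)

text \<open>The comorphism \<open>p\<close> takes values in \<open>W\<close>. The universal property
  of \<open>Q\<close> with test object \<open>W\<close> gives a right inverse \<open>h\<close> of
  \<open>p\<close>; with test object \<open>Q\<close> its uniqueness part gives
  \<open>h \<circ> p = id\<close>. These two test objects account for the two type instances in the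
  hypotheses.\<close>

lemma quotient_unique:
  fixes Q :: "('a, 'q) hopf"
  assumes p: "group_scheme_hom A N Q p"
    and q1: "categorical_quotient TYPE((coord multiset \<Rightarrow> 'a) set set) A N T \<iota> Q p"
    and q2: "categorical_quotient TYPE('q) A N T \<iota> Q p"
  shows "\<exists>!\<theta>. group_scheme_iso A W Q \<theta> \<and> \<theta> \<in> extensional (carrier Q) \<and> (\<forall>y\<in>carrier Q. quotient_map A g (\<theta> y) = p y)"
proof -
  have Q: "affine_group_scheme A Q" and ph: "p \<in> alg_hom A Q N"
    and pc: "\<And>y. y \<in> carrier Q \<Longrightarrow> comult N (p y) = tensor_map A N N p p (comult Q y)" "\<And>y. y \<in> carrier Q \<Longrightarrow> counit N (p y) = counit Q y"
    using p by (auto simp: group_scheme_hom_def)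
  have Qa: "algebra A Q" using Q by (rule affine_group_scheme.axioms)
  interpret QQ: tensor_algebra A Q Q by (rule tensor_algebra.intro) (rule Qa)+
  have pinv: "\<sigma> (p y) = proj A N T (p y)" if "y \<in> carrier Q" for y
    using q1 that by (simp add: categorical_quotient_def)
  have pW: "p y \<in> carrier W" if "y \<in> carrier Q" for y
    using invariant_constant alg_hom_closed[OF ph that] pinv[OF that] by (simp add: W_carrier proj_def)
  have phW: "p \<in> alg_hom A Q W" by (rule alg_hom_W[OF ph pW])
  let ?Z1 = "module.truncate W" and ?Z2 = "module.truncate Q"
  have "\<exists>!h. h \<in> alg_hom A ?Z1 Q \<inter> extensional (carrier ?Z1) \<and> (\<forall>z\<in>carrier ?Z1. p (h z) = z)"
    by (rule categorical_quotientD[OF q1 algebra_truncate[OF W_algebra]])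
      (simp_all add: alg_hom_truncate carrier_truncate incl_hom invariant_r W_carrier proj_def)
  then obtain h where h: "h \<in> alg_hom A W Q" "\<And>z. z \<in> carrier W \<Longrightarrow> p (h z) = z"
    by (auto simp: carrier_truncate alg_hom_truncate)
  have "\<exists>!k. k \<in> alg_hom A ?Z2 Q \<inter> extensional (carrier ?Z2) \<and> (\<forall>z\<in>carrier ?Z2. p (k z) = p z)"
    by (rule categorical_quotientD[OF q2 algebra_truncate[OF Qa]])
      (simp_all add: alg_hom_truncate carrier_truncate ph pinv)
  then obtain k where "\<forall>k'. k' \<in> alg_hom A ?Z2 Q \<inter> extensional (carrier ?Z2) \<and> (\<forall>z\<in>carrier ?Z2. p (k' z) = p z) \<longrightarrow> k' = k"
    by (rule ex1E)
  then have k: "k' = k" if "k' \<in> alg_hom A Q Q" "k' \<in> extensional (carrier Q)" "\<And>z. z \<in> carrier Q \<Longrightarrow> p (k' z) = p z" for k'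
    using that by (simp add: carrier_truncate alg_hom_truncate)
  have k1: "restrict (\<lambda>y. h (p y)) (carrier Q) = k"
    by (rule k) (auto intro: alg_hom_cong[OF Qa alg_hom_comp[OF phW h(1)]] simp: h(2) pW)
  have k2: "restrict (\<lambda>y. y) (carrier Q) = k"
    by (rule k) (auto intro: alg_hom_cong[OF Qa alg_hom_id])
  have hp: "h (p y) = y" if "y \<in> carrier Q" for y
    by (rule restrict_eqD[OF trans[OF k1 k2[symmetric]] that])
  let ?\<theta> = "restrict p (carrier Q)"
  have \<theta>: "?\<theta> \<in> alg_hom A Q W" by (rule alg_hom_cong[OF Qa phW]) simp
  have QD: "comult Q \<in> alg_hom A Q (tensor A Q Q)"
    using Q by (auto simp: affine_group_scheme_def affine_group_scheme_axioms_def)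
  \<comment> \<open>The comultiplication of \<open>W\<close> is that of \<open>N\<close> followed by
    \<open>r \<otimes> r\<close>, and \<open>r\<close> fixes the values of \<open>p\<close>; hence
    compatibility of \<open>p\<close> with \<open>N\<close> gives compatibility with
    \<open>W\<close>.\<close>
  have fac: "tensor_map A W W r r (tensor_map A N N p p w) = tensor_map A W W ?\<theta> ?\<theta> w" if "w \<in> carrier (tensor A Q Q)" for w
    by (rule QQ.lin_map_ext[OF alg_hom_lin[OF alg_hom_comp[OF QQ.tensor_map_hom[OF N_algebra N_algebra ph ph] r2]]
          alg_hom_lin[OF QQ.tensor_map_hom[OF W_algebra W_algebra \<theta> \<theta>]] _ that])
      (use pW in \<open>simp add: QQ.tensor_map_pure_hom[OF N_algebra N_algebra ph ph] QQ.tensor_map_pure_hom[OF W_algebra W_algebra \<theta> \<theta>]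
        NN.tensor_map_pure_hom[OF W_algebra W_algebra r_hom_W r_hom_W] alg_hom_closed[OF ph] W_carrier\<close>)
  have "comult W (?\<theta> y) = tensor_map A W W ?\<theta> ?\<theta> (comult Q y) \<and> counit W (?\<theta> y) = counit Q y" if y: "y \<in> carrier Q" for y
    using comult_W(3)[OF pW[OF y]] pc[OF y] fac[OF alg_hom_closed[OF QD y]] y by (simp add: W_sel)
  moreover have "bij_betw ?\<theta> (carrier Q) (carrier W)"
    by (rule bij_betw_byWitness[of _ h]) (use hp h(2) alg_hom_closed[OF h(1)] pW in auto)
  ultimately have "group_scheme_iso A W Q ?\<theta>"
    unfolding group_scheme_iso_def group_scheme_hom_def using W_group Q \<theta> by simp
  then show ?thesis
    unfolding quotient_map_eq
    by (intro ex1I[of _ ?\<theta>]) (auto intro!: extensionalityI[of _ "carrier Q"])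
qed

section \<open>The splitting for \<open>GL\<^sub>2\<close>\<close>

lemma r_n: "v \<in> coords g \<Longrightarrow> r (n v) = counit_coord A v \<odot>\<^bsub>N\<^esub> E \<oplus>\<^bsub>N\<^esub> weyl_coord (base_algebra A) g v \<odot>\<^bsub>N\<^esub> E'"
  by (simp add: r_def N_counit \<epsilon>w(2))

lemma r_n_entries: "r (n X11) = E" "r (n X12) = E'" "r (n X22) = E"
  by (simp_all add: r_n idem_facts)

lemma counit_r: "z \<in> carrier N \<Longrightarrow> \<epsilon> (r z) = \<epsilon> z"
  unfolding r_def using \<epsilon>_closed by (simp add: alg_hom_simps[OF \<epsilon>_hom] idem_facts idem_values)

lemma r_point: "matrix_point N g (\<lambda>v. r (n v))"
  by (rule hom_mat(4)[OF N_algebra N_algebra r_hom n_point])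

lemma a_inv_base: "\<ominus>\<^bsub>base_algebra A\<^esub> y = \<ominus>\<^bsub>A\<^esub> y"
  by (simp add: a_inv_def m_inv_def base_algebra_def)

text \<open>For \<open>GL2\<close> the matrix of \<open>r\<close> is \<open>(E, E'; E', E)\<close>,
  the generic permutation matrix. The comultiplication of \<open>E\<close> and \<open>E'\<close>
  reproduces its matrix square over \<open>W \<otimes> W\<close>, and at \<open>Dinv\<close> it is
  the multiplicativity of the sign character.\<close>

lemma section_hom:
  assumes g: "g = GL2"
  shows "group_scheme_hom A W N r"
proof (rule N.subgroup_hom[OF W_group, unfolded N_eq, OF r_hom_W])
  interpret WWA: algebra A "tensor A W W" by (rule WW.tensor_algebra)
  have \<Delta>: "comult W \<in> alg_hom A W (tensor A W W)"
    using W_group by (auto simp: affine_group_scheme_def affine_group_scheme_axioms_def)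
  have comE: "comult W E = pure A W W E E \<oplus>\<^bsub>tensor A W W\<^esub> pure A W W E' E'"
    "comult W E' = pure A W W E E' \<oplus>\<^bsub>tensor A W W\<^esub> pure A W W E' E"
    using idem_facts idem_W
    by (simp_all add: comult_W(3) comult_idem alg_hom_simps[OF r2] NN.pure_closed
        NN.tensor_map_pure_hom[OF W_algebra W_algebra r_hom_W r_hom_W] r_idem)
  fix v assume v: "v \<in> coords g"
  show "counit W (r (n v)) = counit_coord A v"
    using counit_r[OF n_closed[OF v]] N_counit[OF v] by (simp add: W_sel)
  have sgn: "weyl_sign (base_algebra A) g = \<one>\<^bsub>A\<^esub>" by (subst g) simp
  have e21: "r (n X21) = E'" by (simp add: r_n idem_facts sgn)
  have cl: "pure A W W a b \<in> carrier (tensor A W W)" if "a \<in> {E, E', \<one>\<^bsub>W\<^esub>}" "b \<in> {E, E', \<one>\<^bsub>W\<^esub>}" for a b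
    using that idem_W by (auto intro: WW.pure_closed)
  show "comult W (r (n v)) = mat_mult (tensor A W W) (\<lambda>v. pure A W W (r (n v)) \<one>\<^bsub>W\<^esub>) (\<lambda>v. pure A W W \<one>\<^bsub>W\<^esub> (r (n v))) v"
    using v
  proof (cases rule: coords_cases[consumes 1])
    case 5
    have "r (n Dinv) = \<one>\<^bsub>A\<^esub> \<odot>\<^bsub>W\<^esub> E \<oplus>\<^bsub>W\<^esub> (\<ominus>\<^bsub>A\<^esub> \<one>\<^bsub>A\<^esub>) \<odot>\<^bsub>W\<^esub> E'"
      using v unfolding 5(2) by (simp add: r_n W_sel sgn a_inv_base)
    \<comment> \<open>The inverse determinant is \<open>1\<close> at the identity and
      \<open>- 1\<close> at the permutation matrix.\<close>
    then have d: "r (n Dinv) = E \<ominus>\<^bsub>W\<^esub> E'"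
      using idem_W by (simp add: WW.B.smult_l_minus WW.B.minus_eq)
    let ?l = "\<lambda>a. pure A W W a \<one>\<^bsub>W\<^esub>" and ?r = "\<lambda>a. pure A W W \<one>\<^bsub>W\<^esub> a"
    have p: "pure A W W a b = ?l a \<otimes>\<^bsub>tensor A W W\<^esub> ?r b" if "a \<in> carrier W" "b \<in> carrier W" for a b
      using that by (simp add: WW.pure_mult)
    have "comult W (E \<ominus>\<^bsub>W\<^esub> E') = (?l E \<ominus>\<^bsub>tensor A W W\<^esub> ?l E') \<otimes>\<^bsub>tensor A W W\<^esub> (?r E \<ominus>\<^bsub>tensor A W W\<^esub> ?r E')"
      unfolding alg_hom_minus[OF W_algebra WW.tensor_algebra \<Delta> idem_W] comE
        p[OF idem_W(1) idem_W(1)] p[OF idem_W(2) idem_W(2)] p[OF idem_W(1) idem_W(2)] p[OF idem_W(2) idem_W(1)]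
      by (rule WWA.sign_product) (simp_all add: cl)
    then show ?thesis
      unfolding 5(2) by (simp add: d alg_hom_minus[OF W_algebra WW.tensor_algebra WW.pure_left_hom idem_W]
          alg_hom_minus[OF W_algebra WW.tensor_algebra WW.pure_right_hom idem_W])
  qed (use idem_W in \<open>simp_all add: r_n_entries e21 comE WW.pure_mult WWA.a_comm cl\<close>)
qed

sublocale WT: tensor_algebra A W T
  by (rule tensor_algebra.intro) (rule W_algebra T_algebra)+

text \<open>The conditions \<open>normal\<close> and \<open>retract\<close> ask two points of
  \<open>N\<close> to lie in \<open>T\<close>. By \<open>diagonal_kills_kernel\<close> it is enough
  that their matrices are diagonal, which is \<open>diagonal_conj\<close> for the first and
  \<open>diagonal_retract\<close> for the second.\<close>

lemma split:
  assumes g: "g = GL2"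
  shows "split_extension A N T W \<iota> (\<lambda>z. z) r"
proof (rule split_extension.intro)
  note C = WT.tensor_algebra
  interpret CA: algebra A "tensor A W T" by (rule C)
  interpret Nh: hopf_data A N by (rule N_data)
  show "\<iota> y = counit W y \<odot>\<^bsub>T\<^esub> \<one>\<^bsub>T\<^esub>" if y: "y \<in> carrier W" for y
  proof -
    interpret Ta: algebra A T by (rule T_algebra)
    have yN: "y \<in> carrier N" using y by (simp add: W_carrier)
    have "\<iota> (\<epsilon> y \<odot>\<^bsub>N\<^esub> E \<oplus>\<^bsub>N\<^esub> \<epsilon>w y \<odot>\<^bsub>N\<^esub> E') = \<epsilon> y \<odot>\<^bsub>T\<^esub> \<one>\<^bsub>T\<^esub>"
      using \<epsilon>_closed[OF yN] by (simp add: alg_hom_simps[OF \<iota>_hom] idem_facts \<iota>_idem)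
    then show ?thesis using W_expand[OF y] by (simp add: W_sel)
  qed
  let ?a = "\<lambda>x. pure A W T (r x) \<one>\<^bsub>T\<^esub>" and ?b = "\<lambda>x. pure A W T \<one>\<^bsub>W\<^esub> (\<iota> x)"
  have a: "?a \<in> alg_hom A N (tensor A W T)" by (rule alg_hom_comp[OF r_hom_W WT.pure_left_hom])
  have b: "?b \<in> alg_hom A N (tensor A W T)" by (rule alg_hom_comp[OF \<iota>_hom WT.pure_right_hom])
  note ab = Nh.pt_mult_hom[OF C a b] and ai = Nh.pt_inv_hom[OF a]
  have bd: "diagonal (tensor A W T) (\<lambda>v. ?b (n v))"
  proof -
    have "diagonal T (\<lambda>v. \<iota> (n v))" using t_diagonal by (simp add: diagonal_def \<iota>_n)
    then show ?thesis by (rule hom_mat(6)[OF T_algebra C WT.pure_right_hom hom_mat(4)[OF N_algebra T_algebra \<iota>_hom n_point]])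
  qed
  note dc = CA.diagonal_conj[OF hom_mat(4)[OF N_algebra C a n_point] hom_mat(5)[OF N_algebra C a n_point n_monomial]
      hom_mat(4)[OF N_algebra C b n_point] bd]
  have "pt_mult A N (tensor A W T) (pt_mult A N (tensor A W T) ?a ?b) (pt_inv N ?a) (n v) =
      mat_mult (tensor A W T) (mat_mult (tensor A W T) (\<lambda>v. ?a (n v)) (\<lambda>v. ?b (n v))) (mat_inv (tensor A W T) g (\<lambda>v. ?a (n v))) v"
    if v: "v \<in> coords g" for v
    unfolding N_pt_mult[OF C ab ai v v]
    by (rule mat_mult_cong[OF _ _ v]) (rule N_pt_mult[OF C a b] N_pt_inv[OF C a]; assumption)+
  then have "diagonal (tensor A W T) (\<lambda>v. pt_mult A N (tensor A W T) (pt_mult A N (tensor A W T) ?a ?b) (pt_inv N ?a) (n v))"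
    using dc by (simp only: diagonal_def coords_entries)
  then show "pt_mult A N (tensor A W T) (pt_mult A N (tensor A W T) ?a ?b) (pt_inv N ?a) z = \<zero>\<^bsub>tensor A W T\<^esub>"
    if "z \<in> carrier N" "\<iota> z = \<zero>\<^bsub>T\<^esub>" for z
    by (rule diagonal_kills_kernel[OF C Nh.pt_mult_hom[OF C ab ai] _ that])
  have "weyl_sign (base_algebra A) g = \<one>\<^bsub>A\<^esub>" by (subst g) simp
  then have "r (n X21) = E'" by (simp add: r_n idem_facts)
  then have d: "diagonal N (mat_mult N n (mat_inv N g (\<lambda>v. r (n v))))"
    by (intro NTa.B.diagonal_retract[OF n_point n_monomial r_point]) (simp_all add: r_n_entries)
  note ri = Nh.pt_inv_hom[OF r_hom]
  have "pt_mult A N N (\<lambda>x. x) (pt_inv N r) (n v) = mat_mult N n (mat_inv N g (\<lambda>v. r (n v))) v" if v: "v \<in> coords g" for v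
    unfolding N_pt_mult[OF N_algebra alg_hom_id ri v v]
    by (rule mat_mult_cong[OF _ _ v]) (rule refl N_pt_inv[OF N_algebra r_hom]; assumption?)+
  then have "diagonal N (\<lambda>v. pt_mult A N N (\<lambda>x. x) (pt_inv N r) (n v))"
    using d by (simp only: diagonal_def coords_entries)
  then show "pt_mult A N N (\<lambda>x. x) (pt_inv N (\<lambda>x. r x)) z = \<zero>\<^bsub>N\<^esub>" if "z \<in> carrier N" "\<iota> z = \<zero>\<^bsub>T\<^esub>" for z
    by (rule diagonal_kills_kernel[OF N_algebra Nh.pt_mult_hom[OF N_algebra alg_hom_id ri] _ that])
qed (use \<iota>_group_hom \<iota>_surj incl_group_hom section_hom[OF g] in \<open>simp_all add: W_carrier\<close>)

end

theorem theorem1p1: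
  fixes A :: "('a, 'r) ring_scheme" and g :: matrix_group
  assumes "cring A"
  shows
    "short_exact TYPE('m1) TYPE('m2) TYPE('m3) A
       (torus A g) (torus_incl A g) (normalizer A g) (quotient_map A g) (weyl A g) \<and>
     categorical_quotient TYPE('z) A (normalizer A g) (torus A g) (torus_incl A g)
       (weyl A g) (quotient_map A g) \<and>
     (\<forall>(Q :: ('a, 'q) hopf) p.
        group_scheme_hom A (normalizer A g) Q p \<and>
        categorical_quotient TYPE((coord multiset \<Rightarrow> 'a) set set) A
          (normalizer A g) (torus A g) (torus_incl A g) Q p \<and>
        categorical_quotient TYPE('q) A (normalizer A g) (torus A g) (torus_incl A g) Q p \<longrightarrow>
        (\<exists>!\<theta>. group_scheme_iso A (weyl A g) Q \<theta> \<and> \<theta> \<in> extensional (carrier Q) \<and>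
              (\<forall>y\<in>carrier Q. quotient_map A g (\<theta> y) = p y))) \<and>
     (g = GL2 \<longrightarrow>
        (\<exists>s. group_scheme_hom A (weyl A g) (normalizer A g) s \<and>
             (\<forall>x\<in>carrier (weyl A g). s (quotient_map A g x) = x) \<and>
             (\<exists>\<theta>. group_scheme_iso A (normalizer A g)
                (semidirect A (torus A g) (weyl A g)
                  (conj_action A (normalizer A g) (torus A g) (torus_incl A g) (weyl A g) s)) \<theta>)))"
proof -
  interpret matrix_setting A g by (rule matrix_setting.intro) (rule assms)
  have split': "\<exists>s. group_scheme_hom A W N s \<and> (\<forall>x\<in>carrier W. s (quotient_map A g x) = x) \<and>
      (\<exists>\<theta>. group_scheme_iso A N (semidirect A T W (conj_action A N T \<iota> W s)) \<theta>)" if "g = GL2"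
    by (intro exI[of _ r] conjI section_hom[OF that])
      (use split_extension.semidirect_iso[OF split[OF that]] in \<open>auto simp: quotient_map_eq W_carrier\<close>)
  have unique: "\<exists>!\<theta>. group_scheme_iso A W Q \<theta> \<and> \<theta> \<in> extensional (carrier Q) \<and> (\<forall>y\<in>carrier Q. quotient_map A g (\<theta> y) = p y)"
    if "group_scheme_hom A N Q p \<and> categorical_quotient TYPE((coord multiset \<Rightarrow> 'a) set set) A N T \<iota> Q p \<and>
      categorical_quotient TYPE('q) A N T \<iota> Q p" for Q :: "('a, 'q) hopf" and p
    using that by (elim conjE) (rule quotient_unique)
  show ?thesis
    by (intro conjI exact_sequence categorical_quotient_W; intro allI impI; (rule unique | rule split'); assumption)
qed

end
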